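(* Let $n\ge2$, $\boldsymbol\lambda\in\mathbb C^n$ with $\sum_l\lambda_l=0$, and let $a$ be a given integer. For $j=1,\dots,n$ define $\xi_j=e^{\pi i\frac{2j+a-2}n}$. For $d=0,1,\dots,n-1$ and $l=1,\dots,n$, let $\sigma_{l,d}(\boldsymbol\lambda)$ denote the elementary symmetric polynomial of degree $d$ in the $n-1$ quantities $e^{-2\pi i\lambda_1},\dots,\widehat{e^{-2\pi i\lambda_l}},\dots,e^{-2\pi i\lambda_n}$ (the $l$-th omitted). Then for $z\in\mathbb U$ and $l=1,\dots,n$ $$J_l\big(z;(-)^a,\boldsymbol\lambda\big)=\frac{e^{\frac34\pi i(n-1)}}{\sqrt n(2\pi)^{\frac{n-1}2}}\,e^{\pi i(\frac12n+a-2)\lambda_l}\sum_{j=1}^n(-1)^{n-j}\xi_j^{-\frac{n-1}2}\sigma_{l,n-j}(\boldsymbol\lambda)\,J(z;\boldsymbol\lambda;\xi_j).$$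
   Context: $\mathbb U$ is the universal cover of $\mathbb C\smallsetminus\{0\}$, with elements $z=|z|e^{i\arg z}$, $\arg z\in\mathbb R$, $z^b=e^{b\log z}$. The $\xi_j$ are regarded as points of $\mathbb U$ with $\arg\xi_j=\pi\frac{2j+a-2}n$; they satisfy $\xi_j^n=(-1)^a$ in $\mathbb C$. Signs are identified with $\pm1$; $(-)^a$ is the sign of $(-1)^a$. Bessel functions of the first kind: $$J_l(z;\varsigma,\boldsymbol\lambda)=\sum_{m=0}^\infty\frac{(\varsigma i^n)^mz^{n(-\lambda_l+m)}}{\prod_{k=1}^n\Gamma(\lambda_k-\lambda_l+m+1)},\qquad z\in\mathbb U.$$ Bessel functions of the second kind: the Bessel equation of index $\boldsymbol\lambda$ and sign $\varsigma$ is $$\sum_{j=1}^nV_{n,j}(\boldsymbol\lambda)z^jw^{(j)}+\big(V_{n,0}(\boldsymbol\lambda)-\varsigma(in)^nz^n\big)w=0,\qquad V_{n,j}(\boldsymbol\lambda)=\sum_{m=0}^{n-j}A_{j,n-j-m}\,n^m\sigma_m(\boldsymbol\lambda),$$ $\sigma_m(\boldsymbol\lambda)$ the $m$-th elementary symmetric polynomial in $\boldsymbol\lambda$, $A_{0,0}=1$, $A_{0,m}=0$ ($m\ge1$), $A_{j,m}=\sum_{r=1}^j\frac{(-1)^{j-r}r^{m+j}}{r!(j-r)!}$ ($j\ge1,m\ge0$). For $\xi\in\mathbb U$ with $\xi^n=\varsigma1$ there is a unique sequence of symmetric polynomials $B_m(\boldsymbol\lambda;\xi)$ with $B_0=1$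 such that $\widehat J(z;\boldsymbol\lambda;\xi)=e^{in\xi z}z^{-\frac{n-1}2}\sum_{m\ge0}B_m(\boldsymbol\lambda;\xi)z^{-m}$ is a formal solution, and $J(z;\boldsymbol\lambda;\xi)$ is the unique solution on $\mathbb U$ having $\widehat J(z;\boldsymbol\lambda;\xi)$ as its asymptotic expansion (as $|z|\to\infty$) on $\{z\in\mathbb U:|\arg z-(\frac\pi2-\arg\xi)|<\frac\pi n\}$. *)

theory Defs
  imports "HOL-Analysis.Analysis" "HOL-Library.Landau_Symbols"
begin

section \<open>The universal cover of the punctured plane\<close>

text \<open>
  A point of the universal cover is given by its modulus and its (real, not reduced) argument.
\<close>

typedef ucover = "{p :: real \<times> real. fst p > 0}"
  morphisms polar_of polar
  by (rule exI[of _ "(1, 0)"]) simp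

definition umod :: "ucover \<Rightarrow> real" where
  "umod z = fst (polar_of z)"

definition uarg :: "ucover \<Rightarrow> real" where
  "uarg z = snd (polar_of z)"

definition uproj :: "ucover \<Rightarrow> complex" where
  "uproj z = rcis (umod z) (uarg z)"

definition ulog :: "ucover \<Rightarrow> complex" where
  "ulog z = Complex (ln (umod z)) (uarg z)"

definition uexp :: "complex \<Rightarrow> ucover" where
  "uexp s = polar (exp (Re s), Im s)"

definition upowr :: "ucover \<Rightarrow> complex \<Rightarrow> complex" where
  "upowr z b = exp (b * ulog z)"

text \<open>
  The map \<^const>\<open>uexp\<close> (with inverse \<^const>\<open>ulog\<close>) is a global chart of the Riemann surface.  In
  this chart \<open>z = e\<^sup>s\<close>, hence \<open>d/dz = e\<^sup>-\<^sup>s d/ds\<close>.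
\<close>

definition uholomorphic :: "(ucover \<Rightarrow> complex) \<Rightarrow> bool" where
  "uholomorphic w \<longleftrightarrow> (\<lambda>s. w (uexp s)) holomorphic_on UNIV"

definition uderiv :: "(ucover \<Rightarrow> complex) \<Rightarrow> ucover \<Rightarrow> complex" where
  "uderiv w z = deriv (\<lambda>s. w (uexp s)) (ulog z) / uproj z"


section \<open>Bessel functions of the first kind\<close>

text \<open>
  The index is \<open>(lam 1, \<dots>, lam n)\<close>; other values of \<open>lam\<close> are never used.  The function
  \<^const>\<open>rGamma\<close> is \<open>1/\<Gamma>\<close>, with value \<open>0\<close> at the poles of \<open>\<Gamma>\<close>.
\<close>

definition bessel_first ::
    "nat \<Rightarrow> nat \<Rightarrow> ucover \<Rightarrow> complex \<Rightarrow> (nat \<Rightarrow> complex) \<Rightarrow> complex" where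
  "bessel_first n l z \<epsilon> lam =
     (\<Sum>m. (\<epsilon> * \<i> ^ n) ^ m * upowr z (of_nat n * (- lam l + of_nat m)) *
          (\<Prod>k=1..n. rGamma (lam k - lam l + of_nat m + 1)))"


section \<open>The Bessel equation\<close>

definition esym :: "nat set \<Rightarrow> (nat \<Rightarrow> complex) \<Rightarrow> nat \<Rightarrow> complex" where
  "esym I x d = (\<Sum>S | S \<subseteq> I \<and> card S = d. \<Prod>k\<in>S. x k)"

definition bessel_A :: "nat \<Rightarrow> nat \<Rightarrow> complex" where
  "bessel_A j m =
     (if j = 0 then (if m = 0 then 1 else 0)
      else (\<Sum>r=1..j. (-1) ^ (j - r) * of_nat r ^ (m + j) / (fact r * fact (j - r))))"

definition bessel_V :: "nat \<Rightarrow> nat \<Rightarrow> (nat \<Rightarrow> complex) \<Rightarrow> complex" where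
  "bessel_V n j lam =
     (\<Sum>m=0..n-j. bessel_A j (n - j - m) * of_nat n ^ m * esym {1..n} lam m)"

definition bessel_solution ::
    "nat \<Rightarrow> (nat \<Rightarrow> complex) \<Rightarrow> complex \<Rightarrow> (ucover \<Rightarrow> complex) \<Rightarrow> bool" where
  "bessel_solution n lam \<epsilon> w \<longleftrightarrow>
     uholomorphic w \<and>
     (\<forall>z. (\<Sum>j=1..n. bessel_V n j lam * uproj z ^ j * (uderiv ^^ j) w z)
          + (bessel_V n 0 lam - \<epsilon> * (\<i> * of_nat n) ^ n * uproj z ^ n) * w z = 0)"


section \<open>Formal solutions\<close>

text \<open>
  The formal expression \<open>e\<^bsup>\<alpha>z\<^esup> z\<^bsup>\<rho>\<^esup> c(1/z)\<close> is represented by the power series \<open>c\<close> in the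
  variable \<open>X = 1/z\<close>.  As \<open>dX/dz = - X\<^sup>2\<close>, its derivative with respect to \<open>z\<close> is represented by
  \<open>\<alpha> c + \<rho> X c - X\<^sup>2 c'\<close>.
\<close>

definition formal_deriv :: "complex \<Rightarrow> complex \<Rightarrow> complex fps \<Rightarrow> complex fps" where
  "formal_deriv \<alpha> \<rho> c =
     fps_const \<alpha> * c + fps_const \<rho> * fps_X * c - fps_X ^ 2 * fps_deriv c"

text \<open>
  The Bessel equation multiplied by \<open>z\<^sup>-\<^sup>n\<close>, so that \<open>z\<^sup>j\<close> becomes \<open>X\<^bsup>n-j\<^esup>\<close>.
\<close>

definition formal_bessel_solution ::
    "nat \<Rightarrow> (nat \<Rightarrow> complex) \<Rightarrow> complex \<Rightarrow> complex \<Rightarrow> complex \<Rightarrow> complex fps \<Rightarrow> bool" where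
  "formal_bessel_solution n lam \<epsilon> \<alpha> \<rho> c \<longleftrightarrow>
     (\<Sum>j=1..n. fps_const (bessel_V n j lam) * fps_X ^ (n - j) * (formal_deriv \<alpha> \<rho> ^^ j) c)
     + (fps_const (bessel_V n 0 lam) * fps_X ^ n - fps_const (\<epsilon> * (\<i> * of_nat n) ^ n)) * c = 0"

text \<open>
  The sign of the equation attached to \<open>\<xi>\<close> is \<open>\<xi>\<^sup>n\<close>.  For a fixed index the coefficients are
  already determined by the recursion expressing that the series is a formal solution, so that
  their being symmetric polynomials in the index does not enter the definition.
\<close>

definition bessel_B :: "nat \<Rightarrow> (nat \<Rightarrow> complex) \<Rightarrow> ucover \<Rightarrow> nat \<Rightarrow> complex" where
  "bessel_B n lam \<xi> =
     fps_nth (THE c. fps_nth c 0 = 1 \<and>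
       formal_bessel_solution n lam (uproj \<xi> ^ n)
         (\<i> * of_nat n * uproj \<xi>) (- (of_nat n - 1) / 2) c)"


section \<open>Bessel functions of the second kind\<close>

text \<open>
  Poincare asymptotics as \<open>|z| \<rightarrow> \<infinity>\<close>, uniformly for \<open>z\<close> in \<open>S\<close>:
  \<open>w(z) = e\<^bsup>\<alpha>z\<^esup> z\<^bsup>\<rho>\<^esup> (\<Sum>\<^bsub>m<M\<^esub> b\<^sub>m z\<^bsup>-m\<^esup> + O(|z|\<^bsup>-M\<^esup>))\<close> for every \<open>M\<close>.
\<close>

definition has_asymptotic_expansion ::
    "(ucover \<Rightarrow> complex) \<Rightarrow> complex \<Rightarrow> complex \<Rightarrow> (nat \<Rightarrow> complex) \<Rightarrow> ucover set \<Rightarrow> bool" where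
  "has_asymptotic_expansion w \<alpha> \<rho> b S \<longleftrightarrow>
     (\<forall>M. (\<lambda>z. w z / (exp (\<alpha> * uproj z) * upowr z \<rho>) - (\<Sum>m<M. b m / uproj z ^ m))
           \<in> O[inf (filtercomap umod at_top) (principal S)](\<lambda>z. 1 / uproj z ^ M))"

definition bessel_sector :: "nat \<Rightarrow> ucover \<Rightarrow> ucover set" where
  "bessel_sector n \<xi> = {z. \<bar>uarg z - (pi / 2 - uarg \<xi>)\<bar> < pi / of_nat n}"

definition bessel_second ::
    "nat \<Rightarrow> ucover \<Rightarrow> (nat \<Rightarrow> complex) \<Rightarrow> ucover \<Rightarrow> complex" where
  "bessel_second n z lam \<xi> =
     (THE w. bessel_solution n lam (uproj \<xi> ^ n) w \<and>
        has_asymptotic_expansion w (\<i> * of_nat n * uproj \<xi>) (- (of_nat n - 1) / 2)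
          (bessel_B n lam \<xi>) (bessel_sector n \<xi>)) z"

definition bessel_xi :: "nat \<Rightarrow> int \<Rightarrow> nat \<Rightarrow> ucover" where
  "bessel_xi n a j = polar (1, pi * of_int (2 * int j + a - 2) / of_nat n)"

end

theory Submission
  imports Defs "HOL-Complex_Analysis.Complex_Analysis" "HOL-Combinatorics.Stirling" "HOL-Real_Asymp.Real_Asymp"
begin

text \<open>
  In the chart \<open>z = e\<^sup>s\<close> the Bessel equation becomes \<open>(D + \<mu>\<^sub>0) \<cdots> (D + \<mu>\<^bsub>n-1\<^esub>) f = (-1)\<^sup>n e\<^bsup>nt\<^esup> f\<close> with
  \<open>\<mu>\<^sub>k = n \<lambda>\<^bsub>k+1\<^esub>\<close> and \<open>t\<close> a translate of \<open>s\<close> depending on \<open>\<xi>\<close>, so that all the functions of the second kind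
  are translates of a single solution \<open>f\<close> which decays like \<open>exp (-e\<^sup>t)\<close>.  The Mellin transform of \<open>f\<close>
  satisfies a first-order recursion in \<open>s\<close> and is therefore, by Stirling's asymptotics and up to an entire
  function, a product of the \<open>\<Gamma>((s - \<mu>\<^sub>k)/n)\<close>.  By the reflection formula, the linear combination of the
  theorem cancels the poles of all these factors but the \<open>l\<close>-th.  What remains has the poles and
  residues of the Mellin transform of the series of the first kind, so the difference of the two sides
  is a solution whose Mellin transform is entire; such a solution vanishes, because the
  difference equation makes its Mellin transform bounded.
\<close>

section \<open>Stirling numbers and the Bessel operator as a product of Euler factors\<close>

section \<open>The Bessel operator in factored form\<close>

text \<open>The coefficients of the theorem are dictated by poles. Translating \<open>f\<close> by 2
  pi i j / n multiplies its Mellin transform, up to an entire term, by T^j with T = exp (-2 pi i s /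
  n). The signed elementary symmetric polynomials are the coefficients of the product over k
  \<noteq> l of T - exp (-2 pi i lambda_k), which vanishes at every pole of the unwanted Gamma
  factors.

  A function of the first kind may grow along the positive t-axis, so it has no Mellin transform
  over the whole line. Transforms of solutions are therefore compared over t \<le> 0 only. For
  \<open>f\<close> the missing half is entire in s, and so is the integral over the segment that a
  translation adds. The price is that integration by parts leaves boundary values at 0, which the
  vanishing argument has to absorb.

  A function of the second kind is characterised by an expansion of the function alone, without its
  derivatives. Existence and uniqueness both come from a first-order system at infinity, in which
  decay of one sufficiently high power already forces a solution to vanish.

  The power of 2 pi combines Stirling's constant with the n - 1 factors 2 pi of the reflection
  formula.\<close>

lemma sum_alternating_Stirling:
  "(\<Sum>r\<le>j. (-1) ^ (j - r) * of_nat r ^ N / (fact r * fact (j - r))) = (of_nat (Stirling N j) :: complex)"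
proof (induction N arbitrary: j)
  case 0
  show ?case
  proof (cases j)
    case (Suc i)
    have "(\<Sum>r\<le>j. (-1) ^ (j - r) * of_nat r ^ 0 / (fact r * fact (j - r)))
        = (\<Sum>r\<le>j. of_nat (j choose r) * 1 ^ r * (-1 :: complex) ^ (j - r)) / fact j"
      unfolding sum_divide_distrib
      by (intro sum.cong refl) (simp add: binomial_fact field_simps)
    also have "(\<Sum>r\<le>j. of_nat (j choose r) * 1 ^ r * (-1 :: complex) ^ (j - r)) = (1 + (-1)) ^ j"
      by (rule binomial_ring [symmetric])
    finally show ?thesis using Suc by simp
  qed simp
next
  case (Suc N)
  show ?case
  proof (cases j)
    case 0
    then show ?thesis by simp
  next
    case (Suc i)
    \<comment> \<open>Writing one factor r as j - (j - r) reproduces the recursion S(N+1, j) = j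
      S(N, j) + S(N, j-1): the factor j - r cancels against the factorial and lowers j by one, with
      a change of sign.\<close>
    have "(\<Sum>r\<le>j. (-1) ^ (j - r) * of_nat r ^ Suc N / (fact r * fact (j - r)) :: complex)
        = (\<Sum>r\<le>j. of_nat j * ((-1) ^ (j - r) * of_nat r ^ N / (fact r * fact (j - r)))
              - of_nat (j - r) * ((-1) ^ (j - r) * of_nat r ^ N / (fact r * fact (j - r))))"
      by (intro sum.cong refl) (auto simp: of_nat_diff field_simps)
    also have "\<dots> = of_nat j * of_nat (Stirling N j)
        - (\<Sum>r\<le>j. of_nat (j - r) * ((-1) ^ (j - r) * of_nat r ^ N / (fact r * fact (j - r))))"
      by (simp only: sum_subtractf sum_distrib_left [symmetric] Suc.IH)
    also have "(\<Sum>r\<le>j. of_nat (j - r) * ((-1) ^ (j - r) * of_nat r ^ N / (fact r * fact (j - r))) :: complex)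
        = (\<Sum>r\<le>i. of_nat (j - r) * ((-1) ^ (j - r) * of_nat r ^ N / (fact r * fact (j - r))))"
      unfolding Suc by simp
    also have "\<dots> = (\<Sum>r\<le>i. - ((-1) ^ (i - r) * of_nat r ^ N / (fact r * fact (i - r))))"
      unfolding Suc by (intro sum.cong refl) (auto simp: Suc_diff_le field_simps simp flip: of_nat_Suc)
    also have "\<dots> = - of_nat (Stirling N i)"
      by (simp only: sum_negf Suc.IH)
    finally show ?thesis
      unfolding Suc by (simp add: algebra_simps)
  qed
qed

text \<open>The sum in \<open>bessel_A\<close> starts at r = 1 and the Stirling formula at r = 0;
  for j > 0 the extra term contains a positive power of 0. The case j = 0 is the separate convention
  of the definition.\<close>

lemma bessel_A_eq_Stirling: "bessel_A j m = of_nat (Stirling (m + j) j)"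
proof (cases j)
  case 0
  then show ?thesis by (cases m) (auto simp: bessel_A_def)
next
  case (Suc i)
  have "(\<Sum>r\<le>j. (-1) ^ (j - r) * of_nat r ^ (m + j) / (fact r * fact (j - r)) :: complex)
      = (\<Sum>r=1..j. (-1) ^ (j - r) * of_nat r ^ (m + j) / (fact r * fact (j - r)))"
    by (rule sum.mono_neutral_right) (auto simp: Suc not_le)
  then show ?thesis
    using sum_alternating_Stirling [of j "m + j"] Suc by (simp add: bessel_A_def)
qed

lemma esym_0 [simp]: "finite I \<Longrightarrow> esym I x 0 = 1"
proof -
  assume "finite I"
  then have "{S. S \<subseteq> I \<and> card S = 0} = {{}}"
    using finite_subset by fastforce
  then show ?thesis by (simp add: esym_def)
qed

lemma esym_eq_0: "finite I \<Longrightarrow> card I < d \<Longrightarrow> esym I x d = 0"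
proof -
  assume "finite I" "card I < d"
  then have "{S. S \<subseteq> I \<and> card S = d} = {}"
    using card_mono leD by blast
  then show ?thesis by (simp add: esym_def del: Collect_empty_eq)
qed

lemma esym_insert:
  assumes "finite I" "a \<notin> I"
  shows "esym (insert a I) x (Suc d) = esym I x (Suc d) + x a * esym I x d"
proof -
  have eq: "{S. S \<subseteq> insert a I \<and> card S = Suc d}
      = {S. S \<subseteq> I \<and> card S = Suc d} \<union> insert a ` {S. S \<subseteq> I \<and> card S = d}" (is "?L = ?A \<union> ?B")
  proof (intro set_eqI iffI)
    fix S assume "S \<in> ?L"
    then have S: "S \<subseteq> insert a I" "card S = Suc d" by auto
    show "S \<in> ?A \<union> ?B"
    proof (cases "a \<in> S")
      case True
      then have "S = insert a (S - {a})" "S - {a} \<subseteq> I" "card (S - {a}) = d"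
        using S by auto
      then show ?thesis by blast
    qed (use S in auto)
  next
    fix S assume "S \<in> ?A \<union> ?B"
    then show "S \<in> ?L"
    proof
      assume "S \<in> ?B"
      then obtain U where "S = insert a U" "U \<subseteq> I" "card U = d" by blast
      moreover from this have "finite U" "a \<notin> U"
        using assms finite_subset by auto
      ultimately show ?thesis by auto
    qed auto
  qed
  have fin: "finite {S. S \<subseteq> I \<and> card S = k}" for k
    using assms by simp
  have inj: "inj_on (insert a) {S. S \<subseteq> I \<and> card S = d}"
    using assms(2) by (auto simp: inj_on_def)
  have "esym (insert a I) x (Suc d) = (\<Sum>S\<in>?A. prod x S) + (\<Sum>S\<in>?B. prod x S)"
    unfolding esym_def eq
    using fin assms(2) by (intro sum.union_disjoint) auto
  also have "(\<Sum>S\<in>?B. prod x S) = (\<Sum>S | S \<subseteq> I \<and> card S = d. prod x (insert a S))"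
    by (simp add: sum.reindex [OF inj] o_def)
  also have "\<dots> = (\<Sum>S | S \<subseteq> I \<and> card S = d. x a * prod x S)"
    using assms by (intro sum.cong refl prod.insert) (auto dest: finite_subset)
  finally show ?thesis
    by (simp add: esym_def sum_distrib_left)
qed

lemma esym_smult:
  "esym I (\<lambda>k. c * x k) d = c ^ d * esym I x d"
  unfolding esym_def sum_distrib_left
  by (intro sum.cong refl) (simp add: prod.distrib)

text \<open>Vieta's formula. It serves at the very end, to read the coefficients of the theorem as
  those of a polynomial with prescribed zeros.\<close>

lemma prod_diff_esym:
  fixes T :: complex
  assumes "finite I"
  shows "(\<Prod>k\<in>I. T - x k) = (\<Sum>i\<le>card I. T ^ i * (-1) ^ (card I - i) * esym I x (card I - i))"
  using assms
proof (induction I rule: finite_induct)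
  case empty
  then show ?case by simp
next
  case (insert a I)
  define N where "N = card I"
  have c: "card (insert a I) = Suc N"
    using insert by (simp add: N_def)
  have "(\<Prod>k\<in>insert a I. T - x k) = (T - x a) * (\<Sum>i\<le>N. T ^ i * (-1) ^ (N - i) * esym I x (N - i))"
    using insert N_def by simp
  also have "\<dots> = (\<Sum>i\<le>N. T ^ Suc i * (-1) ^ (N - i) * esym I x (N - i))
       - (\<Sum>i\<le>N. T ^ i * (-1) ^ (N - i) * (x a * esym I x (N - i)))"
    by (simp add: sum_distrib_left left_diff_distrib sum_subtractf right_diff_distrib mult_ac)
  also have "(\<Sum>i\<le>N. T ^ Suc i * (-1) ^ (N - i) * esym I x (N - i))
      = (\<Sum>i\<le>Suc N. T ^ i * (-1) ^ (Suc N - i) * esym I x (Suc N - i))"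
    unfolding sum.atMost_Suc_shift using insert by (simp add: esym_eq_0 N_def)
  also have "\<dots> - (\<Sum>i\<le>N. T ^ i * (-1) ^ (N - i) * (x a * esym I x (N - i)))
      = (\<Sum>i\<le>N. T ^ i * (-1) ^ (Suc N - i) * (esym I x (Suc N - i) + x a * esym I x (N - i))) + T ^ Suc N"
    using insert by (simp add: Suc_diff_le sum_subtractf sum.distrib sum_negf algebra_simps)
  also have "(\<Sum>i\<le>N. T ^ i * (-1) ^ (Suc N - i) * (esym I x (Suc N - i) + x a * esym I x (N - i)))
      = (\<Sum>i\<le>N. T ^ i * (-1) ^ (Suc N - i) * esym (insert a I) x (Suc N - i))"
    using insert by (intro sum.cong refl) (simp add: Suc_diff_le esym_insert)
  finally show ?case
    using insert by (simp add: c)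
qed

text \<open>Let theta = z d/dz. Since theta^m is the sum of S(m, j) z^j (d/dz)^j, these are the
  coefficients of z^j (d/dz)^j in the product of theta + x_1, ..., theta + x_N.\<close>

definition factor_coeff :: "(nat \<Rightarrow> complex) \<Rightarrow> nat \<Rightarrow> nat \<Rightarrow> complex" where
  "factor_coeff x N j = (\<Sum>m\<le>N. of_nat (Stirling (N - m) j) * esym {1..N} x m)"

text \<open>The factors n^m are absorbed by homogeneity of the elementary symmetric polynomials, so
  the differential part of the Bessel equation is the product of the operators theta + n
  lambda_k.\<close>

lemma bessel_V_eq:
  assumes "j \<le> n"
  shows "bessel_V n j lam = factor_coeff (\<lambda>k. of_nat n * lam k) n j"
proof -
  have "factor_coeff (\<lambda>k. of_nat n * lam k) n j
      = (\<Sum>m\<in>{0..n-j}. of_nat (Stirling (n - m) j) * esym {1..n} (\<lambda>k. of_nat n * lam k) m)"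
    unfolding factor_coeff_def by (rule sum.mono_neutral_right) auto
  also have "\<dots> = bessel_V n j lam"
    unfolding bessel_V_def using assms
    by (intro sum.cong refl) (simp add: bessel_A_eq_Stirling esym_smult)
  finally show ?thesis ..
qed


lemma factor_coeff_0: "factor_coeff x 0 j = (if j = 0 then 1 else 0)"
  by (cases j) (simp_all add: factor_coeff_def)

lemma factor_coeff_Suc:
  "factor_coeff x (Suc N) j
     = (\<Sum>m\<le>N. of_nat (Stirling (Suc (N - m)) j) * esym {1..N} x m) + x (Suc N) * factor_coeff x N j"
proof -
  have ins: "{1..Suc N} = insert (Suc N) {1..N}"
    by auto
  have "factor_coeff x (Suc N) j
      = of_nat (Stirling (Suc N) j) + (\<Sum>m\<le>N. of_nat (Stirling (N - m) j) * esym {1..Suc N} x (Suc m))"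
    unfolding factor_coeff_def by (subst sum.atMost_Suc_shift) simp
  also have "\<dots> = (of_nat (Stirling (Suc N) j) + (\<Sum>m\<le>N. of_nat (Stirling (N - m) j) * esym {1..N} x (Suc m)))
      + x (Suc N) * factor_coeff x N j"
    unfolding ins factor_coeff_def
    by (simp add: esym_insert algebra_simps sum.distrib sum_distrib_left)
  also have "of_nat (Stirling (Suc N) j) + (\<Sum>m\<le>N. of_nat (Stirling (N - m) j) * esym {1..N} x (Suc m))
      = (\<Sum>m\<le>Suc N. of_nat (Stirling (Suc N - m) j) * esym {1..N} x m)"
    by (subst sum.atMost_Suc_shift) simp
  also have "\<dots> = (\<Sum>m\<le>N. of_nat (Stirling (Suc (N - m)) j) * esym {1..N} x m)"
    by (simp add: esym_eq_0 Suc_diff_le)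
  finally show ?thesis .
qed

lemma factor_coeff_Suc_0: "factor_coeff x (Suc N) 0 = x (Suc N) * factor_coeff x N 0"
  by (simp add: factor_coeff_Suc)

text \<open>Coefficient form of the rule (theta + x) z^j (d/dz)^j = z^(j+1) (d/dz)^(j+1) + (j + x)
  z^j (d/dz)^j.\<close>

lemma factor_coeff_Suc_Suc:
  "factor_coeff x (Suc N) (Suc j) = factor_coeff x N j + (of_nat (Suc j) + x (Suc N)) * factor_coeff x N (Suc j)"
  unfolding factor_coeff_Suc
  by (simp add: factor_coeff_def algebra_simps sum.distrib sum_distrib_left)

lemma factor_coeff_eq_0: "N < j \<Longrightarrow> factor_coeff x N j = 0"
  unfolding factor_coeff_def by (rule sum.neutral) simp

text \<open>One more Euler factor, regrouped by the old coefficients. An arbitrary additive and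
  multiplicative map \<open>h\<close> is allowed so that the computation serves twice: with the
  identity for genuine derivatives and with \<open>fps_const\<close> for formal ones.\<close>

lemma sum_factor_coeff_Suc:
  fixes h :: "complex \<Rightarrow> 'a :: comm_ring" and g :: "nat \<Rightarrow> 'a"
  assumes add: "\<And>u v. h (u + v) = h u + h v" and mult: "\<And>u v. h (u * v) = h u * h v"
  shows "(\<Sum>j\<le>Suc N. h (factor_coeff x (Suc N) j) * g j)
       = (\<Sum>j\<le>N. h (factor_coeff x N j) * (g (Suc j) + h (of_nat j + x (Suc N)) * g j))"
proof -
  let ?W = "factor_coeff x N"
  have h0: "h 0 = 0" using add [of 0 0] by simp
  have "(\<Sum>j\<le>Suc N. h (factor_coeff x (Suc N) j) * g j)
      = h (x (Suc N) * ?W 0) * g 0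
        + (\<Sum>j\<le>N. h (?W j) * g (Suc j) + h ((of_nat (Suc j) + x (Suc N)) * ?W (Suc j)) * g (Suc j))"
    by (subst sum.atMost_Suc_shift)
       (simp only: factor_coeff_Suc_0 factor_coeff_Suc_Suc add distrib_right)
  also have "\<dots> = (\<Sum>j\<le>N. h (?W j) * g (Suc j))
        + (h ((of_nat 0 + x (Suc N)) * ?W 0) * g 0
          + (\<Sum>j\<le>N. h ((of_nat (Suc j) + x (Suc N)) * ?W (Suc j)) * g (Suc j)))"
    by (simp add: sum.distrib)
  also have "h ((of_nat 0 + x (Suc N)) * ?W 0) * g 0
          + (\<Sum>j\<le>N. h ((of_nat (Suc j) + x (Suc N)) * ?W (Suc j)) * g (Suc j))
      = (\<Sum>j\<le>Suc N. h ((of_nat j + x (Suc N)) * ?W j) * g j)"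
    by (rule sum.atMost_Suc_shift [symmetric])
  also have "\<dots> = (\<Sum>j\<le>N. h ((of_nat j + x (Suc N)) * ?W j) * g j)"
    by (simp add: factor_coeff_eq_0 h0)
  also have "\<dots> = (\<Sum>j\<le>N. h (?W j) * (h (of_nat j + x (Suc N)) * g j))"
    by (intro sum.cong refl) (simp only: mult mult_ac)
  finally show ?thesis
    by (simp only: distrib_left sum.distrib)
qed

text \<open>The operators D + \<mu> 0, D + \<mu> 1, ... with D = d/dt, applied one after the other.
  Keeping the intermediate functions turns an equation of order n into a first-order system.\<close>

primrec tower :: "(nat \<Rightarrow> complex) \<Rightarrow> (complex \<Rightarrow> complex) \<Rightarrow> nat \<Rightarrow> complex \<Rightarrow> complex" where
  "tower \<mu> f 0 = f"
| "tower \<mu> f (Suc k) = (\<lambda>t. deriv (tower \<mu> f k) t + \<mu> k * tower \<mu> f k t)"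

lemma uproj_uexp [simp]: "uproj (uexp s) = exp s"
  by (simp add: uproj_def uexp_def umod_def uarg_def polar_inverse rcis_def exp_eq_polar)

lemma ulog_uexp [simp]: "ulog (uexp s) = s"
  by (simp add: ulog_def uexp_def umod_def uarg_def polar_inverse)

lemma umod_pos [simp]: "umod z > 0"
  using polar_of [of z] by (simp add: umod_def)

lemma uexp_ulog [simp]: "uexp (ulog z) = z"
proof -
  have "uexp (ulog z) = polar (umod z, uarg z)"
    by (simp add: ulog_def uexp_def)
  also have "\<dots> = z"
    unfolding umod_def uarg_def prod.collapse by (rule polar_of_inverse)
  finally show ?thesis .
qed

lemma umod_uexp [simp]: "umod (uexp s) = exp (Re s)"
  by (simp add: uexp_def umod_def polar_inverse)

lemma uarg_uexp [simp]: "uarg (uexp s) = Im s"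
  by (simp add: uexp_def uarg_def polar_inverse)

lemma uderiv_uexp: "uderiv w (uexp s) = deriv (\<lambda>s. w (uexp s)) s / exp s"
  by (simp add: uderiv_def)

lemma holomorphic_uderiv_funpow:
  assumes "uholomorphic w"
  shows "(\<lambda>s. (uderiv ^^ j) w (uexp s)) holomorphic_on UNIV"
proof (induction j)
  case 0
  then show ?case using assms by (simp add: uholomorphic_def)
next
  case (Suc j)
  then show ?case
    by (simp add: uderiv_uexp) (intro holomorphic_intros, auto)
qed

text \<open>In the chart z = e^s the operator z d/dz is d/ds, so each further factor acts on e^(js)
  times the j-th derivative of w by the rule behind \<open>factor_coeff\<close>.\<close>

lemma tower_eq_sum_uderiv:
  assumes "uholomorphic w"
  shows "tower (\<lambda>k. x (Suc k)) (\<lambda>s. w (uexp s)) N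
       = (\<lambda>s. \<Sum>j\<le>N. factor_coeff x N j * (exp (of_nat j * s) * (uderiv ^^ j) w (uexp s)))"
proof (induction N)
  case 0
  then show ?case by (simp add: factor_coeff_0)
next
  case (Suc N)
  define F where "F = (\<lambda>j s. exp (of_nat j * s) * (uderiv ^^ j) w (uexp s))"
  have F: "(F j has_field_derivative F (Suc j) s + of_nat j * F j s) (at s)" for j s
  proof -
    have "((\<lambda>s. (uderiv ^^ j) w (uexp s)) has_field_derivative deriv (\<lambda>s. (uderiv ^^ j) w (uexp s)) s) (at s)"
      using holomorphic_uderiv_funpow [OF assms] by (intro holomorphic_derivI [of _ UNIV]) auto
    then have "(F j has_field_derivative exp (of_nat j * s) * deriv (\<lambda>s. (uderiv ^^ j) w (uexp s)) s
        + of_nat j * F j s) (at s)"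
      unfolding F_def by (auto intro!: derivative_eq_intros)
    moreover have "exp (of_nat j * s) * deriv (\<lambda>s. (uderiv ^^ j) w (uexp s)) s = F (Suc j) s"
      by (simp add: F_def uderiv_uexp exp_add distrib_right)
    ultimately show ?thesis by simp
  qed
  have "tower (\<lambda>k. x (Suc k)) (\<lambda>s. w (uexp s)) (Suc N) s = (\<Sum>j\<le>Suc N. factor_coeff x (Suc N) j * F j s)" for s
  proof -
    have "((\<lambda>s. \<Sum>j\<le>N. factor_coeff x N j * F j s) has_field_derivative
        (\<Sum>j\<le>N. factor_coeff x N j * (F (Suc j) s + of_nat j * F j s))) (at s)"
      by (intro DERIV_sum DERIV_cmult F)
    then have "deriv (\<lambda>s. \<Sum>j\<le>N. factor_coeff x N j * F j s) s
        = (\<Sum>j\<le>N. factor_coeff x N j * (F (Suc j) s + of_nat j * F j s))"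
      by (rule DERIV_imp_deriv)
    then have "tower (\<lambda>k. x (Suc k)) (\<lambda>s. w (uexp s)) (Suc N) s
        = (\<Sum>j\<le>N. factor_coeff x N j * (F (Suc j) s + (of_nat j + x (Suc N)) * F j s))"
      using Suc by (simp add: F_def sum_distrib_left sum.distrib algebra_simps)
    then show ?thesis
      using sum_factor_coeff_Suc [of "\<lambda>u. u" x N "\<lambda>j. F j s"] by simp
  qed
  then show ?case by (auto simp: F_def)
qed

lemma bessel_solution_iff_tower:
  "bessel_solution n lam \<epsilon> w \<longleftrightarrow> uholomorphic w \<and>
     (\<forall>s. tower (\<lambda>k. of_nat n * lam (Suc k)) (\<lambda>s. w (uexp s)) n s
          = \<epsilon> * (\<i> * of_nat n) ^ n * exp (of_nat n * s) * w (uexp s))"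
proof (cases "uholomorphic w")
  case True
  have "(\<Sum>j=1..n. bessel_V n j lam * uproj (uexp s) ^ j * (uderiv ^^ j) w (uexp s))
          + (bessel_V n 0 lam - \<epsilon> * (\<i> * of_nat n) ^ n * uproj (uexp s) ^ n) * w (uexp s)
      = tower (\<lambda>k. of_nat n * lam (Suc k)) (\<lambda>s. w (uexp s)) n s
          - \<epsilon> * (\<i> * of_nat n) ^ n * exp (of_nat n * s) * w (uexp s)" for s
  proof -
    have "tower (\<lambda>k. of_nat n * lam (Suc k)) (\<lambda>s. w (uexp s)) n s
        = (\<Sum>j\<le>n. bessel_V n j lam * uproj (uexp s) ^ j * (uderiv ^^ j) w (uexp s))"
      by (simp add: tower_eq_sum_uderiv [OF True, where x = "\<lambda>k. of_nat n * lam k"] bessel_V_eq exp_of_nat_mult mult.assoc)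
    also have "\<dots> = bessel_V n 0 lam * w (uexp s)
        + (\<Sum>j=1..n. bessel_V n j lam * uproj (uexp s) ^ j * (uderiv ^^ j) w (uexp s))"
      by (simp add: atMost_atLeast0 sum.atLeast_Suc_atMost)
    finally show ?thesis
      by (simp add: algebra_simps exp_of_nat2_mult)
  qed
  then have "(\<Sum>j=1..n. bessel_V n j lam * uproj (uexp s) ^ j * (uderiv ^^ j) w (uexp s))
          + (bessel_V n 0 lam - \<epsilon> * (\<i> * of_nat n) ^ n * uproj (uexp s) ^ n) * w (uexp s) = 0
      \<longleftrightarrow> tower (\<lambda>k. of_nat n * lam (Suc k)) (\<lambda>s. w (uexp s)) n s
          = \<epsilon> * (\<i> * of_nat n) ^ n * exp (of_nat n * s) * w (uexp s)" for s
    by (simp only: eq_iff_diff_eq_0 [symmetric])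
  moreover have "(\<forall>z. P z) \<longleftrightarrow> (\<forall>s. P (uexp s))" for P
  proof (intro iffI allI)
    fix z assume "\<forall>s. P (uexp s)"
    then have "P (uexp (ulog z))" by blast
    then show "P z" by simp
  qed simp
  ultimately show ?thesis
    unfolding bessel_solution_def by (simp only: True)
qed (simp add: bessel_solution_def)


section \<open>The coefficient recursion and its unique normalised fixed point\<close>

section \<open>Formal solutions\<close>

lemma formal_deriv_nth:
  "fps_nth (formal_deriv \<alpha> \<rho> c) m
     = \<alpha> * fps_nth c m + (if m = 0 then 0 else (\<rho> - of_nat (m - 1)) * fps_nth c (m - 1))"
proof -
  have "fps_nth (fps_X ^ 2 * fps_deriv c) m = (if m = 0 then 0 else of_nat (m - 1) * fps_nth c (m - 1))"
    by (cases m; cases "m - 1") (auto simp: fps_X_power_mult_nth)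
  then show ?thesis
    unfolding formal_deriv_def by (cases m) (auto simp: mult.assoc algebra_simps)
qed

lemma formal_deriv_sum: "formal_deriv \<alpha> \<rho> (\<Sum>j\<in>A. g j) = (\<Sum>j\<in>A. formal_deriv \<alpha> \<rho> (g j))"
  by (rule fps_ext) (auto simp: formal_deriv_nth fps_sum_nth sum.distrib sum_distrib_left)

lemma formal_deriv_const_mult: "formal_deriv \<alpha> \<rho> (fps_const u * c) = fps_const u * formal_deriv \<alpha> \<rho> c"
  by (rule fps_ext) (auto simp: formal_deriv_nth algebra_simps)

text \<open>As X stands for 1/z, this is the Leibniz rule with (z^-k)' = -k z^(-k-1).\<close>

lemma formal_deriv_X_power_mult:
  "formal_deriv \<alpha> \<rho> (fps_X ^ k * c) = fps_X ^ k * formal_deriv \<alpha> \<rho> c - fps_const (of_nat k) * fps_X ^ Suc k * c"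
proof (rule fps_ext)
  fix m
  consider "m < k" | "m = k" | i where "m = Suc (k + i)"
    by (metis add_Suc_right less_iff_Suc_add linorder_neqE_nat)
  then show "fps_nth (formal_deriv \<alpha> \<rho> (fps_X ^ k * c)) m
      = fps_nth (fps_X ^ k * formal_deriv \<alpha> \<rho> c - fps_const (of_nat k) * fps_X ^ Suc k * c) m"
  proof cases
    case 1
    then show ?thesis
      by (auto simp: formal_deriv_nth fps_X_power_mult_nth mult.assoc simp del: power_Suc)
  next
    case 2
    then show ?thesis
      by (auto simp: formal_deriv_nth fps_X_power_mult_nth mult.assoc simp del: power_Suc)
  next
    case (3 i)
    then show ?thesis
      by (simp add: formal_deriv_nth fps_X_power_mult_nth mult.assoc del: power_Suc)
         (simp add: algebra_simps)
  qed
qed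

text \<open>Put y = -\<alpha> z. If a function is e^-y y^r times the sum of p_m y^-m, then y d/dy +
  \<mu> sends it to -e^-y y^(r+1) times the series with coefficients p_m - (a - (m-1)) p_(m-1),
  where a = r + \<mu>. Each step of the recursion is one stage of the tower in this
  normalisation.\<close>

primrec ladder_coeff :: "(nat \<Rightarrow> complex) \<Rightarrow> (nat \<Rightarrow> complex) \<Rightarrow> nat \<Rightarrow> nat \<Rightarrow> complex" where
  "ladder_coeff a b 0 = b"
| "ladder_coeff a b (Suc k) = (\<lambda>m. ladder_coeff a b k m
     - (if m = 0 then 0 else (a k - of_nat (m - 1)) * ladder_coeff a b k (m - 1)))"

text \<open>The factors (-\<alpha>)^m express the change of variable from z to y = -\<alpha> z. They
  remove \<alpha> from the recursion, which thereby becomes the same for all \<xi>.\<close>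

lemma nth_sum_formal_deriv:
  assumes "\<alpha> \<noteq> 0"
  shows "fps_nth (\<Sum>j\<le>N. fps_const (factor_coeff x N j) * (fps_X ^ (N - j) * (formal_deriv \<alpha> \<rho> ^^ j) c)) m
       = \<alpha> ^ N / (- \<alpha>) ^ m
         * ladder_coeff (\<lambda>k. \<rho> + of_nat k + x (Suc k)) (\<lambda>m. (- \<alpha>) ^ m * fps_nth c m) N m"
proof (induction N arbitrary: m)
  case 0
  then show ?case using assms by (simp add: factor_coeff_0)
next
  case (Suc N)
  define Q where "Q = (\<lambda>N. \<Sum>j\<le>N. fps_const (factor_coeff x N j) * (fps_X ^ (N - j) * (formal_deriv \<alpha> \<rho> ^^ j) c))"
  let ?L = "ladder_coeff (\<lambda>k. \<rho> + of_nat k + x (Suc k)) (\<lambda>m. (- \<alpha>) ^ m * fps_nth c m) N"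
  have "Q (Suc N) = (\<Sum>j\<le>N. fps_const (factor_coeff x N j)
        * (fps_X ^ (N - j) * (formal_deriv \<alpha> \<rho> ^^ Suc j) c
           + fps_const (of_nat j + x (Suc N)) * (fps_X ^ (Suc N - j) * (formal_deriv \<alpha> \<rho> ^^ j) c)))"
    unfolding Q_def by (subst sum_factor_coeff_Suc) auto
  also have "\<dots> = (\<Sum>j\<le>N. formal_deriv \<alpha> \<rho> (fps_const (factor_coeff x N j) * (fps_X ^ (N - j) * (formal_deriv \<alpha> \<rho> ^^ j) c))
      + fps_const (of_nat N + x (Suc N)) * fps_X
          * (fps_const (factor_coeff x N j) * (fps_X ^ (N - j) * (formal_deriv \<alpha> \<rho> ^^ j) c)))"
  proof (intro sum.cong refl)
    fix j assume "j \<in> {..N}"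
    then have 1: "Suc N - j = Suc (N - j)" and 2: "(of_nat j :: complex) = of_nat N - of_nat (N - j)"
      by (auto simp: of_nat_diff)
    show "fps_const (factor_coeff x N j)
        * (fps_X ^ (N - j) * (formal_deriv \<alpha> \<rho> ^^ Suc j) c
           + fps_const (of_nat j + x (Suc N)) * (fps_X ^ (Suc N - j) * (formal_deriv \<alpha> \<rho> ^^ j) c))
      = formal_deriv \<alpha> \<rho> (fps_const (factor_coeff x N j) * (fps_X ^ (N - j) * (formal_deriv \<alpha> \<rho> ^^ j) c))
      + fps_const (of_nat N + x (Suc N)) * fps_X
          * (fps_const (factor_coeff x N j) * (fps_X ^ (N - j) * (formal_deriv \<alpha> \<rho> ^^ j) c))"
      unfolding 1 2 formal_deriv_const_mult formal_deriv_X_power_mult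
      by (simp add: algebra_simps flip: fps_const_add fps_const_sub)
  qed
  also have "\<dots> = formal_deriv \<alpha> \<rho> (Q N) + fps_const (of_nat N + x (Suc N)) * (fps_X * Q N)"
    unfolding Q_def formal_deriv_sum by (simp add: sum.distrib sum_distrib_left mult_ac)
  finally have rec: "Q (Suc N) = formal_deriv \<alpha> \<rho> (Q N) + fps_const (of_nat N + x (Suc N)) * (fps_X * Q N)" .
  have IH: "fps_nth (Q N) m = \<alpha> ^ N / (- \<alpha>) ^ m * ?L m" for m
    using Suc by (simp add: Q_def)
  have "fps_nth (Q (Suc N)) m = \<alpha> ^ Suc N / (- \<alpha>) ^ m
      * (?L m - (if m = 0 then 0 else (\<rho> + of_nat N + x (Suc N) - of_nat (m - 1)) * ?L (m - 1)))"
    using assms by (cases m) (auto simp: rec formal_deriv_nth IH field_simps)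
  then show ?case
    by (simp add: Q_def)
qed

text \<open>When \<epsilon> (i n)^n = \<alpha>^n both sides of the equation carry the factor
  \<alpha>^n. After its cancellation n ladder steps have to reproduce the coefficients they started
  from.\<close>

lemma formal_bessel_solution_iff:
  assumes "n \<ge> 1" "\<alpha> \<noteq> 0" "\<epsilon> * (\<i> * of_nat n) ^ n = \<alpha> ^ n"
  shows "formal_bessel_solution n lam \<epsilon> \<alpha> \<rho> c \<longleftrightarrow>
    ladder_coeff (\<lambda>k. \<rho> + of_nat k + of_nat n * lam (Suc k)) (\<lambda>m. (- \<alpha>) ^ m * fps_nth c m) n
      = (\<lambda>m. (- \<alpha>) ^ m * fps_nth c m)" (is "_ \<longleftrightarrow> ?L = ?b")
proof -
  define Q where "Q = (\<Sum>j\<le>n. fps_const (factor_coeff (\<lambda>k. of_nat n * lam k) n j) * (fps_X ^ (n - j) * (formal_deriv \<alpha> \<rho> ^^ j) c))"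
  have "Q = (\<Sum>j\<le>n. fps_const (bessel_V n j lam) * fps_X ^ (n - j) * (formal_deriv \<alpha> \<rho> ^^ j) c)"
    by (simp add: Q_def bessel_V_eq mult.assoc)
  also have "\<dots> = fps_const (bessel_V n 0 lam) * fps_X ^ n * c
      + (\<Sum>j=1..n. fps_const (bessel_V n j lam) * fps_X ^ (n - j) * (formal_deriv \<alpha> \<rho> ^^ j) c)"
    by (simp add: atMost_atLeast0 sum.atLeast_Suc_atMost)
  finally have "formal_bessel_solution n lam \<epsilon> \<alpha> \<rho> c \<longleftrightarrow> Q = fps_const (\<alpha> ^ n) * c"
    unfolding formal_bessel_solution_def assms(3) by (simp add: algebra_simps)
  also have "\<dots> \<longleftrightarrow> (\<forall>m. \<alpha> ^ n / (- \<alpha>) ^ m * ?L m = \<alpha> ^ n * fps_nth c m)"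
    unfolding Q_def fps_eq_iff nth_sum_formal_deriv [OF assms(2)] by simp
  also have "\<dots> \<longleftrightarrow> (\<forall>m. ?L m = ?b m)"
    using assms(2) by (simp add: field_simps)
  finally show ?thesis by (simp add: fun_eq_iff)
qed

text \<open>The ladder is linear and triangular, and the two leading terms of a change starting at
  index m are explicit. In a fixed-point equation at index m + 1 the values at m + 1 cancel, and
  what is left is a linear condition on the value at m.\<close>

lemma ladder_coeff_diff:
  assumes "\<And>i. i < m \<Longrightarrow> b i = b' i"
  shows "(\<forall>i<m. ladder_coeff a b k i = ladder_coeff a b' k i)
    \<and> ladder_coeff a b k m - ladder_coeff a b' k m = b m - b' m
    \<and> ladder_coeff a b k (Suc m) - ladder_coeff a b' k (Suc m)
       = b (Suc m) - b' (Suc m) - (\<Sum>i<k. a i - of_nat m) * (b m - b' m)"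
proof (induction k)
  case 0
  then show ?case using assms by simp
next
  case (Suc k)
  have A: "ladder_coeff a b k (m - 1) = ladder_coeff a b' k (m - 1)" if "m \<noteq> 0"
    using Suc that by simp
  from Suc have B: "\<And>i. i < m \<Longrightarrow> ladder_coeff a b k i = ladder_coeff a b' k i" by blast
  from Suc have C: "ladder_coeff a b k m = ladder_coeff a b' k m + (b m - b' m)"
    by (simp add: algebra_simps)
  from Suc have D: "ladder_coeff a b k (Suc m) = ladder_coeff a b' k (Suc m)
       + (b (Suc m) - b' (Suc m) - (\<Sum>i<k. a i - of_nat m) * (b m - b' m))"
    by (simp add: algebra_simps)
  have "\<forall>i<m. ladder_coeff a b (Suc k) i = ladder_coeff a b' (Suc k) i"
    using B by auto
  moreover have "ladder_coeff a b (Suc k) m - ladder_coeff a b' (Suc k) m = b m - b' m"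
    using A C by auto
  moreover have "ladder_coeff a b (Suc k) (Suc m) - ladder_coeff a b' (Suc k) (Suc m)
       = b (Suc m) - b' (Suc m) - (\<Sum>i<Suc k. a i - of_nat m) * (b m - b' m)"
    by (simp add: C D algebra_simps)
  ultimately show ?case by blast
qed

lemma ladder_coeff_zero: "ladder_coeff a (\<lambda>_. 0) k = (\<lambda>_. 0)"
  by (induction k) auto

text \<open>Course-of-values recursion for a functional that expects a whole sequence; the default
  \<open>z\<close> fills the places not yet defined.\<close>

lemma exists_course_of_values:
  fixes F :: "nat \<Rightarrow> (nat \<Rightarrow> 'a) \<Rightarrow> 'a" and z :: 'a
  shows "\<exists>b. \<forall>m. b m = F m (\<lambda>i. if i < m then b i else z)"
proof -
  define R :: "(nat \<times> nat) set" where "R = {(i, m). i < m}"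
  define b where "b = wfrec R (\<lambda>r m. F m (\<lambda>i. if i < m then r i else z))"
  have "wf R" unfolding R_def by (rule wf_less)
  then have "b m = F m (\<lambda>i. if i < m then b i else z)" for m
    unfolding b_def by (subst wfrec) (auto simp: R_def cut_def cong: if_cong)
  then show ?thesis by blast
qed

text \<open>Because the a_k sum to 0, the equation at index m + 1 determines the value at m with
  pivot n m. The pivot is nonzero for m > 0, so only the value at 0 is free.\<close>

lemma ladder_coeff_fixpoint_unique:
  assumes n: "n \<ge> 1" and a: "(\<Sum>k<n. a k) = 0"
    and b: "ladder_coeff a b n = b" "ladder_coeff a b' n = b'" "b 0 = b' 0"
  shows "b = b'"
proof
  fix m
  show "b m = b' m"
  proof (induction m rule: less_induct)
    case (less m)
    then have "b (Suc m) - b' (Suc m) = b (Suc m) - b' (Suc m) - (\<Sum>i<n. a i - of_nat m) * (b m - b' m)"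
      using ladder_coeff_diff [of m b b' a n] b by metis
    then have "of_nat (n * m) * (b m - b' m) = 0"
      by (simp add: sum_subtractf a)
    then have "n * m = 0 \<or> b m = b' m"
      by (metis mult_eq_0_iff of_nat_eq_0_iff right_minus_eq)
    then show ?case using n b(3) by auto
  qed
qed

lemma ladder_coeff_fixpoint_exists:
  assumes n: "n \<ge> 1" and a: "(\<Sum>k<n. a k) = 0"
  shows "\<exists>b. b 0 = 1 \<and> ladder_coeff a b n = b"
proof -
  \<comment> \<open>The equation at index m + 1 is the one that determines b m, hence the shift. It
    is evaluated on the sequence cut off at m and divided by the pivot -n m.\<close>
  obtain b where b: "\<And>m. b m = (if m = 0 then 1 else
      ladder_coeff a (\<lambda>i. if i < m then b i else 0) n (Suc m) / (- of_nat (n * m)))"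
    using exists_course_of_values [of "\<lambda>m r. if m = 0 then 1 else
      ladder_coeff a r n (Suc m) / (- of_nat (n * m))" 0] by blast
  have S: "(\<Sum>i<n. a i - of_nat m) = - of_nat (n * m)" for m
    by (simp add: sum_subtractf a)
  have "ladder_coeff a b n m = b m" for m
  proof (cases m)
    case 0
    have "ladder_coeff a b n 0 - ladder_coeff a (\<lambda>_. 0) n 0 = b 0 - 0"
      using ladder_coeff_diff [of 0 b "\<lambda>_. 0" a n] by auto
    then show ?thesis by (simp add: 0 ladder_coeff_zero)
  next
    case (Suc m')
    define r where "r = (\<lambda>i. if i < m' then b i else 0)"
    have "ladder_coeff a b n (Suc m') - ladder_coeff a r n (Suc m') = b (Suc m') + of_nat (n * m') * b m'"
      using ladder_coeff_diff [of m' b r a n] unfolding S r_def by simp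
    moreover have "of_nat (n * m') * b m' = - ladder_coeff a r n (Suc m')"
    proof (cases "m' = 0")
      case True
      then show ?thesis by (simp add: r_def ladder_coeff_zero)
    next
      case False
      then show ?thesis using n b [of m'] unfolding r_def by (simp add: field_simps)
    qed
    ultimately show ?thesis using Suc by simp
  qed
  moreover have "b 0 = 1" using b [of 0] by simp
  ultimately show ?thesis by blast
qed

section \<open>Variation of constants from infinity in a half-plane\<close>

section \<open>Solutions at infinity\<close>

text \<open>The image under exp of the half-strip Re t > 0, |Im t| < pi/2. It is stable under y -> y
  + u for u \<ge> 0, and these horizontal rays are the paths of integration.\<close>

definition far_half_plane :: "complex set" where
  "far_half_plane = {y. Re y > 0 \<and> norm y > 1}"

definition weight :: "complex \<Rightarrow> real" where
  "weight y = norm y + Re y"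

lemma open_far_half_plane: "open far_half_plane"
proof -
  have eq: "far_half_plane = {y. 0 < Re y} \<inter> {y. 1 < norm y}"
    by (auto simp: far_half_plane_def)
  show ?thesis
    unfolding eq by (intro open_Int open_Collect_less continuous_intros)
qed

lemma norm_add_real_ge:
  assumes "0 \<le> Re y" "0 \<le> u"
  shows "norm (y + of_real u) \<ge> norm y" "norm (y + of_real u) \<ge> u"
proof -
  show "norm (y + of_real u) \<ge> norm y"
    using assms by (auto simp: cmod_def intro!: real_sqrt_le_mono power_mono)
  have "u \<le> Re (y + of_real u)" using assms by simp
  also have "\<dots> \<le> norm (y + of_real u)" by (rule complex_Re_le_cmod)
  finally show "norm (y + of_real u) \<ge> u" .
qed

lemma far_half_plane_add_real:
  assumes "y \<in> far_half_plane" "0 \<le> u"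
  shows "y + of_real u \<in> far_half_plane"
  using assms norm_add_real_ge(1) [of y u] by (auto simp: far_half_plane_def)

lemma weight_ge_norm: "y \<in> far_half_plane \<Longrightarrow> norm y \<le> weight y"
  by (simp add: weight_def far_half_plane_def)

lemma weight_gt_1: "y \<in> far_half_plane \<Longrightarrow> 1 < weight y"
  by (simp add: weight_def far_half_plane_def)

lemma weight_le: "weight y \<le> 2 * norm y"
  using complex_Re_le_cmod [of y] by (simp add: weight_def)

text \<open>Along horizontal rays \<open>weight\<close> has logarithmic derivative \<open>1 / norm\<close>; this is what makes the
  factor \<open>1 / y\<close> of the system integrable against powers of \<open>weight\<close> uniformly up to the
  imaginary axis.\<close>

lemma has_derivative_weight_ray:
  assumes "y \<in> far_half_plane" "0 \<le> u" "M \<ge> 1"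
  shows "((\<lambda>u. - 1 / (real M * weight (y + of_real u) ^ M)) has_real_derivative
     1 / (weight (y + of_real u) ^ M * norm (y + of_real u))) (at u within S)"
proof -
  let ?z = "y + of_real u"
  have z: "?z \<in> far_half_plane" using assms(1,2) by (rule far_half_plane_add_real)
  then have pos: "norm ?z > 0" "weight ?z > 0" by (auto simp: far_half_plane_def weight_def)
  have sq: "(Re y + u) ^ 2 + Im y ^ 2 = (norm ?z) ^ 2"
    by (simp add: cmod_power2)
  have eq: "weight (y + of_real u) = sqrt ((Re y + u) ^ 2 + Im y ^ 2) + (Re y + u)" for u
    by (simp add: weight_def cmod_def)
  have "((\<lambda>u. (Re y + u) ^ 2 + Im y ^ 2) has_real_derivative 2 * (Re y + u)) (at u within S)"
    by (auto intro!: derivative_eq_intros)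
  then have "((\<lambda>u. sqrt ((Re y + u) ^ 2 + Im y ^ 2)) has_real_derivative
      inverse (sqrt ((Re y + u) ^ 2 + Im y ^ 2)) / 2 * (2 * (Re y + u))) (at u within S)"
    using pos by (intro DERIV_chain2 [OF DERIV_real_sqrt]) (simp_all add: sq)
  from this DERIV_add [OF DERIV_const DERIV_ident, of "Re y" u S]
  have "((\<lambda>u. sqrt ((Re y + u) ^ 2 + Im y ^ 2) + (Re y + u)) has_real_derivative
      inverse (sqrt ((Re y + u) ^ 2 + Im y ^ 2)) / 2 * (2 * (Re y + u)) + (0 + 1)) (at u within S)"
    by (rule DERIV_add)
  moreover have "inverse (sqrt ((Re y + u) ^ 2 + Im y ^ 2)) / 2 * (2 * (Re y + u)) + (0 + 1) = weight ?z / norm ?z"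
    unfolding sq using pos(1) by (simp add: weight_def field_simps)
  ultimately have W: "((\<lambda>u. weight (y + of_real u)) has_real_derivative weight ?z / norm ?z) (at u within S)"
    unfolding eq by simp
  obtain m where m: "M = Suc m" using assms(3) by (cases M) auto
  have "((\<lambda>u. - inverse (real M) * inverse (weight (y + of_real u) ^ M)) has_real_derivative
     - inverse (real M) * (- (inverse (weight ?z ^ M) * (real M * (weight ?z / norm ?z * weight ?z ^ (M - Suc 0)))
       * inverse (weight ?z ^ M)))) (at u within S)"
    using pos by (intro DERIV_cmult DERIV_inverse' DERIV_power W) auto
  moreover have "- inverse (real M) * (- (inverse (weight ?z ^ M) * (real M * (weight ?z / norm ?z * weight ?z ^ (M - Suc 0)))
       * inverse (weight ?z ^ M))) = 1 / (weight ?z ^ M * norm ?z)"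
  proof -
    have "- inverse R * (- (inverse (w * p) * (R * (w / nz * p)) * inverse (w * p))) = 1 / (w * p * nz)"
      if "R > 0" "w > 0" "p > 0" "nz > 0" for R w p nz :: real
      using that by (simp add: field_simps)
    from this [of "real M" "weight ?z" "weight ?z ^ m" "norm ?z"] show ?thesis
      using pos by (simp add: m)
  qed
  moreover have "(\<lambda>u. - 1 / (real M * weight (y + of_real u) ^ M))
      = (\<lambda>u. - inverse (real M) * inverse (weight (y + of_real u) ^ M))"
    by (simp add: divide_inverse)
  ultimately show ?thesis by (simp only:)
qed

text \<open>The antiderivative -1 / (M \<open>weight\<close>^M) is explicit. The factor 1 / M that
  it gains makes the later iteration a contraction as soon as M is large.\<close>

lemma integral_weight_bound:
  assumes "y \<in> far_half_plane" "0 \<le> a" "a \<le> b" "M \<ge> 1"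
  shows "(\<lambda>u. 1 / (weight (y + of_real u) ^ M * norm (y + of_real u))) integrable_on {a..b}"
    and "integral {a..b} (\<lambda>u. 1 / (weight (y + of_real u) ^ M * norm (y + of_real u)))
       \<le> 1 / (real M * weight (y + of_real a) ^ M)"
proof -
  have "((\<lambda>u. 1 / (weight (y + of_real u) ^ M * norm (y + of_real u))) has_integral
      (- 1 / (real M * weight (y + of_real b) ^ M) - (- 1 / (real M * weight (y + of_real a) ^ M)))) {a..b}"
  proof (rule fundamental_theorem_of_calculus)
    fix u assume "u \<in> {a..b}"
    then show "((\<lambda>u. - 1 / (real M * weight (y + of_real u) ^ M)) has_vector_derivative
      1 / (weight (y + of_real u) ^ M * norm (y + of_real u))) (at u within {a..b})"
      using has_derivative_weight_ray [of y u M "{a..b}"] assms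
      by (simp add: has_real_derivative_iff_has_vector_derivative)
  qed fact
  note I = this
  then show "(\<lambda>u. 1 / (weight (y + of_real u) ^ M * norm (y + of_real u))) integrable_on {a..b}"
    by blast
  have "weight (y + of_real b) > 1"
    using assms by (intro weight_gt_1 far_half_plane_add_real) auto
  then show "integral {a..b} (\<lambda>u. 1 / (weight (y + of_real u) ^ M * norm (y + of_real u)))
       \<le> 1 / (real M * weight (y + of_real a) ^ M)"
    unfolding integral_unique [OF I] by simp
qed

text \<open>Differentiation under the integral sign yields the integral of h'. Integration by parts
  against exp (-\<kappa> u) turns it into \<kappa> times the original integral plus boundary
  terms.\<close>

lemma has_field_derivative_horizontal_integral:
  assumes h: "h holomorphic_on far_half_plane" and y: "y \<in> far_half_plane" and ab: "0 \<le> a" "a \<le> b"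
  shows "((\<lambda>y. integral {a..b} (\<lambda>u. exp (- \<kappa> * of_real u) * h (y + of_real u))) has_field_derivative
     \<kappa> * integral {a..b} (\<lambda>u. exp (- \<kappa> * of_real u) * h (y + of_real u))
     + exp (- \<kappa> * of_real b) * h (y + of_real b) - exp (- \<kappa> * of_real a) * h (y + of_real a)) (at y)"
proof -
  obtain r where r: "r > 0" "ball y r \<subseteq> far_half_plane"
    using open_far_half_plane y openE by blast
  have mem: "x + of_real u \<in> far_half_plane" if "x \<in> ball y r" "u \<in> {a..b}" for x u
    using r that ab by (intro far_half_plane_add_real) auto
  have dh: "(h has_field_derivative deriv h x) (at x)" if "x \<in> far_half_plane" for x
    using h open_far_half_plane that by (rule holomorphic_derivI)
  have ch: "continuous_on far_half_plane h"
    using h by (rule holomorphic_on_imp_continuous_on)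
  have cdh: "continuous_on far_half_plane (deriv h)"
    using h open_far_half_plane by (intro holomorphic_on_imp_continuous_on holomorphic_deriv)
  have int1: "(\<lambda>u. exp (- \<kappa> * of_real u) * h (x + of_real u)) integrable_on {a..b}" if "x \<in> ball y r" for x
    using mem that
    by (intro integrable_continuous_interval continuous_intros continuous_on_compose2 [OF ch]) auto
  have D: "((\<lambda>y. integral (cbox a b) (\<lambda>u. exp (- \<kappa> * of_real u) * h (y + of_real u))) has_field_derivative
     integral (cbox a b) (\<lambda>u. exp (- \<kappa> * of_real u) * deriv h (y + of_real u))) (at y within ball y r)"
  proof (rule leibniz_rule_field_derivative)
    show "((\<lambda>x. exp (- \<kappa> * of_real u) * h (x + of_real u)) has_field_derivative
       exp (- \<kappa> * of_real u) * deriv h (x + of_real u)) (at x within ball y r)"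
      if "x \<in> ball y r" "u \<in> cbox a b" for x u
    proof -
      have "((\<lambda>x. h (x + of_real u)) has_field_derivative deriv h (x + of_real u)) (at x)"
        using dh [OF mem, of x u] that DERIV_shift by auto
      then show ?thesis
        by (intro DERIV_cmult) (rule has_field_derivative_at_within)
    qed
    show "continuous_on (ball y r \<times> cbox a b) (\<lambda>(x, u). exp (- \<kappa> * of_real u) * deriv h (x + of_real u))"
      unfolding case_prod_unfold using mem
      by (intro continuous_intros continuous_on_compose2 [OF cdh]) auto
  qed (use int1 r y in auto)
  have "((\<lambda>u. - \<kappa> * (exp (- \<kappa> * of_real u) * h (y + of_real u)) + exp (- \<kappa> * of_real u) * deriv h (y + of_real u))
      has_integral (exp (- \<kappa> * of_real b) * h (y + of_real b) - exp (- \<kappa> * of_real a) * h (y + of_real a))) {a..b}"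
  proof (rule fundamental_theorem_of_calculus)
    fix u assume u: "u \<in> {a..b}"
    have "((\<lambda>u. exp (- \<kappa> * u) * h (y + u)) has_field_derivative
       - \<kappa> * (exp (- \<kappa> * of_real u) * h (y + of_real u)) + exp (- \<kappa> * of_real u) * deriv h (y + of_real u)) (at (of_real u))"
    proof -
      have "((\<lambda>u. h (y + u)) has_field_derivative deriv h (y + of_real u)) (at (of_real u))"
        using dh [OF mem, of y u] u r(1) DERIV_shift [of h _ "of_real u" y] by (auto simp: add.commute)
      then show ?thesis
        by (auto intro!: derivative_eq_intros)
    qed
    then show "((\<lambda>u. exp (- \<kappa> * of_real u) * h (y + of_real u)) has_vector_derivative
       - \<kappa> * (exp (- \<kappa> * of_real u) * h (y + of_real u)) + exp (- \<kappa> * of_real u) * deriv h (y + of_real u)) (at u within {a..b})"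
      by (intro has_vector_derivative_real_field [THEN has_vector_derivative_at_within])
  qed fact
  note F = this
  have int2: "(\<lambda>u. exp (- \<kappa> * of_real u) * deriv h (y + of_real u)) integrable_on {a..b}"
    using mem r(1)
    by (intro integrable_continuous_interval continuous_intros continuous_on_compose2 [OF cdh]) auto
  have "integral {a..b} (\<lambda>u. - \<kappa> * (exp (- \<kappa> * of_real u) * h (y + of_real u)) + exp (- \<kappa> * of_real u) * deriv h (y + of_real u))
      = integral {a..b} (\<lambda>u. - \<kappa> * (exp (- \<kappa> * of_real u) * h (y + of_real u)))
      + integral {a..b} (\<lambda>u. exp (- \<kappa> * of_real u) * deriv h (y + of_real u))"
    using r(1) by (intro integral_add integrable_on_mult_right int1 int2) auto
  then have "- \<kappa> * integral {a..b} (\<lambda>u. exp (- \<kappa> * of_real u) * h (y + of_real u))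
      + integral {a..b} (\<lambda>u. exp (- \<kappa> * of_real u) * deriv h (y + of_real u))
      = exp (- \<kappa> * of_real b) * h (y + of_real b) - exp (- \<kappa> * of_real a) * h (y + of_real a)"
    unfolding integral_unique [OF F] integral_mult_right by simp
  then have eq: "integral {a..b} (\<lambda>u. exp (- \<kappa> * of_real u) * deriv h (y + of_real u))
      = \<kappa> * integral {a..b} (\<lambda>u. exp (- \<kappa> * of_real u) * h (y + of_real u))
      + exp (- \<kappa> * of_real b) * h (y + of_real b) - exp (- \<kappa> * of_real a) * h (y + of_real a)"
    by (simp add: algebra_simps)
  have "at y within ball y r = at y"
    using r by (intro at_within_open) auto
  then show ?thesis
    using D by (simp only: eq cbox_interval)
qed

text \<open>The solution is the integral of exp (-\<kappa> u) h(y + u) over u \<ge> 0, convergent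
  because Re \<kappa> \<ge> 0 and h decays. It is assembled as a series over unit intervals, so that
  termwise differentiation applies and the boundary terms telescope.\<close>

lemma exists_decaying_solution:
  assumes h: "h holomorphic_on far_half_plane" and \<kappa>: "Re \<kappa> \<ge> 0" and M: "M \<ge> 1"
    and bound: "\<And>y. y \<in> far_half_plane \<Longrightarrow> norm (h y) \<le> H / (weight y ^ M * norm y)"
  shows "\<exists>x. \<forall>y\<in>far_half_plane. (x has_field_derivative \<kappa> * x y - h y) (at y)
            \<and> norm (x y) \<le> (H / real M) / weight y ^ M"
proof -
  define I where "I = (\<lambda>a b y. integral {a..b} (\<lambda>u. exp (- \<kappa> * of_real u) * h (y + of_real u)))"
  define bd where "bd = (\<lambda>(k::nat) y. exp (- \<kappa> * of_nat k) * h (y + of_nat k))"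
  have ch: "continuous_on far_half_plane h"
    using h by (rule holomorphic_on_imp_continuous_on)
  have int: "(\<lambda>u. exp (- \<kappa> * of_real u) * h (y + of_real u)) integrable_on {a..b}"
    if "y \<in> far_half_plane" "0 \<le> a" for y a b
    using that far_half_plane_add_real
    by (intro integrable_continuous_interval continuous_intros continuous_on_compose2 [OF ch]) auto
  have nb: "norm (exp (- \<kappa> * of_real u) * h (y + of_real u)) \<le> H * (1 / (weight (y + of_real u) ^ M * norm (y + of_real u)))"
    if "y \<in> far_half_plane" "0 \<le> u" for y u
  proof -
    have "norm (exp (- \<kappa> * of_real u)) \<le> 1"
      using \<kappa> that by (simp add: norm_exp_eq_Re)
    then have "norm (exp (- \<kappa> * of_real u) * h (y + of_real u)) \<le> 1 * norm (h (y + of_real u))"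
      unfolding norm_mult by (intro mult_right_mono) auto
    then show ?thesis
      using bound [OF far_half_plane_add_real [OF that]] by simp
  qed
  \<comment> \<open>The sign of H is read off from the bound at a sample point.\<close>
  have "2 \<in> far_half_plane" by (simp add: far_half_plane_def)
  from bound [OF this] have "0 \<le> H / (weight 2 ^ M * norm (2 :: complex))"
    using norm_ge_zero order_trans by blast
  moreover have "0 < weight 2 ^ M * norm (2 :: complex)"
    by (simp add: weight_def)
  ultimately have H: "0 \<le> H"
    by (meson divide_neg_pos not_le)
  have I_bound: "norm (I a b y) \<le> H * (1 / (real M * weight (y + of_real a) ^ M))"
    if "y \<in> far_half_plane" "0 \<le> a" "a \<le> b" for a b y
  proof -
    have "norm (I a b y) \<le> integral {a..b} (\<lambda>u. H * (1 / (weight (y + of_real u) ^ M * norm (y + of_real u))))"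
      unfolding I_def using that
      by (intro integral_norm_bound_integral integrable_on_mult_right integral_weight_bound int nb M) auto
    also have "\<dots> \<le> H * (1 / (real M * weight (y + of_real a) ^ M))"
      unfolding integral_mult_right using integral_weight_bound(2) [OF that M] H by (rule mult_left_mono)
    finally show ?thesis .
  qed
  define hh where "hh = (\<lambda>k. H / (real k)\<^sup>2)"
  have sum_hh: "summable hh"
    unfolding hh_def using inverse_power_summable [of 2, where 'a = real]
    by (simp add: divide_inverse power_inverse summable_mult)
  \<comment> \<open>One power of the modulus comes from the weight, as M \<ge> 1, and a second one
    from the explicit factor: together a summable majorant on the k-th interval.\<close>
  have hb: "norm (h z) \<le> H / k\<^sup>2" if "z \<in> far_half_plane" "k \<le> norm z" "k \<ge> 1" for z k
  proof -
    have "k ^ 2 \<le> weight z ^ M * norm z"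
    proof -
      have "k \<le> weight z" using that weight_ge_norm [of z] by simp
      also have "weight z \<le> weight z ^ M"
        using weight_gt_1 [OF that(1)] M by (intro self_le_power) auto
      finally show ?thesis
        using that unfolding power2_eq_square by (intro mult_mono) auto
    qed
    then have "H / (weight z ^ M * norm z) \<le> H / k\<^sup>2"
      using H that weight_gt_1 [OF that(1)] by (intro divide_left_mono) (auto intro!: mult_pos_pos zero_less_power)
    with bound [OF that(1)] show ?thesis by linarith
  qed
  have f_bound: "norm (I (real k) (real (Suc k)) y) \<le> hh k" if "y \<in> far_half_plane" "k \<ge> 1" for k y
  proof -
    have "norm (I (real k) (real (Suc k)) y) \<le> integral {real k..real (Suc k)} (\<lambda>u. H / (real k)\<^sup>2)"
      unfolding I_def
    proof (intro integral_norm_bound_integral int)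
      fix u assume u: "u \<in> {real k..real (Suc k)}"
      have "norm (exp (- \<kappa> * of_real u) * h (y + of_real u)) \<le> 1 * norm (h (y + of_real u))"
        unfolding norm_mult using \<kappa> u by (intro mult_right_mono) (auto simp: norm_exp_eq_Re)
      also have "\<dots> \<le> H / (real k)\<^sup>2"
        using u that norm_add_real_ge(2) [of y u]
        by (auto intro!: hb far_half_plane_add_real simp: far_half_plane_def)
      finally show "norm (exp (- \<kappa> * of_real u) * h (y + of_real u)) \<le> H / (real k)\<^sup>2" .
    qed (use that in auto)
    then show ?thesis by (simp add: hh_def)
  qed
  have D: "(I (real k) (real (Suc k)) has_field_derivative
        \<kappa> * I (real k) (real (Suc k)) y + (bd (Suc k) y - bd k y)) (at y)" if "y \<in> far_half_plane" for k y
    using has_field_derivative_horizontal_integral [OF h that, of "real k" "real (Suc k)" \<kappa>]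
    by (simp add: I_def bd_def add_diff_eq)
  obtain g g' where g: "\<And>y. y \<in> far_half_plane \<Longrightarrow> (\<lambda>k. I (real k) (real (Suc k)) y) sums g y"
      "\<And>y. y \<in> far_half_plane \<Longrightarrow> (\<lambda>k. \<kappa> * I (real k) (real (Suc k)) y + (bd (Suc k) y - bd k y)) sums g' y"
      "\<And>y. y \<in> far_half_plane \<Longrightarrow> (g has_field_derivative g' y) (at y)"
  proof (rule series_and_derivative_comparison [OF open_far_half_plane sum_hh D])
    show "\<forall>\<^sub>F k in sequentially. \<forall>y\<in>far_half_plane. norm (I (real k) (real (Suc k)) y) \<le> hh k"
      using f_bound by (intro eventually_sequentiallyI [of 1]) auto
  qed auto
  have "g' y = \<kappa> * g y - h y" if y: "y \<in> far_half_plane" for y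
  proof -
    have "(\<lambda>k. bd k y) \<longlonglongrightarrow> 0"
    proof (rule Lim_null_comparison)
      show "\<forall>\<^sub>F k in sequentially. norm (bd k y) \<le> hh k"
      proof (rule eventually_sequentiallyI [of 1])
        fix k :: nat assume "1 \<le> k"
        have "norm (bd k y) \<le> 1 * norm (h (y + of_real (real k)))"
          unfolding bd_def norm_mult using \<kappa> by (intro mult_mono) (auto simp: norm_exp_eq_Re)
        also have "\<dots> \<le> hh k"
          unfolding hh_def mult_1 using y \<open>1 \<le> k\<close> norm_add_real_ge(2) [of y "real k"]
          by (intro hb far_half_plane_add_real) (auto simp: far_half_plane_def)
        finally show "norm (bd k y) \<le> hh k" .
      qed
      show "hh \<longlonglongrightarrow> 0" using sum_hh by (rule summable_LIMSEQ_zero)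
    qed
    then have "(\<lambda>k. bd (Suc k) y - bd k y) sums (0 - bd 0 y)"
      by (rule telescope_sums)
    with g(1) [OF y] have "(\<lambda>k. \<kappa> * I (real k) (real (Suc k)) y + (bd (Suc k) y - bd k y)) sums (\<kappa> * g y + (0 - bd 0 y))"
      by (intro sums_add sums_mult)
    with g(2) [OF y] show ?thesis
      by (auto simp: bd_def dest: sums_unique2)
  qed
  moreover have "norm (g y) \<le> (H / real M) / weight y ^ M" if y: "y \<in> far_half_plane" for y
  proof -
    have "(\<Sum>k<N. I (real k) (real (Suc k)) y) = I 0 (real N) y" for N
    proof (induction N)
      case (Suc N)
      then show ?case
        unfolding I_def using y int [of y 0 "real (Suc N)"]
        by (simp add: Henstock_Kurzweil_Integration.integral_combine)
    qed (simp add: I_def)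
    then have "(\<lambda>N. I 0 (real N) y) \<longlonglongrightarrow> g y"
      using g(1) [OF y] by (simp add: sums_def)
    then have "(\<lambda>N. norm (I 0 (real N) y)) \<longlonglongrightarrow> norm (g y)"
      by (rule tendsto_norm)
    then show ?thesis
      by (rule LIMSEQ_le_const2) (use I_bound [OF y, of 0] in auto)
  qed
  ultimately show ?thesis using g(3) by metis
qed

section \<open>Diagonalising the cyclic system by the discrete Fourier transform\<close>

definition root1 :: "nat \<Rightarrow> complex" where
  "root1 n = exp (2 * of_real pi * \<i> / of_nat n)"

lemma root1_power: "root1 n ^ k = exp (2 * of_real pi * \<i> * of_nat k / of_nat n)"
  unfolding root1_def exp_of_nat_mult [symmetric] by (simp add: mult_ac)

lemma root1_power_n [simp]: "n \<ge> 1 \<Longrightarrow> root1 n ^ n = 1"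
  using complex_root_unity_eq_1 [of n n] by (simp add: root1_power)

lemma norm_root1 [simp]: "norm (root1 n) = 1"
  by (simp add: root1_def norm_exp_eq_Re)

lemma root1_nonzero [simp]: "root1 n \<noteq> 0"
  by (simp add: root1_def)

lemma root1_orthogonal:
  assumes "n \<ge> 1" "k < n" "l < n"
  shows "(\<Sum>i<n. root1 n ^ (i * k) / root1 n ^ (i * l)) = (if k = l then of_nat n else 0)"
proof -
  define r where "r = root1 n ^ k / root1 n ^ l"
  have eq: "(\<Sum>i<n. root1 n ^ (i * k) / root1 n ^ (i * l)) = (\<Sum>i<n. r ^ i)"
    unfolding r_def by (simp add: power_divide power_mult [symmetric] mult.commute)
  show ?thesis
  proof (cases "k = l")
    case True
    then have "r = 1" by (simp add: r_def)
    then show ?thesis using True by (simp only: eq) simp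
  next
    case False
    have "root1 n ^ k \<noteq> root1 n ^ l"
      using complex_root_unity_eq [of n k l] assms False by (simp add: root1_power)
    then have "r \<noteq> 1" by (simp add: r_def)
    moreover have "r ^ n = 1"
    proof -
      have "r ^ n = (root1 n ^ n) ^ k / (root1 n ^ n) ^ l"
        by (simp add: r_def power_divide power_mult [symmetric] mult.commute)
      then show ?thesis using assms by simp
    qed
    ultimately show ?thesis using False by (simp add: eq sum_gp_strict)
  qed
qed

lemma norm_sum_le_card:
  fixes f :: "nat \<Rightarrow> complex"
  assumes "\<And>i. i < n \<Longrightarrow> norm (f i) \<le> B"
  shows "norm (\<Sum>i<n. f i) \<le> real n * B"
  using sum_norm_le [of "{..<n}" f "\<lambda>_. B"] assms by simp

text \<open>The discrete Fourier transform in k diagonalises the cyclic shift. The eigenvalues 1 -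
  \<omega>^i have real part at least 0 because |\<omega>| = 1, so each mode falls under
  \<open>exists_decaying_solution\<close>.\<close>

lemma exists_cyclic_solution:
  assumes n: "n \<ge> 1" and M: "M \<ge> 1"
    and hol: "\<And>k. k < n \<Longrightarrow> \<rho> k holomorphic_on far_half_plane"
    and bound: "\<And>k y. k < n \<Longrightarrow> y \<in> far_half_plane \<Longrightarrow> norm (\<rho> k y) \<le> H / (weight y ^ M * norm y)"
  shows "\<exists>v. (\<forall>y\<in>far_half_plane. v n y = v 0 y \<and>
     (\<forall>k<n. (v k has_field_derivative v k y - v (Suc k) y - \<rho> k y) (at y)
        \<and> norm (v k y) \<le> (real n * H / real M) / weight y ^ M))"
proof -
  define w where "w = root1 n"
  define h where "h = (\<lambda>i y. (\<Sum>l<n. \<rho> l y / w ^ (i * l)) / of_nat n)"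
  have "\<exists>x. \<forall>y\<in>far_half_plane. (x has_field_derivative (1 - w ^ i) * x y - h i y) (at y)
            \<and> norm (x y) \<le> (H / real M) / weight y ^ M" for i
  proof (rule exists_decaying_solution [OF _ _ M])
    show "h i holomorphic_on far_half_plane"
      unfolding h_def using hol n by (intro holomorphic_intros) (auto simp: w_def)
    have "Re (w ^ i) \<le> norm (w ^ i)" by (rule complex_Re_le_cmod)
    then show "Re (1 - w ^ i) \<ge> 0" by (simp add: norm_power w_def)
    fix y assume y: "y \<in> far_half_plane"
    have "norm (\<Sum>l<n. \<rho> l y / w ^ (i * l)) \<le> real n * (H / (weight y ^ M * norm y))"
      by (rule norm_sum_le_card) (use bound y in \<open>auto simp: norm_divide norm_power w_def\<close>)
    then show "norm (h i y) \<le> H / (weight y ^ M * norm y)"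
      unfolding h_def using n by (simp add: norm_divide field_simps)
  qed
  then obtain x where x: "\<And>i y. y \<in> far_half_plane \<Longrightarrow> (x i has_field_derivative (1 - w ^ i) * x i y - h i y) (at y)"
    "\<And>i y. y \<in> far_half_plane \<Longrightarrow> norm (x i y) \<le> (H / real M) / weight y ^ M"
    by metis
  define v where "v = (\<lambda>k y. \<Sum>i<n. w ^ (i * k) * x i y)"
  have "v n y = v 0 y" for y
  proof -
    have "w ^ (i * n) = 1" for i
      using n by (simp add: w_def mult.commute [of i] power_mult)
    then show ?thesis by (simp add: v_def)
  qed
  moreover have "(v k has_field_derivative v k y - v (Suc k) y - \<rho> k y) (at y)"
    if k: "k < n" and y: "y \<in> far_half_plane" for k y
  proof -
    have "(\<Sum>i<n. w ^ (i * k) * h i y) = (\<Sum>i<n. \<Sum>l<n. \<rho> l y * (w ^ (i * k) / w ^ (i * l)) / of_nat n)"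
      by (simp add: h_def sum_divide_distrib sum_distrib_left mult_ac)
    also have "\<dots> = (\<Sum>l<n. \<Sum>i<n. \<rho> l y * (w ^ (i * k) / w ^ (i * l)) / of_nat n)"
      by (rule sum.swap)
    also have "\<dots> = (\<Sum>l<n. \<rho> l y * (\<Sum>i<n. w ^ (i * k) / w ^ (i * l)) / of_nat n)"
      by (simp only: sum_divide_distrib sum_distrib_left)
    also have "\<dots> = (\<Sum>l<n. if l = k then \<rho> l y else 0)"
      using k n by (intro sum.cong refl) (simp add: w_def root1_orthogonal)
    also have "\<dots> = \<rho> k y" using k by simp
    finally have hs: "(\<Sum>i<n. w ^ (i * k) * h i y) = \<rho> k y" .
    have "(v k has_field_derivative (\<Sum>i<n. w ^ (i * k) * ((1 - w ^ i) * x i y - h i y))) (at y)"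
      unfolding v_def using y by (intro DERIV_sum DERIV_cmult x(1))
    also have "(\<Sum>i<n. w ^ (i * k) * ((1 - w ^ i) * x i y - h i y))
        = v k y - v (Suc k) y - (\<Sum>i<n. w ^ (i * k) * h i y)"
      by (simp add: v_def sum_subtractf sum.distrib algebra_simps power_add)
    finally show ?thesis by (simp add: hs)
  qed
  moreover have "norm (v k y) \<le> (real n * H / real M) / weight y ^ M" if y: "y \<in> far_half_plane" for k y
  proof -
    have "norm (v k y) \<le> real n * ((H / real M) / weight y ^ M)"
      unfolding v_def
      by (rule norm_sum_le_card) (use x(2) [OF y] in \<open>auto simp: norm_mult norm_power w_def\<close>)
    then show ?thesis by simp
  qed
  ultimately show ?thesis by blast
qed

text \<open>Successive approximation: the term (a_k / y) v_k is moved to the inhomogeneity and fed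
  back. Each round costs a factor n A / M \<le> 1/2, so the corrections are dominated by a geometric
  series, whose sum is the factor 2 in the bound.\<close>

lemma exists_small_solution:
  assumes n: "n \<ge> 1" and M: "M \<ge> 1"
    and hol: "\<And>k. k < n \<Longrightarrow> \<rho> k holomorphic_on far_half_plane"
    and bound: "\<And>k y. k < n \<Longrightarrow> y \<in> far_half_plane \<Longrightarrow> norm (\<rho> k y) \<le> H / (weight y ^ M * norm y)"
    and a: "\<And>k. k < n \<Longrightarrow> norm (a k) \<le> A" and A: "2 * real n * A \<le> real M"
  shows "\<exists>v. \<forall>y\<in>far_half_plane. v n y = v 0 y \<and>
     (\<forall>k<n. (v k has_field_derivative v k y - v (Suc k) y - a k / y * v k y - \<rho> k y) (at y)
        \<and> norm (v k y) \<le> (2 * real n * H / real M) / weight y ^ M)"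
proof -
  define C where "C = real n * H / real M"
  \<comment> \<open>\<open>P j\<close> is the invariant of the j-th correction, smaller by 2^j than
    the first; only the correction with j = 0 carries the inhomogeneity \<rho>. \<open>Q\<close>
    links consecutive corrections.\<close>
  define P :: "nat \<Rightarrow> (nat \<Rightarrow> complex \<Rightarrow> complex) \<Rightarrow> bool"
    where "P = (\<lambda>j v. (\<forall>k<n. v k holomorphic_on far_half_plane) \<and>
      (\<forall>y\<in>far_half_plane. v n y = v 0 y \<and> (\<forall>k<n. norm (v k y) \<le> C / 2 ^ j / weight y ^ M)) \<and>
      (j = 0 \<longrightarrow> (\<forall>y\<in>far_half_plane. \<forall>k<n. (v k has_field_derivative v k y - v (Suc k) y - \<rho> k y) (at y))))"
  define Q :: "nat \<Rightarrow> (nat \<Rightarrow> complex \<Rightarrow> complex) \<Rightarrow> (nat \<Rightarrow> complex \<Rightarrow> complex) \<Rightarrow> bool"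
    where "Q = (\<lambda>j u v. \<forall>y\<in>far_half_plane. \<forall>k<n.
      (v k has_field_derivative v k y - v (Suc k) y - a k / y * u k y) (at y))"
  have holI: "f holomorphic_on far_half_plane"
    if "\<And>y. y \<in> far_half_plane \<Longrightarrow> (f has_field_derivative f' y) (at y)" for f f'
    using that open_far_half_plane by (auto simp: holomorphic_on_open)
  have nz: "y \<noteq> 0" if "y \<in> far_half_plane" for y
    using that by (auto simp: far_half_plane_def)
  have "\<exists>V. \<forall>j. P j (V j) \<and> Q j (V j) (V (Suc j))"
  proof (rule dependent_nat_choice)
    obtain v where "\<forall>y\<in>far_half_plane. v n y = v 0 y \<and>
     (\<forall>k<n. (v k has_field_derivative v k y - v (Suc k) y - \<rho> k y) (at y)
        \<and> norm (v k y) \<le> (real n * H / real M) / weight y ^ M)"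
      using exists_cyclic_solution [OF n M, of \<rho> H] hol bound by blast
    moreover from this have "v k holomorphic_on far_half_plane" if "k < n" for k
      using that by (intro holI [where f' = "\<lambda>y. v k y - v (Suc k) y - \<rho> k y"]) auto
    ultimately show "\<exists>v. P 0 v"
      unfolding P_def C_def by (intro exI [of _ v]) auto
  next
    fix u j assume u: "P j u"
    have "\<exists>v. \<forall>y\<in>far_half_plane. v n y = v 0 y \<and>
     (\<forall>k<n. (v k has_field_derivative v k y - v (Suc k) y - a k / y * u k y) (at y)
        \<and> norm (v k y) \<le> (real n * (A * (C / 2 ^ j)) / real M) / weight y ^ M)"
    proof (rule exists_cyclic_solution [OF n M])
      show "(\<lambda>y. a k / y * u k y) holomorphic_on far_half_plane" if "k < n" for k
        using u that nz by (auto simp: P_def intro!: holomorphic_intros)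
      fix k y assume k: "k < n" and y: "y \<in> far_half_plane"
      have "norm (a k / y * u k y) = norm (a k) * norm (u k y) / norm y"
        by (simp add: norm_mult norm_divide)
      also have "\<dots> \<le> A * (C / 2 ^ j / weight y ^ M) / norm y"
        using a [OF k] u k y
        by (intro divide_right_mono mult_mono) (auto simp: P_def intro: order_trans [OF norm_ge_zero])
      finally show "norm (a k / y * u k y) \<le> A * (C / 2 ^ j) / (weight y ^ M * norm y)"
        by simp
    qed
    then obtain v where v: "\<forall>y\<in>far_half_plane. v n y = v 0 y \<and>
     (\<forall>k<n. (v k has_field_derivative v k y - v (Suc k) y - a k / y * u k y) (at y)
        \<and> norm (v k y) \<le> (real n * (A * (C / 2 ^ j)) / real M) / weight y ^ M)" by blast
    have C0: "0 \<le> C / 2 ^ j"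
    proof -
      have "2 \<in> far_half_plane" by (simp add: far_half_plane_def)
      then have "norm (u 0 2) \<le> C / 2 ^ j / weight 2 ^ M"
        using u n by (auto simp: P_def)
      then have "0 \<le> C / 2 ^ j / weight 2 ^ M"
        using norm_ge_zero order_trans by blast
      moreover have "0 < weight 2 ^ M" by (simp add: weight_def)
      ultimately show ?thesis by (meson divide_neg_pos not_le)
    qed
    have "real n * (A * (C / 2 ^ j)) / real M \<le> C / 2 ^ Suc j"
    proof -
      have "(2 * real n * A) * (C / 2 ^ j) \<le> real M * (C / 2 ^ j)"
        using A C0 by (rule mult_right_mono)
      then show ?thesis using M by (simp add: field_simps)
    qed
    then have le: "(real n * (A * (C / 2 ^ j)) / real M) / weight y ^ M \<le> C / 2 ^ Suc j / weight y ^ M"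
      if "y \<in> far_half_plane" for y
      using weight_gt_1 [OF that] by (intro divide_right_mono) auto
    have "norm (v k y) \<le> C / 2 ^ Suc j / weight y ^ M" if "y \<in> far_half_plane" "k < n" for k y
      using v that order_trans [OF _ le] by blast
    moreover have "v k holomorphic_on far_half_plane" if "k < n" for k
      using that v by (intro holI [where f' = "\<lambda>y. v k y - v (Suc k) y - a k / y * u k y"]) auto
    ultimately have "P (Suc j) v" "Q j u v"
      unfolding P_def Q_def using v by auto
    then show "\<exists>v. P (Suc j) v \<and> Q j u v" by blast
  qed
  then obtain V where V: "\<And>j. P j (V j)" "\<And>j. Q j (V j) (V (Suc j))" by blast
  define f' where "f' = (\<lambda>k j y. V j k y - V j (Suc k) y - (if j = 0 then \<rho> k y else a k / y * V (j - 1) k y))"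
  have D: "(V j k has_field_derivative f' k j y) (at y)" if "y \<in> far_half_plane" "k < n" for j k y
    using V(1) [of j] V(2) [of "j - 1"] that by (cases j) (auto simp: P_def Q_def f'_def)
  have le: "norm (V j k y) \<le> C / 2 ^ j / weight y ^ M" if "y \<in> far_half_plane" "k < n" for j k y
    using V(1) [of j] that by (auto simp: P_def)
  have sm: "summable (\<lambda>j. C * (1/2) ^ j)"
    by (intro summable_mult summable_geometric) simp
  have "\<exists>g. \<exists>g'. \<forall>y\<in>far_half_plane. (\<lambda>j. V j k y) sums g y \<and> (\<lambda>j. f' k j y) sums g' y
      \<and> (g has_field_derivative g' y) (at y)" if k: "k < n" for k
  proof -
    have "norm (V j k y) \<le> C * (1/2) ^ j" if y: "y \<in> far_half_plane" for j y
    proof -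
      have 1: "1 \<le> weight y ^ M"
        using weight_gt_1 [OF y] by (intro one_le_power) auto
      have "0 \<le> C / 2 ^ j / weight y ^ M"
        using le [OF y k, of j] norm_ge_zero order_trans by blast
      then have "0 \<le> C / 2 ^ j"
        using 1 by (meson divide_neg_pos not_le less_le_trans zero_less_one)
      then have "C / 2 ^ j / weight y ^ M \<le> C / 2 ^ j / 1"
        using 1 by (intro divide_left_mono) auto
      then show ?thesis
        using le [OF y k, of j] by (simp add: power_divide)
    qed
    then have ev: "\<forall>\<^sub>F j in sequentially. \<forall>y\<in>far_half_plane. norm (V j k y) \<le> C * (1/2) ^ j"
      by (intro always_eventually) auto
    show ?thesis
      by (rule series_and_derivative_comparison [OF open_far_half_plane sm D [OF _ k] ev]) blast+
  qed
  then obtain g g' where g: "\<And>k y. k < n \<Longrightarrow> y \<in> far_half_plane \<Longrightarrow> (\<lambda>j. V j k y) sums g k y"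
    "\<And>k y. k < n \<Longrightarrow> y \<in> far_half_plane \<Longrightarrow> (\<lambda>j. f' k j y) sums g' k y"
    "\<And>k y. k < n \<Longrightarrow> y \<in> far_half_plane \<Longrightarrow> (g k has_field_derivative g' k y) (at y)"
    by metis
  define v where "v = (\<lambda>k. if k = n then g 0 else g k)"
  have vs: "(\<lambda>j. V j k y) sums v k y" if "k \<le> n" "y \<in> far_half_plane" for k y
  proof (cases "k = n")
    case True
    have "V j n y = V j 0 y" for j
      using V(1) [of j] that by (auto simp: P_def)
    then show ?thesis
      using g(1) [of 0 y] n that True by (simp add: v_def)
  qed (use g that in \<open>auto simp: v_def\<close>)
  have "g' k y = v k y - v (Suc k) y - a k / y * v k y - \<rho> k y" if k: "k < n" and y: "y \<in> far_half_plane" for k y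
  proof -
    have "(\<lambda>j. if j = 0 then \<rho> k y else a k / y * V (j - 1) k y) sums (\<rho> k y + a k / y * v k y)"
      using sums_Suc [of "\<lambda>j. if j = 0 then \<rho> k y else a k / y * V (j - 1) k y" "a k / y * v k y"]
        sums_mult [OF vs [of k y], of "a k / y"] k y by (simp add: add.commute)
    then have "(\<lambda>j. f' k j y) sums (v k y - v (Suc k) y - (\<rho> k y + a k / y * v k y))"
      unfolding f'_def using k y by (intro sums_diff vs) auto
    then show ?thesis
      using g(2) [OF k y] sums_unique2 by force
  qed
  moreover have "norm (v k y) \<le> (2 * real n * H / real M) / weight y ^ M" if k: "k < n" and y: "y \<in> far_half_plane" for k y
  proof -
    have s: "(\<lambda>j. C / weight y ^ M * (1/2) ^ j) sums (C / weight y ^ M * (1 / (1 - 1/2)))"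
      by (intro sums_mult geometric_sums) simp
    have le': "norm (V j k y) \<le> C / weight y ^ M * (1/2) ^ j" for j
      using le [OF y k, of j] by (simp add: power_divide mult_ac)
    have "norm (\<Sum>j. V j k y) \<le> (\<Sum>j. C / weight y ^ M * (1/2) ^ j)"
      using le' s by (intro norm_suminf_le) (auto simp: sums_iff)
    then show ?thesis
      using s vs [of k y] k y by (simp add: sums_iff C_def mult_ac)
  qed
  ultimately show ?thesis
    using g(3) by (intro exI [of _ v]) (auto simp: v_def)
qed

text \<open>Each Fourier mode is recovered by integration from infinity, where the assumed decay
  leaves no constant of integration. As M \<ge> 2 n A, this improves a bound B / y^M to half of it,
  and repetition leaves only 0.\<close>

lemma cyclic_ray_unique:
  fixes v :: "nat \<Rightarrow> real \<Rightarrow> complex"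
  assumes n: "n \<ge> 1" and M: "M \<ge> 1" and R: "R > 0"
    and deriv: "\<And>k y. k < n \<Longrightarrow> y > R \<Longrightarrow>
        (v k has_vector_derivative v k y - v (Suc k) y - a k / of_real y * v k y) (at y)"
    and cyc: "\<And>y. y > R \<Longrightarrow> v n y = v 0 y"
    and bound: "\<And>k y. k < n \<Longrightarrow> y > R \<Longrightarrow> norm (v k y) \<le> C / y ^ M"
    and a: "\<And>k. k < n \<Longrightarrow> norm (a k) \<le> A" and A: "2 * real n * A \<le> real M"
    and k: "k < n" and y: "y > R"
  shows "v k y = 0"
proof -
  define w where "w = root1 n"
  define x where "x = (\<lambda>i y. (\<Sum>l<n. v l y / w ^ (i * l)) / of_nat n)"
  define r where "r = (\<lambda>i y. (\<Sum>l<n. a l / of_real y * v l y / w ^ (i * l)) / of_nat n)"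
  have w [simp]: "w \<noteq> 0" "norm w = 1" by (auto simp: w_def)
  have v_eq: "v k y = (\<Sum>i<n. w ^ (i * k) * x i y)" if "k < n" for k y
  proof -
    have "(\<Sum>i<n. w ^ (i * k) * x i y) = (\<Sum>i<n. \<Sum>l<n. v l y * (w ^ (i * k) / w ^ (i * l)) / of_nat n)"
      by (simp add: x_def sum_divide_distrib sum_distrib_left mult_ac)
    also have "\<dots> = (\<Sum>l<n. \<Sum>i<n. v l y * (w ^ (i * k) / w ^ (i * l)) / of_nat n)"
      by (rule sum.swap)
    also have "\<dots> = (\<Sum>l<n. v l y * (\<Sum>i<n. w ^ (i * k) / w ^ (i * l)) / of_nat n)"
      by (simp only: sum_divide_distrib sum_distrib_left)
    also have "\<dots> = (\<Sum>l<n. if l = k then v l y else 0)"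
      using that n by (intro sum.cong refl) (simp add: w_def root1_orthogonal)
    also have "\<dots> = v k y" using that by simp
    finally show ?thesis ..
  qed
  have x_deriv: "(x i has_vector_derivative (1 - w ^ i) * x i y - r i y) (at y)" if y: "y > R" for i y
  proof -
    have wn: "w ^ (i * n) = 1"
      using n by (simp add: w_def mult.commute [of i] power_mult)
    have "(\<Sum>l<n. v (Suc l) y / w ^ (i * l)) = (\<Sum>l<n. w ^ i * (v (Suc l) y / w ^ (i * Suc l)))"
      by (simp add: power_add field_simps)
    also have "\<dots> = w ^ i * (\<Sum>l<n. v (Suc l) y / w ^ (i * Suc l))"
      by (simp only: sum_distrib_left)
    also have "(\<Sum>l<n. v (Suc l) y / w ^ (i * Suc l)) = (\<Sum>l<n. v l y / w ^ (i * l))"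
      using sum.lessThan_Suc_shift [of "\<lambda>l. v l y / w ^ (i * l)" n]
        sum.lessThan_Suc [of "\<lambda>l. v l y / w ^ (i * l)" n] cyc [OF y] wn
      by (simp only: mult_0_right power_0) (simp add: algebra_simps)
    finally have shift: "(\<Sum>l<n. v (Suc l) y / w ^ (i * l)) = w ^ i * (\<Sum>l<n. v l y / w ^ (i * l))" .
    have "(x i has_vector_derivative
        (\<Sum>l<n. (v l y - v (Suc l) y - a l / of_real y * v l y) / w ^ (i * l)) / of_nat n) (at y)"
      unfolding x_def
      by (intro has_vector_derivative_divide has_vector_derivative_sum deriv) (use y in auto)
    also have "(\<Sum>l<n. (v l y - v (Suc l) y - a l / of_real y * v l y) / w ^ (i * l)) / of_nat n
        = (1 - w ^ i) * x i y - r i y"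
      unfolding x_def r_def diff_divide_distrib sum_subtractf shift
      by (simp add: algebra_simps diff_divide_distrib)
    finally show ?thesis .
  qed
  have A0: "0 \<le> A" using order_trans [OF norm_ge_zero a [of 0]] n by simp
  have step: "norm (v k y) \<le> (B / 2) / y ^ M"
    if B: "\<And>k y. k < n \<Longrightarrow> y > R \<Longrightarrow> norm (v k y) \<le> B / y ^ M" and k: "k < n" and y: "y > R" for B k y
  proof -
    have y0: "0 < y" using y R by simp
    have B0: "0 \<le> B"
    proof -
      have "0 \<le> B / y ^ M"
        using B [OF k y] norm_ge_zero order_trans by blast
      then show ?thesis
        using y0 by (meson divide_neg_pos not_le zero_less_power)
    qed
    have "norm (x i y) \<le> (A * B / real M) / y ^ M" for i
    proof -
      define \<kappa> where "\<kappa> = 1 - w ^ i"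
      have "Re (w ^ i) \<le> norm (w ^ i)" by (rule complex_Re_le_cmod)
      then have \<kappa>: "Re \<kappa> \<ge> 0" by (simp add: norm_power \<kappa>_def)
      have xb: "norm (x i t) \<le> B / t ^ M" if "t > R" for t
      proof -
        have "norm (\<Sum>l<n. v l t / w ^ (i * l)) \<le> real n * (B / t ^ M)"
          by (rule norm_sum_le_card) (use B that in \<open>auto simp: norm_divide norm_power\<close>)
        then show ?thesis using n by (simp add: x_def norm_divide field_simps)
      qed
      have rb: "norm (r i t) \<le> A * B / t ^ Suc M" if "t > R" for t
      proof -
        have t0: "t > 0" using that R by simp
        have "norm (\<Sum>l<n. a l / of_real t * v l t / w ^ (i * l)) \<le> real n * (A * B / t ^ Suc M)"
        proof (rule norm_sum_le_card)
          fix l assume l: "l < n"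
          have "norm (a l / of_real t * v l t / w ^ (i * l)) = norm (a l) * norm (v l t) / t"
            using t0 by (simp add: norm_divide norm_mult norm_power)
          also have "\<dots> \<le> A * (B / t ^ M) / t"
            using a [OF l] B [OF l that] t0 A0 by (intro divide_right_mono mult_mono) auto
          finally show "norm (a l / of_real t * v l t / w ^ (i * l)) \<le> A * B / t ^ Suc M"
            by (simp add: mult.commute)
        qed
        then show ?thesis using n by (simp add: r_def norm_divide field_simps)
      qed
      \<comment> \<open>The integrating factor removes the term \<kappa> x. As Re \<kappa> \<ge> 0
        it is bounded for positive t, so g inherits the decay of x.\<close>
      define g where "g = (\<lambda>t. exp (- \<kappa> * of_real t) * x i t)"
      define E where "E = exp (- Re \<kappa> * y)"
      \<comment> \<open>An antiderivative of the majorant of |g'| on t > y, chosen to tend to 0 at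
        infinity; E bounds the integrating factor there.\<close>
      define \<phi> where "\<phi> = (\<lambda>t. - (E * (A * B / real M)) * inverse (t ^ M))"
      have g': "(g has_vector_derivative - (exp (- \<kappa> * of_real t) * r i t)) (at t)" if "t > R" for t
      proof -
        have "((\<lambda>t. exp (- \<kappa> * of_real t)) has_vector_derivative exp (- \<kappa> * of_real t) * - \<kappa>) (at t)"
          by (rule has_vector_derivative_real_field [where f = "\<lambda>t. exp (- \<kappa> * t)"]) (auto intro!: derivative_eq_intros)
        then have "(g has_vector_derivative
            exp (- \<kappa> * of_real t) * (\<kappa> * x i t - r i t) + (exp (- \<kappa> * of_real t) * - \<kappa>) * x i t) (at t)"
          unfolding g_def using x_deriv [OF that, of i] unfolding \<kappa>_def [symmetric]
          by (intro has_vector_derivative_mult)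
        then show ?thesis by (simp add: algebra_simps)
      qed
      obtain m where m: "M = Suc m" using M by (cases M) auto
      have \<phi>': "(\<phi> has_vector_derivative E * (A * B / t ^ Suc M)) (at t)" if "t > R" for t
      proof -
        have t0: "t > 0" using that R by simp
        have "(\<phi> has_real_derivative - (E * (A * B / real M)) * - (inverse (t ^ M) * (real M * (1 * t ^ (M - Suc 0))) * inverse (t ^ M))) (at t)"
          unfolding \<phi>_def using t0 by (intro DERIV_cmult DERIV_inverse' DERIV_power DERIV_ident) auto
        moreover have "- (E * (A * B / real M)) * - (inverse (t ^ M) * (real M * (1 * t ^ (M - Suc 0))) * inverse (t ^ M))
            = E * (A * B / t ^ Suc M)"
        proof -
          have "- (E * (A * B / Mr)) * - (inverse (t * p) * (Mr * (1 * p)) * inverse (t * p)) = E * (A * B / (t * (t * p)))"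
            if "Mr > 0" "p > 0" for Mr p
            using that t0 by (simp add: field_simps)
          from this [of "real M" "t ^ m"] show ?thesis using t0 by (simp add: m)
        qed
        ultimately show ?thesis by (simp add: has_real_derivative_iff_has_vector_derivative)
      qed
      have main: "norm (g T - g y) \<le> \<phi> T - \<phi> y" if T: "T > y" for T
      proof (rule differentiable_bound_general [OF T])
        have "isCont g t" "isCont \<phi> t" if "t > R" for t
          using g' \<phi>' that has_vector_derivative_continuous by blast+
        then show "continuous_on {y..T} g" "continuous_on {y..T} \<phi>"
          using y by (auto intro!: continuous_at_imp_continuous_on)
        fix t assume t: "y < t" "t < T"
        then have tR: "t > R" using y by simp
        show "(g has_vector_derivative - (exp (- \<kappa> * of_real t) * r i t)) (at t)"
          "(\<phi> has_vector_derivative E * (A * B / t ^ Suc M)) (at t)"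
          using g' \<phi>' tR by auto
        have "norm (exp (- \<kappa> * of_real t)) \<le> E"
          unfolding E_def using \<kappa> t by (simp add: norm_exp_eq_Re mult_left_mono)
        then show "norm (- (exp (- \<kappa> * of_real t) * r i t)) \<le> E * (A * B / t ^ Suc M)"
          unfolding norm_minus_cancel norm_mult using rb [OF tR] by (intro mult_mono) (auto simp: E_def)
      qed
      have lim1: "((\<lambda>T. norm (g T - g y)) \<longlongrightarrow> norm (0 - g y)) at_top"
      proof (intro tendsto_norm tendsto_diff tendsto_const)
        show "(g \<longlongrightarrow> 0) at_top"
        proof (rule Lim_null_comparison)
          show "\<forall>\<^sub>F t in at_top. norm (g t) \<le> B / t ^ M"
            using eventually_gt_at_top [of "max R 0"]
          proof eventually_elim
            case (elim t)
            then have "norm (g t) \<le> 1 * (B / t ^ M)"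
              unfolding g_def norm_mult using xb \<kappa> R by (intro mult_mono) (auto simp: norm_exp_eq_Re)
            then show ?case by simp
          qed
          show "((\<lambda>t. B / t ^ M) \<longlongrightarrow> 0) at_top"
            using M by (intro tendsto_divide_0 [OF tendsto_const] filterlim_at_top_imp_at_infinity filterlim_pow_at_top filterlim_ident) auto
        qed
      qed
      have lim2: "((\<lambda>T. \<phi> T - \<phi> y) \<longlongrightarrow> 0 - \<phi> y) at_top"
      proof (intro tendsto_diff tendsto_const)
        have "((\<lambda>t::real. 1 / t ^ M) \<longlongrightarrow> 0) at_top"
          using M by (intro tendsto_divide_0 [OF tendsto_const] filterlim_at_top_imp_at_infinity filterlim_pow_at_top filterlim_ident) auto
        then have "((\<lambda>t::real. inverse (t ^ M)) \<longlongrightarrow> 0) at_top"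
          by (simp add: inverse_eq_divide)
        from tendsto_mult_right_zero [OF this] show "(\<phi> \<longlongrightarrow> 0) at_top"
          unfolding \<phi>_def .
      qed
      have "norm (0 - g y) \<le> 0 - \<phi> y"
        by (rule tendsto_le [OF _ lim2 lim1]) (auto intro: main eventually_mono [OF eventually_gt_at_top [of y]])
      then have "E * norm (x i y) \<le> E * ((A * B / real M) / y ^ M)"
        by (simp add: g_def \<phi>_def norm_mult norm_exp_eq_Re E_def divide_inverse)
      then show ?thesis
        by (rule mult_left_le_imp_le) (simp add: E_def)
    qed
    then have "norm (v k y) \<le> real n * ((A * B / real M) / y ^ M)"
      unfolding v_eq [OF k] by (intro norm_sum_le_card) (simp add: norm_mult norm_power)
    also have "\<dots> = (2 * real n * A) * (B / 2 / real M / y ^ M)" by simp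
    also have "\<dots> \<le> real M * (B / 2 / real M / y ^ M)"
      using A B0 y0 by (intro mult_right_mono) auto
    also have "\<dots> = (B / 2) / y ^ M" using M by simp
    finally show ?thesis .
  qed
  have iter: "\<forall>k y. k < n \<longrightarrow> y > R \<longrightarrow> norm (v k y) \<le> (C / 2 ^ j) / y ^ M" for j
  proof (induction j)
    case 0
    then show ?case using bound by simp
  next
    case (Suc j)
    then show ?case using step [of "C / 2 ^ j"] by (simp add: mult.commute)
  qed
  have "(\<lambda>j. C / y ^ M * (1/2) ^ j) \<longlonglongrightarrow> C / y ^ M * 0"
    by (intro tendsto_mult tendsto_const LIMSEQ_power_zero) simp
  then have "norm (v k y) \<le> C / y ^ M * 0"
    by (rule LIMSEQ_le_const) (use iter k y in \<open>auto simp: power_divide mult_ac\<close>)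
  then show ?thesis by simp
qed

section \<open>Truncated series and solutions with a full asymptotic expansion\<close>

definition ladder_sum :: "(nat \<Rightarrow> complex) \<Rightarrow> (nat \<Rightarrow> complex) \<Rightarrow> nat \<Rightarrow> nat \<Rightarrow> complex \<Rightarrow> complex" where
  "ladder_sum a b k N y = (\<Sum>m<N. ladder_coeff a b k m / y ^ m)"

text \<open>The ladder recursion makes all lower orders match exactly. Cutting the series off after
  index M leaves a single defect, of order y^-(M+1).\<close>

lemma ladder_sum_deriv:
  assumes "y \<noteq> 0"
  shows "(ladder_sum a b k (Suc M) has_field_derivative
     ladder_sum a b k (Suc M) y - ladder_sum a b (Suc k) (Suc M) y - a k / y * ladder_sum a b k (Suc M) y
     + (a k - of_nat M) * ladder_coeff a b k M / y ^ Suc M) (at y)"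
proof -
  let ?p = "ladder_coeff a b k"
  have "((\<lambda>y. \<Sum>m<Suc M. ?p m * inverse (y ^ m)) has_field_derivative
      (\<Sum>m<Suc M. ?p m * - (inverse (y ^ m) * (of_nat m * (1 * y ^ (m - Suc 0))) * inverse (y ^ m)))) (at y)"
    using assms by (intro DERIV_sum DERIV_cmult DERIV_inverse' DERIV_power DERIV_ident) auto
  moreover have te: "?p m * - (inverse (y ^ m) * (of_nat m * (1 * y ^ (m - Suc 0))) * inverse (y ^ m))
      = - of_nat m * ?p m / y ^ Suc m" for m
    using assms by (cases m) (simp_all add: field_simps)
  ultimately have D: "(ladder_sum a b k (Suc M) has_field_derivative
      (\<Sum>m<Suc M. - of_nat m * ?p m / y ^ Suc m)) (at y)"
    unfolding te ladder_sum_def [abs_def] divide_inverse by simp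
  have "ladder_sum a b k (Suc M) y - ladder_sum a b (Suc k) (Suc M) y
      = (\<Sum>m<Suc M. (if m = 0 then 0 else (a k - of_nat (m - 1)) * ?p (m - 1)) / y ^ m)"
    unfolding ladder_sum_def sum_subtractf [symmetric] by (simp add: diff_divide_distrib [symmetric])
  also have "\<dots> = (\<Sum>m<M. (a k - of_nat m) * ?p m / y ^ Suc m)"
    unfolding sum.lessThan_Suc_shift by simp
  finally have 1: "ladder_sum a b k (Suc M) y - ladder_sum a b (Suc k) (Suc M) y
      = (\<Sum>m<M. (a k - of_nat m) * ?p m / y ^ Suc m)" .
  have 2: "a k / y * ladder_sum a b k (Suc M) y = (\<Sum>m<Suc M. a k * ?p m / y ^ Suc m)"
    unfolding ladder_sum_def sum_distrib_left by simp
  have "ladder_sum a b k (Suc M) y - ladder_sum a b (Suc k) (Suc M) y - a k / y * ladder_sum a b k (Suc M) y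
     + (a k - of_nat M) * ?p M / y ^ Suc M
     = (\<Sum>m<Suc M. (a k - of_nat m) * ?p m / y ^ Suc m) - (\<Sum>m<Suc M. a k * ?p m / y ^ Suc m)"
    unfolding 1 2 by simp
  also have "\<dots> = (\<Sum>m<Suc M. - of_nat m * ?p m / y ^ Suc m)"
    unfolding sum_subtractf [symmetric] by (intro sum.cong refl) (simp add: diff_divide_distrib [symmetric] algebra_simps)
  finally show ?thesis using D by simp
qed

lemma ladder_sum_diff_bound:
  assumes "N \<le> N'"
  shows "\<exists>C. \<forall>y. norm y > 1 \<longrightarrow> norm (ladder_sum a b k N' y - ladder_sum a b k N y) \<le> C / norm y ^ N"
proof (intro exI allI impI)
  fix y :: complex assume y: "norm y > 1"
  have "{..<N'} = {..<N} \<union> {N..<N'}" using assms by auto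
  then have "ladder_sum a b k N' y = ladder_sum a b k N y + (\<Sum>m\<in>{N..<N'}. ladder_coeff a b k m / y ^ m)"
    unfolding ladder_sum_def by (simp add: sum.union_disjoint ivl_disj_int)
  then have "norm (ladder_sum a b k N' y - ladder_sum a b k N y) = norm (\<Sum>m\<in>{N..<N'}. ladder_coeff a b k m / y ^ m)"
    by simp
  also have "\<dots> \<le> (\<Sum>m\<in>{N..<N'}. norm (ladder_coeff a b k m) / norm y ^ N)"
  proof (rule sum_norm_le)
    fix m assume m: "m \<in> {N..<N'}"
    then have "norm y ^ N \<le> norm y ^ m"
      using y by (intro power_increasing) auto
    then show "norm (ladder_coeff a b k m / y ^ m) \<le> norm (ladder_coeff a b k m) / norm y ^ N"
      using y unfolding norm_divide norm_power by (intro divide_left_mono mult_pos_pos zero_less_power) auto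
  qed
  finally show "norm (ladder_sum a b k N' y - ladder_sum a b k N y)
      \<le> (\<Sum>m\<in>{N..<N'}. norm (ladder_coeff a b k m)) / norm y ^ N"
    by (simp add: sum_divide_distrib)
qed

lemma connected_far_half_plane: "connected far_half_plane"
proof -
  have eq: "far_half_plane = exp ` ({t. Re t > 0} \<inter> {t. Im t < pi / 2} \<inter> {t. Im t > - (pi / 2)})" (is "_ = exp ` ?S")
  proof (intro set_eqI iffI)
    fix y assume y: "y \<in> far_half_plane"
    then have y0: "y \<noteq> 0" "Re y > 0" "norm y > 1" by (auto simp: far_half_plane_def)
    then have "\<bar>Im (Ln y)\<bar> < pi / 2" using Re_Ln_pos_lt by blast
    moreover have "Re (Ln y) > 0" using y0 by (simp add: ln_gt_zero)
    ultimately have "Ln y \<in> ?S" by auto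
    then show "y \<in> exp ` ?S" using y0 exp_Ln by (metis image_eqI)
  next
    fix y assume "y \<in> exp ` ?S"
    then obtain t where t: "y = exp t" "Re t > 0" "Im t < pi / 2" "Im t > - (pi / 2)" by blast
    then have "cos (Im t) > 0" by (intro cos_gt_zero_pi) auto
    then show "y \<in> far_half_plane"
      using t by (simp add: far_half_plane_def Re_exp norm_exp_eq_Re)
  qed
  have "convex ?S"
    by (intro convex_Int convex_halfspace_Re_gt convex_halfspace_Im_lt convex_halfspace_Im_gt)
  then show ?thesis
    unfolding eq by (intro connected_continuous_image continuous_intros convex_connected)
qed

text \<open>The tower in the variable y = e^t after the factor (-1)^k e^-y y^(k+c) is split off from
  the k-th stage, where c = \<open>bexp n\<close>. The closing relation of the tower becomes
  periodicity in k.\<close>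

definition cyclic_system :: "nat \<Rightarrow> (nat \<Rightarrow> complex) \<Rightarrow> (nat \<Rightarrow> complex \<Rightarrow> complex) \<Rightarrow> bool" where
  "cyclic_system n a v \<longleftrightarrow> (\<forall>y\<in>far_half_plane. v n y = v 0 y \<and>
     (\<forall>k<n. (v k has_field_derivative v k y - v (Suc k) y - a k / y * v k y) (at y)))"

text \<open>Uniqueness on the positive ray extends to the half-plane by the identity theorem. The
  difference has to decay at one fixed order M only; this is what later identifies the solutions
  built for different orders.\<close>

lemma cyclic_system_unique:
  assumes n: "n \<ge> 1" and u: "cyclic_system n a u" and v: "cyclic_system n a v"
    and M: "M \<ge> 1" and a: "\<And>k. k < n \<Longrightarrow> norm (a k) \<le> A" "2 * real n * A \<le> real M"
    and bound: "\<And>k. k < n \<Longrightarrow> \<exists>C. \<forall>y\<in>far_half_plane. norm (u k y - v k y) \<le> C / norm y ^ M"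
    and k: "k < n" and y: "y \<in> far_half_plane"
  shows "u k y = v k y"
proof -
  obtain C where C: "\<And>k y. k < n \<Longrightarrow> y \<in> far_half_plane \<Longrightarrow> norm (u k y - v k y) \<le> C k / norm y ^ M"
    using bound by metis
  define B where "B = (\<Sum>k<n. \<bar>C k\<bar>)"
  have CB: "C k \<le> B" if "k < n" for k
    using that member_le_sum [of k "{..<n}" "\<lambda>k. \<bar>C k\<bar>"] by (force simp: B_def)
  have real: "complex_of_real x \<in> far_half_plane" if "x > 1" for x
    using that by (simp add: far_half_plane_def)
  have D: "((\<lambda>y. u k y - v k y) has_field_derivative
      (u k y - v k y) - (u (Suc k) y - v (Suc k) y) - a k / y * (u k y - v k y)) (at y)"
    if "k < n" "y \<in> far_half_plane" for k y
    using that u v unfolding cyclic_system_def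
    by (auto intro!: derivative_eq_intros simp: algebra_simps)
  have ray: "u k (of_real x) - v k (of_real x) = 0" if k: "k < n" and x: "x > 1" for k x
  proof (rule cyclic_ray_unique [where v = "\<lambda>k x. u k (of_real x) - v k (of_real x)" and R = 1 and M = M and n = n, OF n M _ _ _ _ a k x])
    fix k and x :: real assume k: "k < n" and x: "x > 1"
    show "((\<lambda>x. u k (of_real x) - v k (of_real x)) has_vector_derivative
       u k (of_real x) - v k (of_real x) - (u (Suc k) (of_real x) - v (Suc k) (of_real x))
       - a k / of_real x * (u k (of_real x) - v k (of_real x))) (at x)"
      by (rule has_vector_derivative_real_field) (rule D [OF k real [OF x]])
    have "norm (u k (of_real x) - v k (of_real x)) \<le> C k / x ^ M"
      using C [OF k real [OF x]] x by simp
    also have "\<dots> \<le> B / x ^ M"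
      using CB [OF k] x by (intro divide_right_mono) auto
    finally show "norm (u k (of_real x) - v k (of_real x)) \<le> B / x ^ M" .
  next
    show "u n (of_real x) - v n (of_real x) = u 0 (of_real x) - v 0 (of_real x)" if "x > 1" for x
      using u v real [OF that] by (simp add: cyclic_system_def)
  qed auto
  have "(\<lambda>y. u k y - v k y) y = 0"
  proof (rule analytic_continuation [OF _ open_far_half_plane connected_far_half_plane, where f = "\<lambda>y. u k y - v k y" and U = "of_real ` {1<..}" and \<xi> = 2])
    show "(\<lambda>y. u k y - v k y) holomorphic_on far_half_plane"
      using D [OF k] open_far_half_plane by (auto simp: holomorphic_on_open)
    show "(2::complex) islimpt of_real ` {1<..}"
    proof (rule islimptI)
      fix T :: "complex set" assume "2 \<in> T" "open T"
      then obtain e where e: "e > 0" "ball 2 e \<subseteq> T" by (meson openE)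
      then have "complex_of_real (2 + e / 2) \<in> T"
        by (intro subsetD [OF e(2)]) (simp add: dist_norm norm_divide)
      moreover have "complex_of_real (2 + e / 2) \<in> of_real ` {1<..}"
        using e(1) by (intro imageI) simp
      moreover have "complex_of_real (2 + e / 2) \<noteq> 2"
        using e(1) by simp
      ultimately show "\<exists>y\<in>of_real ` {1<..}. y \<in> T \<and> y \<noteq> 2" by blast
    qed
    show "(2::complex) \<in> far_half_plane" by (simp add: far_half_plane_def)
  qed (use ray [OF k] real y in auto)
  then show ?thesis by simp
qed

text \<open>For every large M the series is cut off after M and its defect corrected by
  \<open>exists_small_solution\<close>. Any two of the resulting solutions differ by O(|y|^-M0) and
  therefore coincide, so a single solution has the expansion to every order.\<close>

theorem exists_cyclic_system_asymptotic:
  assumes n: "n \<ge> 1" and b: "ladder_coeff a b n = b"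
  shows "\<exists>v. cyclic_system n a v \<and>
     (\<forall>N. \<forall>k<n. \<exists>C. \<forall>y\<in>far_half_plane. norm (v k y - ladder_sum a b k N y) \<le> C / norm y ^ N)"
proof -
  define A where "A = (\<Sum>k<n. norm (a k))"
  have a: "norm (a k) \<le> A" if "k < n" for k
    using that member_le_sum [of k "{..<n}" "\<lambda>k. norm (a k)"] by (simp add: A_def)
  \<comment> \<open>From this order on the iteration contracts and decay forces uniqueness.\<close>
  obtain M0 :: nat where M0: "2 * real n * A \<le> real M0" "M0 \<ge> 1"
    using real_arch_simple [of "max 1 (2 * real n * A)"] by auto
  have nz: "y \<noteq> 0" "norm y > 1" if "y \<in> far_half_plane" for y
    using that by (auto simp: far_half_plane_def)
  have ex: "\<exists>v. cyclic_system n a v \<and>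
      (\<forall>k<n. \<exists>C. \<forall>y\<in>far_half_plane. norm (v k y - ladder_sum a b k (Suc M) y) \<le> C / norm y ^ M)"
    if "M \<ge> M0" for M
  proof -
    have M: "M \<ge> 1" "2 * real n * A \<le> real M" using M0 that by auto
    define E where "E = (\<lambda>k. (a k - of_nat M) * ladder_coeff a b k M)"
    define EE where "EE = (\<Sum>k<n. norm (E k))"
    have E: "norm (E k) \<le> EE" if "k < n" for k
      using that member_le_sum [of k "{..<n}" "\<lambda>k. norm (E k)"] by (simp add: EE_def)
    have EE0: "EE \<ge> 0" by (simp add: EE_def sum_nonneg)
    have "\<exists>w. \<forall>y\<in>far_half_plane. w n y = w 0 y \<and>
     (\<forall>k<n. (w k has_field_derivative w k y - w (Suc k) y - a k / y * w k y - E k / y ^ Suc M) (at y)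
        \<and> norm (w k y) \<le> (2 * real n * (EE * 2 ^ M) / real M) / weight y ^ M)"
    proof (rule exists_small_solution [OF n M(1) _ _ a M(2)])
      show "(\<lambda>y. E k / y ^ Suc M) holomorphic_on far_half_plane" for k
        using nz by (intro holomorphic_intros) auto
      fix k y assume k: "k < n" and y: "y \<in> far_half_plane"
      have "norm (E k / y ^ Suc M) = norm (E k) / (norm y ^ M * norm y)"
        by (simp add: norm_divide norm_mult norm_power mult.commute)
      also have "\<dots> \<le> EE / (norm y ^ M * norm y)"
        using E [OF k] by (intro divide_right_mono) auto
      also have "\<dots> = EE * 2 ^ M / ((2 * norm y) ^ M * norm y)"
        by (simp add: power_mult_distrib)
      also have "\<dots> \<le> EE * 2 ^ M / (weight y ^ M * norm y)"
        using weight_le [of y] weight_gt_1 [OF y] nz [OF y] EE0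
        by (intro divide_left_mono mult_right_mono power_mono mult_pos_pos zero_less_power mult_nonneg_nonneg) auto
      finally show "norm (E k / y ^ Suc M) \<le> EE * 2 ^ M / (weight y ^ M * norm y)" .
    qed auto
    then obtain w where w: "\<And>y. y \<in> far_half_plane \<Longrightarrow> w n y = w 0 y"
      "\<And>y k. y \<in> far_half_plane \<Longrightarrow> k < n \<Longrightarrow>
        (w k has_field_derivative w k y - w (Suc k) y - a k / y * w k y - E k / y ^ Suc M) (at y)"
      "\<And>y k. y \<in> far_half_plane \<Longrightarrow> k < n \<Longrightarrow> norm (w k y) \<le> (2 * real n * (EE * 2 ^ M) / real M) / weight y ^ M"
      by blast
    define v where "v = (\<lambda>k y. ladder_sum a b k (Suc M) y + w k y)"
    have "cyclic_system n a v"
      unfolding cyclic_system_def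
    proof (intro ballI conjI allI impI)
      fix y assume y: "y \<in> far_half_plane"
      show "v n y = v 0 y"
        by (simp add: v_def w(1) [OF y] ladder_sum_def b)
      fix k assume k: "k < n"
      have "(v k has_field_derivative
        (ladder_sum a b k (Suc M) y - ladder_sum a b (Suc k) (Suc M) y - a k / y * ladder_sum a b k (Suc M) y
          + (a k - of_nat M) * ladder_coeff a b k M / y ^ Suc M)
        + (w k y - w (Suc k) y - a k / y * w k y - E k / y ^ Suc M)) (at y)"
        unfolding v_def by (intro DERIV_add ladder_sum_deriv w(2) nz y k)
      then show "(v k has_field_derivative v k y - v (Suc k) y - a k / y * v k y) (at y)"
        by (simp add: v_def E_def algebra_simps)
    qed
    moreover have "norm (v k y - ladder_sum a b k (Suc M) y) \<le> (2 * real n * (EE * 2 ^ M) / real M) / norm y ^ M"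
      if y: "y \<in> far_half_plane" and k: "k < n" for y k
    proof -
      have "norm (w k y) \<le> (2 * real n * (EE * 2 ^ M) / real M) / weight y ^ M"
        by (rule w(3) [OF y k])
      also have "\<dots> \<le> (2 * real n * (EE * 2 ^ M) / real M) / norm y ^ M"
        using weight_ge_norm [OF y] weight_gt_1 [OF y] nz [OF y] EE0
        by (intro divide_left_mono power_mono mult_pos_pos zero_less_power divide_nonneg_nonneg mult_nonneg_nonneg) auto
      finally show ?thesis by (simp add: v_def)
    qed
    ultimately show ?thesis by blast
  qed
  then obtain V where V: "\<And>M. M \<ge> M0 \<Longrightarrow> cyclic_system n a (V M)"
    "\<And>M k. M \<ge> M0 \<Longrightarrow> k < n \<Longrightarrow> \<exists>C. \<forall>y\<in>far_half_plane. norm (V M k y - ladder_sum a b k (Suc M) y) \<le> C / norm y ^ M"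
    by metis
  have near: "\<exists>C. \<forall>y\<in>far_half_plane. norm (V M k y - ladder_sum a b k N y) \<le> C / norm y ^ N"
    if "M \<ge> M0" "k < n" "N \<le> M" for M k N
  proof -
    obtain C1 where C1: "\<forall>y\<in>far_half_plane. norm (V M k y - ladder_sum a b k (Suc M) y) \<le> C1 / norm y ^ M"
      using V(2) \<open>M \<ge> M0\<close> \<open>k < n\<close> by blast
    obtain C2 where C2: "\<forall>y. norm y > 1 \<longrightarrow> norm (ladder_sum a b k (Suc M) y - ladder_sum a b k N y) \<le> C2 / norm y ^ N"
      using ladder_sum_diff_bound [of N "Suc M" a b k] \<open>N \<le> M\<close> by auto
    show ?thesis
    proof (intro exI ballI)
      fix y assume y: "y \<in> far_half_plane"
      have "norm (V M k y - ladder_sum a b k (Suc M) y) \<le> \<bar>C1\<bar> / norm y ^ M"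
        using C1 y by (force intro: order_trans divide_right_mono)
      also have "\<dots> \<le> \<bar>C1\<bar> / norm y ^ N"
        using nz [OF y] that
        by (intro divide_left_mono power_increasing mult_pos_pos zero_less_power) auto
      finally have "norm (V M k y - ladder_sum a b k (Suc M) y) \<le> \<bar>C1\<bar> / norm y ^ N" .
      moreover have "norm (ladder_sum a b k (Suc M) y - ladder_sum a b k N y) \<le> C2 / norm y ^ N"
        using C2 nz [OF y] by blast
      ultimately have "norm ((V M k y - ladder_sum a b k (Suc M) y) + (ladder_sum a b k (Suc M) y - ladder_sum a b k N y))
          \<le> \<bar>C1\<bar> / norm y ^ N + C2 / norm y ^ N"
        by (rule norm_triangle_mono)
      then show "norm (V M k y - ladder_sum a b k N y) \<le> (\<bar>C1\<bar> + C2) / norm y ^ N"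
        by (simp add: add_divide_distrib)
    qed
  qed
  have same: "V M k y = V M0 k y" if "M \<ge> M0" "k < n" "y \<in> far_half_plane" for M k y
  proof (rule cyclic_system_unique [OF n V(1) V(1) M0(2) a M0(1) _ that(2,3)])
    fix k assume k: "k < n"
    obtain C1 C2 where C: "\<forall>y\<in>far_half_plane. norm (V M k y - ladder_sum a b k M0 y) \<le> C1 / norm y ^ M0"
      "\<forall>y\<in>far_half_plane. norm (V M0 k y - ladder_sum a b k M0 y) \<le> C2 / norm y ^ M0"
      using near [OF \<open>M \<ge> M0\<close> k \<open>M \<ge> M0\<close>] near [OF order_refl k order_refl] by blast
    have "norm (V M k y - V M0 k y) \<le> (C1 + C2) / norm y ^ M0" if y: "y \<in> far_half_plane" for y
    proof -
      have "norm ((V M k y - ladder_sum a b k M0 y) - (V M0 k y - ladder_sum a b k M0 y))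
         \<le> C1 / norm y ^ M0 + C2 / norm y ^ M0"
        by (rule norm_triangle_le_diff, rule add_mono) (use C y in auto)
      then show ?thesis by (simp add: add_divide_distrib)
    qed
    then show "\<exists>C. \<forall>y\<in>far_half_plane. norm (V M k y - V M0 k y) \<le> C / norm y ^ M0" by blast
  qed (use that in auto)
  have "\<exists>C. \<forall>y\<in>far_half_plane. norm (V M0 k y - ladder_sum a b k N y) \<le> C / norm y ^ N" if "k < n" for k N
    using near [of "max M0 N" k N] same [of "max M0 N" k] that by force
  then show ?thesis
    using V(1) by (intro exI [of _ "V M0"]) auto
qed

section \<open>Picard iteration along segments and on discs\<close>

section \<open>Linear systems with entire coefficients\<close>

text \<open>Integration against the weight exp (L x) gains a factor 1 / L. A large L thus makes
  Picard iteration contract on the whole interval at once, without subdivision.\<close>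

lemma norm_diff_le_exp:
  fixes g :: "real \<Rightarrow> complex"
  assumes g: "\<And>x. 0 \<le> x \<Longrightarrow> x \<le> 1 \<Longrightarrow> (g has_vector_derivative g' x) (at x)"
    and bd: "\<And>x. 0 \<le> x \<Longrightarrow> x \<le> 1 \<Longrightarrow> norm (g' x) \<le> M * exp (L * x)"
    and L: "L > 0" and M: "M \<ge> 0" and x: "0 \<le> x" "x \<le> 1"
  shows "norm (g x - g 0) \<le> M / L * exp (L * x)"
proof (cases "x = 0")
  case False
  define \<phi> where "\<phi> = (\<lambda>x. M / L * exp (L * x))"
  have \<phi>: "(\<phi> has_vector_derivative M * exp (L * t)) (at t)" for t
    unfolding \<phi>_def has_real_derivative_iff_has_vector_derivative [symmetric]
    using L by (auto intro!: derivative_eq_intros)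
  have "norm (g x - g 0) \<le> \<phi> x - \<phi> 0"
  proof (rule differentiable_bound_general [where f' = g' and \<phi>' = "\<lambda>t. M * exp (L * t)"])
    show "continuous_on {0..x} g" "continuous_on {0..x} \<phi>"
      using g \<phi> x by (fastforce intro!: continuous_at_imp_continuous_on has_vector_derivative_continuous)+
  qed (use g \<phi> bd x False in auto)
  moreover have "\<phi> 0 \<ge> 0" using L M by (simp add: \<phi>_def)
  ultimately show ?thesis by (simp add: \<phi>_def)
qed (use L M in simp)

lemma has_vector_derivative_segment:
  assumes "(f has_field_derivative f') (at (p + of_real x * d))"
  shows "((\<lambda>x. f (p + of_real x * d)) has_vector_derivative f' * d) (at x)"
proof -
  have "((\<lambda>z. f (p + z * d)) has_field_derivative f' * d) (at (of_real x))"
    by (rule DERIV_chain2 [where f = f and g = "\<lambda>z. p + z * d", OF assms]) (auto intro!: derivative_eq_intros)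
  then show ?thesis by (rule has_vector_derivative_real_field)
qed

definition linear_system ::
    "nat \<Rightarrow> (nat \<Rightarrow> nat \<Rightarrow> complex \<Rightarrow> complex) \<Rightarrow> complex set \<Rightarrow> (nat \<Rightarrow> complex \<Rightarrow> complex) \<Rightarrow> bool" where
  "linear_system n A S F \<longleftrightarrow>
     (\<forall>t\<in>S. \<forall>i<n. (F i has_field_derivative (\<Sum>j<n. A i j t * F j t)) (at t))"

lemma bounded_coefficients:
  fixes A :: "nat \<Rightarrow> nat \<Rightarrow> complex \<Rightarrow> complex"
  assumes "\<And>i j. i < n \<Longrightarrow> j < n \<Longrightarrow> A i j holomorphic_on UNIV" "compact K"
  shows "\<exists>B\<ge>0. \<forall>i<n. \<forall>j<n. \<forall>t\<in>K. norm (A i j t) \<le> B"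
proof -
  have "\<exists>B. \<forall>t\<in>K. norm (A i j t) \<le> B" if "i < n" "j < n" for i j
  proof -
    have "compact (A i j ` K)"
      using assms that holomorphic_on_imp_continuous_on continuous_on_subset
      by (intro compact_continuous_image) blast+
    then show ?thesis
      by (auto dest!: compact_imp_bounded simp: bounded_iff)
  qed
  then obtain B where B: "\<And>i j t. i < n \<Longrightarrow> j < n \<Longrightarrow> t \<in> K \<Longrightarrow> norm (A i j t) \<le> B i j"
    by metis
  have "norm (A i j t) \<le> (\<Sum>i<n. \<Sum>j<n. \<bar>B i j\<bar>)" if "i < n" "j < n" "t \<in> K" for i j t
  proof -
    have "norm (A i j t) \<le> \<bar>B i j\<bar>" using B [OF that] by simp
    also have "\<dots> \<le> (\<Sum>j<n. \<bar>B i j\<bar>)"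
      using that by (intro member_le_sum) auto
    also have "\<dots> \<le> (\<Sum>i<n. \<Sum>j<n. \<bar>B i j\<bar>)"
      using that by (intro member_le_sum [of i "{..<n}" "\<lambda>i. \<Sum>j<n. \<bar>B i j\<bar>"]) (auto intro: sum_nonneg)
    finally show ?thesis .
  qed
  then show ?thesis by (intro exI [of _ "\<Sum>i<n. \<Sum>j<n. \<bar>B i j\<bar>"]) (auto intro!: sum_nonneg)
qed

lemma norm_linear_combination_le:
  fixes A F :: "nat \<Rightarrow> complex"
  assumes "\<And>j. j < n \<Longrightarrow> norm (A j) \<le> B" "\<And>j. j < n \<Longrightarrow> norm (F j) \<le> C" "B \<ge> 0"
  shows "norm (\<Sum>j<n. A j * F j) \<le> real n * (B * C)"
proof (rule norm_sum_le_card)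
  fix j assume "j < n"
  then show "norm (A j * F j) \<le> B * C"
    unfolding norm_mult using assms by (intro mult_mono) auto
qed

text \<open>On the segment from t0 to t the solution is bounded by a multiple of exp (L x). With L >
  2 n B |d| one integration of the system halves this multiple, hence it can be taken arbitrarily
  small.\<close>

lemma linear_system_unique_0:
  assumes A: "\<And>i j. i < n \<Longrightarrow> j < n \<Longrightarrow> A i j holomorphic_on UNIV"
    and F: "linear_system n A S F" and S: "convex S" "t0 \<in> S" "t \<in> S"
    and init: "\<And>i. i < n \<Longrightarrow> F i t0 = 0" and i: "i < n"
  shows "F i t = 0"
proof -
  define d where "d = t - t0"
  define p where "p = (\<lambda>x::real. t0 + of_real x * d)"
  have p: "p x \<in> S" if "0 \<le> x" "x \<le> 1" for x
  proof -
    have "p x = (1 - x) *\<^sub>R t0 + x *\<^sub>R t"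
      by (simp add: p_def d_def scaleR_conv_of_real algebra_simps)
    then show ?thesis using S that by (simp add: convexD)
  qed
  define K where "K = p ` {0..1}"
  have cK: "compact K"
    unfolding K_def p_def by (intro compact_continuous_image continuous_intros) auto
  have "\<exists>B\<ge>0. \<forall>i<n. \<forall>j<n. \<forall>t\<in>K. norm (A i j t) \<le> B"
    by (rule bounded_coefficients [OF A cK])
  then obtain B where B: "B \<ge> 0" "\<And>i j t. i < n \<Longrightarrow> j < n \<Longrightarrow> t \<in> K \<Longrightarrow> norm (A i j t) \<le> B"
    by auto
  have D: "((\<lambda>x. F i (p x)) has_vector_derivative (\<Sum>j<n. A i j (p x) * F j (p x)) * d) (at x)"
    if "i < n" "0 \<le> x" "x \<le> 1" for i x
    unfolding p_def using F p [OF that(2,3)] that(1)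
    by (intro has_vector_derivative_segment) (auto simp: linear_system_def p_def)
  have "\<exists>C. \<forall>x\<in>{0..1}. norm (F i (p x)) \<le> C" if "i < n" for i
  proof -
    have "isCont (\<lambda>x. F i (p x)) x" if "x \<in> {0..1}" for x
      by (rule has_vector_derivative_continuous [OF D]) (use \<open>i < n\<close> that in auto)
    then have "compact ((\<lambda>x. F i (p x)) ` {0..1})"
      by (intro compact_continuous_image continuous_at_imp_continuous_on) auto
    then show ?thesis
      by (auto dest!: compact_imp_bounded simp: bounded_iff)
  qed
  then obtain Ci where Ci: "\<And>i x. i < n \<Longrightarrow> x \<in> {0..1} \<Longrightarrow> norm (F i (p x)) \<le> Ci i"
    by metis
  define C where "C = (\<Sum>i<n. \<bar>Ci i\<bar>)"
  have C0: "C \<ge> 0" by (simp add: C_def sum_nonneg)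
  define L where "L = 2 * real n * B * norm d + 1"
  have L: "L > 0" using B(1) by (simp add: L_def add_nonneg_pos)
  have main: "\<forall>i<n. \<forall>x. 0 \<le> x \<longrightarrow> x \<le> 1 \<longrightarrow> norm (F i (p x)) \<le> C / 2 ^ k * exp (L * x)" for k
  proof (induction k)
    case 0
    show ?case
    proof (intro allI impI)
      fix i and x :: real assume i: "i < n" and x: "0 \<le> x" "x \<le> 1"
      have "norm (F i (p x)) \<le> \<bar>Ci i\<bar>" using Ci [OF i, of x] x by simp
      also have "\<dots> \<le> C" unfolding C_def using i by (intro member_le_sum) auto
      also have "\<dots> \<le> C * exp (L * x)"
        using mult_left_mono [of 1 "exp (L * x)" C] C0 L x by simp
      finally show "norm (F i (p x)) \<le> C / 2 ^ 0 * exp (L * x)" by simp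
    qed
  next
    case (Suc k)
    show ?case
    proof (intro allI impI)
      fix i and x :: real assume i: "i < n" and x: "0 \<le> x" "x \<le> 1"
      define M where "M = real n * (B * (C / 2 ^ k)) * norm d"
      have "norm (F i (p x) - F i (p 0)) \<le> M / L * exp (L * x)"
      proof (rule norm_diff_le_exp [OF D [OF i] _ L])
        fix x :: real assume x: "0 \<le> x" "x \<le> 1"
        then have "p x \<in> K" by (auto simp: K_def)
        then have "norm (\<Sum>j<n. A i j (p x) * F j (p x)) \<le> real n * (B * (C / 2 ^ k * exp (L * x)))"
          using Suc x B i by (intro norm_linear_combination_le) auto
        then have "norm ((\<Sum>j<n. A i j (p x) * F j (p x)) * d) \<le> real n * (B * (C / 2 ^ k * exp (L * x))) * norm d"
          unfolding norm_mult by (rule mult_right_mono) simp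
        then show "norm ((\<Sum>j<n. A i j (p x) * F j (p x)) * d) \<le> M * exp (L * x)"
          by (simp add: M_def mult_ac)
      next
        show "M \<ge> 0" using B(1) C0 by (simp add: M_def)
      qed (use x in auto)
      also have "M / L \<le> C / 2 ^ Suc k"
      proof -
        have "2 * real n * B * norm d * (C / 2 ^ k) \<le> L * (C / 2 ^ k)"
          using C0 by (intro mult_right_mono) (auto simp: L_def)
        then show ?thesis using L by (simp add: M_def field_simps)
      qed
      finally show "norm (F i (p x)) \<le> C / 2 ^ Suc k * exp (L * x)"
        using init [OF i] by (simp add: p_def)
    qed
  qed
  have "norm (F i (p 1)) \<le> C * exp L * (1/2) ^ k" for k
    using main [of k, rule_format, of i 1] i by (simp add: power_divide)
  moreover have "(\<lambda>k. C * exp L * (1/2) ^ k) \<longlonglongrightarrow> C * exp L * 0"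
    by (intro tendsto_mult tendsto_const LIMSEQ_power_zero) simp
  ultimately have "norm (F i (p 1)) \<le> C * exp L * 0"
    by (intro LIMSEQ_le_const) auto
  then show ?thesis by (simp add: p_def d_def)
qed

text \<open>The Picard corrections are iterated complex primitives, available because the
  coefficients are entire. On every disc about t0 the weighted estimate bounds the k-th one by a
  multiple of 2^-k, so their sum is entire and differentiable term by term.\<close>

lemma linear_system_exists:
  assumes A: "\<And>i j. i < n \<Longrightarrow> j < n \<Longrightarrow> A i j holomorphic_on UNIV"
  shows "\<exists>F. linear_system n A UNIV F \<and> (\<forall>i<n. F i t0 = c i)"
proof -
  \<comment> \<open>The zeroth iterate is the constant vector of initial values and all later ones
    vanish at t0, so the sum has the prescribed value there.\<close>
  define P :: "nat \<Rightarrow> (nat \<Rightarrow> complex \<Rightarrow> complex) \<Rightarrow> bool"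
    where "P = (\<lambda>k G. (\<forall>i<n. G i holomorphic_on UNIV \<and> (k > 0 \<longrightarrow> G i t0 = 0)) \<and> (k = 0 \<longrightarrow> G = (\<lambda>i _. c i)))"
  define Q :: "nat \<Rightarrow> (nat \<Rightarrow> complex \<Rightarrow> complex) \<Rightarrow> (nat \<Rightarrow> complex \<Rightarrow> complex) \<Rightarrow> bool"
    where "Q = (\<lambda>k G H. \<forall>i<n. \<forall>t. (H i has_field_derivative (\<Sum>j<n. A i j t * G j t)) (at t))"
  have "\<exists>G. \<forall>k. P k (G k) \<and> Q k (G k) (G (Suc k))"
  proof (rule dependent_nat_choice)
    show "\<exists>G. P 0 G" by (auto simp: P_def)
    fix G k assume G: "P k G"
    have "\<exists>H. \<forall>t. (H has_field_derivative (\<Sum>j<n. A i j t * G j t)) (at t)" if "i < n" for i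
    proof -
      have "(\<lambda>t. \<Sum>j<n. A i j t * G j t) holomorphic_on UNIV"
        using A G that by (intro holomorphic_intros) (auto simp: P_def)
      from holomorphic_convex_primitive' [OF convex_UNIV open_UNIV this] show ?thesis
        by auto
    qed
    then obtain H where H: "\<And>i t. i < n \<Longrightarrow> (H i has_field_derivative (\<Sum>j<n. A i j t * G j t)) (at t)"
      by metis
    have H': "((\<lambda>t. H i t - H i t0) has_field_derivative (\<Sum>j<n. A i j t * G j t)) (at t)" if "i < n" for i t
      using DERIV_diff [OF H [OF that] DERIV_const] by simp
    then have "P (Suc k) (\<lambda>i t. H i t - H i t0)" "Q k G (\<lambda>i t. H i t - H i t0)"
      unfolding P_def Q_def by (auto simp: holomorphic_on_open)
    then show "\<exists>H. P (Suc k) H \<and> Q k G H" by blast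
  qed
  then obtain G where G: "\<And>k. P k (G k)" "\<And>k. Q k (G k) (G (Suc k))" by blast
  define G' where "G' = (\<lambda>i k t. if k = 0 then 0 else (\<Sum>j<n. A i j t * G (k - 1) j t))"
  have D: "(G k i has_field_derivative G' i k t) (at t)" if "i < n" for i k t
    using G(1) [of k] G(2) [of "k - 1"] that by (cases k) (auto simp: P_def Q_def G'_def)
  define C where "C = (\<Sum>i<n. norm (c i))"
  have C0: "C \<ge> 0" by (simp add: C_def sum_nonneg)
  have bound: "\<exists>E. \<forall>k. \<forall>i<n. \<forall>t\<in>cball t0 r. norm (G k i t) \<le> E * (1/2) ^ k" if r: "r > 0" for r
  proof -
    have "\<exists>B\<ge>0. \<forall>i<n. \<forall>j<n. \<forall>t\<in>cball t0 r. norm (A i j t) \<le> B"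
      by (rule bounded_coefficients [OF A compact_cball])
    then obtain B where B: "B \<ge> 0" "\<And>i j t. i < n \<Longrightarrow> j < n \<Longrightarrow> t \<in> cball t0 r \<Longrightarrow> norm (A i j t) \<le> B"
      by auto
    define L where "L = 2 * real n * B * r + 1"
    have L: "L > 0" using B(1) r by (simp add: L_def add_nonneg_pos)
    have main: "\<forall>i<n. \<forall>t\<in>cball t0 r. \<forall>x. 0 \<le> x \<longrightarrow> x \<le> 1 \<longrightarrow>
        norm (G k i (t0 + of_real x * (t - t0))) \<le> C / 2 ^ k * exp (L * x)" for k
    proof (induction k)
      case 0
      show ?case
      proof (intro allI impI ballI)
        fix i t and x :: real assume i: "i < n" and x: "0 \<le> x" "x \<le> 1"
        have "norm (G 0 i (t0 + of_real x * (t - t0))) = norm (c i)"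
          using G(1) [of 0] by (simp add: P_def)
        also have "\<dots> \<le> C" unfolding C_def using i by (intro member_le_sum) auto
        also have "\<dots> \<le> C * exp (L * x)"
          using mult_left_mono [of 1 "exp (L * x)" C] C0 L x by simp
        finally show "norm (G 0 i (t0 + of_real x * (t - t0))) \<le> C / 2 ^ 0 * exp (L * x)" by simp
      qed
    next
      case (Suc k)
      show ?case
      proof (intro allI impI ballI)
        fix i t and x :: real assume i: "i < n" and t: "t \<in> cball t0 r" and x: "0 \<le> x" "x \<le> 1"
        define d where "d = t - t0"
        have d: "norm d \<le> r" using t by (simp add: d_def dist_norm norm_minus_commute)
        define M where "M = real n * (B * (C / 2 ^ k)) * r"
        have "norm (G (Suc k) i (t0 + of_real x * d) - G (Suc k) i (t0 + of_real 0 * d)) \<le> M / L * exp (L * x)"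
        proof (rule norm_diff_le_exp [OF has_vector_derivative_segment [OF D [OF i]] _ L])
          fix x :: real assume x: "0 \<le> x" "x \<le> 1"
          have "x * norm d \<le> 1 * r" using x d by (intro mult_mono) auto
          then have mem: "t0 + of_real x * d \<in> cball t0 r"
            using x by (simp add: dist_norm norm_mult)
          have "norm (\<Sum>j<n. A i j (t0 + of_real x * d) * G k j (t0 + of_real x * d))
              \<le> real n * (B * (C / 2 ^ k * exp (L * x)))"
            using Suc x B i mem t by (intro norm_linear_combination_le) (auto simp: d_def)
          then have "norm (G' i (Suc k) (t0 + of_real x * d) * d)
              \<le> (real n * (B * (C / 2 ^ k * exp (L * x)))) * r"
            unfolding norm_mult G'_def using d B(1) C0 by (intro mult_mono) auto
          then show "norm (G' i (Suc k) (t0 + of_real x * d) * d) \<le> M * exp (L * x)"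
            by (simp add: M_def mult_ac)
        next
          show "M \<ge> 0" using B(1) C0 r by (simp add: M_def)
        qed (use x in auto)
        also have "M / L \<le> C / 2 ^ Suc k"
        proof -
          have "2 * real n * B * r * (C / 2 ^ k) \<le> L * (C / 2 ^ k)"
            using C0 by (intro mult_right_mono) (auto simp: L_def)
          then show ?thesis using L by (simp add: M_def field_simps)
        qed
        finally show "norm (G (Suc k) i (t0 + of_real x * (t - t0))) \<le> C / 2 ^ Suc k * exp (L * x)"
          using G(1) [of "Suc k"] i by (simp add: P_def d_def)
      qed
    qed
    show ?thesis
    proof (intro exI allI impI ballI)
      fix k i t assume "i < n" "t \<in> cball t0 r"
      then show "norm (G k i t) \<le> (C * exp L) * (1/2) ^ k"
        using main [of k, rule_format, of i t 1] by (simp add: power_divide)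
    qed
  qed
  have "\<exists>g g'. \<forall>t\<in>UNIV. ((\<lambda>k. G k i t) sums g t) \<and> ((\<lambda>k. G' i k t) sums g' t) \<and> (g has_field_derivative g' t) (at t)"
    if i: "i < n" for i
  proof (rule series_and_derivative_comparison_local [OF open_UNIV D [OF i]])
    fix x :: complex
    have "dist t0 x + 1 > 0" by (simp add: add_nonneg_pos)
    from bound [OF this] obtain E where
      E: "\<forall>k. \<forall>i<n. \<forall>t\<in>cball t0 (dist t0 x + 1). norm (G k i t) \<le> E * (1/2) ^ k" by blast
    have "norm (G k i t) \<le> E * (1/2) ^ k" if "t \<in> ball x 1" for t k
    proof (rule E [rule_format, OF i])
      show "t \<in> cball t0 (dist t0 x + 1)"
        using that dist_triangle [of t0 t x] by simp
    qed
    moreover have "summable (\<lambda>k. E * (1/2) ^ k)"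
      by (intro summable_mult summable_geometric) simp
    ultimately show "\<exists>d h. 0 < d \<and> summable h \<and> (\<forall>\<^sub>F k in sequentially. \<forall>y\<in>ball x d \<inter> UNIV. norm (G k i y) \<le> h k)"
      by (intro exI [of _ 1] exI [of _ "\<lambda>k. E * (1/2) ^ k"] conjI always_eventually) auto
  qed
  then obtain g g' where g: "\<And>i t. i < n \<Longrightarrow> (\<lambda>k. G k i t) sums g i t"
    "\<And>i t. i < n \<Longrightarrow> (\<lambda>k. G' i k t) sums g' i t" "\<And>i t. i < n \<Longrightarrow> (g i has_field_derivative g' i t) (at t)"
    by (metis UNIV_I)
  have "g' i t = (\<Sum>j<n. A i j t * g j t)" if i: "i < n" for i t
  proof -
    have "(\<lambda>k. \<Sum>j<n. A i j t * G k j t) sums (\<Sum>j<n. A i j t * g j t)"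
      using g(1) by (intro sums_sum sums_mult) auto
    then have "(\<lambda>k. G' i k t) sums (\<Sum>j<n. A i j t * g j t)"
      using sums_Suc [of "\<lambda>k. G' i k t"] by (simp add: G'_def)
    then show ?thesis using g(2) [OF i] sums_unique2 by blast
  qed
  moreover have "g i t0 = c i" if i: "i < n" for i
  proof -
    have "G k i t0 = (if k = 0 then c i else 0)" for k
      using G(1) [of k] i by (auto simp: P_def)
    then have "(\<lambda>k. G k i t0) sums c i"
      using sums_single [of 0 "\<lambda>_. c i"] by simp
    then show ?thesis using g(1) [OF i] sums_unique2 by blast
  qed
  ultimately show ?thesis
    using g(3) by (intro exI [of _ g]) (auto simp: linear_system_def)
qed

section \<open>Passage from the half-plane at infinity to entire solutions\<close>

section \<open>The normalised solution\<close>

text \<open>The stages of the tower as unknowns, closed up by the equation of order n. The set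
  \<open>S\<close> is a parameter because the solution at infinity is at first known on a half-strip
  only.\<close>

definition tower_system ::
    "nat \<Rightarrow> (nat \<Rightarrow> complex) \<Rightarrow> complex \<Rightarrow> complex set \<Rightarrow> (nat \<Rightarrow> complex \<Rightarrow> complex) \<Rightarrow> bool" where
  "tower_system n \<mu> \<kappa> S F \<longleftrightarrow> (\<forall>t\<in>S. F n t = \<kappa> * exp (of_nat n * t) * F 0 t \<and>
     (\<forall>k<n. (F k has_field_derivative F (Suc k) t - \<mu> k * F k t) (at t)))"

text \<open>The entries are added rather than chosen by cases because two of them may fall on the
  same place: for n = 1 the corner is also on the diagonal.\<close>

definition companion :: "nat \<Rightarrow> (nat \<Rightarrow> complex) \<Rightarrow> complex \<Rightarrow> nat \<Rightarrow> nat \<Rightarrow> complex \<Rightarrow> complex" where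
  "companion n \<mu> \<kappa> k j t = (if j = k then - \<mu> k else 0) + (if j = Suc k then 1 else 0)
     + (if Suc k = n \<and> j = 0 then \<kappa> * exp (of_nat n * t) else 0)"

lemma companion_holomorphic: "companion n \<mu> \<kappa> k j holomorphic_on S"
  unfolding companion_def
  by (cases "Suc k = n \<and> j = 0") (simp_all only: simp_thms if_True if_False, (intro holomorphic_intros)+)

lemma sum_companion:
  assumes "k < n"
  shows "(\<Sum>j<n. companion n \<mu> \<kappa> k j t * F j t)
     = (if Suc k = n then \<kappa> * exp (of_nat n * t) * F 0 t else F (Suc k) t) - \<mu> k * F k t"
proof -
  have "(\<Sum>j<n. companion n \<mu> \<kappa> k j t * F j t)
      = (\<Sum>j<n. if j = k then - \<mu> k * F j t else 0) + (\<Sum>j<n. if j = Suc k then F j t else 0)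
        + (\<Sum>j<n. if j = 0 then (if Suc k = n then \<kappa> * exp (of_nat n * t) * F j t else 0) else 0)"
    unfolding companion_def sum.distrib [symmetric] by (intro sum.cong refl) (auto simp: algebra_simps)
  then show ?thesis using assms by (auto simp: algebra_simps)
qed

lemma tower_system_imp_linear_system:
  "tower_system n \<mu> \<kappa> S F \<Longrightarrow> linear_system n (companion n \<mu> \<kappa>) S F"
  unfolding linear_system_def
proof (intro ballI allI impI)
  fix t k assume F: "tower_system n \<mu> \<kappa> S F" and t: "t \<in> S" and k: "k < n"
  have "(\<Sum>j<n. companion n \<mu> \<kappa> k j t * F j t) = F (Suc k) t - \<mu> k * F k t"
    using F t k by (cases "Suc k = n") (auto simp: sum_companion tower_system_def)
  then show "(F k has_field_derivative (\<Sum>j<n. companion n \<mu> \<kappa> k j t * F j t)) (at t)"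
    using F t k by (simp add: tower_system_def)
qed

lemma tower_system_diff:
  assumes "tower_system n \<mu> \<kappa> S F" "tower_system n \<mu> \<kappa> S G"
  shows "tower_system n \<mu> \<kappa> S (\<lambda>k t. F k t - G k t)"
  using assms unfolding tower_system_def
  by (auto intro!: derivative_eq_intros simp: algebra_simps)

lemma tower_system_unique_0:
  assumes "tower_system n \<mu> \<kappa> S F" "convex S" "t0 \<in> S" "t \<in> S"
    and "\<And>k. k < n \<Longrightarrow> F k t0 = 0" and "k < n"
  shows "F k t = 0"
  by (rule linear_system_unique_0 [OF companion_holomorphic tower_system_imp_linear_system])
     (use assms in auto)

text \<open>The linear system involves the stages below n only; the n-th one is then defined by the
  closing relation.\<close>

lemma tower_system_exists:
  assumes "n \<ge> 1"
  shows "\<exists>F. tower_system n \<mu> \<kappa> UNIV F \<and> (\<forall>k<n. F k t0 = c k)"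
proof -
  obtain F where F: "linear_system n (companion n \<mu> \<kappa>) UNIV F" "\<And>k. k < n \<Longrightarrow> F k t0 = c k"
    using linear_system_exists [of n "companion n \<mu> \<kappa>" t0 c] companion_holomorphic by blast
  define G where "G = (\<lambda>k t. if k = n then \<kappa> * exp (of_nat n * t) * F 0 t else F k t)"
  have "(F k has_field_derivative G (Suc k) t - \<mu> k * G k t) (at t)" if k: "k < n" for k t
  proof -
    have "(F k has_field_derivative (\<Sum>j<n. companion n \<mu> \<kappa> k j t * F j t)) (at t)"
      using F(1) k by (simp add: linear_system_def)
    moreover have "(\<Sum>j<n. companion n \<mu> \<kappa> k j t * F j t) = G (Suc k) t - \<mu> k * G k t"
      using k by (auto simp: sum_companion G_def)
    ultimately show ?thesis by simp
  qed
  moreover have "G k = F k" if "k < n" for k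
    using that by (simp add: G_def)
  ultimately have "tower_system n \<mu> \<kappa> UNIV G"
    using assms unfolding tower_system_def by (auto simp: G_def)
  then show ?thesis using F(2) by (intro exI [of _ G]) (auto simp: G_def)
qed

lemma tower_system_imp_tower:
  assumes "tower_system n \<mu> \<kappa> UNIV F" "k \<le> n"
  shows "tower \<mu> (F 0) k = F k"
  using assms(2)
proof (induction k)
  case (Suc k)
  then have "deriv (F k) t = F (Suc k) t - \<mu> k * F k t" for t
    using assms(1) by (intro DERIV_imp_deriv) (auto simp: tower_system_def)
  then show ?case using Suc by simp
qed simp

lemma tower_holomorphic:
  assumes "f holomorphic_on UNIV"
  shows "tower \<mu> f k holomorphic_on UNIV"
  by (induction k) (use assms in \<open>auto intro!: holomorphic_intros\<close>)

lemma tower_system_tower: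
  assumes "f holomorphic_on UNIV" "\<And>t. tower \<mu> f n t = \<kappa> * exp (of_nat n * t) * f t"
  shows "tower_system n \<mu> \<kappa> UNIV (tower \<mu> f)"
  unfolding tower_system_def
proof (intro ballI conjI allI impI)
  fix t k
  show "(tower \<mu> f k has_field_derivative tower \<mu> f (Suc k) t - \<mu> k * tower \<mu> f k t) (at t)"
    using holomorphic_derivI [OF tower_holomorphic [OF assms(1)] open_UNIV, of t] by simp
qed (simp add: assms(2))

lemma tower_system_holomorphic:
  "n \<ge> 1 \<Longrightarrow> tower_system n \<mu> \<kappa> UNIV F \<Longrightarrow> F 0 holomorphic_on UNIV"
  unfolding tower_system_def by (auto simp: holomorphic_on_open)

text \<open>The common form to which the equations for all \<xi> reduce. The sign (-1)^n fits the
  behaviour exp (-e^t), since to leading order each D multiplies this function by -e^t.\<close>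

definition normal_solution :: "nat \<Rightarrow> (nat \<Rightarrow> complex) \<Rightarrow> (complex \<Rightarrow> complex) \<Rightarrow> bool" where
  "normal_solution n \<mu> f \<longleftrightarrow>
     f holomorphic_on UNIV \<and> (\<forall>t. tower \<mu> f n t = (-1) ^ n * exp (of_nat n * t) * f t)"

text \<open>The value for which the numbers \<open>bexp n\<close> + k + \<mu> k sum to 0 when the
  \<mu> k do, which is the solvability condition of the coefficient recursion.\<close>

definition bexp :: "nat \<Rightarrow> complex" where
  "bexp n = - (of_nat n - 1) / 2"

lemma sum_bexp:
  assumes "(\<Sum>k<n. \<mu> k) = 0"
  shows "(\<Sum>k<n. bexp n + of_nat k + \<mu> k) = 0"
proof -
  have gauss: "(\<Sum>k<m. of_nat k) = (of_nat m * (of_nat m - 1) / 2 :: complex)" for m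
    by (induction m) (auto simp: field_simps)
  have "(\<Sum>k<n. bexp n + of_nat k + \<mu> k) = of_nat n * bexp n + (\<Sum>k<n. of_nat k)"
    by (simp add: sum.distrib assms)
  then show ?thesis
    by (simp add: gauss bexp_def field_simps)
qed

text \<open>The solution at infinity lives on a half-strip. The entire solution with the same
  initial values at t = 1 agrees with it there, because the half-strip is convex and contains 1. The
  bounds for all stages are recorded as well: they make the boundary terms at infinity vanish in the
  Mellin integrals.\<close>

lemma normal_solution_exists:
  assumes n: "n \<ge> 1" and b: "ladder_coeff (\<lambda>k. bexp n + of_nat k + \<mu> k) b n = b"
  shows "\<exists>f. normal_solution n \<mu> f \<and>
     (\<forall>N. \<exists>C. \<forall>t. Re t > 0 \<longrightarrow> \<bar>Im t\<bar> < pi / 2 \<longrightarrow>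
        norm (f t / exp (bexp n * t - exp t) - (\<Sum>m<N. b m * exp (- of_nat m * t))) \<le> C * exp (- real N * Re t)) \<and>
     (\<forall>k<n. \<exists>C. \<forall>t. Re t > 0 \<longrightarrow> \<bar>Im t\<bar> < pi / 2 \<longrightarrow>
        norm (tower \<mu> f k t) \<le> C * norm (exp ((of_nat k + bexp n) * t - exp t)))"
proof -
  define c where "c = bexp n"
  define a where "a = (\<lambda>k. bexp n + of_nat k + \<mu> k)"
  obtain v where v: "cyclic_system n a v"
    and asym: "\<forall>N. \<forall>k<n. \<exists>C. \<forall>y\<in>far_half_plane. norm (v k y - ladder_sum a b k N y) \<le> C / norm y ^ N"
    using exists_cyclic_system_asymptotic [of n a b] n b by (auto simp: a_def)
  define S where "S = {t. Re t > 0} \<inter> {t. Im t < pi / 2} \<inter> {t. Im t > - (pi / 2)}"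
  have S: "convex S"
    unfolding S_def by (intro convex_Int convex_halfspace_Re_gt convex_halfspace_Im_lt convex_halfspace_Im_gt)
  have mem: "exp t \<in> far_half_plane" if "t \<in> S" for t
  proof -
    have "cos (Im t) > 0" using that by (intro cos_gt_zero_pi) (auto simp: S_def)
    then show ?thesis using that by (simp add: S_def far_half_plane_def Re_exp norm_exp_eq_Re)
  qed
  \<comment> \<open>The factor split off from the k-th stage is restored, which turns the cyclic
    system back into the tower.\<close>
  define F where "F = (\<lambda>k t. (-1) ^ k * exp ((of_nat k + c) * t - exp t) * v k (exp t))"
  have F: "tower_system n \<mu> ((-1) ^ n) S F"
    unfolding tower_system_def
  proof (intro ballI conjI allI impI)
    fix t assume t: "t \<in> S"
    show "F n t = (-1) ^ n * exp (of_nat n * t) * F 0 t"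
      using v mem [OF t]
      by (simp add: F_def cyclic_system_def mult_exp_exp algebra_simps)
    fix k assume k: "k < n"
    have "((\<lambda>t. v k (exp t)) has_field_derivative
        (v k (exp t) - v (Suc k) (exp t) - a k / exp t * v k (exp t)) * exp t) (at t)"
      using v k mem [OF t] unfolding cyclic_system_def
      by (intro DERIV_chain2 [where f = "v k" and g = exp]) auto
    moreover have "((\<lambda>t. exp ((of_nat k + c) * t - exp t)) has_field_derivative
        exp ((of_nat k + c) * t - exp t) * ((of_nat k + c) - exp t)) (at t)"
      by (auto intro!: derivative_eq_intros)
    ultimately have "(F k has_field_derivative
        (-1) ^ k * (exp ((of_nat k + c) * t - exp t) * ((of_nat k + c) - exp t) * v k (exp t)
         + (v k (exp t) - v (Suc k) (exp t) - a k / exp t * v k (exp t)) * exp t * exp ((of_nat k + c) * t - exp t))) (at t)"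
      unfolding F_def mult.assoc [of "(-1) ^ k"] by (intro DERIV_cmult DERIV_mult)
    moreover have "exp ((of_nat (Suc k) + c) * t - exp t) = exp t * exp ((of_nat k + c) * t - exp t)"
      by (simp add: mult_exp_exp algebra_simps)
    then have "(-1) ^ k * (exp ((of_nat k + c) * t - exp t) * ((of_nat k + c) - exp t) * v k (exp t)
         + (v k (exp t) - v (Suc k) (exp t) - a k / exp t * v k (exp t)) * exp t * exp ((of_nat k + c) * t - exp t))
      = F (Suc k) t - \<mu> k * F k t"
      unfolding F_def a_def c_def [symmetric] by (simp add: field_simps)
    ultimately show "(F k has_field_derivative F (Suc k) t - \<mu> k * F k t) (at t)" by simp
  qed
  obtain G where G: "tower_system n \<mu> ((-1) ^ n) UNIV G" "\<And>k. k < n \<Longrightarrow> G k 1 = F k 1"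
    using tower_system_exists [OF n, of \<mu> "(-1) ^ n" 1 "\<lambda>k. F k 1"] by blast
  have GF: "G k t = F k t" if t: "t \<in> S" and k: "k < n" for k t
  proof -
    have "tower_system n \<mu> ((-1) ^ n) S G"
      using G(1) by (simp add: tower_system_def)
    from tower_system_unique_0 [OF tower_system_diff [OF this F] S _ t _ k, of 1] G(2)
    show ?thesis by (simp add: S_def pi_gt_zero)
  qed
  have "normal_solution n \<mu> (G 0)"
    unfolding normal_solution_def
    using tower_system_imp_tower [OF G(1) order_refl] tower_system_holomorphic [OF n G(1)] G(1)
    by (simp add: tower_system_def)
  moreover have "\<exists>C. \<forall>t. Re t > 0 \<longrightarrow> \<bar>Im t\<bar> < pi / 2 \<longrightarrow>
        norm (G 0 t / exp (bexp n * t - exp t) - (\<Sum>m<N. b m * exp (- of_nat m * t))) \<le> C * exp (- real N * Re t)" for N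
  proof -
    have "0 < n" using n by simp
    with asym obtain C where C: "\<And>y. y \<in> far_half_plane \<Longrightarrow> norm (v 0 y - ladder_sum a b 0 N y) \<le> C / norm y ^ N"
      by meson
    show ?thesis
    proof (intro exI allI impI)
      fix t assume t: "Re t > 0" "\<bar>Im t\<bar> < pi / 2"
      then have tS: "t \<in> S" by (auto simp: S_def)
      have "G 0 t / exp (bexp n * t - exp t) = v 0 (exp t)"
        using GF [OF tS, of 0] n by (simp add: F_def c_def)
      moreover have "(\<Sum>m<N. b m * exp (- of_nat m * t)) = ladder_sum a b 0 N (exp t)"
        by (simp add: ladder_sum_def exp_minus exp_of_nat_mult divide_inverse)
      moreover have "exp (- real N * Re t) = 1 / norm (exp t) ^ N"
        by (simp add: norm_exp_eq_Re exp_minus exp_of_nat_mult divide_inverse)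
      ultimately show "norm (G 0 t / exp (bexp n * t - exp t) - (\<Sum>m<N. b m * exp (- of_nat m * t))) \<le> C * exp (- real N * Re t)"
        using C [OF mem [OF tS]] by simp
    qed
  qed
  moreover have "\<exists>C. \<forall>t. Re t > 0 \<longrightarrow> \<bar>Im t\<bar> < pi / 2 \<longrightarrow>
        norm (tower \<mu> (G 0) k t) \<le> C * norm (exp ((of_nat k + bexp n) * t - exp t))" if k: "k < n" for k
  proof -
    obtain C where C: "\<And>y. y \<in> far_half_plane \<Longrightarrow> norm (v k y - ladder_sum a b k 0 y) \<le> C / norm y ^ 0"
      using asym k by meson
    show ?thesis
    proof (intro exI allI impI)
      fix t assume t: "Re t > 0" "\<bar>Im t\<bar> < pi / 2"
      then have tS: "t \<in> S" by (auto simp: S_def)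
      have "tower \<mu> (G 0) k t = F k t"
        using tower_system_imp_tower [OF G(1), of k] k GF [OF tS k] by simp
      also have "norm \<dots> = norm (exp ((of_nat k + bexp n) * t - exp t)) * norm (v k (exp t))"
        by (simp add: F_def norm_mult norm_power c_def)
      also have "\<dots> \<le> norm (exp ((of_nat k + bexp n) * t - exp t)) * C"
        using C [OF mem [OF tS]] by (intro mult_left_mono) (auto simp: ladder_sum_def)
      finally show "norm (tower \<mu> (G 0) k t) \<le> C * norm (exp ((of_nat k + bexp n) * t - exp t))"
        by (simp add: mult.commute)
    qed
  qed
  ultimately show ?thesis by blast
qed

text \<open>Only decay of \<open>g\<close> itself, in a strip of some width, is available, as in the
  definition of the second kind. In y = e^t that strip contains, far out, a horizontal strip about
  the positive ray. There Cauchy's estimate passes the decay from each stage to the next, and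
  uniqueness on the ray applies.\<close>

lemma normal_solution_zero:
  assumes n: "n \<ge> 1" and g: "normal_solution n \<mu> g" and \<delta>: "\<delta> > 0"
    and decay: "\<And>N. \<exists>C R. \<forall>t. Re t > R \<longrightarrow> \<bar>Im t\<bar> < \<delta> \<longrightarrow>
        norm (g t / exp (bexp n * t - exp t)) \<le> C * exp (- real N * Re t)"
  shows "g t = 0"
proof -
  define c where "c = bexp n"
  define a where "a = (\<lambda>k. of_nat k + c + \<mu> k)"
  define F where "F = tower \<mu> g"
  have holF: "F k holomorphic_on UNIV" for k
    using tower_holomorphic g by (simp add: F_def normal_solution_def)
  have F': "(F k has_field_derivative F (Suc k) t - \<mu> k * F k t) (at t)" for k t
    using holomorphic_derivI [OF holF open_UNIV, of t k] by (simp add: F_def)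
  have Fn: "F n t = (-1) ^ n * exp (of_nat n * t) * F 0 t" for t
    using g by (simp add: F_def normal_solution_def)
  define v where "v = (\<lambda>k y. (-1) ^ k * F k (Ln y) * exp (y - (of_nat k + c) * Ln y))"
  have v': "(v k has_field_derivative v k y - v (Suc k) y - a k / y * v k y) (at y)" if y: "Re y > 0" for k y
  proof -
    have y': "y \<notin> \<real>\<^sub>\<le>\<^sub>0" "y \<noteq> 0" using y by (auto simp: complex_nonpos_Reals_iff)
    have E: "exp (y - (of_nat k + c) * Ln y) = y * exp (y - (of_nat (Suc k) + c) * Ln y)"
    proof -
      have "y - (of_nat k + c) * Ln y = Ln y + (y - (of_nat (Suc k) + c) * Ln y)"
        by (simp add: algebra_simps)
      then have "exp (y - (of_nat k + c) * Ln y) = exp (Ln y) * exp (y - (of_nat (Suc k) + c) * Ln y)"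
        by (simp only: exp_add)
      then show ?thesis using y' by simp
    qed
    have "((\<lambda>y. F k (Ln y)) has_field_derivative (F (Suc k) (Ln y) - \<mu> k * F k (Ln y)) * inverse y) (at y)"
      using y' by (intro DERIV_chain2 [where f = "F k" and g = Ln] F') (auto intro!: derivative_eq_intros)
    moreover have "((\<lambda>y. exp (y - (of_nat k + c) * Ln y)) has_field_derivative
        exp (y - (of_nat k + c) * Ln y) * (1 - (of_nat k + c) * inverse y)) (at y)"
      using y' by (auto intro!: derivative_eq_intros)
    ultimately have "(v k has_field_derivative
        (-1) ^ k * ((F (Suc k) (Ln y) - \<mu> k * F k (Ln y)) * inverse y * exp (y - (of_nat k + c) * Ln y)
          + exp (y - (of_nat k + c) * Ln y) * (1 - (of_nat k + c) * inverse y) * F k (Ln y))) (at y)"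
      unfolding v_def mult.assoc [of "(-1) ^ k"] by (intro DERIV_cmult DERIV_mult)
    moreover have "(-1) ^ k * ((F (Suc k) (Ln y) - \<mu> k * F k (Ln y)) * inverse y * exp (y - (of_nat k + c) * Ln y)
          + exp (y - (of_nat k + c) * Ln y) * (1 - (of_nat k + c) * inverse y) * F k (Ln y))
        = v k y - v (Suc k) y - a k / y * v k y"
      using y' unfolding v_def a_def E by (simp add: field_simps)
    ultimately show ?thesis by simp
  qed
  have vn: "v n y = v 0 y" if "Re y > 0" for y
  proof -
    have "exp (of_nat n * Ln y) * exp (y - (of_nat n + c) * Ln y) = exp (y - c * Ln y)"
      by (simp add: mult_exp_exp algebra_simps)
    moreover have "v n y = ((-1) ^ n * (-1) ^ n) * F 0 (Ln y) * (exp (of_nat n * Ln y) * exp (y - (of_nat n + c) * Ln y))"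
      by (simp add: v_def Fn)
    ultimately show ?thesis
      by (simp add: v_def power_mult_distrib [symmetric])
  qed
  have opn: "open {y. Re y > 0}" by (simp add: open_halfspace_Re_gt)
  have holv: "v k holomorphic_on {y. Re y > 0}" for k
    using v' opn by (auto simp: holomorphic_on_open)
  define A where "A = (\<Sum>k<n. norm (a k))"
  have a: "norm (a k) \<le> A" if "k < n" for k
    using that member_le_sum [of k "{..<n}" "\<lambda>k. norm (a k)"] by (simp add: A_def)
  obtain M :: nat where M: "2 * real n * A \<le> real M" "M \<ge> 1"
    using real_arch_simple [of "max 1 (2 * real n * A)"] by auto
  \<comment> \<open>The widths 1 / (k + 1) decrease with k, so that every stage leaves room for
    Cauchy discs whose radius does not depend on y.\<close>
  have tube: "\<exists>C R. R \<ge> 2 \<and> C \<ge> 0 \<and> (\<forall>y. Re y > R \<longrightarrow> \<bar>Im y\<bar> < 1 / real (Suc k) \<longrightarrow> norm (v k y) \<le> C / Re y ^ M)" for k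
  proof (induction k)
    case 0
    obtain C R where CR: "\<And>t. Re t > R \<Longrightarrow> \<bar>Im t\<bar> < \<delta> \<Longrightarrow> norm (g t / exp (bexp n * t - exp t)) \<le> C * exp (- real M * Re t)"
      using decay [of M] by blast
    \<comment> \<open>The bound |Im (Ln y)| \<le> |Im y| / Re y explains 1 / \<delta>, and |y| \<ge>
      Re y explains exp R: beyond R' the point Ln y lies in the region of the hypothesis.\<close>
    define R' where "R' = max 2 (max (exp R) (1 / \<delta>))"
    have "norm (v 0 y) \<le> \<bar>C\<bar> / Re y ^ M" if y: "Re y > R'" "\<bar>Im y\<bar> < 1" for y
    proof -
      have y0: "Re y > 0" "y \<noteq> 0" using y by (auto simp: R'_def)
      have "exp R < norm y" using y complex_Re_le_cmod [of y] by (simp add: R'_def)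
      then have "ln (exp R) < ln (norm y)" using y0 by (subst ln_less_cancel_iff) auto
      then have "R < Re (Ln y)" using y0 by simp
      moreover have "\<bar>Im (Ln y)\<bar> < \<delta>"
      proof -
        have "\<bar>Im (Ln y)\<bar> \<le> \<bar>Im y / Re y\<bar>"
          using y0 abs_arctan_le [of "Im y / Re y"] by (simp add: Im_Ln_eq)
        also have "\<dots> < 1 / Re y" using y y0 by (simp add: abs_divide divide_strict_right_mono)
        also have "\<dots> < \<delta>" using y \<delta> y0 by (simp add: R'_def field_simps)
        finally show ?thesis .
      qed
      ultimately have "norm (g (Ln y) / exp (bexp n * Ln y - exp (Ln y))) \<le> C * exp (- real M * Re (Ln y))"
        by (rule CR)
      also have "g (Ln y) / exp (bexp n * Ln y - exp (Ln y)) = v 0 y"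
        using y0 by (simp add: v_def F_def c_def exp_diff divide_inverse exp_minus [symmetric])
      also have "exp (- real M * Re (Ln y)) = 1 / norm y ^ M"
        using y0 by (simp add: exp_minus exp_of_nat_mult divide_inverse)
      also have "C * (1 / norm y ^ M) \<le> \<bar>C\<bar> / norm y ^ M"
        by (simp add: divide_right_mono)
      also have "\<dots> \<le> \<bar>C\<bar> / Re y ^ M"
        using y0 complex_Re_le_cmod [of y] by (intro divide_left_mono power_mono mult_pos_pos zero_less_power) auto
      finally show ?thesis .
    qed
    then show ?case
      by (intro exI [of _ "\<bar>C\<bar>"] exI [of _ R']) (auto simp: R'_def)
  next
    case (Suc k)
    then obtain C R where CR: "R \<ge> 2" "C \<ge> 0"
      "\<And>y. Re y > R \<Longrightarrow> \<bar>Im y\<bar> < 1 / real (Suc k) \<Longrightarrow> norm (v k y) \<le> C / Re y ^ M" by blast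
    \<comment> \<open>Half of the gap between consecutive widths, so that the disc about a point of
      the narrower strip stays in the wider one.\<close>
    define r where "r = (1 / real (Suc k) - 1 / real (Suc (Suc k))) / 2"
    have r: "r > 0" "r \<le> 1"
    proof -
      have "1 / real (Suc (Suc k)) < 1 / real (Suc k)" by (simp add: frac_less2)
      then show "r > 0" by (simp add: r_def)
      have pq: "(p - q) / 2 \<le> 1" if "p \<le> 1" "q \<ge> 0" for p q :: real
        using that by simp
      show "r \<le> 1" unfolding r_def by (rule pq) simp_all
    qed
    have "norm (v (Suc k) y) \<le> (C + C * 2 ^ M / r + norm (a k) * C) / Re y ^ M"
      if y: "Re y > R + 1" "\<bar>Im y\<bar> < 1 / real (Suc (Suc k))" for y
    proof -
      have nb: "norm (v k x) \<le> C * 2 ^ M / Re y ^ M" if x: "norm (y - x) \<le> r" for x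
      proof -
        have "\<bar>Re y - Re x\<bar> \<le> r" "\<bar>Im y - Im x\<bar> \<le> r"
          using abs_Re_le_cmod [of "y - x"] abs_Im_le_cmod [of "y - x"] x by auto
        moreover have "Re x > R \<and> Re x \<ge> Re y / 2 \<and> \<bar>Im x\<bar> < p"
          if "\<bar>Re y - Re x\<bar> \<le> r" "\<bar>Im y - Im x\<bar> \<le> r" "r = (p - q) / 2" "\<bar>Im y\<bar> < q" for p q
        proof -
          have "p = q + 2 * r" using that by simp
          then show ?thesis using that(1,2,4) r CR(1) y(1) by (auto simp: abs_le_iff abs_less_iff)
        qed
        ultimately have "Re x > R" "Re x \<ge> Re y / 2" "\<bar>Im x\<bar> < 1 / real (Suc k)"
          using y(2) r_def by blast+
        then have "norm (v k x) \<le> C / Re x ^ M" by (intro CR(3))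
        also have "\<dots> \<le> C / (Re y / 2) ^ M"
          using \<open>Re x \<ge> Re y / 2\<close> CR y by (intro divide_left_mono power_mono mult_pos_pos zero_less_power) auto
        finally show ?thesis by (simp add: power_divide)
      qed
      have sub: "cball y r \<subseteq> {y. Re y > 0}"
      proof
        fix x assume "x \<in> cball y r"
        then have "norm (y - x) \<le> r" by (simp add: dist_norm)
        then have "\<bar>Re y - Re x\<bar> \<le> r" using abs_Re_le_cmod [of "y - x"] by auto
        then show "x \<in> {y. Re y > 0}" using r CR(1) y by auto
      qed
      have "norm ((deriv ^^ 1) (v k) y) \<le> fact 1 * (C * 2 ^ M / Re y ^ M) / r ^ 1"
      proof (rule Cauchy_inequality)
        show "v k holomorphic_on ball y r"
          using holv sub ball_subset_cball by (meson holomorphic_on_subset order_trans)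
        show "continuous_on (cball y r) (v k)"
          using holv sub holomorphic_on_imp_continuous_on continuous_on_subset by blast
      qed (use r nb in auto)
      then have d: "norm (deriv (v k) y) \<le> C * 2 ^ M / r / Re y ^ M" by (simp add: mult.commute)
      have y0: "Re y > 0" "norm y \<ge> 1" using y CR(1) complex_Re_le_cmod [of y] by auto
      have vk: "norm (v k y) \<le> C / Re y ^ M"
      proof (rule CR(3))
        have "1 / real (Suc (Suc k)) < 1 / real (Suc k)" by (simp add: frac_less2)
        then show "\<bar>Im y\<bar> < 1 / real (Suc k)" using y by linarith
      qed (use y in auto)
      have "deriv (v k) y = v k y - v (Suc k) y - a k / y * v k y"
        using v' [OF y0(1)] by (rule DERIV_imp_deriv)
      then have "v (Suc k) y = v k y - deriv (v k) y - a k / y * v k y" by simp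
      also have "norm \<dots> \<le> norm (v k y) + norm (deriv (v k) y) + norm (a k / y * v k y)"
        by (meson norm_triangle_ineq4 order_trans add_right_mono)
      also have "norm (a k / y * v k y) \<le> norm (a k) * norm (v k y)"
        using y0 unfolding norm_mult norm_divide
        by (intro mult_right_mono) (auto simp: divide_le_eq mult_le_cancel_left1)
      also have "\<dots> \<le> norm (a k) * (C / Re y ^ M)"
        using vk by (rule mult_left_mono) simp
      finally show ?thesis
        using vk d by (simp add: add_divide_distrib)
    qed
    moreover have "C + C * 2 ^ M / r + norm (a k) * C \<ge> 0" using CR r by simp
    moreover have "R + 1 \<ge> 2" using CR by simp
    ultimately show ?case by blast
  qed
  then obtain C R where CR: "\<And>k. R k \<ge> 2" "\<And>k. C k \<ge> 0"
    "\<And>k y. Re y > R k \<Longrightarrow> \<bar>Im y\<bar> < 1 / real (Suc k) \<Longrightarrow> norm (v k y) \<le> C k / Re y ^ M"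
    by metis
  define R' where "R' = 1 + (\<Sum>k<n. R k)"
  define C' where "C' = (\<Sum>k<n. C k)"
  have R': "R k \<le> R'" "R' > 0" if "k < n" for k
  proof -
    have "0 \<le> R j" for j using CR(1) [of j] by linarith
    then have "R k \<le> (\<Sum>k<n. R k)" using that by (intro member_le_sum) auto
    then show "R k \<le> R'" "R' > 0" using CR(1) [of k] by (auto simp: R'_def)
  qed
  have C': "C k \<le> C'" if "k < n" for k
    unfolding C'_def using that CR(2) by (intro member_le_sum) auto
  have R'0: "R' > 0" using R'(2) [of 0] n by simp
  have vd: "((\<lambda>x. v k (of_real x)) has_vector_derivative
       v k (of_real x) - v (Suc k) (of_real x) - a k / of_real x * v k (of_real x)) (at x)"
    if "x > R'" for k and x :: real
    by (rule has_vector_derivative_real_field, rule v') (use that R'0 in simp)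
  have vb: "norm (v k (of_real x)) \<le> C' / x ^ M" if k: "k < n" and x: "x > R'" for k and x :: real
  proof -
    have "norm (v k (of_real x)) \<le> C k / x ^ M"
      using CR(3) [of k "of_real x"] x R'(1) [OF k] by simp
    also have "\<dots> \<le> C' / x ^ M"
      using C' [OF k] x R'0 by (intro divide_right_mono) auto
    finally show ?thesis .
  qed
  have vc: "v n (of_real x) = v 0 (of_real x)" if "x > R'" for x :: real
    using that R'0 by (intro vn) simp
  have ray: "v 0 (of_real x) = 0" if x: "x > R'" for x :: real
    by (rule cyclic_ray_unique [where v = "\<lambda>k x. v k (of_real x)" and R = R' and M = M and n = n and a = a
          and A = A and C = C' and k = 0 and y = x, OF n M(2) R'0 vd vc vb a M(1) _ x]) (use n in auto)
  show ?thesis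
  proof (rule analytic_continuation [where f = g and S = UNIV and U = "of_real ` {ln R'<..}" and \<xi> = "of_real (ln R' + 1)"])
    show "g holomorphic_on UNIV" using g by (simp add: normal_solution_def)
    show "complex_of_real (ln R' + 1) islimpt of_real ` {ln R'<..}"
    proof (rule islimptI)
      fix T :: "complex set" assume "of_real (ln R' + 1) \<in> T" "open T"
      then obtain e where e: "e > 0" "ball (of_real (ln R' + 1)) e \<subseteq> T" by (meson openE)
      then have "complex_of_real (ln R' + 1 + e / 2) \<in> T"
        by (intro subsetD [OF e(2)]) (simp add: dist_norm norm_divide)
      moreover have "complex_of_real (ln R' + 1 + e / 2) \<in> of_real ` {ln R'<..}"
        using e(1) by (intro imageI) simp
      moreover have "complex_of_real (ln R' + 1 + e / 2) \<noteq> of_real (ln R' + 1)"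
        using e(1) by simp
      ultimately show "\<exists>y\<in>of_real ` {ln R'<..}. y \<in> T \<and> y \<noteq> of_real (ln R' + 1)" by blast
    qed
    fix z assume "z \<in> complex_of_real ` {ln R'<..}"
    then obtain u where u: "z = of_real u" "u > ln R'" by auto
    then have "exp u > R'" using R'0 by (metis exp_less_mono exp_ln)
    from ray [OF this] have "F 0 (Ln (of_real (exp u))) = 0" by (simp add: v_def)
    then show "g z = 0" by (simp add: F_def u exp_of_real [symmetric])
  qed auto
qed

section \<open>Reduction of all functions of the second kind to one solution\<close>

section \<open>Bessel functions of the second kind\<close>

text \<open>A logarithm of -i n \<xi> when |\<xi>| = 1. With t = log z + shift one has exp (i n
  \<xi> z) = exp (-e^t), and the chosen branch sends the defining sector to |Im t| < pi / n.\<close>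

definition bessel_shift :: "nat \<Rightarrow> ucover \<Rightarrow> complex" where
  "bessel_shift n \<xi> = of_real (ln (real n)) + \<i> * of_real (uarg \<xi> - pi / 2)"

lemma exp_bessel_shift:
  assumes "n \<ge> 1" "umod \<xi> = 1"
  shows "exp (bessel_shift n \<xi>) = - (\<i> * of_nat n * uproj \<xi>)"
proof -
  have "cis (uarg \<xi> - pi / 2) = - \<i> * cis (uarg \<xi>)"
    by (simp add: complex_eq_iff cos_diff sin_diff)
  then have "exp (\<i> * of_real (uarg \<xi> - pi / 2)) = - \<i> * cis (uarg \<xi>)"
    by (simp only: cis_conv_exp)
  then show ?thesis
    unfolding bessel_shift_def exp_add using assms by (simp add: exp_of_real uproj_def rcis_def)
qed

lemma deriv_shift: "deriv (\<lambda>t. g (t - a)) t = deriv g (t - a)" for g :: "complex \<Rightarrow> complex"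
  using DERIV_shift [of g _ t "- a"] by (simp add: deriv_def)

lemma tower_shift: "tower \<mu> (\<lambda>t. g (t - a)) k = (\<lambda>t. tower \<mu> g k (t - a))"
  by (induction k) (simp_all add: deriv_shift)

text \<open>The shift satisfies \<xi>^n (i n z)^n = (-1)^n e^(nt), so \<xi> disappears from the
  equation; the derivatives are unaffected by a translation.\<close>

lemma bessel_solution_iff_normal_solution:
  assumes "n \<ge> 1" "umod \<xi> = 1"
  shows "bessel_solution n lam (uproj \<xi> ^ n) w \<longleftrightarrow>
    normal_solution n (\<lambda>k. of_nat n * lam (Suc k)) (\<lambda>t. w (uexp (t - bessel_shift n \<xi>)))"
proof -
  define \<sigma> where "\<sigma> = bessel_shift n \<xi>"
  have hol: "uholomorphic w \<longleftrightarrow> (\<lambda>t. w (uexp (t - \<sigma>))) holomorphic_on UNIV"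
  proof
    assume "uholomorphic w"
    then have "((\<lambda>s. w (uexp s)) \<circ> (\<lambda>t. t - \<sigma>)) holomorphic_on UNIV"
      unfolding uholomorphic_def by (intro holomorphic_on_compose_gen [where t = UNIV] holomorphic_intros) auto
    then show "(\<lambda>t. w (uexp (t - \<sigma>))) holomorphic_on UNIV" by (simp add: o_def)
  next
    assume "(\<lambda>t. w (uexp (t - \<sigma>))) holomorphic_on UNIV"
    then have "((\<lambda>t. w (uexp (t - \<sigma>))) \<circ> (\<lambda>s. s + \<sigma>)) holomorphic_on UNIV"
      by (intro holomorphic_on_compose_gen [where t = UNIV] holomorphic_intros) auto
    then show "uholomorphic w" by (simp add: o_def uholomorphic_def)
  qed
  let ?W = "\<lambda>s. w (uexp s)" and ?\<mu> = "\<lambda>k. of_nat n * lam (Suc k)"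
  have eps: "uproj \<xi> ^ n * (\<i> * of_nat n) ^ n * exp (of_nat n * (t - \<sigma>)) = (-1) ^ n * exp (of_nat n * t)" for t
  proof -
    have "uproj \<xi> ^ n * (\<i> * of_nat n) ^ n = (- 1) ^ n * exp \<sigma> ^ n"
      unfolding \<sigma>_def exp_bessel_shift [OF assms] by (simp add: power_mult_distrib [symmetric] mult_ac)
    also have "exp \<sigma> ^ n = exp (of_nat n * \<sigma>)"
      by (rule exp_of_nat_mult [symmetric])
    finally show ?thesis
      by (simp add: mult_exp_exp right_diff_distrib)
  qed
  have "(\<forall>s. tower ?\<mu> ?W n s = uproj \<xi> ^ n * (\<i> * of_nat n) ^ n * exp (of_nat n * s) * ?W s)
      \<longleftrightarrow> (\<forall>t. tower ?\<mu> ?W n (t - \<sigma>) = uproj \<xi> ^ n * (\<i> * of_nat n) ^ n * exp (of_nat n * (t - \<sigma>)) * ?W (t - \<sigma>))"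
    (is "(\<forall>s. ?P s) \<longleftrightarrow> (\<forall>t. ?P (t - \<sigma>))")
  proof (intro iffI allI)
    fix s assume "\<forall>t. ?P (t - \<sigma>)"
    then have "?P ((s + \<sigma>) - \<sigma>)" by blast
    then show "?P s" by simp
  qed blast
  then show ?thesis
    unfolding bessel_solution_iff_tower normal_solution_def hol \<sigma>_def [symmetric]
    by (simp only: tower_shift [of _ "\<lambda>s. w (uexp s)"] eps)
qed

lemma bigo_sector_iff:
  "h \<in> O[inf (filtercomap umod at_top) (principal S)](g) \<longleftrightarrow>
    (\<exists>C R. \<forall>z\<in>S. umod z > R \<longrightarrow> norm (h z) \<le> C * norm (g z))"
proof
  assume "h \<in> O[inf (filtercomap umod at_top) (principal S)](g)"
  then obtain C where "C > 0" "\<forall>\<^sub>F z in inf (filtercomap umod at_top) (principal S). norm (h z) \<le> C * norm (g z)"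
    by (elim landau_o.bigE)
  then show "\<exists>C R. \<forall>z\<in>S. umod z > R \<longrightarrow> norm (h z) \<le> C * norm (g z)"
    by (auto simp: eventually_inf_principal eventually_filtercomap_at_top_linorder) (meson less_imp_le)
next
  assume "\<exists>C R. \<forall>z\<in>S. umod z > R \<longrightarrow> norm (h z) \<le> C * norm (g z)"
  then obtain C R where CR: "\<forall>z\<in>S. umod z > R \<longrightarrow> norm (h z) \<le> C * norm (g z)" by blast
  then have "\<forall>\<^sub>F z in inf (filtercomap umod at_top) (principal S). norm (h z) \<le> C * norm (g z)"
    unfolding eventually_inf_principal eventually_filtercomap_at_top_linorder
    by (intro exI [of _ "R + 1"]) auto
  then show "h \<in> O[inf (filtercomap umod at_top) (principal S)](g)"
    by (rule bigoI)
qed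

text \<open>With \<sigma> the shift, z^c is e^(ct) e^(-c \<sigma>), whence the constant in front of
  w; the powers of e^\<sigma> in \<open>B\<close> combine with those of z in the same way. The
  region |z| > R becomes a half-plane Re t > R'.\<close>

lemma has_asymptotic_expansion_iff:
  assumes n: "n \<ge> 1" and \<xi>: "umod \<xi> = 1" and B: "\<And>m. B m = b m / exp (bessel_shift n \<xi>) ^ m"
  shows "has_asymptotic_expansion w (\<i> * of_nat n * uproj \<xi>) c B (bessel_sector n \<xi>) \<longleftrightarrow>
    (\<forall>N. \<exists>C R. \<forall>t. Re t > R \<longrightarrow> \<bar>Im t\<bar> < pi / real n \<longrightarrow>
      norm (exp (c * bessel_shift n \<xi>) * w (uexp (t - bessel_shift n \<xi>)) / exp (c * t - exp t)
             - (\<Sum>m<N. b m * exp (- of_nat m * t))) \<le> C * exp (- real N * Re t))"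
proof -
  define \<sigma> where "\<sigma> = bessel_shift n \<xi>"
  have e\<sigma>: "exp \<sigma> = - (\<i> * of_nat n * uproj \<xi>)"
    unfolding \<sigma>_def using exp_bessel_shift [OF n \<xi>] .
  have nz: "uproj \<xi> \<noteq> 0" using \<xi> by (simp add: uproj_def rcis_def)
  have n\<sigma>: "Re \<sigma> = ln (real n)" "Im \<sigma> = uarg \<xi> - pi / 2"
    by (simp_all add: \<sigma>_def bessel_shift_def)
  define h where "h = (\<lambda>N z. w z / (exp (\<i> * of_nat n * uproj \<xi> * uproj z) * upowr z c) - (\<Sum>m<N. B m / uproj z ^ m))"
  define k where "k = (\<lambda>N t. exp (c * \<sigma>) * w (uexp (t - \<sigma>)) / exp (c * t - exp t) - (\<Sum>m<N. b m * exp (- of_nat m * t)))"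
  have hk: "h N (uexp (t - \<sigma>)) = k N t" for N t
  proof -
    have "\<i> * of_nat n * uproj \<xi> * exp (t - \<sigma>) = - exp t"
      using nz n e\<sigma> by (simp add: exp_diff)
    then have "exp (\<i> * of_nat n * uproj \<xi> * uproj (uexp (t - \<sigma>))) * upowr (uexp (t - \<sigma>)) c = exp (c * t - exp t) / exp (c * \<sigma>)"
      by (simp add: upowr_def exp_diff [symmetric] mult_exp_exp algebra_simps)
    moreover have "B m / uproj (uexp (t - \<sigma>)) ^ m = b m * exp (- of_nat m * t)" for m
    proof -
      have "B m / uproj (uexp (t - \<sigma>)) ^ m = b m / (exp \<sigma> * exp (t - \<sigma>)) ^ m"
        by (simp add: B \<sigma>_def power_mult_distrib)
      also have "exp \<sigma> * exp (t - \<sigma>) = exp t" by (simp add: mult_exp_exp)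
      finally show ?thesis by (simp add: exp_minus exp_of_nat_mult divide_inverse)
    qed
    ultimately show ?thesis by (simp add: h_def k_def mult.commute)
  qed
  have gN: "norm (1 / uproj (uexp (t - \<sigma>)) ^ N) = real n ^ N * exp (- real N * Re t)" for N t
  proof -
    have "norm (1 / uproj (uexp (t - \<sigma>)) ^ N) = 1 / exp (Re t - ln (real n)) ^ N"
      by (simp add: norm_divide norm_power norm_exp_eq_Re n\<sigma>)
    also have "exp (Re t - ln (real n)) = exp (Re t) / real n"
      using n by (simp add: exp_diff)
    moreover have "exp (- real N * Re t) = 1 / exp (Re t) ^ N"
      by (simp add: exp_minus exp_of_nat_mult divide_inverse)
    ultimately show ?thesis by (simp add: power_divide)
  qed
  have sec: "uexp (t - \<sigma>) \<in> bessel_sector n \<xi> \<longleftrightarrow> \<bar>Im t\<bar> < pi / real n" for t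
    by (simp add: bessel_sector_def n\<sigma>)
  have mod: "umod (uexp (t - \<sigma>)) > R \<longleftrightarrow> exp (Re t) > R * real n" for t R
    using n by (simp add: n\<sigma> exp_diff field_simps)
  have all: "(\<forall>z. P z) \<longleftrightarrow> (\<forall>t. P (uexp (t - \<sigma>)))" for P :: "ucover \<Rightarrow> bool"
  proof (intro iffI allI)
    fix z assume "\<forall>t. P (uexp (t - \<sigma>))"
    then have "P (uexp ((ulog z + \<sigma>) - \<sigma>))" by blast
    then show "P z" by simp
  qed blast
  have "(\<exists>C R. \<forall>z\<in>bessel_sector n \<xi>. umod z > R \<longrightarrow> norm (h N z) \<le> C * norm (1 / uproj z ^ N))
     \<longleftrightarrow> (\<exists>C R. \<forall>t. Re t > R \<longrightarrow> \<bar>Im t\<bar> < pi / real n \<longrightarrow> norm (k N t) \<le> C * exp (- real N * Re t))" for N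
  proof
    assume "\<exists>C R. \<forall>z\<in>bessel_sector n \<xi>. umod z > R \<longrightarrow> norm (h N z) \<le> C * norm (1 / uproj z ^ N)"
    then obtain C R where CR: "\<And>z. z \<in> bessel_sector n \<xi> \<Longrightarrow> umod z > R \<Longrightarrow> norm (h N z) \<le> C * norm (1 / uproj z ^ N)"
      by blast
    show "\<exists>C R. \<forall>t. Re t > R \<longrightarrow> \<bar>Im t\<bar> < pi / real n \<longrightarrow> norm (k N t) \<le> C * exp (- real N * Re t)"
    proof (intro exI allI impI)
      fix t assume t: "Re t > ln (max 1 (R * real n))" "\<bar>Im t\<bar> < pi / real n"
      then have "exp (ln (max 1 (R * real n))) < exp (Re t)" by (simp only: exp_less_cancel_iff)
      then have "exp (Re t) > R * real n" by (subst (asm) exp_ln) auto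
      then have "norm (h N (uexp (t - \<sigma>))) \<le> C * norm (1 / uproj (uexp (t - \<sigma>)) ^ N)"
        using t by (intro CR) (auto simp only: sec mod)
      then show "norm (k N t) \<le> (C * real n ^ N) * exp (- real N * Re t)"
        unfolding hk gN by (simp add: mult.assoc)
    qed
  next
    assume "\<exists>C R. \<forall>t. Re t > R \<longrightarrow> \<bar>Im t\<bar> < pi / real n \<longrightarrow> norm (k N t) \<le> C * exp (- real N * Re t)"
    then obtain C R where CR: "\<And>t. Re t > R \<Longrightarrow> \<bar>Im t\<bar> < pi / real n \<Longrightarrow> norm (k N t) \<le> C * exp (- real N * Re t)"
      by blast
    have "\<forall>z. z \<in> bessel_sector n \<xi> \<longrightarrow> umod z > exp R / real n \<longrightarrow> norm (h N z) \<le> (C / real n ^ N) * norm (1 / uproj z ^ N)"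
      unfolding all
    proof (intro allI impI)
      fix t assume "uexp (t - \<sigma>) \<in> bessel_sector n \<xi>" "umod (uexp (t - \<sigma>)) > exp R / real n"
      then have t: "\<bar>Im t\<bar> < pi / real n" "Re t > R" using n by (auto simp only: sec mod) simp
      from CR [OF t(2,1)] show "norm (h N (uexp (t - \<sigma>))) \<le> (C / real n ^ N) * norm (1 / uproj (uexp (t - \<sigma>)) ^ N)"
        unfolding hk gN using n by simp
    qed
    then show "\<exists>C R. \<forall>z\<in>bessel_sector n \<xi>. umod z > R \<longrightarrow> norm (h N z) \<le> C * norm (1 / uproj z ^ N)"
      by blast
  qed
  then show ?thesis
    unfolding has_asymptotic_expansion_def bigo_sector_iff h_def k_def \<sigma>_def by (simp only: simp_thms)
qed

text \<open>Existence and uniqueness of the formal series, which give the definite description its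
  value, both come from the fixed point of the ladder. The scaling is the passage from z to y, as
  e^\<sigma> = -\<alpha>.\<close>

lemma bessel_B_eq:
  assumes n: "n \<ge> 1" and \<xi>: "umod \<xi> = 1" and lam: "(\<Sum>k<n. of_nat n * lam (Suc k)) = 0"
    and b: "b 0 = 1" "ladder_coeff (\<lambda>k. bexp n + of_nat k + of_nat n * lam (Suc k)) b n = b"
  shows "bessel_B n lam \<xi> m = b m / exp (bessel_shift n \<xi>) ^ m"
proof -
  define \<alpha> where "\<alpha> = \<i> * of_nat n * uproj \<xi>"
  have \<alpha>: "\<alpha> \<noteq> 0" "exp (bessel_shift n \<xi>) = - \<alpha>"
    using n \<xi> exp_bessel_shift [OF n \<xi>] by (auto simp: \<alpha>_def uproj_def rcis_def)
  have eps: "uproj \<xi> ^ n * (\<i> * of_nat n) ^ n = \<alpha> ^ n"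
    by (simp add: \<alpha>_def power_mult_distrib mult_ac)
  define c where "c = Abs_fps (\<lambda>m. b m / (- \<alpha>) ^ m)"
  have "(THE c. fps_nth c 0 = 1 \<and> formal_bessel_solution n lam (uproj \<xi> ^ n) \<alpha> (bexp n) c) = c"
  proof (rule the_equality)
    have "(\<lambda>m. (- \<alpha>) ^ m * fps_nth c m) = b" using \<alpha> by (simp add: c_def)
    then show "fps_nth c 0 = 1 \<and> formal_bessel_solution n lam (uproj \<xi> ^ n) \<alpha> (bexp n) c"
      unfolding formal_bessel_solution_iff [OF n \<alpha>(1) eps] using b by (simp add: c_def)
  next
    fix c' assume c': "fps_nth c' 0 = 1 \<and> formal_bessel_solution n lam (uproj \<xi> ^ n) \<alpha> (bexp n) c'"
    then have L: "ladder_coeff (\<lambda>k. bexp n + of_nat k + of_nat n * lam (Suc k)) (\<lambda>m. (- \<alpha>) ^ m * fps_nth c' m) n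
        = (\<lambda>m. (- \<alpha>) ^ m * fps_nth c' m)"
      using formal_bessel_solution_iff [OF n \<alpha>(1) eps] by blast
    have "(\<lambda>m. (- \<alpha>) ^ m * fps_nth c' m) = b"
      by (rule ladder_coeff_fixpoint_unique [OF n sum_bexp [OF lam] L b(2)]) (simp add: b(1) c')
    then have "(- \<alpha>) ^ m * fps_nth c' m = b m" for m by (rule fun_cong)
    then show "c' = c" using \<alpha> by (intro fps_ext) (simp add: c_def field_simps)
  qed
  then show ?thesis
    unfolding bessel_B_def \<alpha>_def [symmetric] bexp_def [symmetric] by (simp add: c_def \<alpha>(2))
qed

text \<open>For n \<ge> 2 the sector |Im t| < pi / n lies in the half-strip on which f has its
  expansion. Two candidates have the same expansion, so their difference, divided by e^(ct - e^t),
  decays faster than any power of e^-t and vanishes by \<open>normal_solution_zero\<close>.\<close>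

lemma bessel_second_eq:
  assumes n: "n \<ge> 2" and \<xi>: "umod \<xi> = 1" and lam: "(\<Sum>k<n. of_nat n * lam (Suc k)) = 0"
    and b: "b 0 = 1" "ladder_coeff (\<lambda>k. bexp n + of_nat k + of_nat n * lam (Suc k)) b n = b"
    and f: "normal_solution n (\<lambda>k. of_nat n * lam (Suc k)) f"
    and asym: "\<And>N. \<exists>C. \<forall>t. Re t > 0 \<longrightarrow> \<bar>Im t\<bar> < pi / 2 \<longrightarrow>
        norm (f t / exp (bexp n * t - exp t) - (\<Sum>m<N. b m * exp (- of_nat m * t))) \<le> C * exp (- real N * Re t)"
  shows "bessel_second n z lam \<xi> = exp (- bexp n * bessel_shift n \<xi>) * f (ulog z + bessel_shift n \<xi>)"
proof -
  define \<sigma> where "\<sigma> = bessel_shift n \<xi>"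
  define c where "c = bexp n"
  have n1: "n \<ge> 1" using n by simp
  define w where "w = (\<lambda>z. exp (- c * \<sigma>) * f (ulog z + \<sigma>))"
  have scale: "normal_solution n \<mu> (\<lambda>t. u * g t)" if "normal_solution n \<mu> g" for u g \<mu>
  proof -
    have "g holomorphic_on UNIV" using that by (simp add: normal_solution_def)
    then have "tower \<mu> (\<lambda>t. u * g t) k = (\<lambda>t. u * tower \<mu> g k t)" for k
    proof (induction k)
      case (Suc k)
      have "deriv (\<lambda>t. u * tower \<mu> g k t) t = u * deriv (tower \<mu> g k) t" for t
        by (intro deriv_cmult holomorphic_on_imp_differentiable_at [OF tower_holomorphic [OF Suc.prems]]) auto
      then show ?case using Suc by (simp add: distrib_left mult_ac)
    qed simp
    with that show ?thesis
      by (auto simp: normal_solution_def intro!: holomorphic_intros)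
  qed
  have diff: "normal_solution n \<mu> (\<lambda>t. g t - h t)" if "normal_solution n \<mu> g" "normal_solution n \<mu> h" for g h \<mu>
  proof -
    have gh: "g holomorphic_on UNIV" "h holomorphic_on UNIV" using that by (simp_all add: normal_solution_def)
    have "tower \<mu> (\<lambda>t. g t - h t) k = (\<lambda>t. tower \<mu> g k t - tower \<mu> h k t)" for k
    proof (induction k)
      case (Suc k)
      have d: "deriv (\<lambda>t. tower \<mu> g k t - tower \<mu> h k t) t = deriv (tower \<mu> g k) t - deriv (tower \<mu> h k) t" for t
        by (intro deriv_diff holomorphic_on_imp_differentiable_at [OF tower_holomorphic] gh) auto
      show ?case unfolding tower.simps Suc d by (simp add: algebra_simps)
    qed simp
    with that show ?thesis
      by (auto simp: normal_solution_def algebra_simps intro!: holomorphic_intros)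
  qed
  have exp_iff: "has_asymptotic_expansion w (\<i> * of_nat n * uproj \<xi>) c (bessel_B n lam \<xi>) (bessel_sector n \<xi>) \<longleftrightarrow>
    (\<forall>N. \<exists>C R. \<forall>t. Re t > R \<longrightarrow> \<bar>Im t\<bar> < pi / real n \<longrightarrow>
      norm (exp (c * \<sigma>) * w (uexp (t - \<sigma>)) / exp (c * t - exp t)
             - (\<Sum>m<N. b m * exp (- of_nat m * t))) \<le> C * exp (- real N * Re t))" for w
    unfolding \<sigma>_def by (rule has_asymptotic_expansion_iff [OF n1 \<xi> bessel_B_eq [OF n1 \<xi> lam b]])
  have w: "bessel_solution n lam (uproj \<xi> ^ n) w \<and>
      has_asymptotic_expansion w (\<i> * of_nat n * uproj \<xi>) c (bessel_B n lam \<xi>) (bessel_sector n \<xi>)"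
  proof
    show "bessel_solution n lam (uproj \<xi> ^ n) w"
      unfolding bessel_solution_iff_normal_solution [OF n1 \<xi>] w_def \<sigma>_def
      using scale [OF f] by simp
    have "pi / real n \<le> pi / 2" using n by (intro divide_left_mono) auto
    then have "\<exists>C R. \<forall>t. Re t > R \<longrightarrow> \<bar>Im t\<bar> < pi / real n \<longrightarrow>
        norm (f t / exp (c * t - exp t) - (\<Sum>m<N. b m * exp (- of_nat m * t))) \<le> C * exp (- real N * Re t)" for N
      using asym [of N] unfolding c_def by (meson less_le_trans)
    moreover have "exp (c * \<sigma>) * w (uexp (t - \<sigma>)) = f t" for t
      by (simp add: w_def mult_exp_exp mult.assoc [symmetric])
    ultimately show "has_asymptotic_expansion w (\<i> * of_nat n * uproj \<xi>) c (bessel_B n lam \<xi>) (bessel_sector n \<xi>)"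
      unfolding exp_iff by simp
  qed
  have "(THE w. bessel_solution n lam (uproj \<xi> ^ n) w \<and>
      has_asymptotic_expansion w (\<i> * of_nat n * uproj \<xi>) c (bessel_B n lam \<xi>) (bessel_sector n \<xi>)) = w"
  proof (rule the_equality, rule w)
    fix v assume v: "bessel_solution n lam (uproj \<xi> ^ n) v \<and>
      has_asymptotic_expansion v (\<i> * of_nat n * uproj \<xi>) c (bessel_B n lam \<xi>) (bessel_sector n \<xi>)"
    define g where "g = (\<lambda>t. v (uexp (t - \<sigma>)) - w (uexp (t - \<sigma>)))"
    have gs: "normal_solution n (\<lambda>k. of_nat n * lam (Suc k)) g"
      unfolding g_def using v w by (intro diff) (simp_all add: bessel_solution_iff_normal_solution [OF n1 \<xi>] \<sigma>_def)
    have gd: "\<exists>C R. \<forall>t. Re t > R \<longrightarrow> \<bar>Im t\<bar> < pi / real n \<longrightarrow>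
        norm (g t / exp (bexp n * t - exp t)) \<le> C * exp (- real N * Re t)" for N
    proof -
      obtain C R where CR: "\<And>t. Re t > R \<Longrightarrow> \<bar>Im t\<bar> < pi / real n \<Longrightarrow>
        norm (exp (c * \<sigma>) * v (uexp (t - \<sigma>)) / exp (c * t - exp t) - (\<Sum>m<N. b m * exp (- of_nat m * t))) \<le> C * exp (- real N * Re t)"
        using v unfolding exp_iff by meson
      obtain C' R' where CR': "\<And>t. Re t > R' \<Longrightarrow> \<bar>Im t\<bar> < pi / real n \<Longrightarrow>
        norm (exp (c * \<sigma>) * w (uexp (t - \<sigma>)) / exp (c * t - exp t) - (\<Sum>m<N. b m * exp (- of_nat m * t))) \<le> C' * exp (- real N * Re t)"
        using w unfolding exp_iff by meson
      show ?thesis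
      proof (intro exI allI impI)
        fix t assume t: "Re t > max R R'" "\<bar>Im t\<bar> < pi / real n"
        have "norm ((exp (c * \<sigma>) * v (uexp (t - \<sigma>)) / exp (c * t - exp t) - (\<Sum>m<N. b m * exp (- of_nat m * t)))
          - (exp (c * \<sigma>) * w (uexp (t - \<sigma>)) / exp (c * t - exp t) - (\<Sum>m<N. b m * exp (- of_nat m * t))))
          \<le> C * exp (- real N * Re t) + C' * exp (- real N * Re t)"
          by (rule norm_triangle_le_diff, rule add_mono) (use CR CR' t in auto)
        also have "(exp (c * \<sigma>) * v (uexp (t - \<sigma>)) / exp (c * t - exp t) - (\<Sum>m<N. b m * exp (- of_nat m * t)))
          - (exp (c * \<sigma>) * w (uexp (t - \<sigma>)) / exp (c * t - exp t) - (\<Sum>m<N. b m * exp (- of_nat m * t)))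
          = exp (c * \<sigma>) * (g t / exp (bexp n * t - exp t))"
          by (simp add: g_def c_def diff_divide_distrib right_diff_distrib)
        finally have "norm (exp (c * \<sigma>)) * norm (g t / exp (bexp n * t - exp t)) \<le> (C + C') * exp (- real N * Re t)"
          by (simp only: norm_mult distrib_right)
        then show "norm (g t / exp (bexp n * t - exp t)) \<le> ((C + C') / norm (exp (c * \<sigma>))) * exp (- real N * Re t)"
          by (simp add: field_simps)
      qed
    qed
    have "g t = 0" for t
      by (rule normal_solution_zero [OF n1 gs _ gd]) (use n in simp)
    then have "g (ulog z + \<sigma>) = 0" for z .
    then show "v = w" by (auto simp: g_def)
  qed
  then show ?thesis
    unfolding bessel_second_def by (simp add: c_def \<sigma>_def w_def bexp_def)
qed

section \<open>Growth towards minus infinity and transforms over a half-line\<close>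

section \<open>Mellin transforms\<close>

text \<open>A crude bound for the entries of the companion matrix in Re t \<le> 0, times n.
  Solutions grow at most like exp (-A Re t) with this A as Re t decreases, so transforms over a left
  half-line exist for Re s > A.\<close>

definition growth_exp :: "nat \<Rightarrow> (nat \<Rightarrow> complex) \<Rightarrow> complex \<Rightarrow> real" where
  "growth_exp n \<mu> \<kappa> = real n * ((\<Sum>k<n. norm (\<mu> k)) + 1 + norm \<kappa>)"

lemma growth_exp_nonneg: "growth_exp n \<mu> \<kappa> \<ge> 0"
  by (simp add: growth_exp_def sum_nonneg add_nonneg_nonneg)

lemma growth_exp_ge: "k < n \<Longrightarrow> norm (\<mu> k) \<le> growth_exp n \<mu> \<kappa>"
proof -
  assume k: "k < n"
  have "norm (\<mu> k) \<le> (\<Sum>k<n. norm (\<mu> k))"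
    using k by (intro member_le_sum) auto
  then have "norm (\<mu> k) \<le> 1 * ((\<Sum>k<n. norm (\<mu> k)) + 1 + norm \<kappa>)"
    by (simp add: add_increasing2)
  also have "\<dots> \<le> real n * ((\<Sum>k<n. norm (\<mu> k)) + 1 + norm \<kappa>)"
    using k by (intro mult_right_mono) (auto intro!: add_nonneg_nonneg sum_nonneg)
  finally show ?thesis by (simp add: growth_exp_def)
qed

lemma has_real_derivative_norm_square:
  assumes "(g has_vector_derivative g') (at x)"
  shows "((\<lambda>x. (norm (g x :: complex))\<^sup>2) has_real_derivative 2 * Re (cnj (g x) * g')) (at x)"
proof -
  have "((\<lambda>x. Re (g x)) has_real_derivative Re g') (at x)" "((\<lambda>x. Im (g x)) has_real_derivative Im g') (at x)"
    using assms bounded_linear.has_vector_derivative [OF bounded_linear_Re]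
      bounded_linear.has_vector_derivative [OF bounded_linear_Im]
    by (auto simp: has_real_derivative_iff_has_vector_derivative)
  then have "((\<lambda>x. (Re (g x))\<^sup>2 + (Im (g x))\<^sup>2) has_real_derivative
      of_nat 2 * (Re g' * Re (g x) ^ (2 - Suc 0)) + of_nat 2 * (Im g' * Im (g x) ^ (2 - Suc 0))) (at x)"
    by (intro DERIV_add DERIV_power)
  then show ?thesis by (simp add: cmod_power2 algebra_simps)
qed

text \<open>Energy estimate: let S be the sum of the |F k|^2 on a horizontal line. For x \<le> 0 one
  has S' \<ge> -2 A S, so exp (2 A x) S is nondecreasing and bounded by its value at x = 0, which
  compactness controls for |Im t| \<le> \<alpha>. The factor n in A comes from
  Cauchy-Schwarz.\<close>

lemma tower_system_growth:
  assumes F: "tower_system n \<mu> \<kappa> UNIV F"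
  shows "\<exists>C. \<forall>k<n. \<forall>t. Re t \<le> 0 \<longrightarrow> \<bar>Im t\<bar> \<le> \<alpha> \<longrightarrow>
     norm (F k t) \<le> C * exp (- growth_exp n \<mu> \<kappa> * Re t)"
proof -
  define B where "B = (\<Sum>k<n. norm (\<mu> k)) + 1 + norm \<kappa>"
  define A where "A = growth_exp n \<mu> \<kappa>"
  have AB: "A = real n * B" by (simp add: A_def B_def growth_exp_def)
  have F': "(F k has_field_derivative (\<Sum>j<n. companion n \<mu> \<kappa> k j t * F j t)) (at t)" if "k < n" for k t
    using tower_system_imp_linear_system [OF F] that by (simp add: linear_system_def)
  have cb: "norm (companion n \<mu> \<kappa> k j t) \<le> B" if "k < n" "Re t \<le> 0" for k j t
  proof -
    have "norm (\<mu> k) \<le> (\<Sum>k<n. norm (\<mu> k))" using that by (intro member_le_sum) auto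
    then have 1: "norm (if j = k then - \<mu> k else 0) \<le> (\<Sum>k<n. norm (\<mu> k))"
      by (auto simp: sum_nonneg)
    have "norm (exp (of_nat n * t)) \<le> 1"
      using that by (simp add: norm_exp_eq_Re mult_nonneg_nonpos)
    then have 3: "norm (if Suc k = n \<and> j = 0 then \<kappa> * exp (of_nat n * t) else 0) \<le> norm \<kappa>"
      by (simp add: norm_mult mult_left_le)
    have 2: "norm (if j = Suc k then 1 else 0 :: complex) \<le> 1" by simp
    show ?thesis
      unfolding companion_def B_def by (intro norm_triangle_mono 1 2 3)
  qed
  define S where "S = (\<lambda>y x. \<Sum>k<n. (norm (F k (of_real x + \<i> * of_real y)))\<^sup>2)"
  define S' where "S' = (\<lambda>y x. \<Sum>k<n. 2 * Re (cnj (F k (of_real x + \<i> * of_real y)) * (\<Sum>j<n. companion n \<mu> \<kappa> k j (of_real x + \<i> * of_real y) * F j (of_real x + \<i> * of_real y))))"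
  have S': "(S y has_real_derivative S' y x) (at x)" for x y
    unfolding S_def S'_def
  proof (intro DERIV_sum has_real_derivative_norm_square)
    fix k assume "k \<in> {..<n}"
    then have "((\<lambda>x. F k (\<i> * of_real y + of_real x * 1)) has_vector_derivative
        (\<Sum>j<n. companion n \<mu> \<kappa> k j (\<i> * of_real y + of_real x * 1) * F j (\<i> * of_real y + of_real x * 1)) * 1) (at x)"
      by (intro has_vector_derivative_segment F') auto
    then show "((\<lambda>x. F k (of_real x + \<i> * of_real y)) has_vector_derivative
        (\<Sum>j<n. companion n \<mu> \<kappa> k j (of_real x + \<i> * of_real y) * F j (of_real x + \<i> * of_real y))) (at x)"
      by (simp add: add.commute)
  qed
  have S'_ge: "- (2 * A * S y x) \<le> S' y x" if "x \<le> 0" for x y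
  proof -
    define G where "G = (\<lambda>k. F k (of_real x + \<i> * of_real y))"
    define N where "N = (\<Sum>k<n. norm (G k))"
    have "\<bar>2 * Re (cnj (G k) * (\<Sum>j<n. companion n \<mu> \<kappa> k j (of_real x + \<i> * of_real y) * G j))\<bar> \<le> 2 * (norm (G k) * (B * N))" if k: "k < n" for k
    proof -
      have "norm (\<Sum>j<n. companion n \<mu> \<kappa> k j (of_real x + \<i> * of_real y) * G j) \<le> (\<Sum>j<n. B * norm (G j))"
        using cb [OF k] \<open>x \<le> 0\<close> by (intro sum_norm_le) (auto simp: norm_mult intro!: mult_right_mono)
      also have "\<dots> = B * N" by (simp add: N_def sum_distrib_left)
      finally have "norm (cnj (G k) * (\<Sum>j<n. companion n \<mu> \<kappa> k j (of_real x + \<i> * of_real y) * G j)) \<le> norm (G k) * (B * N)"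
        unfolding norm_mult complex_mod_cnj by (rule mult_left_mono) simp
      from order_trans [OF abs_Re_le_cmod this] show ?thesis
        unfolding abs_mult abs_numeral by (rule mult_left_mono) simp
    qed
    then have "\<bar>S' y x\<bar> \<le> (\<Sum>k<n. 2 * (norm (G k) * (B * N)))"
      unfolding S'_def G_def by (intro order_trans [OF sum_abs] sum_mono) auto
    also have "\<dots> = 2 * B * N\<^sup>2"
      by (simp add: N_def sum_distrib_left [symmetric] sum_distrib_right [symmetric] power2_eq_square)
    also have "N\<^sup>2 \<le> real n * S y x"
      using sum_squared_le_sum_of_squares [of "\<lambda>k. norm (G k)" "{..<n}"]
      by (simp add: N_def S_def G_def mult.commute)
    then have "2 * B * N\<^sup>2 \<le> 2 * B * (real n * S y x)"
      by (intro mult_left_mono) (auto simp: B_def intro!: add_nonneg_nonneg sum_nonneg)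
    finally show ?thesis by (simp add: AB mult_ac)
  qed
  have mono: "exp (2 * A * x) * S y x \<le> S y 0" if "x \<le> 0" for x y
  proof -
    have "exp (2 * A * x) * S y x \<le> exp (2 * A * 0) * S y 0"
    proof (rule DERIV_nonneg_imp_nondecreasing [OF that])
      fix u assume u: "x \<le> u" "u \<le> 0"
      have "((\<lambda>x. exp (2 * A * x) * S y x) has_real_derivative
          exp (2 * A * u) * (2 * A) * S y u + S' y u * exp (2 * A * u)) (at u)"
        by (intro DERIV_mult S') (auto intro!: derivative_eq_intros)
      moreover have "exp (2 * A * u) * (2 * A) * S y u + S' y u * exp (2 * A * u) = exp (2 * A * u) * (S' y u + 2 * A * S y u)"
        by (simp add: algebra_simps)
      moreover have "\<dots> \<ge> 0" using S'_ge [OF u(2), of y] by (intro mult_nonneg_nonneg) auto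
      ultimately show "\<exists>z. ((\<lambda>x. exp (2 * A * x) * S y x) has_real_derivative z) (at u) \<and> 0 \<le> z" by metis
    qed
    then show ?thesis by simp
  qed
  have "\<exists>D. \<forall>y\<in>{-\<alpha>..\<alpha>}. S y 0 \<le> D"
  proof -
    have cF: "continuous_on UNIV (F k)" if "k < n" for k
      using DERIV_isCont [OF F' [OF that]] by (intro continuous_at_imp_continuous_on) blast
    have "continuous_on {-\<alpha>..\<alpha>} (\<lambda>y. norm (F k (of_real 0 + \<i> * of_real y)))" if "k < n" for k
      by (intro continuous_on_norm continuous_on_compose2 [OF cF [OF that]] continuous_intros) auto
    then have "continuous_on {-\<alpha>..\<alpha>} (\<lambda>y. S y 0)"
      unfolding S_def by (intro continuous_on_sum continuous_on_power) auto
    then have "compact ((\<lambda>y. S y 0) ` {-\<alpha>..\<alpha>})"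
      by (intro compact_continuous_image) auto
    then have "bounded ((\<lambda>y. S y 0) ` {-\<alpha>..\<alpha>})" by (rule compact_imp_bounded)
    then obtain D where "\<forall>y\<in>{-\<alpha>..\<alpha>}. \<bar>S y 0\<bar> \<le> D"
      by (auto simp: bounded_iff)
    then have "S y 0 \<le> D" if "y \<in> {-\<alpha>..\<alpha>}" for y
      using that abs_ge_self [of "S y 0"] by fastforce
    then show ?thesis by blast
  qed
  then obtain D where D: "\<And>y. \<bar>y\<bar> \<le> \<alpha> \<Longrightarrow> S y 0 \<le> D" by fastforce
  show ?thesis
  proof (intro exI allI impI)
    fix k t assume k: "k < n" and t: "Re t \<le> 0" "\<bar>Im t\<bar> \<le> \<alpha>"
    have t_eq: "t = of_real (Re t) + \<i> * of_real (Im t)" by (rule complex_eq)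
    have "(norm (F k t))\<^sup>2 \<le> S (Im t) (Re t)"
      unfolding S_def t_eq [symmetric] using k by (intro member_le_sum) auto
    then have "exp (2 * A * Re t) * (norm (F k t))\<^sup>2 \<le> exp (2 * A * Re t) * S (Im t) (Re t)"
      by (intro mult_left_mono) auto
    also have "\<dots> \<le> D" using mono [OF t(1)] D [OF t(2)] order_trans by blast
    also have "exp (2 * A * Re t) * (norm (F k t))\<^sup>2 = (exp (A * Re t) * norm (F k t))\<^sup>2"
      by (simp add: power_mult_distrib exp_double [symmetric] mult.assoc)
    finally have "exp (A * Re t) * norm (F k t) \<le> sqrt D" by (rule real_le_rsqrt)
    then show "norm (F k t) \<le> sqrt D * exp (- growth_exp n \<mu> \<kappa> * Re t)"
      by (simp add: A_def exp_minus field_simps)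
  qed
qed

text \<open>\<open>P\<close> is the primitive \<open>P(t) = \<integral>\<^bsub>-\<infinity>\<^esub>\<^bsup>t\<^esup> g(u) e\<^bsup>su\<^esup> du\<close>; its value at \<open>0\<close> is the Mellin
  transform over the unit interval.\<close>

definition left_primitive :: "(complex \<Rightarrow> complex) \<Rightarrow> complex \<Rightarrow> (complex \<Rightarrow> complex) \<Rightarrow> bool" where
  "left_primitive g s P \<longleftrightarrow> (\<forall>t. (P has_field_derivative g t * exp (s * t)) (at t)) \<and>
     (\<forall>y. ((\<lambda>x. P (of_real x + \<i> * of_real y)) \<longlongrightarrow> 0) at_bot)"

lemma left_primitive_unique:
  assumes "left_primitive g s P" "left_primitive g s Q"
  shows "P = Q"
proof -
  have "((\<lambda>t. P t - Q t) has_field_derivative 0) (at t within UNIV)" for t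
    using assms DERIV_diff [of P _ t UNIV Q] unfolding left_primitive_def by fastforce
  then obtain c where c: "\<And>t. P t - Q t = c"
    using has_field_derivative_zero_constant [of UNIV "\<lambda>t. P t - Q t"] by (metis UNIV_I convex_UNIV)
  have "((\<lambda>x. P (of_real x + \<i> * of_real 0) - Q (of_real x + \<i> * of_real 0)) \<longlongrightarrow> 0 - 0) at_bot"
    using assms unfolding left_primitive_def by (intro tendsto_diff) blast+
  then have "((\<lambda>x::real. c) \<longlongrightarrow> 0) at_bot" by (simp add: c)
  then have "c = 0" using tendsto_const_iff trivial_limit_at_bot_linorder by blast
  then show ?thesis using c by (simp add: fun_eq_iff)
qed

lemma horizontal_bound:
  assumes D: "\<And>t. (Q has_field_derivative h t) (at t)"
    and h: "\<And>x. x \<le> Re t \<Longrightarrow> norm (h (of_real x + \<i> * of_real (Im t))) \<le> C * exp (\<eta> * x)"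
    and \<eta>: "\<eta> > 0" and C: "C \<ge> 0" and x: "x < Re t"
  shows "norm (Q t - Q (of_real x + \<i> * of_real (Im t))) \<le> C / \<eta> * exp (\<eta> * Re t)"
proof -
  define q where "q = (\<lambda>u. Q (\<i> * of_real (Im t) + of_real u * 1))"
  define \<phi> where "\<phi> = (\<lambda>u. C / \<eta> * exp (\<eta> * u))"
  have q': "(q has_vector_derivative h (\<i> * of_real (Im t) + of_real u * 1) * 1) (at u)" for u
    unfolding q_def by (intro has_vector_derivative_segment D)
  have \<phi>': "(\<phi> has_vector_derivative C * exp (\<eta> * u)) (at u)" for u
    unfolding \<phi>_def has_real_derivative_iff_has_vector_derivative [symmetric]
    using \<eta> by (auto intro!: derivative_eq_intros)
  have cont: "isCont q u" "isCont \<phi> u" for u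
    using q' \<phi>' has_vector_derivative_continuous by blast+
  have "norm (q (Re t) - q x) \<le> \<phi> (Re t) - \<phi> x"
  proof (rule differentiable_bound_general [OF x _ _ q' \<phi>'])
    show "continuous_on {x..Re t} q" "continuous_on {x..Re t} \<phi>"
      using cont by (auto intro!: continuous_at_imp_continuous_on)
    fix u assume "x < u" "u < Re t"
    then show "norm (h (\<i> * of_real (Im t) + of_real u * 1) * 1) \<le> C * exp (\<eta> * u)"
      using h [of u] by (simp add: add.commute)
  qed
  also have "\<dots> \<le> C / \<eta> * exp (\<eta> * Re t)" using C \<eta> by (simp add: \<phi>_def)
  also have "q (Re t) = Q t" using complex_eq [of t] by (simp add: q_def add.commute)
  finally show ?thesis by (simp add: q_def add.commute)
qed

text \<open>An entire primitive has a limit to the left on every horizontal line. Vertical segments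
  far to the left contribute exponentially little, so the limit is the same on all lines and one
  constant can be subtracted.\<close>

lemma left_primitive_exists:
  assumes g: "g holomorphic_on UNIV"
    and growth: "\<And>\<alpha>. \<exists>C. \<forall>t. Re t \<le> 0 \<longrightarrow> \<bar>Im t\<bar> \<le> \<alpha> \<longrightarrow> norm (g t) \<le> C * exp (- A * Re t)"
    and s: "Re s > A"
  shows "\<exists>P. left_primitive g s P"
proof -
  define h where "h = (\<lambda>t. g t * exp (s * t))"
  define \<eta> where "\<eta> = Re s - A"
  have \<eta>: "\<eta> > 0" using s by (simp add: \<eta>_def)
  have "h holomorphic_on UNIV" unfolding h_def using g by (intro holomorphic_intros)
  then obtain Q where Q: "\<And>t. (Q has_field_derivative h t) (at t)"
    using holomorphic_convex_primitive' [OF convex_UNIV open_UNIV] by auto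
  have hb: "\<exists>C\<ge>0. \<forall>t. Re t \<le> 0 \<longrightarrow> \<bar>Im t\<bar> \<le> \<alpha> \<longrightarrow> norm (h t) \<le> C * exp (\<eta> * Re t)" for \<alpha>
  proof -
    obtain C where C: "\<And>t. Re t \<le> 0 \<Longrightarrow> \<bar>Im t\<bar> \<le> \<alpha> \<Longrightarrow> norm (g t) \<le> C * exp (- A * Re t)"
      using growth by blast
    show ?thesis
    proof (intro exI [of _ "\<bar>C\<bar> * exp (\<bar>Im s\<bar> * \<bar>\<alpha>\<bar>)"] conjI allI impI)
      fix t assume t: "Re t \<le> 0" "\<bar>Im t\<bar> \<le> \<alpha>"
      have "- (Im s * Im t) \<le> \<bar>Im s\<bar> * \<bar>Im t\<bar>" by (metis abs_ge_minus_self abs_mult)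
      also have "\<dots> \<le> \<bar>Im s\<bar> * \<bar>\<alpha>\<bar>" using t by (intro mult_left_mono) auto
      finally have e: "exp (Re s * Re t - Im s * Im t) \<le> exp (Re s * Re t) * exp (\<bar>Im s\<bar> * \<bar>\<alpha>\<bar>)"
        by (simp add: mult_exp_exp)
      have "C * exp (- A * Re t) \<le> \<bar>C\<bar> * exp (- A * Re t)" by (intro mult_right_mono) auto
      then have "norm (g t) \<le> \<bar>C\<bar> * exp (- A * Re t)" using C [OF t] by linarith
      then have "norm (h t) \<le> (\<bar>C\<bar> * exp (- A * Re t)) * (exp (Re s * Re t) * exp (\<bar>Im s\<bar> * \<bar>\<alpha>\<bar>))"
        unfolding h_def norm_mult norm_exp_eq_Re using e by (intro mult_mono) auto
      also have "\<dots> = \<bar>C\<bar> * exp (\<bar>Im s\<bar> * \<bar>\<alpha>\<bar>) * (exp (- A * Re t) * exp (Re s * Re t))" by simp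
      also have "exp (- A * Re t) * exp (Re s * Re t) = exp (\<eta> * Re t)"
        by (simp add: mult_exp_exp \<eta>_def algebra_simps)
      finally show "norm (h t) \<le> \<bar>C\<bar> * exp (\<bar>Im s\<bar> * \<bar>\<alpha>\<bar>) * exp (\<eta> * Re t)" .
    qed simp
  qed
  have lim0: "((\<lambda>x. C * exp (\<eta> * x)) \<longlongrightarrow> 0) at_bot" for C
  proof -
    have "filterlim (\<lambda>x. \<eta> * x) at_bot at_bot"
      using \<eta> by (intro filterlim_tendsto_pos_mult_at_bot [OF tendsto_const]) (auto simp: filterlim_ident)
    then have "((\<lambda>x. exp (\<eta> * x)) \<longlongrightarrow> 0) at_bot"
      by (rule filterlim_compose [OF exp_at_bot])
    then show ?thesis by (rule tendsto_mult_right_zero)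
  qed
  have line: "\<exists>l. ((\<lambda>x. Q (of_real x + \<i> * of_real y)) \<longlongrightarrow> l) at_bot" for y
  proof -
    obtain C where C: "C \<ge> 0" "\<And>t. Re t \<le> 0 \<Longrightarrow> \<bar>Im t\<bar> \<le> \<bar>y\<bar> \<Longrightarrow> norm (h t) \<le> C * exp (\<eta> * Re t)"
      using hb by blast
    have diff: "norm (Q (of_real x + \<i> * of_real y) - Q (of_real x' + \<i> * of_real y)) \<le> C / \<eta> * exp (\<eta> * x)"
      if "x \<le> 0" "x' < x" for x x'
    proof -
      have "norm (h (of_real u + \<i> * of_real y)) \<le> C * exp (\<eta> * u)" if "u \<le> x" for u
        using C(2) [of "of_real u + \<i> * of_real y"] that \<open>x \<le> 0\<close> by simp
      then show ?thesis
        using horizontal_bound [OF Q _ \<eta> C(1), of "of_real x + \<i> * of_real y" x'] that by simp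
    qed
    have "Cauchy (\<lambda>k. Q (of_real (- real k) + \<i> * of_real y))"
    proof (rule CauchyI')
      fix e :: real assume e: "e > 0"
      have "((\<lambda>k. C / \<eta> * exp (\<eta> * - real k)) \<longlonglongrightarrow> 0)"
        by (rule filterlim_compose [OF lim0]) (simp add: filterlim_uminus_at_bot_at_top filterlim_compose [OF filterlim_uminus_at_bot_at_top filterlim_real_sequentially])
      then have "\<forall>\<^sub>F k in sequentially. C / \<eta> * exp (\<eta> * - real k) < e"
        using e by (rule order_tendstoD)
      then obtain k0 where k0: "\<And>k. k \<ge> k0 \<Longrightarrow> C / \<eta> * exp (\<eta> * - real k) < e"
        by (auto simp: eventually_sequentially)
      have "norm (Q (of_real (- real m) + \<i> * of_real y) - Q (of_real (- real k) + \<i> * of_real y)) < e" if "m \<ge> k0" "k > m" for m k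
        using diff [of "- real m" "- real k"] k0 [OF that(1)] that by simp
      then show "\<exists>M. \<forall>m\<ge>M. \<forall>k>m. dist (Q (of_real (- real m) + \<i> * of_real y)) (Q (of_real (- real k) + \<i> * of_real y)) < e"
        unfolding dist_norm by blast
    qed
    then obtain l where l: "(\<lambda>k. Q (of_real (- real k) + \<i> * of_real y)) \<longlonglongrightarrow> l"
      by (auto simp: Cauchy_convergent_iff convergent_def)
    have near: "norm (Q (of_real x + \<i> * of_real y) - l) \<le> C / \<eta> * exp (\<eta> * x)" if "x \<le> 0" for x
    proof (rule Lim_norm_ubound [of sequentially])
      show "(\<lambda>k. Q (of_real x + \<i> * of_real y) - Q (of_real (- real k) + \<i> * of_real y)) \<longlonglongrightarrow> Q (of_real x + \<i> * of_real y) - l"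
        by (intro tendsto_diff tendsto_const l)
      obtain k0 :: nat where "- x < real k0" using reals_Archimedean2 by blast
      then have "norm (Q (of_real x + \<i> * of_real y) - Q (of_real (- real k) + \<i> * of_real y)) \<le> C / \<eta> * exp (\<eta> * x)" if "k \<ge> k0" for k
        using that \<open>x \<le> 0\<close> by (intro diff) auto
      then show "\<forall>\<^sub>F k in sequentially. norm (Q (of_real x + \<i> * of_real y) - Q (of_real (- real k) + \<i> * of_real y)) \<le> C / \<eta> * exp (\<eta> * x)"
        by (auto simp: eventually_sequentially)
    qed simp
    have "\<forall>\<^sub>F x in at_bot. norm (Q (of_real x + \<i> * of_real y) - l) \<le> C / \<eta> * exp (\<eta> * x)"
      unfolding eventually_at_bot_linorder using near by blast
    then have "((\<lambda>x. Q (of_real x + \<i> * of_real y) - l) \<longlongrightarrow> 0) at_bot"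
      by (rule Lim_null_comparison [OF _ lim0])
    then show ?thesis using Lim_null by blast
  qed
  then obtain l where l: "\<And>y. ((\<lambda>x. Q (of_real x + \<i> * of_real y)) \<longlongrightarrow> l y) at_bot" by metis
  have "l y = l 0" for y
  proof -
    obtain C where C: "C \<ge> 0" "\<And>t. Re t \<le> 0 \<Longrightarrow> \<bar>Im t\<bar> \<le> \<bar>y\<bar> \<Longrightarrow> norm (h t) \<le> C * exp (\<eta> * Re t)"
      using hb by blast
    have "norm (Q (of_real x + \<i> * of_real y) - Q (of_real x + \<i> * of_real 0)) \<le> C * \<bar>y\<bar> * exp (\<eta> * x)" if "x \<le> 0" for x
    proof -
      have "norm (Q (of_real x + \<i> * of_real y) - Q (of_real x + \<i> * of_real 0))
          \<le> (C * exp (\<eta> * x)) * norm ((of_real x + \<i> * of_real y) - (of_real x + \<i> * of_real 0))"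
      proof (rule field_differentiable_bound [where S = "closed_segment (of_real x + \<i> * of_real 0) (of_real x + \<i> * of_real y)" and f' = h])
        fix z assume z: "z \<in> closed_segment (of_real x + \<i> * of_real 0) (of_real x + \<i> * of_real y)"
        show "(Q has_field_derivative h z) (at z within closed_segment (of_real x + \<i> * of_real 0) (of_real x + \<i> * of_real y))"
          using Q has_field_derivative_at_within by blast
        from z obtain u where u: "0 \<le> u" "u \<le> 1" "z = of_real x + \<i> * of_real (u * y)"
          unfolding closed_segment_def by (auto simp: scaleR_conv_of_real algebra_simps)
        have "\<bar>u * y\<bar> \<le> 1 * \<bar>y\<bar>" unfolding abs_mult using u by (intro mult_right_mono) auto
        then show "norm (h z) \<le> C * exp (\<eta> * x)"
          using C(2) [of z] u that by simp
      qed auto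
      then show ?thesis by (simp add: norm_mult mult_ac)
    qed
    then have "\<forall>\<^sub>F x in at_bot. norm (Q (of_real x + \<i> * of_real y) - Q (of_real x + \<i> * of_real 0)) \<le> C * \<bar>y\<bar> * exp (\<eta> * x)"
      unfolding eventually_at_bot_linorder by blast
    then have "((\<lambda>x. Q (of_real x + \<i> * of_real y) - Q (of_real x + \<i> * of_real 0)) \<longlongrightarrow> 0) at_bot"
      by (rule Lim_null_comparison [OF _ lim0])
    then have "l y - l 0 = 0"
      using tendsto_diff [OF l [of y] l [of 0]] tendsto_unique trivial_limit_at_bot_linorder by blast
    then show ?thesis by simp
  qed
  then have "((\<lambda>x. Q (of_real x + \<i> * of_real y) - l 0) \<longlongrightarrow> 0) at_bot" for y
    using l [of y] Lim_null by metis
  moreover have "((\<lambda>t. Q t - l 0) has_field_derivative h t) (at t)" for t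
    using DERIV_diff [OF Q [of t] DERIV_const, of "l 0"] by simp
  ultimately show ?thesis
    by (intro exI [of _ "\<lambda>t. Q t - l 0"]) (simp add: left_primitive_def h_def)
qed

text \<open>The decay of this bound as Re s grows is what finally forces constants to be 0 in the
  vanishing argument.\<close>

lemma left_primitive_bound:
  assumes P: "left_primitive g s P"
    and g: "\<And>x. x \<le> 0 \<Longrightarrow> norm (g (of_real x)) \<le> C * exp (- A * x)" and s: "Re s > A" and C: "C \<ge> 0"
  shows "norm (P 0) \<le> C / (Re s - A)"
proof (rule Lim_norm_ubound [of at_bot])
  have D: "(P has_field_derivative g t * exp (s * t)) (at t)" for t
    using P by (simp add: left_primitive_def)
  have "((\<lambda>x. P 0 - P (of_real x + \<i> * of_real 0)) \<longlongrightarrow> P 0 - 0) at_bot"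
    using P unfolding left_primitive_def by (intro tendsto_diff tendsto_const) blast
  then show "((\<lambda>x. P 0 - P (of_real x)) \<longlongrightarrow> P 0) at_bot" by simp
  have "norm (P 0 - P (of_real x)) \<le> C / (Re s - A)" if "x < 0" for x
  proof -
    have "norm (P 0 - P (of_real x + \<i> * of_real (Im 0))) \<le> C / (Re s - A) * exp ((Re s - A) * Re 0)"
    proof (rule horizontal_bound [OF D])
      fix u :: real assume "u \<le> Re 0"
      then have "norm (g (of_real u)) * exp (Re s * u) \<le> C * exp (- A * u) * exp (Re s * u)"
        using g [of u] by (intro mult_right_mono) auto
      also have "\<dots> = C * exp ((Re s - A) * u)" by (simp add: mult.assoc mult_exp_exp algebra_simps)
      finally show "norm (g (of_real u + \<i> * of_real (Im 0)) * exp (s * (of_real u + \<i> * of_real (Im 0)))) \<le> C * exp ((Re s - A) * u)"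
        by (simp add: norm_mult norm_exp_eq_Re)
    qed (use s C that in auto)
    then show ?thesis by simp
  qed
  then show "\<forall>\<^sub>F x in at_bot. norm (P 0 - P (of_real x)) \<le> C / (Re s - A)"
    by (intro eventually_mono [OF eventually_at_bot_dense [THEN iffD2]]) auto
qed simp

text \<open>Translation by i \<alpha> multiplies the primitive by exp (-i \<alpha> s), but its value
  at 0 then comes from the old primitive at i \<alpha>. The discrepancy is an integral over a
  segment, made up for later.\<close>

lemma left_primitive_shift:
  assumes "left_primitive g s P"
  shows "left_primitive (\<lambda>t. g (t + \<i> * of_real \<alpha>)) s (\<lambda>t. exp (- s * (\<i> * of_real \<alpha>)) * P (t + \<i> * of_real \<alpha>))"
  unfolding left_primitive_def
proof (intro conjI allI)
  fix t
  have "((\<lambda>t. P (t + \<i> * of_real \<alpha>)) has_field_derivative g (t + \<i> * of_real \<alpha>) * exp (s * (t + \<i> * of_real \<alpha>))) (at t)"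
    using assms by (simp add: left_primitive_def DERIV_shift [symmetric])
  then have "((\<lambda>t. exp (- s * (\<i> * of_real \<alpha>)) * P (t + \<i> * of_real \<alpha>)) has_field_derivative
      exp (- s * (\<i> * of_real \<alpha>)) * (g (t + \<i> * of_real \<alpha>) * exp (s * (t + \<i> * of_real \<alpha>)))) (at t)"
    by (rule DERIV_cmult)
  moreover have "exp (- s * (\<i> * of_real \<alpha>)) * exp (s * (t + \<i> * of_real \<alpha>)) = exp (s * t)"
    by (simp add: mult_exp_exp algebra_simps)
  ultimately show "((\<lambda>t. exp (- s * (\<i> * of_real \<alpha>)) * P (t + \<i> * of_real \<alpha>)) has_field_derivative
      g (t + \<i> * of_real \<alpha>) * exp (s * t)) (at t)"
    by (metis mult.left_commute)
next
  fix y
  have "((\<lambda>x. P (of_real x + \<i> * of_real (y + \<alpha>))) \<longlongrightarrow> 0) at_bot"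
    using assms unfolding left_primitive_def by blast
  from tendsto_mult_right_zero [OF this, of "exp (- s * (\<i> * of_real \<alpha>))"]
  show "((\<lambda>x. exp (- s * (\<i> * of_real \<alpha>)) * P (of_real x + \<i> * of_real y + \<i> * of_real \<alpha>)) \<longlongrightarrow> 0) at_bot"
    by (simp add: distrib_left add.assoc)
qed

text \<open>Integration by parts. The term F k e^(st) vanishes to the left because Re s exceeds the
  growth exponent, but it survives at the right end.\<close>

lemma left_primitive_tower_Suc:
  assumes F: "tower_system n \<mu> \<kappa> UNIV F" and k: "k < n" and P: "left_primitive (F k) s P" and s: "Re s > growth_exp n \<mu> \<kappa>"
  shows "left_primitive (F (Suc k)) s (\<lambda>t. F k t * exp (s * t) - (s - \<mu> k) * P t)"
  unfolding left_primitive_def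
proof (intro conjI allI)
  fix t
  have "(F k has_field_derivative F (Suc k) t - \<mu> k * F k t) (at t)"
    using F k by (simp add: tower_system_def)
  moreover have "(P has_field_derivative F k t * exp (s * t)) (at t)"
    using P by (simp add: left_primitive_def)
  ultimately have "((\<lambda>t. F k t * exp (s * t) - (s - \<mu> k) * P t) has_field_derivative
      (F (Suc k) t - \<mu> k * F k t) * exp (s * t) + (exp (s * t) * s) * F k t - (s - \<mu> k) * (F k t * exp (s * t))) (at t)"
    by (intro DERIV_diff DERIV_mult DERIV_cmult) (auto intro!: derivative_eq_intros)
  then show "((\<lambda>t. F k t * exp (s * t) - (s - \<mu> k) * P t) has_field_derivative F (Suc k) t * exp (s * t)) (at t)"
    by (simp add: algebra_simps)
next
  fix y
  define A where "A = growth_exp n \<mu> \<kappa>"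
  obtain C where C: "\<And>t. Re t \<le> 0 \<Longrightarrow> \<bar>Im t\<bar> \<le> \<bar>y\<bar> \<Longrightarrow> norm (F k t) \<le> C * exp (- A * Re t)"
    using tower_system_growth [OF F, of "\<bar>y\<bar>"] k unfolding A_def by blast
  have "((\<lambda>x. F k (of_real x + \<i> * of_real y) * exp (s * (of_real x + \<i> * of_real y))) \<longlongrightarrow> 0) at_bot"
  proof (rule Lim_null_comparison)
    show "\<forall>\<^sub>F x in at_bot. norm (F k (of_real x + \<i> * of_real y) * exp (s * (of_real x + \<i> * of_real y)))
        \<le> (C * exp (- Im s * y)) * exp ((Re s - A) * x)"
      unfolding eventually_at_bot_linorder
    proof (intro exI allI impI)
      fix x :: real assume x: "x \<le> 0"
      have "norm (F k (of_real x + \<i> * of_real y)) * exp (Re s * x - Im s * y) \<le> (C * exp (- A * x)) * exp (Re s * x - Im s * y)"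
        using C [of "of_real x + \<i> * of_real y"] x by (intro mult_right_mono) auto
      also have "\<dots> = (C * exp (- Im s * y)) * exp ((Re s - A) * x)"
        by (simp add: mult.assoc mult_exp_exp algebra_simps)
      finally show "norm (F k (of_real x + \<i> * of_real y) * exp (s * (of_real x + \<i> * of_real y)))
        \<le> (C * exp (- Im s * y)) * exp ((Re s - A) * x)"
        by (simp add: norm_mult norm_exp_eq_Re)
    qed
    have "filterlim (\<lambda>x. (Re s - A) * x) at_bot at_bot"
      using s by (intro filterlim_tendsto_pos_mult_at_bot [OF tendsto_const]) (auto simp: filterlim_ident A_def)
    then have "((\<lambda>x. exp ((Re s - A) * x)) \<longlongrightarrow> 0) at_bot"
      by (rule filterlim_compose [OF exp_at_bot])
    then show "((\<lambda>x. (C * exp (- Im s * y)) * exp ((Re s - A) * x)) \<longlongrightarrow> 0) at_bot"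
      by (rule tendsto_mult_right_zero)
  qed
  moreover have "((\<lambda>x. P (of_real x + \<i> * of_real y)) \<longlongrightarrow> 0) at_bot"
    using P by (simp add: left_primitive_def)
  ultimately have "((\<lambda>x. F k (of_real x + \<i> * of_real y) * exp (s * (of_real x + \<i> * of_real y))
      - (s - \<mu> k) * P (of_real x + \<i> * of_real y)) \<longlongrightarrow> 0 - 0) at_bot"
    by (intro tendsto_diff tendsto_mult_right_zero)
  then show "((\<lambda>x. F k (of_real x + \<i> * of_real y) * exp (s * (of_real x + \<i> * of_real y))
      - (s - \<mu> k) * P (of_real x + \<i> * of_real y)) \<longlongrightarrow> 0) at_bot" by simp
qed

lemma tower_left_primitive_exists:
  assumes F: "tower_system n \<mu> \<kappa> UNIV F" and k: "k < n" and s: "Re s > growth_exp n \<mu> \<kappa>"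
  shows "\<exists>P. left_primitive (F k) s P"
proof (rule left_primitive_exists [OF _ _ s])
  show "F k holomorphic_on UNIV"
    using F k by (auto simp: tower_system_def holomorphic_on_open)
  show "\<exists>C. \<forall>t. Re t \<le> 0 \<longrightarrow> \<bar>Im t\<bar> \<le> \<alpha> \<longrightarrow> norm (F k t) \<le> C * exp (- growth_exp n \<mu> \<kappa> * Re t)" for \<alpha>
    using tower_system_growth [OF F, of \<alpha>] k by blast
qed

section \<open>Stirling's constant and Gamma along arithmetic progressions\<close>

section \<open>Asymptotics of the Gamma function\<close>

text \<open>The limit formula for Gamma as a quotient of a factorial and a Pochhammer symbol, with
  the latter rewritten as a ratio of Gamma values.\<close>

lemma Gamma_shift_asymptotic:
  fixes z :: complex
  assumes z: "z \<notin> \<int>\<^sub>\<le>\<^sub>0"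
  shows "(\<lambda>N. Gamma (z + of_nat N) / (Gamma (of_nat N) * exp (z * of_real (ln (real N))))) \<longlonglongrightarrow> 1"
proof -
  have G: "Gamma z \<noteq> 0" using z by (simp add: Gamma_eq_zero_iff)
  have "(\<lambda>N. Gamma z / Gamma_series' z N) \<longlonglongrightarrow> Gamma z / Gamma z"
    by (intro tendsto_divide tendsto_const Gamma_series'_LIMSEQ G)
  moreover have "\<forall>\<^sub>F N in sequentially. Gamma z / Gamma_series' z N
      = Gamma (z + of_nat N) / (Gamma (of_nat N) * exp (z * of_real (ln (real N))))"
  proof (rule eventually_sequentiallyI [of 1])
    fix N :: nat assume N: "1 \<le> N"
    then obtain m where m: "N = Suc m" by (cases N) auto
    have "Gamma (of_nat N :: complex) = fact (N - 1)"
      unfolding m by (simp add: Gamma_fact [symmetric] add.commute)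
    moreover have "pochhammer z N = Gamma (z + of_nat N) / Gamma z"
      using z by (rule pochhammer_Gamma)
    ultimately show "Gamma z / Gamma_series' z N
      = Gamma (z + of_nat N) / (Gamma (of_nat N) * exp (z * of_real (ln (real N))))"
      using G by (simp add: Gamma_series'_def)
  qed
  ultimately have "(\<lambda>N. Gamma (z + of_nat N) / (Gamma (of_nat N) * exp (z * of_real (ln (real N))))) \<longlonglongrightarrow> Gamma z / Gamma z"
    by (rule Lim_transform_eventually)
  then show ?thesis using G by simp
qed

text \<open>The increments of the sequence are O(N^-2), so it converges. Comparing twice its N-th
  term with the term at 2N by Legendre's duplication formula evaluates the limit.\<close>

lemma Stirling_Gamma:
  "(\<lambda>N. ln_Gamma (real N) - (real N - 1 / 2) * ln (real N) + real N) \<longlonglongrightarrow> ln (2 * pi) / 2"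
proof -
  define L where "L = (\<lambda>N. ln_Gamma (real N) - (real N - 1 / 2) * ln (real N) + real N)"
  define e where "e = (\<lambda>N::nat. 1 - (real N + 1 / 2) * (ln (real N + 1) - ln (real N)))"
  have step: "L (Suc N) - L N = e N" if "N \<ge> 1" for N
  proof -
    have "ln_Gamma (real N + 1) = ln_Gamma (real N) + ln (real N)"
    proof -
      have "Gamma (real N + 1) = real N * Gamma (real N)"
        using that by (intro Gamma_plus1) (auto elim!: nonpos_Ints_cases)
      moreover have "Gamma (real N) \<noteq> 0"
        using Gamma_real_pos [of "real N"] that by force
      ultimately show ?thesis
        using that by (simp add: ln_Gamma_real_pos ln_mult)
    qed
    then show ?thesis
      by (simp add: L_def e_def algebra_simps)
  qed
  have "summable e"
  proof (rule summable_comparison_test_bigo)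
    show "summable (\<lambda>N. norm (1 / real N ^ 2))"
      using inverse_power_summable [of 2, where 'a = real] by (simp add: divide_inverse power_inverse)
    show "e \<in> O(\<lambda>N. 1 / real N ^ 2)"
      unfolding e_def by real_asymp
  qed
  then have "convergent (\<lambda>N. L 1 + (\<Sum>k<N. e (Suc k)))"
    by (intro convergent_add convergent_const) (simp add: summable_iff_convergent [symmetric] summable_Suc_iff)
  moreover have "L 1 + (\<Sum>k<N. e (Suc k)) = L (Suc N)" for N
    by (induction N) (use step in \<open>auto simp: algebra_simps\<close>)
  ultimately have "convergent (\<lambda>N. L (Suc N))" by simp
  then obtain l where l: "L \<longlonglongrightarrow> l"
    unfolding convergent_def using LIMSEQ_imp_Suc by blast
  have r: "(\<lambda>N. ln_Gamma (1/2 + real N) - ln_Gamma (real N) - ln (real N) / 2) \<longlonglongrightarrow> 0"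
  proof -
    have "(\<lambda>N. Gamma (1/2 + of_nat N :: complex) / (Gamma (of_nat N) * exp (1/2 * of_real (ln (real N))))) \<longlonglongrightarrow> 1"
    proof (rule Gamma_shift_asymptotic)
      show "(1/2 :: complex) \<notin> \<int>\<^sub>\<le>\<^sub>0"
        by (auto elim!: nonpos_Ints_cases simp: complex_eq_iff)
    qed
    moreover have "Gamma (1/2 + of_nat N :: complex) / (Gamma (of_nat N) * exp (1/2 * of_real (ln (real N))))
        = complex_of_real (Gamma (1/2 + real N) / (Gamma (real N) * exp (1/2 * ln (real N))))" for N
      by (simp add: Gamma_complex_of_real [symmetric] exp_of_real [symmetric])
    ultimately have "(\<lambda>N. complex_of_real (Gamma (1/2 + real N) / (Gamma (real N) * exp (1/2 * ln (real N))))) \<longlonglongrightarrow> complex_of_real 1"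
      by simp
    then have "(\<lambda>N. Gamma (1/2 + real N) / (Gamma (real N) * exp (1/2 * ln (real N)))) \<longlonglongrightarrow> 1"
      by (simp only: tendsto_of_real_iff)
    then have "(\<lambda>N. ln (Gamma (1/2 + real N) / (Gamma (real N) * exp (1/2 * ln (real N))))) \<longlonglongrightarrow> ln 1"
      by (intro tendsto_ln) auto
    moreover have "\<forall>\<^sub>F N in sequentially. ln (Gamma (1/2 + real N) / (Gamma (real N) * exp (1/2 * ln (real N))))
        = ln_Gamma (1/2 + real N) - ln_Gamma (real N) - ln (real N) / 2"
      using eventually_gt_at_top [of 0]
    proof eventually_elim
      case (elim N)
      then have "Gamma (real N) \<noteq> 0" "Gamma (1/2 + real N) \<noteq> 0"
        using Gamma_real_pos [of "real N"] Gamma_real_pos [of "1/2 + real N"] by force+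
      then show ?case using elim by (simp add: ln_div ln_mult ln_Gamma_real_pos)
    qed
    ultimately have "(\<lambda>N. ln_Gamma (1/2 + real N) - ln_Gamma (real N) - ln (real N) / 2) \<longlonglongrightarrow> ln 1"
      by (rule Lim_transform_eventually)
    then show ?thesis by simp
  qed
  have dup: "ln_Gamma (real N) + ln_Gamma (1/2 + real N) = (1 - 2 * real N) * ln 2 + ln pi / 2 + ln_Gamma (real (2 * N))" if "N \<ge> 1" for N
  proof -
    have "Gamma (of_nat N :: complex) * Gamma (of_nat N + 1/2)
        = exp ((1 - 2 * of_nat N) * of_real (ln 2)) * of_real (sqrt pi) * Gamma (2 * of_nat N)"
      using that by (intro Gamma_legendre_duplication) (auto elim!: nonpos_Ints_cases simp: complex_eq_iff)
    then have "complex_of_real (Gamma (real N) * Gamma (real N + 1/2))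
        = complex_of_real (exp ((1 - 2 * real N) * ln 2) * sqrt pi * Gamma (2 * real N))"
      by (simp add: Gamma_complex_of_real [symmetric] exp_of_real [symmetric])
    then have "Gamma (real N) * Gamma (real N + 1/2) = exp ((1 - 2 * real N) * ln 2) * sqrt pi * Gamma (2 * real N)"
      by (simp only: of_real_eq_iff)
    then have "ln (Gamma (real N) * Gamma (real N + 1/2)) = ln (exp ((1 - 2 * real N) * ln 2) * sqrt pi * Gamma (2 * real N))"
      by simp
    moreover have "Gamma (real N) \<noteq> 0" "Gamma (real N + 1/2) \<noteq> 0" "Gamma (2 * real N) \<noteq> 0"
      using Gamma_real_pos [of "real N"] Gamma_real_pos [of "real N + 1/2"] Gamma_real_pos [of "2 * real N"] that by force+
    ultimately show ?thesis
      using that by (simp add: ln_mult ln_Gamma_real_pos ln_sqrt add.commute)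
  qed
  have "(\<lambda>N. L N + L N - L (2 * N) + (ln_Gamma (1/2 + real N) - ln_Gamma (real N) - ln (real N) / 2)) \<longlonglongrightarrow> l + l - l + 0"
    by (intro tendsto_add tendsto_diff l r filterlim_compose [OF l]) (simp add: filterlim_subseq strict_mono_def)
  moreover have "\<forall>\<^sub>F N in sequentially. L N + L N - L (2 * N) + (ln_Gamma (1/2 + real N) - ln_Gamma (real N) - ln (real N) / 2)
      = ln (2 * pi) / 2"
  proof (rule eventually_sequentiallyI [of 1])
    fix N :: nat assume N: "1 \<le> N"
    have "ln (real (2 * N)) = ln 2 + ln (real N)" using N by (simp add: ln_mult)
    then show "L N + L N - L (2 * N) + (ln_Gamma (1/2 + real N) - ln_Gamma (real N) - ln (real N) / 2) = ln (2 * pi) / 2"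
      using dup [OF N] N by (simp add: L_def ln_mult field_simps)
  qed
  ultimately have "(\<lambda>N::nat. ln (2 * pi) / 2) \<longlonglongrightarrow> l + l - l + 0"
    by (rule Lim_transform_eventually)
  then have l_eq: "l = ln (2 * pi) / 2" by (simp add: LIMSEQ_const_iff)
  show ?thesis using l unfolding l_eq L_def .
qed

text \<open>The number (2 pi)^(-(n-1)/2) n^(-n/2), which Stirling's formula produces when Gamma(nN)
  is compared with Gamma(N)^n.\<close>

definition mellin_const :: "nat \<Rightarrow> real" where
  "mellin_const n = exp (- (real n - 1) / 2 * ln (2 * pi) - real n / 2 * ln (real n))"

text \<open>Stirling's formula at nN minus n times Stirling's formula at N, exponentiated.\<close>

lemma Gamma_multiple_asymptotic:
  assumes n: "n \<ge> 1"
  shows "(\<lambda>N. Gamma (real (n * N)) * exp (- (real n - 1) / 2 * (ln (real n) + ln (real N)))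
     / (exp (real (n * N) * ln (real n)) * Gamma (real N) ^ n)) \<longlonglongrightarrow> mellin_const n"
proof -
  define L where "L = (\<lambda>N. ln_Gamma (real N) - (real N - 1 / 2) * ln (real N) + real N)"
  have L: "L \<longlonglongrightarrow> ln (2 * pi) / 2" unfolding L_def by (rule Stirling_Gamma)
  have "(\<lambda>N. L (n * N)) \<longlonglongrightarrow> ln (2 * pi) / 2"
    using n by (intro filterlim_compose [OF L] filterlim_subseq) (auto simp: strict_mono_def)
  then have lim: "(\<lambda>N. exp (L (n * N) - real n * L N - real n / 2 * ln (real n))) \<longlonglongrightarrow> exp (ln (2 * pi) / 2 - real n * (ln (2 * pi) / 2) - real n / 2 * ln (real n))"
    by (intro tendsto_exp tendsto_diff tendsto_mult tendsto_const L)
  have eq: "exp (ln (2 * pi) / 2 - real n * (ln (2 * pi) / 2) - real n / 2 * ln (real n)) = mellin_const n"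
    by (simp add: mellin_const_def algebra_simps diff_divide_distrib)
  have "\<forall>\<^sub>F N in sequentially. exp (L (n * N) - real n * L N - real n / 2 * ln (real n))
     = Gamma (real (n * N)) * exp (- (real n - 1) / 2 * (ln (real n) + ln (real N)))
     / (exp (real (n * N) * ln (real n)) * Gamma (real N) ^ n)"
  proof (rule eventually_sequentiallyI [of 1])
    fix N :: nat assume N: "1 \<le> N"
    have pos: "real (n * N) > 0" "real N > 0" using n N by auto
    have ln: "ln (real (n * N)) = ln (real n) + ln (real N)" using n N by (simp add: ln_mult)
    have e: "L (n * N) - real n * L N - real n / 2 * ln (real n)
        = ln_Gamma (real (n * N)) + - (real n - 1) / 2 * (ln (real n) + ln (real N)) - (real (n * N) * ln (real n) + real n * ln_Gamma (real N))"
      unfolding L_def ln by (simp add: field_simps)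
    show "exp (L (n * N) - real n * L N - real n / 2 * ln (real n))
     = Gamma (real (n * N)) * exp (- (real n - 1) / 2 * (ln (real n) + ln (real N)))
     / (exp (real (n * N) * ln (real n)) * Gamma (real N) ^ n)"
      unfolding e Gamma_real_pos_exp [OF pos(1)] Gamma_real_pos_exp [OF pos(2)]
      by (simp only: exp_diff exp_add exp_of_nat_mult)
  qed
  then show ?thesis by (rule Lim_transform_eventually [OF lim [unfolded eq]])
qed

text \<open>As the \<mu> k sum to 0, the arguments (s - \<mu> k) / n sum to s. The powers of N^s on
  both sides then cancel, and the comparison reduces to integer arguments.\<close>

lemma Gamma_quotient_asymptotic:
  assumes n: "n \<ge> 1" and \<mu>: "(\<Sum>k<n. \<mu> k) = 0"
    and z: "s + bexp n \<notin> \<int>\<^sub>\<le>\<^sub>0" and w: "\<And>k. k < n \<Longrightarrow> (s - \<mu> k) / of_nat n \<notin> \<int>\<^sub>\<le>\<^sub>0"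
  shows "(\<lambda>N. Gamma (s + bexp n + of_nat (n * N))
     / (exp ((s + of_nat (n * N)) * of_real (ln (real n))) * (\<Prod>k<n. Gamma ((s - \<mu> k) / of_nat n + of_nat N)))) \<longlonglongrightarrow> of_real (mellin_const n)"
proof -
  define w where "w = (\<lambda>k. (s - \<mu> k) / of_nat n)"
  have sw: "(\<Sum>k<n. w k) = s"
    using n by (simp add: w_def sum_divide_distrib [symmetric] sum_subtractf \<mu>)
  have 1: "(\<lambda>N. Gamma (s + bexp n + of_nat (n * N)) / (Gamma (of_nat (n * N)) * exp ((s + bexp n) * of_real (ln (real (n * N)))))) \<longlonglongrightarrow> 1"
    using n by (intro filterlim_compose [OF Gamma_shift_asymptotic [OF z]] filterlim_subseq) (auto simp: strict_mono_def)
  have 2: "(\<lambda>N. \<Prod>k<n. Gamma (w k + of_nat N) / (Gamma (of_nat N) * exp (w k * of_real (ln (real N))))) \<longlonglongrightarrow> (\<Prod>k<n. 1)"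
    using assms(4) by (intro tendsto_prod Gamma_shift_asymptotic) (auto simp: w_def)
  have 3: "(\<lambda>N. complex_of_real (Gamma (real (n * N)) * exp (- (real n - 1) / 2 * (ln (real n) + ln (real N)))
     / (exp (real (n * N) * ln (real n)) * Gamma (real N) ^ n))) \<longlonglongrightarrow> of_real (mellin_const n)"
    by (intro tendsto_of_real Gamma_multiple_asymptotic n)
  have "(\<lambda>N. Gamma (s + bexp n + of_nat (n * N)) / (Gamma (of_nat (n * N)) * exp ((s + bexp n) * of_real (ln (real (n * N)))))
      / (\<Prod>k<n. Gamma (w k + of_nat N) / (Gamma (of_nat N) * exp (w k * of_real (ln (real N)))))
      * complex_of_real (Gamma (real (n * N)) * exp (- (real n - 1) / 2 * (ln (real n) + ln (real N)))
     / (exp (real (n * N) * ln (real n)) * Gamma (real N) ^ n))) \<longlonglongrightarrow> 1 / (\<Prod>k<n. 1) * of_real (mellin_const n)"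
    by (intro tendsto_mult tendsto_divide 1 2 3) simp
  moreover have "\<forall>\<^sub>F N in sequentially. Gamma (s + bexp n + of_nat (n * N)) / (Gamma (of_nat (n * N)) * exp ((s + bexp n) * of_real (ln (real (n * N)))))
      / (\<Prod>k<n. Gamma (w k + of_nat N) / (Gamma (of_nat N) * exp (w k * of_real (ln (real N)))))
      * complex_of_real (Gamma (real (n * N)) * exp (- (real n - 1) / 2 * (ln (real n) + ln (real N)))
     / (exp (real (n * N) * ln (real n)) * Gamma (real N) ^ n))
     = Gamma (s + bexp n + of_nat (n * N))
     / (exp ((s + of_nat (n * N)) * of_real (ln (real n))) * (\<Prod>k<n. Gamma (w k + of_nat N)))"
  proof (rule eventually_sequentiallyI [of 1])
    fix N :: nat assume N: "1 \<le> N"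
    define a where "a = complex_of_real (ln (real n))"
    define b where "b = complex_of_real (ln (real N))"
    define G where "G = complex_of_real (Gamma (real N))"
    define H where "H = complex_of_real (Gamma (real (n * N)))"
    have G: "Gamma (of_nat N) = G" "G \<noteq> 0"
      using N Gamma_complex_of_real [of "real N"] Gamma_real_pos [of "real N"] unfolding G_def of_real_eq_0_iff
      by (simp, linarith)
    have "Gamma (real (n * N)) > 0" using N n by (intro Gamma_real_pos) simp
    then have H: "Gamma (of_nat (n * N)) = H" "H \<noteq> 0"
      using Gamma_complex_of_real [of "real (n * N)"] unfolding H_def of_real_eq_0_iff
      by (simp, linarith)
    have ln: "complex_of_real (ln (real (n * N))) = a + b" using n N by (simp add: ln_mult a_def b_def)
    have P: "(\<Prod>k<n. Gamma (w k + of_nat N) / (G * exp (w k * b))) = (\<Prod>k<n. Gamma (w k + of_nat N)) / (G ^ n * exp (s * b))"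
      by (simp add: prod_dividef prod.distrib exp_sum [symmetric] sum_distrib_right [symmetric] sw)
    have R: "complex_of_real (Gamma (real (n * N)) * exp (- (real n - 1) / 2 * (ln (real n) + ln (real N)))
     / (exp (real (n * N) * ln (real n)) * Gamma (real N) ^ n)) = H * exp (bexp n * (a + b)) / (exp (of_nat (n * N) * a) * G ^ n)"
      by (simp add: H_def G_def a_def b_def bexp_def exp_of_real [symmetric])
    have E: "exp ((s + bexp n) * (a + b)) * exp (of_nat (n * N) * a) = exp (bexp n * (a + b)) * exp (s * b) * exp ((s + of_nat (n * N)) * a)"
      by (simp add: mult_exp_exp algebra_simps)
    show "Gamma (s + bexp n + of_nat (n * N)) / (Gamma (of_nat (n * N)) * exp ((s + bexp n) * of_real (ln (real (n * N)))))
      / (\<Prod>k<n. Gamma (w k + of_nat N) / (Gamma (of_nat N) * exp (w k * of_real (ln (real N)))))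
      * complex_of_real (Gamma (real (n * N)) * exp (- (real n - 1) / 2 * (ln (real n) + ln (real N)))
     / (exp (real (n * N) * ln (real n)) * Gamma (real N) ^ n))
     = Gamma (s + bexp n + of_nat (n * N))
     / (exp ((s + of_nat (n * N)) * of_real (ln (real n))) * (\<Prod>k<n. Gamma (w k + of_nat N)))"
      unfolding R G(1) H(1) ln b_def [symmetric] P a_def [symmetric]
    proof -
      define X where "X = Gamma (s + bexp n + of_nat (n * N))"
      define Y where "Y = (\<Prod>k<n. Gamma (w k + of_nat N))"
      have gen: "X / (H * e1) / (Y / (g * e2)) * (H * e3 / (e4 * g)) = X / (e5 * Y)"
        if "e1 * e4 = e3 * e2 * e5" "e1 \<noteq> 0" "e4 \<noteq> 0" "e5 \<noteq> 0" "g \<noteq> 0" "e2 \<noteq> 0" "e3 \<noteq> 0" for e1 e2 e3 e4 e5 g :: complex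
      proof (cases "Y = 0")
        case False
        have "X / (H * e1) / (Y / (g * e2)) * (H * e3 / (e4 * g)) = X * (e3 * e2) / (Y * (e1 * e4))"
          using that H(2) False by (simp add: field_simps)
        also have "\<dots> = X / (e5 * Y)" unfolding that(1) using that False by (simp add: field_simps)
        finally show ?thesis .
      qed simp
      show "X / (H * exp ((s + bexp n) * (a + b))) / (Y / (G ^ n * exp (s * b))) * (H * exp (bexp n * (a + b)) / (exp (of_nat (n * N) * a) * G ^ n))
         = X / (exp ((s + of_nat (n * N)) * a) * Y)"
        by (rule gen) (use E G in auto)
    qed
  qed
  ultimately have "(\<lambda>N. Gamma (s + bexp n + of_nat (n * N))
     / (exp ((s + of_nat (n * N)) * of_real (ln (real n))) * (\<Prod>k<n. Gamma (w k + of_nat N)))) \<longlonglongrightarrow> 1 / (\<Prod>k<n. 1) * of_real (mellin_const n)"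
    by (rule Lim_transform_eventually)
  then show ?thesis by (simp only: w_def prod.neutral_const div_by_1 mult_1)
qed

text \<open>Makes two kinds of error negligible against Gamma(z + N): bounded ones, and those of the
  size of Gamma at a real part smaller by 1.\<close>

lemma Gamma_shift_decay:
  assumes z: "Re z > 1"
  shows "(\<lambda>N. 1 / norm (Gamma (z + of_nat N))) \<longlonglongrightarrow> 0"
    and "(\<lambda>N. Gamma (Re z - 1 + real N) / norm (Gamma (z + of_nat N))) \<longlonglongrightarrow> 0"
proof -
  have z': "z \<notin> \<int>\<^sub>\<le>\<^sub>0" using z by (auto elim!: nonpos_Ints_cases)
  have r': "complex_of_real (Re z - 1) \<notin> \<int>\<^sub>\<le>\<^sub>0"
    using z by (auto elim!: nonpos_Ints_cases simp: complex_eq_iff)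
  define g where "g = (\<lambda>N. Gamma (real N) * exp (Re z * ln (real N)))"
  have g: "g N > 0" if "N \<ge> 1" for N using that by (simp add: g_def Gamma_real_pos)
  have nG: "norm (Gamma (of_nat N :: complex)) = Gamma (real N)" if "N \<ge> 1" for N
    using that Gamma_complex_of_real [of "real N"] Gamma_real_pos [of "real N"] by simp
  have 1: "(\<lambda>N. norm (Gamma (z + of_nat N)) / g N) \<longlonglongrightarrow> norm (1 :: complex)"
  proof (rule Lim_transform_eventually [OF tendsto_norm [OF Gamma_shift_asymptotic [OF z']]])
    show "\<forall>\<^sub>F N in sequentially. norm (Gamma (z + of_nat N) / (Gamma (of_nat N) * exp (z * of_real (ln (real N)))))
        = norm (Gamma (z + of_nat N)) / g N"
      by (rule eventually_sequentiallyI [of 1]) (simp add: norm_divide norm_mult norm_exp_eq_Re nG g_def)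
  qed
  have inv1: "(\<lambda>N. g N / norm (Gamma (z + of_nat N))) \<longlonglongrightarrow> 1"
    using tendsto_inverse [OF 1] by simp
  have lim_inv: "(\<lambda>N. 1 / real N) \<longlonglongrightarrow> 0" by (rule lim_1_over_n)
  have g0: "(\<lambda>N. 1 / g N) \<longlonglongrightarrow> 0"
  proof (rule Lim_null_comparison [OF _ lim_inv], rule eventually_sequentiallyI [of 1])
    fix N :: nat assume N: "1 \<le> N"
    then obtain m where m: "N = Suc m" by (cases N) auto
    have "Gamma (real N) \<ge> 1"
      unfolding m using Gamma_fact [of m, where 'a = real] by (simp add: add.commute fact_ge_1)
    moreover have "exp (Re z * ln (real N)) \<ge> real N"
    proof -
      have "exp (1 * ln (real N)) \<le> exp (Re z * ln (real N))"
        using N z by (subst exp_le_cancel_iff) (intro mult_right_mono, auto)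
      then show ?thesis using N by simp
    qed
    ultimately have "1 * real N \<le> g N" unfolding g_def by (intro mult_mono) auto
    then show "norm (1 / g N) \<le> 1 / real N"
      using N g [OF N] by (simp add: frac_le)
  qed
  have "(\<lambda>N. g N / norm (Gamma (z + of_nat N)) * (1 / g N)) \<longlonglongrightarrow> 1 * 0"
    by (intro tendsto_mult inv1 g0)
  then have "(\<lambda>N. g N / norm (Gamma (z + of_nat N)) * (1 / g N)) \<longlonglongrightarrow> 0" by simp
  moreover have "\<forall>\<^sub>F N in sequentially. g N / norm (Gamma (z + of_nat N)) * (1 / g N) = 1 / norm (Gamma (z + of_nat N))"
    by (rule eventually_sequentiallyI [of 1]) (use g in force)
  ultimately show "(\<lambda>N. 1 / norm (Gamma (z + of_nat N))) \<longlonglongrightarrow> 0"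
    by (rule Lim_transform_eventually)
  have 2: "(\<lambda>N. Gamma (Re z - 1 + real N) / (Gamma (real N) * exp ((Re z - 1) * ln (real N)))) \<longlonglongrightarrow> 1"
  proof -
    have "Gamma (complex_of_real (Re z - 1) + of_nat N) / (Gamma (of_nat N) * exp (complex_of_real (Re z - 1) * of_real (ln (real N))))
        = complex_of_real (Gamma (Re z - 1 + real N) / (Gamma (real N) * exp ((Re z - 1) * ln (real N))))" for N
      by (simp add: Gamma_complex_of_real [symmetric] exp_of_real [symmetric])
    then have "(\<lambda>N. complex_of_real (Gamma (Re z - 1 + real N) / (Gamma (real N) * exp ((Re z - 1) * ln (real N))))) \<longlonglongrightarrow> complex_of_real 1"
      using Gamma_shift_asymptotic [OF r'] by simp
    then show ?thesis by (simp only: tendsto_of_real_iff)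
  qed
  have "(\<lambda>N. Gamma (Re z - 1 + real N) / (Gamma (real N) * exp ((Re z - 1) * ln (real N)))
      * (g N / norm (Gamma (z + of_nat N))) * (1 / real N)) \<longlonglongrightarrow> 1 * 1 * 0"
    by (intro tendsto_mult inv1 2 lim_inv)
  then have "(\<lambda>N. Gamma (Re z - 1 + real N) / (Gamma (real N) * exp ((Re z - 1) * ln (real N)))
      * (g N / norm (Gamma (z + of_nat N))) * (1 / real N)) \<longlonglongrightarrow> 0" by simp
  moreover have "\<forall>\<^sub>F N in sequentially. Gamma (Re z - 1 + real N) / (Gamma (real N) * exp ((Re z - 1) * ln (real N)))
      * (g N / norm (Gamma (z + of_nat N))) * (1 / real N) = Gamma (Re z - 1 + real N) / norm (Gamma (z + of_nat N))"
  proof (rule eventually_sequentiallyI [of 1])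
    fix N :: nat assume N: "1 \<le> N"
    have "Gamma (real N) \<noteq> 0" using Gamma_real_pos [of "real N"] N by force
    moreover have "exp (Re z * ln (real N)) = exp ((Re z - 1) * ln (real N)) * real N"
      using N by (simp add: left_diff_distrib exp_diff)
    ultimately show "Gamma (Re z - 1 + real N) / (Gamma (real N) * exp ((Re z - 1) * ln (real N)))
      * (g N / norm (Gamma (z + of_nat N))) * (1 / real N) = Gamma (Re z - 1 + real N) / norm (Gamma (z + of_nat N))"
      using N by (simp add: g_def)
  qed
  ultimately show "(\<lambda>N. Gamma (Re z - 1 + real N) / norm (Gamma (z + of_nat N))) \<longlonglongrightarrow> 0"
    by (rule Lim_transform_eventually)
qed

section \<open>The transform of the decaying solution as a product of Gamma values\<close>

section \<open>The Mellin transform of the normalised solution\<close>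

lemma Re_pos_not_nonpos_Int: "Re z > 0 \<Longrightarrow> z \<notin> \<int>\<^sub>\<le>\<^sub>0"
  by (auto elim!: nonpos_Ints_cases)

text \<open>Euler's integral after the substitution u = e^x, in the form of a primitive so that it
  can be compared with the primitive of f(x) e^(sx) by a differential inequality.\<close>

lemma Gamma_incomplete_exists:
  assumes z: "Re z \<ge> 1"
  shows "\<exists>J :: real \<Rightarrow> complex. (\<forall>x. (J has_vector_derivative exp (z * of_real x - of_real (exp x))) (at x)) \<and>
     (\<lambda>k. J (real k)) \<longlonglongrightarrow> Gamma z \<and> norm (J 0) \<le> 1"
proof -
  define f where "f = (\<lambda>u. complex_of_real u powr (z - 1) / of_real (exp u))"
  define h where "h = (\<lambda>u. u powr (Re z - 1) / exp u)"
  have f: "(f has_integral Gamma z) {0..}"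
    unfolding f_def using z by (intro Gamma_integral_complex) simp
  have h: "h integrable_on {0..}"
    unfolding h_def by (rule has_integral_integrable, rule Gamma_integral_real) (use z in simp)
  have fh: "norm (f u) = h u" if "u \<ge> 0" for u
    using that by (simp add: f_def h_def norm_divide norm_powr_real_powr)
  have fi: "f integrable_on {0..b}" for b
    by (rule integrable_on_subinterval [OF has_integral_integrable [OF f]]) auto
  define I where "I = (\<lambda>y. integral {0..y} f)"
  define J where "J = (\<lambda>x. I (exp x))"
  have "(J has_vector_derivative exp (z * of_real x - of_real (exp x))) (at x)" for x
  proof -
    have "\<forall>\<^sub>F u in nhds (exp x). u \<in> {0<..}"
      by (rule eventually_nhds_in_open) auto
    then have "\<forall>\<^sub>F u in nhds (exp x). f u = exp ((z - 1) * of_real (ln u)) / of_real (exp u)"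
      by eventually_elim (simp add: f_def powr_def Ln_of_real)
    moreover have "isCont (\<lambda>u. exp ((z - 1) * complex_of_real (ln u)) / of_real (exp u)) (exp x)"
      by (intro continuous_intros) auto
    ultimately have "isCont f (exp x)" by (simp cong: isCont_cong)
    then have "continuous (at (exp x) within {0..2 * exp x}) f"
      by (rule continuous_at_imp_continuous_at_within)
    then have "(I has_vector_derivative f (exp x)) (at (exp x) within {0..2 * exp x})"
      unfolding I_def using integral_has_vector_derivative_continuous_at [OF fi, of "exp x" "2 * exp x" "{}"] by simp
    moreover have "at (exp x) within {0..2 * exp x} = at (exp x)"
      by (rule at_within_interior) simp
    ultimately have "(I has_vector_derivative f (exp x)) (at (exp x))" by simp
    moreover have "(exp has_vector_derivative exp x) (at x)"
      by (auto simp: has_real_derivative_iff_has_vector_derivative [symmetric])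
    ultimately have "(I \<circ> exp has_vector_derivative exp x *\<^sub>R f (exp x)) (at x)"
      by (intro vector_diff_chain_at)
    moreover have "exp x *\<^sub>R f (exp x) = exp (z * of_real x - of_real (exp x))"
    proof -
      have "complex_of_real (exp x) powr (z - 1) = exp ((z - 1) * of_real x)"
        by (simp add: powr_def Ln_of_real)
      then have "exp x *\<^sub>R f (exp x) = exp (of_real x) * exp ((z - 1) * of_real x) / exp (of_real (exp x))"
        by (simp add: f_def scaleR_conv_of_real exp_of_real)
      also have "exp (of_real x) * exp ((z - 1) * of_real x) = exp (z * of_real x)"
        by (simp add: mult_exp_exp algebra_simps)
      also have "\<dots> / exp (of_real (exp x)) = exp (z * of_real x - of_real (exp x))"
        by (rule exp_diff [symmetric])
      finally show ?thesis .
    qed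
    ultimately show ?thesis by (simp add: J_def o_def)
  qed
  moreover have "(\<lambda>k. J (real k)) \<longlonglongrightarrow> Gamma z"
  proof -
    have "(\<lambda>k. integral {0..} (\<lambda>u. if u \<in> {0..exp (real k)} then f u else 0)) \<longlonglongrightarrow> integral {0..} f"
    proof (rule dominated_convergence(2) [OF _ h])
      show "(\<lambda>u. if u \<in> {0..exp (real k)} then f u else 0) integrable_on {0..}" for k
        using fi [of "exp (real k)"] integrable_restrict_Int [of "{0..exp (real k)}" f "{0..}"]
        by (simp add: Int_absorb2)
      show "norm (if u \<in> {0..exp (real k)} then f u else 0) \<le> h u" if "u \<in> {0..}" for k u
        using fh that norm_ge_zero [of "f u"] by auto
      fix u :: real assume u: "u \<in> {0..}"
      have "filterlim (\<lambda>k. exp (real k)) at_top sequentially"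
        by (rule filterlim_compose [OF exp_at_top filterlim_real_sequentially])
      then have "\<forall>\<^sub>F k in sequentially. u \<le> exp (real k)"
        by (simp add: filterlim_at_top)
      then have "\<forall>\<^sub>F k in sequentially. f u = (if u \<in> {0..exp (real k)} then f u else 0)"
        by eventually_elim (use u in auto)
      then show "(\<lambda>k. if u \<in> {0..exp (real k)} then f u else 0) \<longlonglongrightarrow> f u"
        by (rule Lim_transform_eventually [OF tendsto_const])
    qed
    moreover have "integral {0..} (\<lambda>u. if u \<in> {0..exp (real k)} then f u else 0) = J (real k)" for k
      unfolding J_def I_def Henstock_Kurzweil_Integration.integral_restrict_Int by (simp add: Int_absorb2)
    ultimately show ?thesis using integral_unique [OF f] by simp
  qed
  moreover have "norm (J 0) \<le> 1"
  proof -
    have "norm (integral {0..1} f) \<le> integral {0..1} (\<lambda>u::real. 1 :: real)"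
    proof (rule integral_norm_bound_integral [OF fi])
      fix u :: real assume u: "u \<in> {0..1}"
      have "u powr (Re z - 1) \<le> 1" using u z by (intro powr_le1) auto
      moreover have "exp u \<ge> 1" using u by simp
      ultimately show "norm (f u) \<le> 1"
        using fh [of u] u by (simp add: h_def divide_le_eq order_trans)
    qed auto
    then show ?thesis by (simp add: J_def I_def)
  qed
  ultimately show ?thesis by blast
qed

text \<open>Parametrised over a fixed interval, so that differentiation under the integral sign
  shows it to be entire in \<open>s\<close>.\<close>

definition segment_integral :: "(complex \<Rightarrow> complex) \<Rightarrow> complex \<Rightarrow> complex \<Rightarrow> complex \<Rightarrow> complex" where
  "segment_integral f p d s = integral {0..1} (\<lambda>x. f (p + of_real x * d) * exp (s * (p + of_real x * d)) * d)"

lemma segment_integral_eq: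
  assumes "\<And>t. (P has_field_derivative f t * exp (s * t)) (at t)"
  shows "segment_integral f p d s = P (p + d) - P p"
proof -
  have "((\<lambda>x. f (p + of_real x * d) * exp (s * (p + of_real x * d)) * d) has_integral
      (P (p + of_real 1 * d) - P (p + of_real 0 * d))) {0..1}"
    by (rule fundamental_theorem_of_calculus)
       (auto intro!: has_vector_derivative_at_within has_vector_derivative_segment assms)
  note I = this
  show ?thesis unfolding segment_integral_def integral_unique [OF I] by simp
qed

lemma segment_integral_holomorphic:
  assumes f: "f holomorphic_on UNIV"
  shows "segment_integral f p d holomorphic_on UNIV"
proof -
  have cf: "continuous_on UNIV f" using f by (rule holomorphic_on_imp_continuous_on)
  have "(\<lambda>s. integral (cbox 0 1) (\<lambda>x. f (p + of_real x * d) * exp (s * (p + of_real x * d)) * d)) holomorphic_on UNIV"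
  proof (rule leibniz_rule_holomorphic)
    fix s and x :: real
    show "((\<lambda>s. f (p + of_real x * d) * exp (s * (p + of_real x * d)) * d) has_field_derivative
      f (p + of_real x * d) * (exp (s * (p + of_real x * d)) * (p + of_real x * d)) * d) (at s within UNIV)"
      by (auto intro!: derivative_eq_intros)
  next
    show "(\<lambda>x. f (p + of_real x * d) * exp (s * (p + of_real x * d)) * d) integrable_on cbox 0 1" for s
      unfolding cbox_interval
      by (intro integrable_continuous_interval continuous_intros continuous_on_compose2 [OF cf]) auto
    show "continuous_on (UNIV \<times> cbox 0 1) (\<lambda>(s, x::real). f (p + of_real x * d) * (exp (s * (p + of_real x * d)) * (p + of_real x * d)) * d)"
      unfolding case_prod_unfold
      by (intro continuous_intros continuous_on_compose2 [OF cf]) auto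
  qed auto
  then show ?thesis by (simp add: segment_integral_def [abs_def] cbox_interval)
qed

text \<open>From e^x \<ge> x^2 / 2 and completing the square. The resulting constant is uniform for
  bounded a, as local uniformity in s requires.\<close>

lemma exp_times_exp_bound:
  assumes "x \<ge> 0"
  shows "exp (a * x - exp x) \<le> exp ((a + 1)\<^sup>2 / 2) * exp (- x :: real)"
proof -
  have "1 + x + x\<^sup>2 / 2 \<le> exp x" using exp_lower_Taylor_quadratic [OF assms] .
  then have "x\<^sup>2 / 2 \<le> exp x" using assms by linarith
  moreover have "(a + 1) * x - x\<^sup>2 / 2 \<le> (a + 1)\<^sup>2 / 2"
    using zero_le_power2 [of "a + 1 - x"] by (simp add: power2_eq_square algebra_simps)
  ultimately have "a * x - exp x \<le> (a + 1)\<^sup>2 / 2 + - x" by (simp add: algebra_simps)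
  then show ?thesis by (simp only: exp_add [symmetric] exp_le_cancel_iff)
qed

text \<open>\<open>R\<close> is the transform over t \<ge> 0, summed over unit segments. The double
  exponential decay of f makes the series converge locally uniformly in all of the s-plane.\<close>

lemma right_part_exists:
  assumes f: "f holomorphic_on UNIV"
    and decay: "\<And>x. x > 0 \<Longrightarrow> norm (f (of_real x)) \<le> C * exp (c * x - exp x)"
  shows "\<exists>R. R holomorphic_on UNIV \<and>
     (\<forall>s P. left_primitive f s P \<longrightarrow> (\<lambda>k. P (of_nat k)) \<longlonglongrightarrow> P 0 + R s)"
proof -
  define V where "V = (\<lambda>k::nat. segment_integral f (of_nat k) 1)"
  have holV: "V k holomorphic_on UNIV" for k
    unfolding V_def using f by (rule segment_integral_holomorphic)
  have cf: "continuous_on UNIV f" using f by (rule holomorphic_on_imp_continuous_on)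
  have "0 \<le> C * exp (c * 1 - exp 1)"
    by (rule order_trans [OF norm_ge_zero decay]) simp
  then have C: "C \<ge> 0" by (simp add: zero_le_mult_iff)
  have bound: "norm (V k s) \<le> (C * exp ((\<bar>c\<bar> + \<rho> + 1)\<^sup>2 / 2)) * exp (- 1) ^ k" if "k \<ge> 1" "norm s \<le> \<rho>" for k s \<rho>
  proof -
    define B where "B = (C * exp ((\<bar>c\<bar> + \<rho> + 1)\<^sup>2 / 2)) * exp (- 1) ^ k"
    have "norm (V k s) \<le> integral {0..1} (\<lambda>x::real. B)"
      unfolding V_def segment_integral_def
    proof (rule integral_norm_bound_integral)
      show "(\<lambda>x. f (of_nat k + of_real x * 1) * exp (s * (of_nat k + of_real x * 1)) * 1) integrable_on {0..1}"
        by (intro integrable_continuous_interval continuous_intros continuous_on_compose2 [OF cf]) auto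
      fix x :: real assume x: "x \<in> {0..1}"
      define y where "y = real k + x"
      have y: "y > 0" "y \<ge> real k" using x that by (auto simp: y_def)
      have "Re s \<le> \<rho>" using that complex_Re_le_cmod [of s] by simp
      then have "exp (Re s * y) \<le> exp (\<rho> * y)" using y by (simp add: mult_right_mono)
      moreover have "exp (c * y - exp y) \<le> exp (\<bar>c\<bar> * y - exp y)" using y by (simp add: mult_right_mono)
      then have "norm (f (of_real y)) \<le> C * exp (\<bar>c\<bar> * y - exp y)"
        using order_trans [OF decay [OF y(1)] mult_left_mono] C by blast
      ultimately have "norm (f (of_real y)) * exp (Re s * y) \<le> (C * exp (\<bar>c\<bar> * y - exp y)) * exp (\<rho> * y)"
        using C by (intro mult_mono) auto
      also have "\<dots> = C * exp ((\<bar>c\<bar> + \<rho>) * y - exp y)"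
        by (simp add: mult.assoc mult_exp_exp algebra_simps)
      also have "\<dots> \<le> C * (exp ((\<bar>c\<bar> + \<rho> + 1)\<^sup>2 / 2) * exp (- y))"
        using C y by (intro mult_left_mono exp_times_exp_bound) auto
      also have "\<dots> \<le> C * (exp ((\<bar>c\<bar> + \<rho> + 1)\<^sup>2 / 2) * exp (- real k))"
        using C y by (intro mult_left_mono) auto
      also have "exp (- real k) = exp (- 1) ^ k"
        by (simp add: exp_of_nat_mult [symmetric])
      finally show "norm (f (of_nat k + of_real x * 1) * exp (s * (of_nat k + of_real x * 1)) * 1) \<le> B"
        by (simp add: B_def y_def norm_mult norm_exp_eq_Re mult.assoc)
    qed auto
    then show ?thesis by (simp add: B_def)
  qed
  have "\<exists>g g'. \<forall>s\<in>UNIV. ((\<lambda>k. V k s) sums g s) \<and> ((\<lambda>k. deriv (V k) s) sums g' s) \<and> (g has_field_derivative g' s) (at s)"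
  proof (rule series_and_derivative_comparison_local [OF open_UNIV])
    show "(V k has_field_derivative deriv (V k) s) (at s)" for k s
      using holomorphic_derivI [OF holV open_UNIV] by simp
    fix x :: complex
    define K where "K = C * exp ((\<bar>c\<bar> + (norm x + 1) + 1)\<^sup>2 / 2)"
    have "norm (V k y) \<le> K * exp (- 1) ^ k" if "k \<ge> 1" "y \<in> ball x 1" for k y
      unfolding K_def
    proof (rule bound [OF that(1)])
      have "norm y \<le> norm x + norm (y - x)" using norm_triangle_ineq [of x "y - x"] by simp
      then show "norm y \<le> norm x + 1" using that(2) by (simp add: dist_norm norm_minus_commute)
    qed
    then have "\<forall>\<^sub>F k in sequentially. \<forall>y\<in>ball x 1 \<inter> UNIV. norm (V k y) \<le> K * exp (- 1) ^ k"
      by (intro eventually_sequentiallyI [of 1]) auto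
    moreover have "summable (\<lambda>k. K * exp (- 1 :: real) ^ k)"
      by (intro summable_mult summable_geometric) simp
    ultimately show "\<exists>d h. 0 < d \<and> summable h \<and> (\<forall>\<^sub>F k in sequentially. \<forall>y\<in>ball x d \<inter> UNIV. norm (V k y) \<le> h k)"
      by (intro exI [of _ 1] exI [of _ "\<lambda>k. K * exp (- 1) ^ k"]) simp
  qed
  then obtain R R' where R: "\<And>s. (\<lambda>k. V k s) sums R s" "\<And>s. (R has_field_derivative R' s) (at s)" by blast
  have "(\<lambda>k. P (of_nat k)) \<longlonglongrightarrow> P 0 + R s" if P: "left_primitive f s P" for s P
  proof -
    have "V k s = P (of_nat (Suc k)) - P (of_nat k)" for k
      unfolding V_def using P by (subst segment_integral_eq [of P]) (auto simp: left_primitive_def add.commute)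
    then have "(\<Sum>k<N. V k s) = P (of_nat N) - P 0" for N
      using sum_lessThan_telescope [of "\<lambda>k. P (of_nat k)" N] by simp
    then have "(\<lambda>N. P (of_nat N) - P 0) \<longlonglongrightarrow> R s"
      using R(1) [of s] by (simp add: sums_def)
    from tendsto_add [OF tendsto_const [of "P 0"] this] show ?thesis by simp
  qed
  moreover have "R holomorphic_on UNIV" using R(2) by (auto simp: holomorphic_on_open)
  ultimately show ?thesis by blast
qed

text \<open>Let D be the transform over the whole line. Integrating by parts n times gives D(s + n)
  = D(s) times the product of the s - \<mu> k, a recursion that n^s times the Gamma product
  satisfies as well. Their quotient is constant along s + n N. Since f behaves like e^(ct - e^t), D
  behaves like Gamma(s + c) there, and letting N grow evaluates the constant.\<close>

lemma mellin_normal_solution: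
  assumes n: "n \<ge> 1" and \<mu>: "(\<Sum>k<n. \<mu> k) = 0" and f: "normal_solution n \<mu> f" and b0: "b 0 = 1"
    and asym: "\<And>N. \<exists>C. \<forall>t. Re t > 0 \<longrightarrow> \<bar>Im t\<bar> < pi / 2 \<longrightarrow>
        norm (f t / exp (bexp n * t - exp t) - (\<Sum>m<N. b m * exp (- of_nat m * t))) \<le> C * exp (- real N * Re t)"
    and tow: "\<And>k. k < n \<Longrightarrow> \<exists>C. \<forall>t. Re t > 0 \<longrightarrow> \<bar>Im t\<bar> < pi / 2 \<longrightarrow>
        norm (tower \<mu> f k t) \<le> C * norm (exp ((of_nat k + bexp n) * t - exp t))"
  shows "\<exists>R. R holomorphic_on UNIV \<and>
     (\<forall>s P. Re s > growth_exp n \<mu> ((-1) ^ n) + real n + 2 \<longrightarrow> left_primitive f s P \<longrightarrow>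
        P 0 + R s = of_real (mellin_const n) * exp (s * of_real (ln (real n))) * (\<Prod>k<n. Gamma ((s - \<mu> k) / of_nat n)))"
proof -
  define A where "A = growth_exp n \<mu> ((-1) ^ n)"
  define F where "F = tower \<mu> f"
  define c where "c = - (real n - 1) / 2"
  have c: "bexp n = of_real c" by (simp add: c_def bexp_def)
  have F: "tower_system n \<mu> ((-1) ^ n) UNIV F"
    unfolding F_def using f by (intro tower_system_tower) (auto simp: normal_solution_def)
  have F0: "F 0 = f" by (simp add: F_def)
  have holf: "f holomorphic_on UNIV" using f by (simp add: normal_solution_def)
  have Fdecay: "\<exists>C. \<forall>x>0. norm (F k (of_real x)) \<le> C * exp ((real k + c) * x - exp x)" if k: "k < n" for k
  proof -
    obtain C where C: "\<And>t. Re t > 0 \<Longrightarrow> \<bar>Im t\<bar> < pi / 2 \<Longrightarrow> norm (F k t) \<le> C * norm (exp ((of_nat k + bexp n) * t - exp t))"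
      using tow [OF k] unfolding F_def by blast
    have "norm (F k (of_real x)) \<le> C * exp ((real k + c) * x - exp x)" if "x > 0" for x
    proof -
      have "Re ((of_nat k + bexp n) * of_real x - exp (of_real x)) = (real k + c) * x - exp x"
        by (simp add: c exp_of_real)
      then show ?thesis using C [of "of_real x"] that by (simp add: norm_exp_eq_Re)
    qed
    then show ?thesis by blast
  qed
  obtain C0 where C0: "\<And>x. x > 0 \<Longrightarrow> norm (f (of_real x)) \<le> C0 * exp (c * x - exp x)"
    using Fdecay [of 0] n by (auto simp: F0)
  obtain R where R: "R holomorphic_on UNIV"
    "\<And>s P. left_primitive f s P \<Longrightarrow> (\<lambda>k. P (of_nat k)) \<longlonglongrightarrow> P 0 + R s"
    using right_part_exists [OF holf C0] by blast
  have exP: "\<exists>P. left_primitive f s P" if "Re s > A" for s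
    using tower_left_primitive_exists [OF F _ that [unfolded A_def], of 0] n by (simp add: F0)
  then obtain P where P: "\<And>s. Re s > A \<Longrightarrow> left_primitive f s (P s)" by metis
  define D where "D = (\<lambda>s. P s 0 + R s)"
  have PD: "(\<lambda>k. P s (of_nat k)) \<longlonglongrightarrow> D s" if "Re s > A" for s
    unfolding D_def using R(2) [OF P [OF that]] .
  have Fto0: "(\<lambda>k. F j (of_nat k) * exp (s * of_nat k)) \<longlonglongrightarrow> 0" if "j < n" for j s
  proof -
    obtain C where C: "\<And>x. x > 0 \<Longrightarrow> norm (F j (of_real x)) \<le> C * exp ((real j + c) * x - exp x)"
      using Fdecay \<open>j < n\<close> by blast
    define K where "K = exp ((real j + c + Re s + 1)\<^sup>2 / 2)"
    have "0 \<le> C * exp ((real j + c) * 1 - exp 1)"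
      by (rule order_trans [OF norm_ge_zero C]) simp
    then have C': "C \<ge> 0" by (simp add: zero_le_mult_iff)
    show ?thesis
    proof (rule Lim_null_comparison, rule eventually_sequentiallyI [of 1])
      fix k :: nat assume k: "1 \<le> k"
      have "norm (F j (of_nat k) * exp (s * of_nat k)) \<le> (C * exp ((real j + c) * real k - exp (real k))) * exp (Re s * real k)"
        using C [of "real k"] k by (simp add: norm_mult norm_exp_eq_Re mult_right_mono)
      also have "\<dots> = C * exp ((real j + c + Re s) * real k - exp (real k))"
        by (simp add: mult.assoc mult_exp_exp algebra_simps)
      also have "\<dots> \<le> C * (K * exp (- real k))"
        unfolding K_def using C' by (intro mult_left_mono exp_times_exp_bound) auto
      finally show "norm (F j (of_nat k) * exp (s * of_nat k)) \<le> (C * K) * exp (- real k)" by simp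
    next
      have "(\<lambda>k. exp (- real k)) \<longlonglongrightarrow> 0"
        by (rule filterlim_compose [OF exp_at_bot]) (simp add: filterlim_uminus_at_bot filterlim_real_sequentially)
      then show "(\<lambda>k. (C * K) * exp (- real k)) \<longlonglongrightarrow> 0" by (rule tendsto_mult_right_zero)
    qed
  qed
  \<comment> \<open>The n integrations by parts produce a sign (-1)^n, which cancels the one in the
    equation; the boundary terms vanish at both ends.\<close>
  have feq: "D (s + of_nat n) = (\<Prod>k<n. s - \<mu> k) * D s" if s: "Re s > A" for s
  proof -
    have "\<exists>Q. left_primitive (F j) s Q \<and> (\<lambda>k. Q (of_nat k)) \<longlonglongrightarrow> (-1) ^ j * (\<Prod>k<j. s - \<mu> k) * D s" if "j \<le> n" for j
      using that
    proof (induction j)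
      case 0
      then show ?case using P [OF s] PD [OF s] by (auto simp: F0)
    next
      case (Suc j)
      then obtain Q where Q: "left_primitive (F j) s Q" "(\<lambda>k. Q (of_nat k)) \<longlonglongrightarrow> (-1) ^ j * (\<Prod>k<j. s - \<mu> k) * D s" by auto
      define Q' where "Q' = (\<lambda>t. F j t * exp (s * t) - (s - \<mu> j) * Q t)"
      have "left_primitive (F (Suc j)) s Q'"
        unfolding Q'_def using Suc.prems s by (intro left_primitive_tower_Suc [OF F _ Q(1)]) (auto simp: A_def)
      moreover have "(\<lambda>k. Q' (of_nat k)) \<longlonglongrightarrow> 0 - (s - \<mu> j) * ((-1) ^ j * (\<Prod>k<j. s - \<mu> k) * D s)"
        unfolding Q'_def using Suc.prems by (intro tendsto_diff tendsto_mult tendsto_const Fto0 Q(2)) auto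
      then have "(\<lambda>k. Q' (of_nat k)) \<longlonglongrightarrow> (-1) ^ Suc j * (\<Prod>k<Suc j. s - \<mu> k) * D s"
        by (simp add: mult_ac)
      ultimately show ?case by blast
    qed
    then obtain Q where Q: "left_primitive (F n) s Q" "(\<lambda>k. Q (of_nat k)) \<longlonglongrightarrow> (-1) ^ n * (\<Prod>k<n. s - \<mu> k) * D s" by blast
    have Fn: "F n t = (-1) ^ n * exp (of_nat n * t) * f t" for t
      using F by (simp add: tower_system_def F0)
    have "left_primitive f (s + of_nat n) (\<lambda>t. (-1) ^ n * Q t)"
      unfolding left_primitive_def
    proof (intro conjI allI)
      fix t
      have "(Q has_field_derivative F n t * exp (s * t)) (at t)" using Q(1) by (simp add: left_primitive_def)
      then have "((\<lambda>t. (-1) ^ n * Q t) has_field_derivative (-1) ^ n * (F n t * exp (s * t))) (at t)" by (rule DERIV_cmult)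
      moreover have "(-1) ^ n * (F n t * exp (s * t)) = ((-1) ^ n * (-1) ^ n) * (f t * (exp (of_nat n * t) * exp (s * t)))"
        by (simp add: Fn)
      moreover have "((-1) ^ n * (-1) ^ n :: complex) = 1" by (simp add: power_mult_distrib [symmetric])
      ultimately show "((\<lambda>t. (-1) ^ n * Q t) has_field_derivative f t * exp ((s + of_nat n) * t)) (at t)"
        by (simp add: mult_exp_exp distrib_right add.commute)
    next
      show "((\<lambda>x. (-1) ^ n * Q (of_real x + \<i> * of_real y)) \<longlongrightarrow> 0) at_bot" for y
        using Q(1) unfolding left_primitive_def by (intro tendsto_mult_right_zero) blast
    qed
    moreover have s': "Re (s + of_nat n) > A" using s by simp
    ultimately have "P (s + of_nat n) = (\<lambda>t. (-1) ^ n * Q t)"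
      using left_primitive_unique [OF P [OF s']] by blast
    then have "(\<lambda>k. (-1) ^ n * Q (of_nat k)) \<longlonglongrightarrow> D (s + of_nat n)"
      using PD [OF s'] by simp
    moreover have "(\<lambda>k. (-1) ^ n * Q (of_nat k)) \<longlonglongrightarrow> (-1) ^ n * ((-1) ^ n * (\<Prod>k<n. s - \<mu> k) * D s)"
      by (intro tendsto_mult tendsto_const Q(2))
    ultimately have "D (s + of_nat n) = (-1) ^ n * ((-1) ^ n * (\<Prod>k<n. s - \<mu> k) * D s)"
      by (rule LIMSEQ_unique)
    also have "\<dots> = ((-1) ^ n * (-1) ^ n) * ((\<Prod>k<n. s - \<mu> k) * D s)" by (simp only: mult.assoc)
    also have "((-1) ^ n * (-1) ^ n :: complex) = 1" by (simp add: power_mult_distrib [symmetric])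
    finally show ?thesis by simp
  qed
  obtain B where B: "\<And>x. x \<le> 0 \<Longrightarrow> norm (f (of_real x)) \<le> B * exp (- A * x)" "B \<ge> 0"
  proof -
    obtain B where "\<forall>k<n. \<forall>t. Re t \<le> 0 \<longrightarrow> \<bar>Im t\<bar> \<le> 0 \<longrightarrow> norm (F k t) \<le> B * exp (- A * Re t)"
      using tower_system_growth [OF F, of 0] unfolding A_def by blast
    then have FB: "Re t \<le> 0 \<Longrightarrow> \<bar>Im t\<bar> \<le> 0 \<Longrightarrow> norm (F 0 t) \<le> B * exp (- A * Re t)" for t
      using n by simp
    have B: "norm (f (of_real x)) \<le> B * exp (- A * x)" if "x \<le> 0" for x
      using FB [of "of_real x"] \<open>x \<le> 0\<close> by (simp add: F0)
    have "0 \<le> B * exp (- A * 0)" by (rule order_trans [OF norm_ge_zero B]) simp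
    then have "B \<ge> 0" by simp
    with B show ?thesis using that by blast
  qed
  obtain C2 where C2: "\<And>t. Re t > 0 \<Longrightarrow> \<bar>Im t\<bar> < pi / 2 \<Longrightarrow> norm (f t / exp (bexp n * t - exp t) - 1) \<le> C2 * exp (- Re t)"
    using asym [of 1] b0 by auto
  have "0 \<le> C2 * exp (- Re 1)"
    by (rule order_trans [OF norm_ge_zero C2]) auto
  then have C2': "C2 \<ge> 0" by (simp add: zero_le_mult_iff)
  \<comment> \<open>The relative error of the leading term of the expansion is e^-x, which lowers
    the argument of Gamma by 1. The halves over t \<le> 0 contribute a bounded amount only.\<close>
  have close: "norm (D s - Gamma (s + bexp n)) \<le> (B + 1 + C2) + C2 * Gamma (Re (s + bexp n) - 1)"
    if s: "Re s > A + real n + 2" for s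
  proof -
    define z where "z = s + bexp n"
    define r where "r = Re z - 1"
    have A0: "A \<ge> 0" by (simp add: A_def growth_exp_nonneg)
    have r: "r \<ge> 1" using s A0 n by (simp add: r_def z_def c c_def field_simps)
    obtain J where J: "\<And>x. (J has_vector_derivative exp (z * of_real x - of_real (exp x))) (at x)"
      "(\<lambda>k. J (real k)) \<longlonglongrightarrow> Gamma z" "norm (J 0) \<le> 1"
      using Gamma_incomplete_exists [of z] r by (auto simp: r_def)
    obtain j where j: "\<And>x. (j has_vector_derivative exp (of_real r * of_real x - of_real (exp x))) (at x)"
      "(\<lambda>k. j (real k)) \<longlonglongrightarrow> Gamma (complex_of_real r)" "norm (j 0) \<le> 1"
      using Gamma_incomplete_exists [of "of_real r"] r by auto
    define E where "E = (\<lambda>x. P s (of_real x) - J x)"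
    define \<phi> where "\<phi> = (\<lambda>x. C2 * Re (j x))"
    have sA: "Re s > A" using s n by simp
    have E': "(E has_vector_derivative f (of_real x) * exp (s * of_real x) - exp (z * of_real x - of_real (exp x))) (at x)" for x
    proof -
      have "((\<lambda>x. P s (0 + of_real x * 1)) has_vector_derivative f (0 + of_real x * 1) * exp (s * (0 + of_real x * 1)) * 1) (at x)"
        using P [OF sA] by (intro has_vector_derivative_segment) (simp add: left_primitive_def)
      then have "((\<lambda>x. P s (of_real x)) has_vector_derivative f (of_real x) * exp (s * of_real x)) (at x)" by simp
      then show ?thesis unfolding E_def by (intro has_vector_derivative_diff J)
    qed
    have \<phi>': "(\<phi> has_vector_derivative C2 * exp (r * x - exp x)) (at x)" for x
    proof -
      have "((\<lambda>x. Re (j x)) has_vector_derivative Re (exp (of_real r * of_real x - of_real (exp x)))) (at x)"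
        by (rule bounded_linear.has_vector_derivative [OF bounded_linear_Re j(1)])
      moreover have "exp (of_real r * of_real x - of_real (exp x)) = complex_of_real (exp (r * x - exp x))"
        by (simp add: exp_of_real [symmetric])
      ultimately have "((\<lambda>x. Re (j x)) has_real_derivative exp (r * x - exp x)) (at x)"
        by (simp add: has_real_derivative_iff_has_vector_derivative)
      from DERIV_cmult [OF this] show ?thesis
        by (simp add: \<phi>_def has_real_derivative_iff_has_vector_derivative)
    qed
    have cont: "isCont E x" "isCont \<phi> x" for x
      using E' \<phi>' has_vector_derivative_continuous by blast+
    have diff: "norm (E (real k) - E 0) \<le> \<phi> (real k) - \<phi> 0" if "k \<ge> 1" for k
    proof (rule differentiable_bound_general [OF _ _ _ E' \<phi>'])
      show "continuous_on {0..real k} E" "continuous_on {0..real k} \<phi>"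
        using cont by (auto intro!: continuous_at_imp_continuous_on)
      fix x :: real assume x: "0 < x" "x < real k"
      define u where "u = exp (bexp n * of_real x - exp (of_real x))"
      have "f (of_real x) * exp (s * of_real x) - exp (z * of_real x - of_real (exp x))
          = (f (of_real x) / u - 1) * (u * exp (s * of_real x))"
      proof -
        have "exp (z * of_real x - of_real (exp x)) = u * exp (s * of_real x)"
          by (simp add: u_def z_def mult_exp_exp exp_of_real algebra_simps)
        then show ?thesis by (simp add: u_def field_simps)
      qed
      also have "norm \<dots> \<le> (C2 * exp (- x)) * norm (u * exp (s * of_real x))"
        unfolding norm_mult using C2 [of "of_real x"] x unfolding u_def [symmetric]
        by (intro mult_right_mono) auto
      also have "norm (u * exp (s * of_real x)) = exp (Re z * x - exp x)"
        by (simp add: u_def norm_mult norm_exp_eq_Re z_def mult_exp_exp c exp_of_real algebra_simps)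
      also have "(C2 * exp (- x)) * exp (Re z * x - exp x) = C2 * exp (r * x - exp x)"
        by (simp add: r_def mult.assoc mult_exp_exp algebra_simps)
      finally show "norm (f (of_real x) * exp (s * of_real x) - exp (z * of_real x - of_real (exp x))) \<le> C2 * exp (r * x - exp x)" .
    qed (use that in auto)
    have "(\<lambda>k. norm (E (real k) - E 0)) \<longlonglongrightarrow> norm (D s - Gamma z - E 0)"
      unfolding E_def using PD [OF sA] J(2) by (intro tendsto_norm tendsto_diff tendsto_const) auto
    moreover have "(\<lambda>k. \<phi> (real k) - \<phi> 0) \<longlonglongrightarrow> C2 * Re (Gamma (complex_of_real r)) - \<phi> 0"
      unfolding \<phi>_def using j(2) by (intro tendsto_diff tendsto_mult tendsto_Re tendsto_const)
    ultimately have "norm (D s - Gamma z - E 0) \<le> C2 * Re (Gamma (complex_of_real r)) - \<phi> 0"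
      by (rule LIMSEQ_le) (use diff in blast)
    also have "Re (Gamma (complex_of_real r)) = Gamma r" by (simp add: Gamma_complex_of_real)
    also have "- \<phi> 0 \<le> C2"
    proof -
      have "\<bar>Re (j 0)\<bar> \<le> 1" using j(3) abs_Re_le_cmod order_trans by blast
      then have "C2 * - Re (j 0) \<le> C2 * 1" using C2' by (intro mult_left_mono) auto
      then show ?thesis by (simp add: \<phi>_def)
    qed
    then have "C2 * Gamma r - \<phi> 0 \<le> C2 * Gamma r + C2" by simp
    finally have 1: "norm (D s - Gamma z - E 0) \<le> C2 * Gamma r + C2" .
    have "norm (P s 0) \<le> B / (Re s - A)"
      by (rule left_primitive_bound [OF P [OF sA] B(1) sA B(2)])
    also have "\<dots> \<le> B / 1" using s B(2) n by (intro divide_left_mono) auto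
    finally have 2: "norm (E 0) \<le> B + 1"
      using J(3) unfolding E_def by (simp add: norm_triangle_le_diff)
    have "norm (D s - Gamma z) \<le> norm (D s - Gamma z - E 0) + norm (E 0)"
      using norm_triangle_ineq [of "D s - Gamma z - E 0" "E 0"] by simp
    then show ?thesis using 1 2 by (simp add: z_def r_def)
  qed
  have main: "D s = of_real (mellin_const n) * exp (s * of_real (ln (real n))) * (\<Prod>k<n. Gamma ((s - \<mu> k) / of_nat n))"
    if s: "Re s > A + real n + 2" for s
  proof -
    define z where "z = s + bexp n"
    define w where "w = (\<lambda>k. (s - \<mu> k) / of_nat n)"
    \<comment> \<open>The expected product at s + n N without its constant; D satisfies the same
      recursion in N.\<close>
    define T where "T = (\<lambda>N. exp ((s + of_nat (n * N)) * of_real (ln (real n))) * (\<Prod>k<n. Gamma (w k + of_nat N)))"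
    have A0: "A \<ge> 0" by (simp add: A_def growth_exp_nonneg)
    have z: "Re z > 1" using s A0 n by (simp add: z_def c c_def field_simps)
    have zI: "z \<notin> \<int>\<^sub>\<le>\<^sub>0" using z by (auto elim!: nonpos_Ints_cases)
    have w: "Re (w k) > 0" if "k < n" for k
    proof -
      have "Re (\<mu> k) \<le> A" using growth_exp_ge [OF that, of \<mu> "(-1) ^ n"] complex_Re_le_cmod [of "\<mu> k"] by (simp add: A_def)
      then show ?thesis using s n by (simp add: w_def)
    qed
    have wI: "w k + of_nat N \<notin> \<int>\<^sub>\<le>\<^sub>0" if "k < n" for k N
      using w [OF that] by (auto elim!: nonpos_Ints_cases simp: complex_eq_iff)
    have T0: "T N \<noteq> 0" for N
      using wI by (auto simp: T_def Gamma_eq_zero_iff)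
    have step: "D (s + of_nat (n * N)) / T N = D s / T 0" for N
    proof (induction N)
      case (Suc N)
      have "0 \<le> real n * real N" by simp
      then have "Re s + real n * real N > A" using s by linarith
      then have "Re (s + of_nat (n * N)) > A" by simp
      from feq [OF this] have "D (s + of_nat (n * Suc N)) = (\<Prod>k<n. s + of_nat (n * N) - \<mu> k) * D (s + of_nat (n * N))"
        by (simp add: algebra_simps)
      also have "(\<Prod>k<n. s + of_nat (n * N) - \<mu> k) = (\<Prod>k<n. of_nat n * (w k + of_nat N))"
        using n by (intro prod.cong refl) (simp add: w_def field_simps)
      also have "\<dots> = of_nat n ^ n * (\<Prod>k<n. w k + of_nat N)" by (simp add: prod.distrib)
      finally have Ds: "D (s + of_nat (n * Suc N)) = of_nat n ^ n * (\<Prod>k<n. w k + of_nat N) * D (s + of_nat (n * N))" .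
      have TS: "T (Suc N) = of_nat n ^ n * (\<Prod>k<n. w k + of_nat N) * T N"
      proof -
        have g1: "(\<Prod>k<n. Gamma (w k + of_nat (Suc N))) = (\<Prod>k<n. (w k + of_nat N) * Gamma (w k + of_nat N))"
          using Gamma_plus1 [OF wI] by (intro prod.cong refl) (simp add: add_ac)
        have g2: "exp ((s + of_nat (n * Suc N)) * of_real (ln (real n)))
            = exp (of_nat n * complex_of_real (ln (real n))) * exp ((s + of_nat (n * N)) * of_real (ln (real n)))"
          by (simp add: mult_exp_exp algebra_simps)
        have g3: "exp (of_nat n * complex_of_real (ln (real n))) = of_nat n ^ n"
          using n by (simp add: exp_of_nat_mult exp_of_real)
        show ?thesis unfolding T_def g1 g2 g3 prod.distrib by (simp only: mult_ac)
      qed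
      then have nz: "of_nat n ^ n * (\<Prod>k<n. w k + of_nat N) \<noteq> 0" using T0 [of "Suc N"] by auto
      have "D (s + of_nat (n * Suc N)) / T (Suc N) = D (s + of_nat (n * N)) / T N"
        unfolding Ds TS by (rule mult_divide_mult_cancel_left [OF nz])
      then show ?case using Suc by simp
    qed simp
    have lim1: "(\<lambda>N. Gamma (z + of_nat (n * N)) / T N) \<longlonglongrightarrow> of_real (mellin_const n)"
      using Gamma_quotient_asymptotic [OF n \<mu>, of s] zI wI [of _ 0] unfolding T_def z_def w_def by simp
    have sub: "filterlim (\<lambda>N. n * N) sequentially sequentially"
      using n by (intro filterlim_subseq) (auto simp: strict_mono_def)
    have lim2: "(\<lambda>N. D (s + of_nat (n * N)) / Gamma (z + of_nat (n * N)) - 1) \<longlonglongrightarrow> 0"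
    proof (rule Lim_null_comparison, rule always_eventually, rule allI)
      fix N
      have "0 \<le> real n * real N" by simp
      then have "Re s + real n * real N > A + real n + 2" using s by linarith
      then have "Re (s + of_nat (n * N)) > A + real n + 2" by simp
      from close [OF this] have "norm (D (s + of_nat (n * N)) - Gamma (z + of_nat (n * N)))
          \<le> (B + 1 + C2) + C2 * Gamma (Re z - 1 + real (n * N))"
        by (simp add: z_def algebra_simps)
      moreover have G: "Gamma (z + of_nat (n * N)) \<noteq> 0"
      proof -
        have "Re (z + of_nat (n * N)) > 0" using z by (simp add: add_pos_nonneg)
        then have "z + of_nat (n * N) \<notin> \<int>\<^sub>\<le>\<^sub>0" by (rule Re_pos_not_nonpos_Int)
        then show ?thesis by (simp add: Gamma_eq_zero_iff)
      qed
      ultimately have "norm (D (s + of_nat (n * N)) - Gamma (z + of_nat (n * N))) / norm (Gamma (z + of_nat (n * N)))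
          \<le> ((B + 1 + C2) + C2 * Gamma (Re z - 1 + real (n * N))) / norm (Gamma (z + of_nat (n * N)))"
        by (intro divide_right_mono) auto
      moreover have "D (s + of_nat (n * N)) / Gamma (z + of_nat (n * N)) - 1
          = (D (s + of_nat (n * N)) - Gamma (z + of_nat (n * N))) / Gamma (z + of_nat (n * N))"
        using G by (simp add: diff_divide_distrib)
      ultimately show "norm (D (s + of_nat (n * N)) / Gamma (z + of_nat (n * N)) - 1)
          \<le> (B + 1 + C2) * (1 / norm (Gamma (z + of_nat (n * N)))) + C2 * (Gamma (Re z - 1 + real (n * N)) / norm (Gamma (z + of_nat (n * N))))"
        by (simp add: norm_divide add_divide_distrib)
    next
      have "(\<lambda>N. (B + 1 + C2) * (1 / norm (Gamma (z + of_nat (n * N)))) + C2 * (Gamma (Re z - 1 + real (n * N)) / norm (Gamma (z + of_nat (n * N)))))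
          \<longlonglongrightarrow> (B + 1 + C2) * 0 + C2 * 0"
        by (intro tendsto_add tendsto_mult tendsto_const
            filterlim_compose [OF Gamma_shift_decay(1) [OF z] sub] filterlim_compose [OF Gamma_shift_decay(2) [OF z] sub])
      then show "(\<lambda>N. (B + 1 + C2) * (1 / norm (Gamma (z + of_nat (n * N)))) + C2 * (Gamma (Re z - 1 + real (n * N)) / norm (Gamma (z + of_nat (n * N)))))
          \<longlonglongrightarrow> 0" by simp
    qed
    have "(\<lambda>N. (D (s + of_nat (n * N)) / Gamma (z + of_nat (n * N)) - 1 + 1) * (Gamma (z + of_nat (n * N)) / T N)) \<longlonglongrightarrow> (0 + 1) * of_real (mellin_const n)"
      by (intro tendsto_mult tendsto_add lim1 lim2 tendsto_const)
    moreover have "(D (s + of_nat (n * N)) / Gamma (z + of_nat (n * N)) - 1 + 1) * (Gamma (z + of_nat (n * N)) / T N) = D s / T 0" for N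
    proof -
      have "Re (z + of_nat (n * N)) > 0" using z by (simp add: add_pos_nonneg)
      then have "z + of_nat (n * N) \<notin> \<int>\<^sub>\<le>\<^sub>0" by (rule Re_pos_not_nonpos_Int)
      then have "Gamma (z + of_nat (n * N)) \<noteq> 0" by (simp add: Gamma_eq_zero_iff)
      then show ?thesis using step [of N] by simp
    qed
    ultimately have "D s / T 0 = of_real (mellin_const n)" by (simp add: LIMSEQ_const_iff)
    then show ?thesis using T0 [of 0] by (simp add: T_def w_def field_simps)
  qed
  show ?thesis
  proof (intro exI conjI allI impI, rule R(1))
    fix s Q assume s: "Re s > growth_exp n \<mu> ((-1) ^ n) + real n + 2" and Q: "left_primitive f s Q"
    have "Re s > A" using s n by (simp add: A_def)
    then have "Q = P s" using left_primitive_unique [OF Q P] by blast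
    then show "Q 0 + R s = of_real (mellin_const n) * exp (s * of_real (ln (real n))) * (\<Prod>k<n. Gamma ((s - \<mu> k) / of_nat n))"
      using main [of s] s by (simp add: D_def A_def)
  qed
qed

section \<open>A difference equation with boundary terms and Liouville's theorem\<close>

section \<open>Vanishing of solutions with entire Mellin transform\<close>

text \<open>With the boundary values F k 0 included, integration by parts continues the transforms
  of all stages to entire functions, and the equation yields a relation between m(s) and m(s + n).
  For large |s| the product of the s - \<mu> i dominates, so |m(s)| is at most half of |m(s + n)|
  plus a constant. Boundedness thus spreads from the right to the whole plane; m is constant, and 0
  by decay. The initial values then vanish one after another.\<close>

lemma tower_zero_of_entire_mellin:
  assumes n: "n \<ge> 1" and F: "tower_system n \<mu> \<kappa> UNIV F"
    and hol: "m holomorphic_on UNIV" and \<sigma>: "\<sigma> > growth_exp n \<mu> \<kappa>"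
    and m: "\<And>s P. Re s > \<sigma> \<Longrightarrow> left_primitive (F 0) s P \<Longrightarrow> P 0 = m s"
  shows "F 0 t = 0"
proof -
  define A where "A = growth_exp n \<mu> \<kappa>"
  have A0: "A \<ge> 0" by (simp add: A_def growth_exp_nonneg)
  define M where "M = (\<lambda>s. rec_nat (m s) (\<lambda>k x. F k 0 - (s - \<mu> k) * x))"
  have M0: "M s 0 = m s" and MS: "M s (Suc k) = F k 0 - (s - \<mu> k) * M s k" for s k
    by (simp_all add: M_def)
  have exP: "\<exists>P. left_primitive (F k) s P" if "Re s > \<sigma>" "k < n" for s k
    using tower_left_primitive_exists [OF F that(2), of s] that \<sigma> by simp
  have MP: "\<exists>P. left_primitive (F k) s P \<and> P 0 = M s k" if s: "Re s > \<sigma>" and "k \<le> n" for s k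
    using that(2)
  proof (induction k)
    case 0
    then show ?case using exP [OF s, of 0] n m [OF s] by (auto simp: M0)
  next
    case (Suc k)
    then obtain P where P: "left_primitive (F k) s P" "P 0 = M s k" by auto
    have "left_primitive (F (Suc k)) s (\<lambda>t. F k t * exp (s * t) - (s - \<mu> k) * P t)"
      using Suc.prems s \<sigma> by (intro left_primitive_tower_Suc [OF F _ P(1)]) auto
    then show ?case
      by (intro exI [of _ "\<lambda>t. F k t * exp (s * t) - (s - \<mu> k) * P t"]) (simp add: MS P(2))
  qed
  have holM: "(\<lambda>s. M s k) holomorphic_on UNIV" for k
    by (induction k) (auto simp: M0 MS intro!: holomorphic_intros hol)
  have Mn: "M s n = \<kappa> * m (s + of_nat n)" for s
  proof -
    have right: "M s n - \<kappa> * m (s + of_nat n) = 0" if s: "Re s > \<sigma>" for s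
    proof -
      obtain P where P: "left_primitive (F n) s P" "P 0 = M s n" using MP [OF s order_refl] by blast
      have s': "Re (s + of_nat n) > \<sigma>" using s by simp
      obtain Q where Q: "left_primitive (F 0) (s + of_nat n) Q" using exP [OF s', of 0] n by auto
      have "left_primitive (F n) s (\<lambda>t. \<kappa> * Q t)"
        unfolding left_primitive_def
      proof (intro conjI allI)
        fix t
        have "(Q has_field_derivative F 0 t * exp ((s + of_nat n) * t)) (at t)" using Q by (simp add: left_primitive_def)
        then have "((\<lambda>t. \<kappa> * Q t) has_field_derivative \<kappa> * (F 0 t * exp ((s + of_nat n) * t))) (at t)" by (rule DERIV_cmult)
        moreover have "F n t * exp (s * t) = \<kappa> * (F 0 t * (exp (of_nat n * t) * exp (s * t)))"
          using F by (simp add: tower_system_def)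
        ultimately show "((\<lambda>t. \<kappa> * Q t) has_field_derivative F n t * exp (s * t)) (at t)"
          by (simp add: mult_exp_exp distrib_right add.commute)
      next
        show "((\<lambda>x. \<kappa> * Q (of_real x + \<i> * of_real y)) \<longlongrightarrow> 0) at_bot" for y
          using Q unfolding left_primitive_def by (intro tendsto_mult_right_zero) blast
      qed
      then have "P = (\<lambda>t. \<kappa> * Q t)" by (rule left_primitive_unique [OF P(1)])
      then show ?thesis using P(2) m [OF s' Q] by simp
    qed
    have "M s n - \<kappa> * m (s + of_nat n) = 0"
    proof (rule analytic_continuation_open [where f = "\<lambda>s. M s n - \<kappa> * m (s + of_nat n)" and g = "\<lambda>_. 0" and s = "{s. Re s > \<sigma>}" and s' = UNIV])
      have "(m \<circ> (\<lambda>s. s + of_nat n)) holomorphic_on UNIV"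
        by (intro holomorphic_on_compose_gen [OF _ hol] holomorphic_intros) auto
      then show "(\<lambda>s. M s n - \<kappa> * m (s + of_nat n)) holomorphic_on UNIV"
        using holM by (intro holomorphic_intros) (auto simp: o_def)
      show "{s. Re s > \<sigma>} \<noteq> {}" by (metis (mono_tags) Re_complex_of_real empty_iff mem_Collect_eq gt_ex)
    qed (use right in \<open>auto simp: open_halfspace_Re_gt\<close>)
    then show ?thesis by simp
  qed
  \<comment> \<open>Separates the main term from the boundary values. The latter contribute degree k
    - 1 in s, one less than the product. For k = 0, where truncated subtraction would allow a
    constant, the contribution is 0.\<close>
  have bounds: "\<exists>B\<ge>0. \<exists>\<beta>. \<forall>s. M s k = (-1) ^ k * (\<Prod>i<k. s - \<mu> i) * m s + \<beta> s \<and> norm (\<beta> s) \<le> B * (1 + norm s) ^ (k - 1) \<and> (k = 0 \<longrightarrow> \<beta> s = 0)" for k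
  proof (induction k)
    case 0
    then show ?case by (intro exI [of _ 0] conjI exI [of _ "\<lambda>_. 0"]) (auto simp: M0)
  next
    case (Suc k)
    then obtain B \<beta> where B: "B \<ge> 0" and \<beta>: "\<And>s. M s k = (-1) ^ k * (\<Prod>i<k. s - \<mu> i) * m s + \<beta> s"
      "\<And>s. norm (\<beta> s) \<le> B * (1 + norm s) ^ (k - 1)" "\<And>s. k = 0 \<Longrightarrow> \<beta> s = 0" by blast
    define B' where "B' = norm (F k 0) + (1 + norm (\<mu> k)) * B"
    define \<beta>' where "\<beta>' = (\<lambda>s. F k 0 - (s - \<mu> k) * \<beta> s)"
    have "M s (Suc k) = (-1) ^ Suc k * (\<Prod>i<Suc k. s - \<mu> i) * m s + \<beta>' s" for s
      by (simp add: MS \<beta>(1) \<beta>'_def algebra_simps)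
    moreover have "norm (\<beta>' s) \<le> B' * (1 + norm s) ^ (Suc k - 1)" for s
    proof -
      have 1: "1 \<le> (1 + norm s) ^ k" by (rule one_le_power) simp
      have "norm ((s - \<mu> k) * \<beta> s) \<le> ((1 + norm (\<mu> k)) * B) * (1 + norm s) ^ k"
      proof (cases k)
        case 0
        then show ?thesis using \<beta>(3) B by simp
      next
        case (Suc j)
        have "norm (s - \<mu> k) \<le> norm s + norm (\<mu> k)" by (rule norm_triangle_ineq4)
        also have "\<dots> \<le> (1 + norm (\<mu> k)) * (1 + norm s)" by (simp add: algebra_simps)
        finally have "norm ((s - \<mu> k) * \<beta> s) \<le> ((1 + norm (\<mu> k)) * (1 + norm s)) * (B * (1 + norm s) ^ (k - 1))"
          unfolding norm_mult using \<beta>(2) by (intro mult_mono) auto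
        also have "\<dots> = ((1 + norm (\<mu> k)) * B) * (1 + norm s) ^ k" by (simp add: Suc)
        finally show ?thesis .
      qed
      moreover have "norm (F k 0) * 1 \<le> norm (F k 0) * (1 + norm s) ^ k" using 1 by (intro mult_left_mono) auto
      moreover have "norm (\<beta>' s) \<le> norm (F k 0) + norm ((s - \<mu> k) * \<beta> s)"
        unfolding \<beta>'_def by (rule norm_triangle_ineq4)
      ultimately show ?thesis by (simp add: B'_def distrib_right)
    qed
    moreover have "B' \<ge> 0" using B by (simp add: B'_def)
    ultimately show ?case by (intro exI [of _ B'] conjI exI [of _ \<beta>']) auto
  qed
  obtain B \<beta> where B: "B \<ge> 0" and \<beta>: "\<And>s. M s n = (-1) ^ n * (\<Prod>i<n. s - \<mu> i) * m s + \<beta> s"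
      "\<And>s. norm (\<beta> s) \<le> B * (1 + norm s) ^ (n - 1)" using bounds [of n] by blast
  obtain j where j: "n = Suc j" using n by (cases n) auto
  \<comment> \<open>Beyond R every |s - \<mu> i| is at least |s| / 2, and the n-th power of |s| / 2
    is at least 2 |\<kappa>|, which gives the factor 1/2.\<close>
  define R where "R = 2 * A + 1 + 2 * 2 ^ n * norm \<kappa>"
  have step: "norm (m s) \<le> norm (m (s + of_nat n)) / 2 + B * 4 ^ n" if s: "norm s > R" for s
  proof -
    have "0 \<le> 2 * 2 ^ n * norm \<kappa>" by simp
    then have s1: "norm s \<ge> 1" "norm s \<ge> 2 * A" "norm s \<ge> 2 * 2 ^ n * norm \<kappa>"
      using s A0 unfolding R_def by linarith+
    define p where "p = norm (\<Prod>i<n. s - \<mu> i)"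
    have "(\<Prod>i<n. norm s / 2) \<le> (\<Prod>i<n. norm (s - \<mu> i))"
    proof (rule prod_mono)
      fix i assume "i \<in> {..<n}"
      then have "norm (\<mu> i) \<le> A" using growth_exp_ge [of i n \<mu> \<kappa>] by (simp add: A_def)
      then show "0 \<le> norm s / 2 \<and> norm s / 2 \<le> norm (s - \<mu> i)"
        using norm_triangle_ineq2 [of s "\<mu> i"] s1 by simp
    qed
    then have p: "(norm s / 2) ^ n \<le> p" by (simp add: p_def prod_norm)
    have p0: "(norm s / 2) ^ n > 0" using s1(1) by (intro zero_less_power) linarith
    have "p * norm (m s) = norm ((-1) ^ n * (\<Prod>i<n. s - \<mu> i) * m s)"
      by (simp add: p_def norm_mult norm_power)
    also have "(-1) ^ n * (\<Prod>i<n. s - \<mu> i) * m s = \<kappa> * m (s + of_nat n) - \<beta> s"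
      using \<beta>(1) [of s] Mn [of s] by (simp add: algebra_simps)
    also have "norm \<dots> \<le> norm \<kappa> * norm (m (s + of_nat n)) + B * (1 + norm s) ^ (n - 1)"
      using \<beta>(2) [of s] norm_triangle_ineq4 [of "\<kappa> * m (s + of_nat n)" "\<beta> s"] by (simp add: norm_mult)
    finally have "(norm s / 2) ^ n * norm (m s) \<le> norm \<kappa> * norm (m (s + of_nat n)) + B * (1 + norm s) ^ (n - 1)"
      using mult_right_mono [OF p norm_ge_zero [of "m s"]] by (rule order_trans [rotated])
    also have "norm \<kappa> * norm (m (s + of_nat n)) \<le> ((norm s / 2) ^ n / 2) * norm (m (s + of_nat n))"
    proof (rule mult_right_mono)
      have "norm s \<le> norm s ^ n" using s1 n by (intro self_le_power) auto
      then have "2 * 2 ^ n * norm \<kappa> \<le> norm s ^ n" using s1 by linarith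
      then show "norm \<kappa> \<le> (norm s / 2) ^ n / 2" by (simp add: power_divide field_simps)
    qed simp
    also have "B * (1 + norm s) ^ (n - 1) \<le> B * ((norm s / 2) ^ n * 4 ^ n)"
    proof (rule mult_left_mono [OF _ B])
      have "(1 + norm s) ^ (n - 1) \<le> (1 + norm s) ^ n" by (rule power_increasing) auto
      also have "\<dots> \<le> (2 * norm s) ^ n" using s1 by (intro power_mono) auto
      also have "2 * norm s = norm s / 2 * 4" by simp
      also have "\<dots> ^ n = (norm s / 2) ^ n * 4 ^ n" by (rule power_mult_distrib)
      finally show "(1 + norm s) ^ (n - 1) \<le> (norm s / 2) ^ n * 4 ^ n" .
    qed
    finally have "(norm s / 2) ^ n * norm (m s) \<le> (norm s / 2) ^ n * (norm (m (s + of_nat n)) / 2 + B * 4 ^ n)"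
      by (simp add: algebra_simps)
    then show ?thesis using p0 by (rule mult_left_le_imp_le)
  qed
  have growth: "\<exists>C\<ge>0. \<forall>x\<le>0. norm (F k (of_real x)) \<le> C * exp (- A * x)" if k: "k < n" for k
  proof -
    obtain C where "\<forall>k<n. \<forall>t. Re t \<le> 0 \<longrightarrow> \<bar>Im t\<bar> \<le> 0 \<longrightarrow> norm (F k t) \<le> C * exp (- A * Re t)"
      using tower_system_growth [OF F, of 0] unfolding A_def by blast
    note C = this
    have Cx: "norm (F k (of_real x)) \<le> C * exp (- A * x)" if "x \<le> 0" for x
      using C [rule_format, OF k, of "of_real x"] that by simp
    have "0 \<le> C * exp (- A * 0)" by (rule order_trans [OF norm_ge_zero Cx]) simp
    then show ?thesis using Cx by auto
  qed
  have Mdecay: "\<exists>C. \<forall>s. Re s > \<sigma> \<longrightarrow> norm (M s k) \<le> C / (Re s - A)" if k: "k < n" for k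
  proof -
    obtain C where C: "C \<ge> 0" "\<And>x. x \<le> 0 \<Longrightarrow> norm (F k (of_real x)) \<le> C * exp (- A * x)"
      using growth [OF k] by blast
    have "norm (M s k) \<le> C / (Re s - A)" if s: "Re s > \<sigma>" for s
    proof -
      obtain P where P: "left_primitive (F k) s P" "P 0 = M s k" using MP [OF s less_imp_le [OF k]] by blast
      have "Re s > A" using s \<sigma> by (simp add: A_def)
      from left_primitive_bound [OF P(1) C(2) this C(1)] show ?thesis by (simp add: P(2))
    qed
    then show ?thesis by blast
  qed
  have const0: "v = 0" if v: "\<And>s. Re s > \<sigma> \<Longrightarrow> norm v \<le> C / (Re s - A)" for v :: complex and C
  proof -
    have "((\<lambda>x. C / (x - A)) \<longlongrightarrow> 0) at_top" by real_asymp
    moreover have "\<forall>\<^sub>F x in at_top. norm v \<le> C / (x - A)"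
      using eventually_gt_at_top [of \<sigma>] by eventually_elim (use v [of "of_real _"] in simp)
    ultimately have "norm v \<le> 0" by (rule tendsto_lowerbound) simp
    then show ?thesis by simp
  qed
  obtain C where C: "\<And>s. Re s > \<sigma> \<Longrightarrow> norm (m s) \<le> C / (Re s - A)"
    using Mdecay [of 0] n by (auto simp: M0)
  have "compact (m ` cball 0 R)"
    by (intro compact_continuous_image continuous_on_subset [OF holomorphic_on_imp_continuous_on [OF hol]]) auto
  then have "bounded (m ` cball 0 R)" by (rule compact_imp_bounded)
  then obtain S where S0: "\<forall>x\<in>m ` cball 0 R. norm x \<le> S" unfolding bounded_iff by blast
  have S: "norm (m s) \<le> S" if "norm s \<le> R" for s using S0 that by auto
  define G where "G = max (\<bar>C\<bar>) (max S (2 * (B * 4 ^ n)))"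
  \<comment> \<open>Induction on the number of steps of length n that lead into the half-plane of
    known bounds. G absorbs the constant of the halving estimate: half of G bounds it, and the other
    half comes from m(s + n).\<close>
  have "norm (m s) \<le> G" if "Re s + real n * real k > \<sigma> + 1" for s k
    using that
  proof (induction k arbitrary: s)
    case 0
    then have s: "Re s > \<sigma>" "Re s - A \<ge> 1" using \<sigma> by (auto simp: A_def)
    have "norm (m s) \<le> C / (Re s - A)" by (rule C [OF s(1)])
    also have "\<dots> \<le> \<bar>C\<bar> / (Re s - A)" using s by (intro divide_right_mono) auto
    also have "\<dots> \<le> \<bar>C\<bar> / 1" using s by (intro divide_left_mono) auto
    also have "\<dots> \<le> G" by (simp add: G_def)
    finally show ?case .
  next
    case (Suc k)
    show ?case
    proof (cases "norm s \<le> R")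
      case True
      then show ?thesis using S [OF True] by (simp add: G_def)
    next
      case False
      have "norm (m (s + of_nat n)) \<le> G" using Suc.prems by (intro Suc.IH) (simp add: algebra_simps)
      moreover have "B * 4 ^ n \<le> G / 2" by (simp add: G_def)
      ultimately show ?thesis using step [of s] False by simp
    qed
  qed note mG = this
  have "norm (m s) \<le> G" for s
  proof -
    obtain k :: nat where k: "\<sigma> + 1 - Re s < real k" using reals_Archimedean2 by blast
    have "real k * 1 \<le> real k * real n" using n by (intro mult_left_mono) auto
    then show ?thesis using k by (intro mG [of s k]) (simp add: mult.commute)
  qed
  then have "bounded (range m)" by (auto simp: bounded_iff)
  then have "m constant_on UNIV" using hol by (intro Liouville_theorem)
  then obtain v where v: "\<And>s. m s = v" by (auto simp: constant_on_def)
  have v0: "v = 0" by (rule const0 [of v C]) (use C v in metis)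
  \<comment> \<open>Once the earlier transforms vanish, the next one is the constant F k 0. It has
    to decay if it belongs to a stage below n, and equals \<kappa> m(s + n) = 0 for the n-th
    stage.\<close>
  have init: "F k 0 = 0 \<and> (\<forall>s. M s k = 0)" if "k < n" for k
    using that
  proof (induction k)
    case 0
    have "M s 1 = F 0 0" for s using MS [of s 0] by (simp add: M0 v v0)
    then show ?case
    proof (cases "n = 1")
      case True
      then have "F 0 0 = 0" using Mn [of 0] \<open>M 0 1 = F 0 0\<close> by (simp add: v v0)
      then show ?thesis by (simp add: M0 v v0)
    next
      case False
      then obtain C where "\<And>s. Re s > \<sigma> \<Longrightarrow> norm (M s 1) \<le> C / (Re s - A)" using Mdecay [of 1] n by auto
      then have "F 0 0 = 0" using \<open>\<And>s. M s 1 = F 0 0\<close> by (intro const0 [of _ C]) simp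
      then show ?thesis by (simp add: M0 v v0)
    qed
  next
    case (Suc k)
    then have Mk: "F k 0 = 0" "\<And>s. M s k = 0" by auto
    then have Mk1: "M s (Suc k) = 0" for s by (simp add: MS)
    then have Mk2: "M s (Suc (Suc k)) = F (Suc k) 0" for s by (simp add: MS)
    have "F (Suc k) 0 = 0"
    proof (cases "Suc (Suc k) = n")
      case True
      then show ?thesis using Mn [of 0] Mk2 [of 0] by (simp add: v v0)
    next
      case False
      then obtain C where "\<And>s. Re s > \<sigma> \<Longrightarrow> norm (M s (Suc (Suc k))) \<le> C / (Re s - A)" using Mdecay [of "Suc (Suc k)"] Suc.prems by auto
      then show ?thesis unfolding Mk2 by (rule const0)
    qed
    then show ?case using Mk1 by blast
  qed
  show ?thesis
    by (rule tower_system_unique_0 [OF F convex_UNIV, of 0]) (use init n in auto)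
qed

section \<open>Subtracting the principal parts of a Gamma factor\<close>

section \<open>Removing the poles of the Gamma function\<close>

text \<open>The number \<beta> m is the residue of Gamma times E at -m. Near a pole only one term of
  the series is singular and the rest is bounded, so after subtraction every singularity is
  removable.\<close>

lemma Gamma_minus_poles_entire:
  assumes E: "E holomorphic_on UNIV" and sm: "summable (\<lambda>m. norm (\<beta> m))"
    and \<beta>: "\<And>m. \<beta> m = (-1) ^ m / fact m * E (- of_nat m)"
  shows "\<exists>e. e holomorphic_on UNIV \<and> (\<forall>w. w \<notin> \<int>\<^sub>\<le>\<^sub>0 \<longrightarrow> e w = Gamma w * E w - (\<Sum>m. \<beta> m / (w + of_nat m)))"
proof -
  define S :: "complex set" where "S = - \<int>\<^sub>\<le>\<^sub>0"
  have oS: "open S" unfolding S_def by (simp add: open_Compl)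
  have "\<exists>g g'. \<forall>w\<in>S. ((\<lambda>m. \<beta> m / (w + of_nat m)) sums g w) \<and> ((\<lambda>m. - \<beta> m / (w + of_nat m)\<^sup>2) sums g' w) \<and> (g has_field_derivative g' w) (at w)"
  proof (rule series_and_derivative_comparison_local [OF oS])
    fix m w assume w: "w \<in> S"
    have "w + of_nat m \<noteq> 0"
    proof
      assume "w + of_nat m = 0"
      then have "w = - of_nat m" by (simp add: eq_neg_iff_add_eq_0)
      then show False using w by (simp add: S_def)
    qed
    then show "((\<lambda>w. \<beta> m / (w + of_nat m)) has_field_derivative - \<beta> m / (w + of_nat m)\<^sup>2) (at w)"
      by (auto intro!: derivative_eq_intros simp: power2_eq_square)
  next
    fix x assume x: "x \<in> S"
    then obtain d where d: "d > 0" "ball x (2 * d) \<subseteq> S"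
      using oS by (metis openE field_sum_of_halves half_gt_zero_iff mult_2)
    have "norm (\<beta> m / (w + of_nat m)) \<le> norm (\<beta> m) / d" if w: "w \<in> ball x d" for m w
    proof -
      have "- of_nat m \<notin> ball x (2 * d)" using d(2) by (auto simp: S_def)
      then have "2 * d \<le> norm (x + of_nat m)" by (simp add: dist_norm)
      also have "\<dots> \<le> norm (x - w) + norm (w + of_nat m)" using norm_triangle_ineq [of "x - w" "w + of_nat m"] by simp
      finally have "d \<le> norm (w + of_nat m)" using w by (simp add: dist_norm)
      then show ?thesis unfolding norm_divide using d by (intro divide_left_mono mult_pos_pos) auto
    qed
    then show "\<exists>d h. 0 < d \<and> summable h \<and> (\<forall>\<^sub>F m in sequentially. \<forall>w\<in>ball x d \<inter> S. norm (\<beta> m / (w + of_nat m)) \<le> h m)"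
      using d sm by (intro exI [of _ d] exI [of _ "\<lambda>m. norm (\<beta> m) / d"]) (auto intro: summable_divide)
  qed
  then obtain g g' where g: "\<And>w. w \<in> S \<Longrightarrow> (\<lambda>m. \<beta> m / (w + of_nat m)) sums g w" "\<And>w. w \<in> S \<Longrightarrow> (g has_field_derivative g' w) (at w)"
    by blast
  define f where "f = (\<lambda>w. Gamma w * E w - g w)"
  have holf: "f holomorphic_on S"
  proof -
    have "g holomorphic_on S" using g(2) oS by (auto simp: holomorphic_on_open)
    moreover have "E holomorphic_on S" using E holomorphic_on_subset by blast
    ultimately show ?thesis unfolding f_def by (intro holomorphic_intros) (auto simp: S_def)
  qed
  have local: "\<exists>r>0. \<exists>h. h holomorphic_on ball z r \<and> (\<forall>w\<in>ball z r - {z}. w \<in> S \<and> h w = f w)" for z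
  proof (cases "z \<in> S")
    case True
    then obtain r where "r > 0" "ball z r \<subseteq> S" using oS openE by blast
    then show ?thesis using holf holomorphic_on_subset by blast
  next
    case False
    then obtain p where p: "z = - of_nat p"
      unfolding S_def using nonpos_Ints_cases' by blast
    have sub: "ball z 1 - {z} \<subseteq> S"
    proof
      fix w assume w: "w \<in> ball z 1 - {z}"
      show "w \<in> S"
      proof (rule ccontr)
        assume "w \<notin> S"
        then obtain q where q: "w = - of_nat q" unfolding S_def using nonpos_Ints_cases' by blast
        have "norm (of_int (int q - int p) :: complex) < 1" using w by (simp add: p q dist_norm norm_minus_commute)
        then have "int q - int p = 0" unfolding norm_of_int by linarith
        then show False using w by (simp add: p q)
      qed
    qed
    have far: "norm (w + of_nat m) \<ge> 1/2" if "norm (w - z) < 1/2" "m \<noteq> p" for w m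
    proof -
      have "1 \<le> norm (of_int (int m - int p) :: complex)" unfolding norm_of_int using that by linarith
      also have "(of_int (int m - int p) :: complex) = (w + of_nat m) - (w - z)" by (simp add: p)
      also have "norm \<dots> \<le> norm (w + of_nat m) + norm (w - z)" by (rule norm_triangle_ineq4)
      finally show ?thesis using that by linarith
    qed
    \<comment> \<open>The series without its term at the pole z. The other poles are at distance at
      least 1/2 from w, which bounds the remainder by twice the sum of the |\<beta> m|.\<close>
    define k where "k = (\<lambda>w. g w - \<beta> p / (w - z))"
    have kb: "norm (k w) \<le> 2 * (\<Sum>m. norm (\<beta> m))" if w: "w \<in> S" "norm (w - z) < 1/2" for w
    proof -
      have "(\<lambda>m. if m = p then \<beta> p / (w - z) else 0) sums (\<beta> p / (w - z))"
        by (rule sums_single)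
      then have "(\<lambda>m. \<beta> m / (w + of_nat m) - (if m = p then \<beta> p / (w - z) else 0)) sums k w"
        unfolding k_def by (intro sums_diff g(1) w)
      moreover have "norm (\<beta> m / (w + of_nat m) - (if m = p then \<beta> p / (w - z) else 0)) \<le> 2 * norm (\<beta> m)" for m
      proof (cases "m = p")
        case False
        then have "norm (\<beta> m) / norm (w + of_nat m) \<le> norm (\<beta> m) / (1/2)"
          using far [OF w(2) False] by (intro divide_left_mono mult_pos_pos) auto
        then show ?thesis using False by (simp add: norm_divide)
      qed (simp add: p)
      moreover have "summable (\<lambda>m. 2 * norm (\<beta> m))" using sm by (rule summable_mult)
      ultimately have "norm (k w) \<le> (\<Sum>m. 2 * norm (\<beta> m))"
        by (metis (no_types, lifting) norm_suminf_le sums_unique)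
      then show ?thesis using sm by (simp add: suminf_mult)
    qed
    have ev: "\<forall>\<^sub>F w in at z. w \<in> S \<and> norm (w - z) < 1/2"
      unfolding eventually_at using sub by (intro exI [of _ "1/2"]) (auto simp: dist_norm norm_minus_commute)
    have "((\<lambda>w. (w - z) * f w) \<longlongrightarrow> (-1) ^ p / fact p * E z - \<beta> p - 0) (at z)"
    proof -
      have "((\<lambda>w. (w - z) * k w) \<longlongrightarrow> 0) (at z)"
      proof (rule Lim_null_comparison)
        show "\<forall>\<^sub>F w in at z. norm ((w - z) * k w) \<le> norm (w - z) * (2 * (\<Sum>m. norm (\<beta> m)))"
          using ev by eventually_elim (simp add: norm_mult mult_left_mono kb)
        have "((\<lambda>w. norm (w - z) * (2 * (\<Sum>m. norm (\<beta> m)))) \<longlongrightarrow> norm (z - z) * (2 * (\<Sum>m. norm (\<beta> m)))) (at z)"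
          by (intro tendsto_intros)
        then show "((\<lambda>w. norm (w - z) * (2 * (\<Sum>m. norm (\<beta> m)))) \<longlongrightarrow> 0) (at z)" by simp
      qed
      moreover have "((\<lambda>w. Gamma w * (w + of_nat p) * E w) \<longlongrightarrow> (-1) ^ p / fact p * E z) (at z)"
      proof (intro tendsto_mult)
        show "((\<lambda>w. Gamma w * (w + of_nat p)) \<longlongrightarrow> (-1) ^ p / fact p) (at z)"
          unfolding p by (rule Gamma_residues)
        have "isCont E z" using E by (simp add: holomorphic_on_imp_continuous_on continuous_on_interior [of UNIV])
        then show "(E \<longlongrightarrow> E z) (at z)" by (simp add: isCont_def)
      qed
      ultimately have "((\<lambda>w. Gamma w * (w + of_nat p) * E w - \<beta> p - (w - z) * k w) \<longlongrightarrow> (-1) ^ p / fact p * E z - \<beta> p - 0) (at z)"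
        by (intro tendsto_diff tendsto_const)
      moreover have "\<forall>\<^sub>F w in at z. Gamma w * (w + of_nat p) * E w - \<beta> p - (w - z) * k w = (w - z) * f w"
        using eventually_neq_at_within [of z z UNIV]
      proof eventually_elim
        case (elim w)
        then have "(w - z) * (\<beta> p / (w - z)) = \<beta> p" by simp
        then have a: "(w - z) * k w = (w - z) * g w - \<beta> p" by (simp add: k_def right_diff_distrib)
        have b: "w + of_nat p = w - z" by (simp add: p)
        show ?case unfolding a b f_def by (simp add: algebra_simps)
      qed
      ultimately show ?thesis by (rule Lim_transform_eventually)
    qed
    then have "((\<lambda>w. (w - z) * f w) \<longlongrightarrow> 0) (at z)" by (simp add: \<beta> p)
    moreover have "f holomorphic_on ball z 1 - {z}" using holf sub holomorphic_on_subset by blast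
    ultimately obtain h where "h holomorphic_on ball z 1" "\<forall>w\<in>ball z 1 - {z}. h w = f w"
      using holomorphic_on_extend_lim [of f "ball z 1" z] by auto
    then show ?thesis using sub by (intro exI [of _ 1]) auto
  qed
  have rs: "remove_sings f w = f w" if "w \<in> S" for w
    using holf oS that by (intro remove_sings_at_analytic) (auto simp: analytic_at)
  have "remove_sings f holomorphic_on UNIV"
  proof -
    have "remove_sings f field_differentiable (at z)" for z
    proof -
      obtain r h where r: "r > 0" "h holomorphic_on ball z r" "\<And>w. w \<in> ball z r - {z} \<Longrightarrow> w \<in> S \<and> h w = f w"
        using local [of z] by blast
      have "h field_differentiable (at z)"
        using r(1,2) by (intro holomorphic_on_imp_differentiable_at [of h "ball z r"]) auto
      then obtain d where d: "(h has_field_derivative d) (at z)" by (auto simp: field_differentiable_def)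
      then have "isCont h z" by (rule DERIV_isCont)
      then have "(h \<longlongrightarrow> h z) (at z)" by (simp add: isCont_def)
      moreover have "\<forall>\<^sub>F w in at z. h w = f w"
        unfolding eventually_at using r by (intro exI [of _ r]) (auto simp: dist_commute)
      ultimately have "(f \<longlongrightarrow> h z) (at z)" by (rule Lim_transform_eventually)
      then have z: "remove_sings f z = h z" by (rule remove_sings_eqI)
      have eq: "h w = remove_sings f w" if "w \<in> ball z r" for w
        using z rs r(3) [of w] that by (cases "w = z") auto
      have zin: "z \<in> ball z r" using r(1) by (simp only: centre_in_ball)
      have "(remove_sings f has_field_derivative d) (at z)"
        by (rule has_field_derivative_transform_within_open [OF d open_ball zin eq])
      then show ?thesis by (auto simp: field_differentiable_def)
    qed
    then show ?thesis by (simp add: holomorphic_on_def field_differentiable_at_within)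
  qed
  moreover have "remove_sings f w = Gamma w * E w - (\<Sum>m. \<beta> m / (w + of_nat m))" if "w \<notin> \<int>\<^sub>\<le>\<^sub>0" for w
    using rs [of w] g(1) [of w] that by (simp add: S_def f_def sums_iff)
  ultimately show ?thesis by blast
qed

section \<open>The first-kind series as an entire solution and its transform\<close>

section \<open>Functions of the first kind\<close>

text \<open>Multiplying the coefficients by a linear function of the index amounts to a first-order
  differential operator on the sum. Repeated use yields convergence for all stages of the
  tower.\<close>

lemma powser_mult_linear_everywhere:
  fixes c :: "nat \<Rightarrow> complex"
  assumes c: "\<And>u. summable (\<lambda>m. c m * u ^ m)"
  shows "summable (\<lambda>m. c m * (p * of_nat m + r) * u ^ m)"
    "(\<Sum>m. c m * (p * of_nat m + r) * u ^ m) = p * u * (\<Sum>m. diffs c m * u ^ m) + r * (\<Sum>m. c m * u ^ m)"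
proof -
  have "summable (\<lambda>m. diffs c m * u ^ m)" by (rule termdiff_converges_all [OF c])
  then have "(\<lambda>m. of_nat m * c m * u ^ (m - Suc 0)) sums (\<Sum>m. diffs c m * u ^ m)" by (rule diffs_equiv)
  then have 1: "(\<lambda>m. p * u * (of_nat m * c m * u ^ (m - Suc 0))) sums (p * u * (\<Sum>m. diffs c m * u ^ m))" by (rule sums_mult)
  have 2: "(\<lambda>m. r * (c m * u ^ m)) sums (r * (\<Sum>m. c m * u ^ m))" by (intro sums_mult summable_sums c)
  have "p * u * (of_nat m * c m * u ^ (m - Suc 0)) + r * (c m * u ^ m) = c m * (p * of_nat m + r) * u ^ m" for m
    by (cases m) (simp_all add: algebra_simps)
  then have "(\<lambda>m. c m * (p * of_nat m + r) * u ^ m) sums (p * u * (\<Sum>m. diffs c m * u ^ m) + r * (\<Sum>m. c m * u ^ m))"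
    using sums_add [OF 1 2] by simp
  then show "summable (\<lambda>m. c m * (p * of_nat m + r) * u ^ m)"
    "(\<Sum>m. c m * (p * of_nat m + r) * u ^ m) = p * u * (\<Sum>m. diffs c m * u ^ m) + r * (\<Sum>m. c m * u ^ m)"
    by (simp_all only: sums_iff)
qed

lemma DERIV_exp_powser:
  fixes c :: "nat \<Rightarrow> complex"
  assumes c: "\<And>u. summable (\<lambda>m. c m * u ^ m)"
  shows "((\<lambda>t. exp (r * t) * (\<Sum>m. c m * exp (p * t) ^ m)) has_field_derivative
    exp (r * t) * (\<Sum>m. c m * (p * of_nat m + r) * exp (p * t) ^ m)) (at t)"
proof -
  have "((\<lambda>u. \<Sum>m. c m * u ^ m) has_field_derivative (\<Sum>m. diffs c m * exp (p * t) ^ m)) (at (exp (p * t)))"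
    by (rule termdiffs_strong_converges_everywhere [OF c])
  moreover have "((\<lambda>t. exp (p * t)) has_field_derivative exp (p * t) * p) (at t)"
    by (auto intro!: derivative_eq_intros)
  ultimately have 1: "((\<lambda>t. \<Sum>m. c m * exp (p * t) ^ m) has_field_derivative
      (\<Sum>m. diffs c m * exp (p * t) ^ m) * (exp (p * t) * p)) (at t)" by (rule DERIV_chain2)
  have 2: "((\<lambda>t. exp (r * t)) has_field_derivative exp (r * t) * r) (at t)"
    by (auto intro!: derivative_eq_intros)
  show ?thesis unfolding powser_mult_linear_everywhere(2) [OF c]
    by (rule DERIV_cong [OF DERIV_mult [OF 2 1]]) (simp add: algebra_simps)
qed

text \<open>Coefficients of the first-kind series in powers of e^(nt), for the coordinate t used for
  the second kind. Rescaling z turns the base \<epsilon> i^n of the powers into (-1)^n /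
  n^n.\<close>

definition first_coeff :: "nat \<Rightarrow> (nat \<Rightarrow> complex) \<Rightarrow> nat \<Rightarrow> nat \<Rightarrow> complex" where
  "first_coeff n \<mu> l m =
     ((-1) ^ n / of_nat n ^ n) ^ m * (\<Prod>k<n. rGamma ((\<mu> k - \<mu> l) / of_nat n + of_nat m + 1))"

text \<open>The functional equation of 1/Gamma is used as a product, which is valid at the poles of
  Gamma too. Hence the recursion is stated without division by the product, which may
  vanish.\<close>

lemma first_coeff_Suc:
  "first_coeff n \<mu> l (Suc m) * (\<Prod>k<n. (\<mu> k - \<mu> l) / of_nat n + of_nat m + 1) =
     (-1) ^ n / of_nat n ^ n * first_coeff n \<mu> l m"
proof -
  have step: "rGamma (x + of_nat (Suc m) + 1) * (x + of_nat m + 1) = rGamma (x + of_nat m + 1)" for x :: complex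
  proof -
    have eq: "x + of_nat (Suc m) + 1 = (x + of_nat m + 1) + 1" by simp
    show ?thesis unfolding eq using rGamma_plus1 [of "x + of_nat m + 1"] by (simp only: mult.commute)
  qed
  have "(\<Prod>k<n. rGamma ((\<mu> k - \<mu> l) / of_nat n + of_nat (Suc m) + 1)) * (\<Prod>k<n. (\<mu> k - \<mu> l) / of_nat n + of_nat m + 1)
     = (\<Prod>k<n. rGamma ((\<mu> k - \<mu> l) / of_nat n + of_nat m + 1))"
    unfolding prod.distrib [symmetric] step ..
  then show ?thesis by (simp only: first_coeff_def power_Suc mult.assoc)
qed

text \<open>Ratio test: for large m all factors in the recursion have modulus at least 1, and the
  l-th is m + 1, which outgrows the fixed number 2q.\<close>

lemma first_coeff_summable:
  assumes l: "l < n"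
  shows "summable (\<lambda>m. first_coeff n \<mu> l m * u ^ m)"
proof -
  define x where "x k = (\<mu> k - \<mu> l) / of_nat n" for k
  define A where "A = (\<Sum>k<n. norm (x k))"
  define q where "q = norm ((-1) ^ n / of_nat n ^ n * u)"
  obtain N :: nat where N: "max A (2 * q) < real N" using reals_Archimedean2 by blast
  show ?thesis
  proof (rule summable_ratio_test [of "1/2" N])
    fix m assume m: "m \<ge> N"
    define cur where "cur = first_coeff n \<mu> l m * u ^ m"
    define nxt where "nxt = first_coeff n \<mu> l (Suc m) * u ^ Suc m"
    have ge1: "1 \<le> norm (x k + of_nat m + 1)" if "k < n" for k
    proof -
      have "norm (x k) \<le> A" unfolding A_def using that by (intro member_le_sum) auto
      moreover have "real (Suc m) - norm (x k) \<le> norm (x k + of_nat m + 1)"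
        using norm_diff_ineq [of "of_nat (Suc m)" "x k"] unfolding norm_of_nat by (simp add: add_ac)
      ultimately show ?thesis using N m by simp
    qed
    have "(\<Prod>k<n. norm (x k + of_nat m + 1)) = norm (x l + of_nat m + 1) * (\<Prod>k\<in>{..<n}-{l}. norm (x k + of_nat m + 1))"
      using l by (intro prod.remove) auto
    moreover have "norm (x l + of_nat m + 1) = real (Suc m)"
      using norm_of_nat [of "Suc m", where 'a = complex] by (simp add: x_def add.commute)
    moreover have "1 \<le> (\<Prod>k\<in>{..<n}-{l}. norm (x k + of_nat m + 1))"
      by (rule prod_ge_1) (use ge1 in auto)
    ultimately have big: "real (Suc m) \<le> (\<Prod>k<n. norm (x k + of_nat m + 1))"
      using mult_left_mono [of 1 "\<Prod>k\<in>{..<n}-{l}. norm (x k + of_nat m + 1)" "real (Suc m)"] by simp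
    have "real (Suc m) * norm nxt \<le> (\<Prod>k<n. norm (x k + of_nat m + 1)) * norm nxt"
      by (rule mult_right_mono [OF big]) simp
    also have "\<dots> = norm ((first_coeff n \<mu> l (Suc m) * (\<Prod>k<n. x k + of_nat m + 1)) * u ^ Suc m)"
      by (simp add: nxt_def norm_mult prod_norm [symmetric] mult_ac)
    also have "\<dots> = norm ((-1) ^ n / of_nat n ^ n * first_coeff n \<mu> l m * u ^ Suc m)"
      unfolding x_def first_coeff_Suc ..
    also have "\<dots> = q * norm cur"
      unfolding q_def cur_def norm_mult [symmetric] by (rule arg_cong [of _ _ norm]) (simp only: power_Suc mult_ac)
    also have "\<dots> \<le> (real (Suc m) / 2) * norm cur" using N m by (intro mult_right_mono) auto
    finally have "real (Suc m) * norm nxt \<le> real (Suc m) * (1/2 * norm cur)" by simp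
    then have "norm nxt \<le> 1/2 * norm cur" by (rule mult_left_le_imp_le) simp
    then show "norm (first_coeff n \<mu> l (Suc m) * u ^ Suc m) \<le> 1/2 * norm (first_coeff n \<mu> l m * u ^ m)"
      by (simp only: nxt_def cur_def)
  qed simp
qed

text \<open>The operator D + \<mu> i multiplies e^((n m - \<mu> l) t) by n m + \<mu> i - \<mu> l, so
  every stage of the tower is an explicit series.\<close>

definition first_tower :: "nat \<Rightarrow> (nat \<Rightarrow> complex) \<Rightarrow> nat \<Rightarrow> nat \<Rightarrow> complex \<Rightarrow> complex" where
  "first_tower n \<mu> l k t = exp (- \<mu> l * t) *
     (\<Sum>m. first_coeff n \<mu> l m * (\<Prod>i<k. of_nat n * of_nat m + (\<mu> i - \<mu> l)) * exp (of_nat n * t) ^ m)"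

lemma first_tower_summable:
  assumes l: "l < n"
  shows "summable (\<lambda>m. first_coeff n \<mu> l m * (\<Prod>i<k. of_nat n * of_nat m + (\<mu> i - \<mu> l)) * u ^ m)"
proof (induction k arbitrary: u)
  case 0
  then show ?case using first_coeff_summable [OF l, of \<mu> u] by simp
next
  case (Suc k)
  show ?case
    using powser_mult_linear_everywhere(1) [OF Suc, of "of_nat n" "\<mu> k - \<mu> l" u]
    by (simp only: prod.lessThan_Suc mult.assoc)
qed

lemma tower_system_first:
  assumes l: "l < n"
  shows "tower_system n \<mu> ((-1) ^ n) UNIV (first_tower n \<mu> l)"
proof -
  define c where "c k m = first_coeff n \<mu> l m * (\<Prod>i<k. of_nat n * of_nat m + (\<mu> i - \<mu> l))" for k m
  have sm: "summable (\<lambda>m. c k m * u ^ m)" for k u unfolding c_def by (rule first_tower_summable [OF l])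
  have J: "first_tower n \<mu> l k t = exp (- \<mu> l * t) * (\<Sum>m. c k m * exp (of_nat n * t) ^ m)" for k t
    by (simp add: first_tower_def c_def)
  have top: "first_tower n \<mu> l n t = (-1) ^ n * exp (of_nat n * t) * first_tower n \<mu> l 0 t" for t
  proof -
    define u where "u = exp (of_nat n * t)"
    \<comment> \<open>The factor with i = l kills the term m = 0, so the n-th stage begins with m =
      1; the index shift then produces e^(nt).\<close>
    have "(\<Prod>i<n. of_nat n * of_nat 0 + (\<mu> i - \<mu> l)) = 0" using l by (intro prod_zero) auto
    then have z: "c n 0 = 0" unfolding c_def by (simp only: mult_zero_right)
    have cs: "c n (Suc m) = (-1) ^ n * c 0 m" for m
    proof -
      have "of_nat n * of_nat (Suc m) + (\<mu> i - \<mu> l) = of_nat n * ((\<mu> i - \<mu> l) / of_nat n + of_nat m + 1)" for i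
        using l by (simp add: field_simps)
      then have "(\<Prod>i<n. of_nat n * of_nat (Suc m) + (\<mu> i - \<mu> l)) = of_nat n ^ n * (\<Prod>i<n. (\<mu> i - \<mu> l) / of_nat n + of_nat m + 1)"
        by (simp add: prod.distrib)
      then have "c n (Suc m) = of_nat n ^ n * (first_coeff n \<mu> l (Suc m) * (\<Prod>i<n. (\<mu> i - \<mu> l) / of_nat n + of_nat m + 1))"
        unfolding c_def by (simp only: mult_ac)
      then show ?thesis unfolding first_coeff_Suc using l by (simp add: c_def)
    qed
    have "(\<Sum>m. c n m * u ^ m) = (\<Sum>m. c n (Suc m) * u ^ Suc m)"
      using suminf_split_head [OF sm [of n u]] by (simp add: z)
    also have "\<dots> = (\<Sum>m. ((-1) ^ n * u) * (c 0 m * u ^ m))" by (simp add: cs mult_ac)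
    also have "\<dots> = ((-1) ^ n * u) * (\<Sum>m. c 0 m * u ^ m)" by (rule suminf_mult [OF sm])
    finally show ?thesis unfolding J u_def [symmetric] by (simp only: mult_ac)
  qed
  have der: "(first_tower n \<mu> l k has_field_derivative first_tower n \<mu> l (Suc k) t - \<mu> k * first_tower n \<mu> l k t) (at t)" for k t
  proof -
    define u where "u = exp (of_nat n * t)"
    have "(\<Sum>m. c (Suc k) m * u ^ m) = (\<Sum>m. c k m * (of_nat n * of_nat m + - \<mu> l) * u ^ m + \<mu> k * (c k m * u ^ m))"
      by (rule suminf_cong) (simp add: c_def algebra_simps)
    also have "\<dots> = (\<Sum>m. c k m * (of_nat n * of_nat m + - \<mu> l) * u ^ m) + (\<Sum>m. \<mu> k * (c k m * u ^ m))"
      by (intro suminf_add [symmetric] summable_mult sm powser_mult_linear_everywhere(1))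
    also have "(\<Sum>m. \<mu> k * (c k m * u ^ m)) = \<mu> k * (\<Sum>m. c k m * u ^ m)" by (rule suminf_mult [OF sm])
    finally have "exp (- \<mu> l * t) * (\<Sum>m. c k m * (of_nat n * of_nat m + - \<mu> l) * u ^ m)
        = first_tower n \<mu> l (Suc k) t - \<mu> k * first_tower n \<mu> l k t"
      unfolding J u_def [symmetric] by (simp add: algebra_simps)
    with DERIV_exp_powser [OF sm [of k], of "- \<mu> l" "of_nat n" t] show ?thesis
      unfolding J [of k, abs_def] u_def by simp
  qed
  show ?thesis unfolding tower_system_def using top der by blast
qed

lemma exp_line_tendsto_0:
  assumes "Re r > 0"
  shows "((\<lambda>x. exp (r * (of_real x + \<i> * of_real y))) \<longlongrightarrow> 0) at_bot"
proof (rule tendsto_norm_zero_cancel)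
  define p q where "p = Re r" and "q = Im r * y"
  have "p > 0" using assms by (simp add: p_def)
  then have "((\<lambda>x. exp (p * x - q)) \<longlongrightarrow> 0) at_bot" by real_asymp
  then show "((\<lambda>x. norm (exp (r * (of_real x + \<i> * of_real y)))) \<longlongrightarrow> 0) at_bot"
    by (simp add: p_def q_def)
qed

lemma first_primitive_summable:
  assumes l: "l < n" and s: "Re (s - \<mu> l) > 0"
  shows "summable (\<lambda>m. first_coeff n \<mu> l m / (of_nat n * of_nat m + (s - \<mu> l)) * u ^ m)"
proof (rule summable_comparison_test' [where N = 0])
  have "summable (\<lambda>m. norm (first_coeff n \<mu> l m * u ^ m))"
    by (rule powser_insidea [OF first_coeff_summable [OF l, of \<mu> "of_real (norm u + 1)"]]) (subst norm_of_real, linarith)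
  then show "summable (\<lambda>m. norm (first_coeff n \<mu> l m * u ^ m) / Re (s - \<mu> l))" by (rule summable_divide)
next
  fix m
  have "Re (s - \<mu> l) \<le> Re (of_nat n * of_nat m + (s - \<mu> l))" by simp
  also have "\<dots> \<le> norm (of_nat n * of_nat m + (s - \<mu> l))" by (rule complex_Re_le_cmod)
  finally have "norm (first_coeff n \<mu> l m * u ^ m) / norm (of_nat n * of_nat m + (s - \<mu> l)) \<le> norm (first_coeff n \<mu> l m * u ^ m) / Re (s - \<mu> l)"
    using s by (intro divide_left_mono mult_pos_pos) auto
  then show "norm (first_coeff n \<mu> l m / (of_nat n * of_nat m + (s - \<mu> l)) * u ^ m) \<le> norm (first_coeff n \<mu> l m * u ^ m) / Re (s - \<mu> l)"
    by (simp add: norm_mult norm_divide)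
qed

text \<open>Termwise integration. At t = 0 the outcome is a series of simple fractions in s, with
  poles at s = \<mu> l - n m.\<close>

lemma left_primitive_first:
  assumes l: "l < n" and s: "Re (s - \<mu> l) > 0"
  shows "left_primitive (first_tower n \<mu> l 0) s (\<lambda>t. exp ((s - \<mu> l) * t) *
     (\<Sum>m. first_coeff n \<mu> l m / (of_nat n * of_nat m + (s - \<mu> l)) * exp (of_nat n * t) ^ m))"
proof -
  define c where "c m = first_coeff n \<mu> l m / (of_nat n * of_nat m + (s - \<mu> l))" for m
  have sm: "summable (\<lambda>m. c m * u ^ m)" for u unfolding c_def by (rule first_primitive_summable [where \<mu> = \<mu>, OF l s])
  have nz: "of_nat n * of_nat m + (s - \<mu> l) \<noteq> 0" for m
  proof -
    have "Re (of_nat n * of_nat m + (s - \<mu> l)) > 0" using s by (simp add: add_nonneg_pos)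
    then show ?thesis by (metis less_irrefl zero_complex.simps(1))
  qed
  have cd: "c m * (of_nat n * of_nat m + (s - \<mu> l)) = first_coeff n \<mu> l m" for m
    unfolding c_def by (rule nonzero_eq_divide_eq [THEN iffD1, OF nz refl])
  have "left_primitive (first_tower n \<mu> l 0) s (\<lambda>t. exp ((s - \<mu> l) * t) * (\<Sum>m. c m * exp (of_nat n * t) ^ m))"
    unfolding left_primitive_def
  proof (intro conjI allI)
    fix t
    have "exp ((s - \<mu> l) * t) = exp (- \<mu> l * t) * exp (s * t)" by (simp add: mult_exp_exp algebra_simps)
    then have "exp ((s - \<mu> l) * t) * (\<Sum>m. first_coeff n \<mu> l m * exp (of_nat n * t) ^ m) = first_tower n \<mu> l 0 t * exp (s * t)"
      by (simp add: first_tower_def)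
    with DERIV_exp_powser [OF sm, of "s - \<mu> l" "of_nat n" t]
    show "((\<lambda>t. exp ((s - \<mu> l) * t) * (\<Sum>m. c m * exp (of_nat n * t) ^ m)) has_field_derivative first_tower n \<mu> l 0 t * exp (s * t)) (at t)"
      unfolding cd by simp
  next
    fix y :: real
    have "((\<lambda>u. \<Sum>m. c m * u ^ m) has_field_derivative (\<Sum>m. diffs c m * 0 ^ m)) (at 0)"
      by (rule termdiffs_strong_converges_everywhere [OF sm])
    then have "isCont (\<lambda>u. \<Sum>m. c m * u ^ m) 0" by (rule DERIV_isCont)
    then have "((\<lambda>x. \<Sum>m. c m * exp (of_nat n * (of_real x + \<i> * of_real y)) ^ m) \<longlongrightarrow> (\<Sum>m. c m * 0 ^ m)) at_bot"
      by (rule isCont_tendsto_compose) (use l in \<open>intro exp_line_tendsto_0, simp\<close>)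
    moreover have "((\<lambda>x. exp ((s - \<mu> l) * (of_real x + \<i> * of_real y))) \<longlongrightarrow> 0) at_bot"
      by (rule exp_line_tendsto_0 [OF s])
    ultimately have "((\<lambda>x. exp ((s - \<mu> l) * (of_real x + \<i> * of_real y)) * (\<Sum>m. c m * exp (of_nat n * (of_real x + \<i> * of_real y)) ^ m)) \<longlongrightarrow> 0 * (\<Sum>m. c m * 0 ^ m)) at_bot"
      by (rule tendsto_mult [rotated])
    then show "((\<lambda>x. exp ((s - \<mu> l) * (of_real x + \<i> * of_real y)) * (\<Sum>m. c m * exp (of_nat n * (of_real x + \<i> * of_real y)) ^ m)) \<longlongrightarrow> 0) at_bot"
      by (simp only: mult_zero_left)
  qed
  then show ?thesis unfolding c_def .
qed

section \<open>Matching residues between the two kinds of solutions\<close>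

section \<open>The connection formula\<close>

lemma left_primitive_cmult:
  assumes "left_primitive g s P"
  shows "left_primitive (\<lambda>t. c * g t) s (\<lambda>t. c * P t)"
  unfolding left_primitive_def
proof (intro conjI allI)
  fix t
  have "(P has_field_derivative g t * exp (s * t)) (at t)" using assms by (simp add: left_primitive_def)
  from DERIV_cmult [OF this, of c]
  show "((\<lambda>t. c * P t) has_field_derivative c * g t * exp (s * t)) (at t)" by (simp only: mult.assoc)
next
  show "((\<lambda>x. c * P (of_real x + \<i> * of_real y)) \<longlongrightarrow> 0) at_bot" for y
    using assms unfolding left_primitive_def by (intro tendsto_mult_right_zero) blast
qed

lemma left_primitive_sum:
  assumes "\<And>j. j \<in> I \<Longrightarrow> left_primitive (g j) s (P j)"
  shows "left_primitive (\<lambda>t. \<Sum>j\<in>I. g j t) s (\<lambda>t. \<Sum>j\<in>I. P j t)"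
  unfolding left_primitive_def
proof (intro conjI allI)
  fix t
  show "((\<lambda>t. \<Sum>j\<in>I. P j t) has_field_derivative (\<Sum>j\<in>I. g j t) * exp (s * t)) (at t)"
    unfolding sum_distrib_right using assms by (intro DERIV_sum) (simp add: left_primitive_def)
next
  show "((\<lambda>x. \<Sum>j\<in>I. P j (of_real x + \<i> * of_real y)) \<longlongrightarrow> 0) at_bot" for y
    using assms by (intro tendsto_null_sum) (simp add: left_primitive_def)
qed

lemma left_primitive_diff:
  assumes "left_primitive g s P" "left_primitive h s Q"
  shows "left_primitive (\<lambda>t. g t - h t) s (\<lambda>t. P t - Q t)"
  unfolding left_primitive_def
proof (intro conjI allI)
  fix t
  show "((\<lambda>t. P t - Q t) has_field_derivative (g t - h t) * exp (s * t)) (at t)"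
    unfolding left_diff_distrib using assms by (intro DERIV_diff) (simp_all add: left_primitive_def)
next
  show "((\<lambda>x. P (of_real x + \<i> * of_real y) - Q (of_real x + \<i> * of_real y)) \<longlongrightarrow> 0) at_bot" for y
    using tendsto_diff [of "\<lambda>x. P (of_real x + \<i> * of_real y)" 0 at_bot "\<lambda>x. Q (of_real x + \<i> * of_real y)" 0] assms
    by (simp add: left_primitive_def)
qed

text \<open>Translations by d with e^(nd) = 1 leave the factor e^(nt) unchanged. Such translations
  connect the functions of the second kind with each other.\<close>

lemma tower_system_shift_sum:
  assumes F: "tower_system n \<mu> \<kappa> UNIV F" and d: "\<And>j. j \<in> I \<Longrightarrow> exp (of_nat n * d j) = 1"
  shows "tower_system n \<mu> \<kappa> UNIV (\<lambda>k t. \<Sum>j\<in>I. c j * F k (t + d j))"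
  unfolding tower_system_def
proof (intro ballI conjI allI impI)
  fix t
  have "F n (t + d j) = \<kappa> * exp (of_nat n * t) * F 0 (t + d j)" if "j \<in> I" for j
  proof -
    have "exp (of_nat n * (t + d j)) = exp (of_nat n * t) * exp (of_nat n * d j)"
      by (simp only: distrib_left exp_add)
    then show ?thesis using F d [OF that] by (simp add: tower_system_def)
  qed
  then show "(\<Sum>j\<in>I. c j * F n (t + d j)) = \<kappa> * exp (of_nat n * t) * (\<Sum>j\<in>I. c j * F 0 (t + d j))"
    unfolding sum_distrib_left by (intro sum.cong) (simp_all add: mult_ac)
next
  fix t k assume k: "k < n"
  have "((\<lambda>t. \<Sum>j\<in>I. c j * F k (t + d j)) has_field_derivative (\<Sum>j\<in>I. c j * (F (Suc k) (t + d j) - \<mu> k * F k (t + d j)))) (at t)"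
  proof (intro DERIV_sum DERIV_cmult)
    fix j
    have "(F k has_field_derivative F (Suc k) (t + d j) - \<mu> k * F k (t + d j)) (at (t + d j))"
      using F k by (simp add: tower_system_def)
    then show "((\<lambda>t. F k (t + d j)) has_field_derivative F (Suc k) (t + d j) - \<mu> k * F k (t + d j)) (at t)"
      by (simp only: DERIV_shift)
  qed
  moreover have "(\<Sum>j\<in>I. c j * (F (Suc k) (t + d j) - \<mu> k * F k (t + d j)))
      = (\<Sum>j\<in>I. c j * F (Suc k) (t + d j)) - \<mu> k * (\<Sum>j\<in>I. c j * F k (t + d j))"
    by (simp add: right_diff_distrib sum_subtractf sum_distrib_left mult_ac)
  ultimately show "((\<lambda>t. \<Sum>j\<in>I. c j * F k (t + d j)) has_field_derivative
      (\<Sum>j\<in>I. c j * F (Suc k) (t + d j)) - \<mu> k * (\<Sum>j\<in>I. c j * F k (t + d j))) (at t)" by simp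
qed

text \<open>The reflection formula: the exponential factor vanishes at all integers, cancels the
  poles of Gamma and leaves the entire function 1/Gamma.\<close>

lemma Gamma_mult_exp_minus_1:
  fixes w :: complex
  assumes "w \<notin> \<int>\<^sub>\<le>\<^sub>0"
  shows "Gamma w * (exp (- 2 * of_real pi * \<i> * w) - 1) = - 2 * of_real pi * \<i> * exp (- of_real pi * \<i> * w) * rGamma (1 - w)"
proof -
  define p where "p = exp (\<i> * (of_real pi * w))"
  define q where "q = exp (- (\<i> * (of_real pi * w)))"
  have pq: "p * q = 1" by (simp add: p_def q_def mult_exp_exp)
  have "Gamma w \<noteq> 0" using assms by (simp add: Gamma_eq_zero_iff)
  then have G: "Gamma w * rGamma w = 1" by (simp add: rGamma_inverse_Gamma)
  have "sin (of_real pi * w) = (p - q) / (2 * \<i>)" unfolding p_def q_def by (rule sin_exp_eq)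
  then have S: "p - q = 2 * \<i> * sin (of_real pi * w)" by simp
  have R: "sin (of_real pi * w) = of_real pi * (rGamma w * rGamma (1 - w))"
    unfolding rGamma_reflection_complex by simp
  have e1: "exp (- 2 * of_real pi * \<i> * w) = q * q" by (simp add: q_def mult_exp_exp algebra_simps)
  have e2: "exp (- of_real pi * \<i> * w) = q" by (simp add: q_def algebra_simps)
  have "q * q - 1 = - (q * (p - q))" using pq by (simp add: algebra_simps)
  also have "\<dots> = - (2 * of_real pi * \<i> * q * rGamma (1 - w) * rGamma w)" unfolding S R by (simp add: mult_ac)
  finally have "Gamma w * (q * q - 1) = - (2 * of_real pi * \<i> * q * rGamma (1 - w) * (Gamma w * rGamma w))"
    by (simp add: mult_ac)
  then show ?thesis unfolding e1 e2 G by simp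
qed

text \<open>Found by matching residues. The leading factor n arises because the fractions of the
  first-kind transform have denominators n m + s - \<mu> l = n (w + m), where w = (s - \<mu> l) /
  n.\<close>

definition connection_const :: "nat \<Rightarrow> (nat \<Rightarrow> complex) \<Rightarrow> nat \<Rightarrow> complex" where
  "connection_const n \<mu> l = of_nat n * of_real (mellin_const n) * exp (\<mu> l * of_real (ln (real n))) *
     (- 2 * of_real pi * \<i>) ^ (n - 1) * exp (2 * of_real pi * \<i> * \<mu> l / of_nat n - of_real pi * \<i> * \<mu> l)"

text \<open>With w = (s - \<mu> l) / n, the transform of the linear combination is Gamma(w) times
  this function, up to entire terms. Each of the other n - 1 Gamma factors has been merged with an
  exponential factor by the reflection formula.\<close>

definition connection_entire :: "nat \<Rightarrow> (nat \<Rightarrow> complex) \<Rightarrow> nat \<Rightarrow> complex \<Rightarrow> complex" where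
  "connection_entire n \<mu> l w = of_real (mellin_const n) * exp ((of_nat n * w + \<mu> l) * of_real (ln (real n))) *
     (\<Prod>k\<in>{..<n} - {l}. - 2 * of_real pi * \<i> * exp (- 2 * of_real pi * \<i> * \<mu> k / of_nat n) *
        exp (- of_real pi * \<i> * (w - (\<mu> k - \<mu> l) / of_nat n)) * rGamma (1 - (w - (\<mu> k - \<mu> l) / of_nat n)))"

lemma connection_entire_holomorphic: "connection_entire n \<mu> l holomorphic_on UNIV"
  unfolding connection_entire_def [abs_def] by (intro holomorphic_intros)

text \<open>The residue at w = -m on the left is a multiple, independent of m, of the m-th
  coefficient of the first-kind series. The exponentials of the n - 1 factors combine because the
  \<mu> k with k \<noteq> l sum to -\<mu> l.\<close>

lemma connection_entire_neg_nat:
  assumes l: "l < n" and \<mu>: "(\<Sum>k<n. \<mu> k) = 0"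
  shows "(-1) ^ m / fact m * connection_entire n \<mu> l (- of_nat m)
    = connection_const n \<mu> l / of_nat n * first_coeff n \<mu> l m"
proof -
  define I where "I = {..<n} - {l}"
  define L where "L = complex_of_real (ln (real n))"
  define x where "x k = (\<mu> k - \<mu> l) / of_nat n" for k
  define \<rho> where "\<rho> = (\<Prod>k\<in>I. rGamma (x k + of_nat m + 1))"
  define g where "g k = - 2 * of_real pi * \<i> * \<mu> k / of_nat n + of_real pi * \<i> * x k" for k
  define v where "v = - 2 * of_real pi * \<i>"
  have n0: "n > 0" using l by simp
  have cI: "card I = n - 1" and fI: "finite I" using l by (simp_all add: I_def)
  have eL: "exp L = of_nat n" using n0 by (simp add: L_def exp_of_real)
  have epi: "exp (of_real pi * \<i> * of_nat m) = (-1) ^ m"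
    using exp_of_nat_mult [of m "of_real pi * \<i>"] exp_pi_i by (simp add: mult_ac)
  have fac: "v * exp (- 2 * of_real pi * \<i> * \<mu> k / of_nat n) * exp (- of_real pi * \<i> * (- of_nat m - x k)) * rGamma (1 - (- of_nat m - x k))
      = (v * (-1) ^ m) * exp (g k) * rGamma (x k + of_nat m + 1)" for k
  proof -
    have 1: "exp (- of_real pi * \<i> * (- of_nat m - x k)) = exp (of_real pi * \<i> * of_nat m) * exp (of_real pi * \<i> * x k)"
      by (simp add: mult_exp_exp algebra_simps)
    have 2: "exp (g k) = exp (- 2 * of_real pi * \<i> * \<mu> k / of_nat n) * exp (of_real pi * \<i> * x k)"
      by (simp only: g_def exp_add)
    have 3: "1 - (- of_nat m - x k) = x k + of_nat m + 1" by simp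
    show ?thesis unfolding 1 2 3 epi by (simp only: mult_ac)
  qed
  have "(\<Sum>k\<in>I. \<mu> k) = - \<mu> l"
    using \<mu> l by (simp add: I_def sum_diff1)
  then have "(\<Sum>k\<in>I. - of_real pi * \<i> / of_nat n * \<mu> k - of_real pi * \<i> / of_nat n * \<mu> l)
      = - of_real pi * \<i> / of_nat n * (- \<mu> l) - of_nat (n - 1) * (of_real pi * \<i> / of_nat n * \<mu> l)"
    by (simp only: sum_subtractf sum_distrib_left [symmetric] sum_constant cI, simp only: mult_ac)
  also have "\<dots> = 2 * of_real pi * \<i> * \<mu> l / of_nat n - of_real pi * \<i> * \<mu> l"
    using n0 by (simp add: of_nat_diff field_simps)
  finally have "(\<Sum>k\<in>I. - of_real pi * \<i> / of_nat n * \<mu> k - of_real pi * \<i> / of_nat n * \<mu> l)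
      = 2 * of_real pi * \<i> * \<mu> l / of_nat n - of_real pi * \<i> * \<mu> l" .
  moreover have "g k = - of_real pi * \<i> / of_nat n * \<mu> k - of_real pi * \<i> / of_nat n * \<mu> l" for k
    unfolding g_def x_def using n0 by (simp add: field_simps)
  ultimately have eg: "(\<Prod>k\<in>I. exp (g k)) = exp (2 * of_real pi * \<i> * \<mu> l / of_nat n - of_real pi * \<i> * \<mu> l)"
    by (simp only: exp_sum [OF fI, symmetric])
  have "exp ((of_nat n * - of_nat m + \<mu> l) * L) = exp (\<mu> l * L) * inverse (exp L ^ (n * m))"
    unfolding exp_of_nat_mult [symmetric] exp_minus [symmetric] by (simp add: mult_exp_exp algebra_simps)
  then have e1: "exp ((of_nat n * - of_nat m + \<mu> l) * L) = exp (\<mu> l * L) * inverse (of_nat n ^ (n * m))"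
    by (simp only: eL)
  \<comment> \<open>The sign of the residue of Gamma and the n - 1 signs from the half-turn
    exponentials together give (-1)^(n m), as in \<open>first_coeff\<close>.\<close>
  have sgn: "(-1) ^ m * (v * (-1) ^ m) ^ (n - 1) = v ^ (n - 1) * ((-1) ^ n) ^ m"
  proof -
    obtain j where j: "n = Suc j" using n0 by (cases n) auto
    have "((-1 :: complex) ^ n) ^ m = ((-1) ^ m) ^ n" by (simp only: power_mult [symmetric] mult.commute)
    then show ?thesis by (simp add: j power_mult_distrib)
  qed
  have "(\<Prod>k<n. rGamma (x k + of_nat m + 1)) = rGamma (x l + of_nat m + 1) * \<rho>"
    unfolding \<rho>_def I_def using l by (intro prod.remove) auto
  also have "rGamma (x l + of_nat m + 1) = inverse (fact m)"
    using Gamma_fact [of m, where 'a = complex] by (simp add: x_def rGamma_inverse_Gamma add.commute)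
  finally have fc: "first_coeff n \<mu> l m = ((-1) ^ n) ^ m * inverse (of_nat n ^ (n * m)) * inverse (fact m) * \<rho>"
    unfolding first_coeff_def x_def [symmetric] by (simp add: power_mult_distrib power_inverse power_mult divide_inverse)
  have "connection_entire n \<mu> l (- of_nat m) = of_real (mellin_const n) * exp ((of_nat n * - of_nat m + \<mu> l) * L) *
      (\<Prod>k\<in>I. v * exp (- 2 * of_real pi * \<i> * \<mu> k / of_nat n) * exp (- of_real pi * \<i> * (- of_nat m - x k)) * rGamma (1 - (- of_nat m - x k)))"
    by (simp only: connection_entire_def I_def L_def x_def v_def)
  also have "\<dots> = of_real (mellin_const n) * (exp (\<mu> l * L) * inverse (of_nat n ^ (n * m))) *
      ((v * (-1) ^ m) ^ (n - 1) * exp (2 * of_real pi * \<i> * \<mu> l / of_nat n - of_real pi * \<i> * \<mu> l) * \<rho>)"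
    by (simp only: fac prod.distrib prod_constant cI eg e1 \<rho>_def power_mult_distrib)
  finally have "(-1) ^ m / fact m * connection_entire n \<mu> l (- of_nat m) = inverse (fact m) * of_real (mellin_const n) * (exp (\<mu> l * L) * inverse (of_nat n ^ (n * m))) *
      (((-1) ^ m * (v * (-1) ^ m) ^ (n - 1)) * exp (2 * of_real pi * \<i> * \<mu> l / of_nat n - of_real pi * \<i> * \<mu> l) * \<rho>)"
    by (simp only: divide_inverse mult_ac)
  also have "\<dots> = of_real (mellin_const n) * exp (\<mu> l * L) * v ^ (n - 1) * exp (2 * of_real pi * \<i> * \<mu> l / of_nat n - of_real pi * \<i> * \<mu> l)
      * first_coeff n \<mu> l m"
    unfolding sgn fc by (simp only: mult_ac)
  also have "\<dots> = connection_const n \<mu> l / of_nat n * first_coeff n \<mu> l m"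
    using n0 by (simp add: connection_const_def L_def v_def)
  finally show ?thesis .
qed

text \<open>
  The Mellin transform of \<open>f\<close> is a product of Gamma factors up to an entire function.  The
  combination with coefficients \<open>c\<close> turns all of them but the \<open>l\<close>-th into entire factors, and the
  remaining poles are those of the Mellin transform of the function of the first kind.
\<close>

lemma normal_solution_connection:
  assumes \<mu>: "(\<Sum>k<n. \<mu> k) = 0" and l: "l < n" and f: "normal_solution n \<mu> f" and b0: "b 0 = 1"
    and asym: "\<And>N. \<exists>C. \<forall>t. Re t > 0 \<longrightarrow> \<bar>Im t\<bar> < pi / 2 \<longrightarrow>
        norm (f t / exp (bexp n * t - exp t) - (\<Sum>m<N. b m * exp (- of_nat m * t))) \<le> C * exp (- real N * Re t)"
    and tow: "\<And>k. k < n \<Longrightarrow> \<exists>C. \<forall>t. Re t > 0 \<longrightarrow> \<bar>Im t\<bar> < pi / 2 \<longrightarrow>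
        norm (tower \<mu> f k t) \<le> C * norm (exp ((of_nat k + bexp n) * t - exp t))"
    and c: "\<And>T. (\<Sum>j<n. c j * T ^ j) = (\<Prod>k\<in>{..<n} - {l}. T - exp (- 2 * of_real pi * \<i> * \<mu> k / of_nat n))"
  shows "(\<Sum>j<n. c j * f (t + \<i> * of_real (2 * pi * real j / real n)))
    = connection_const n \<mu> l * first_tower n \<mu> l 0 t"
proof -
  define G where "G = growth_exp n \<mu> ((-1) ^ n)"
  define K where "K = connection_const n \<mu> l"
  define E where "E = connection_entire n \<mu> l"
  define \<alpha> where "\<alpha> j = 2 * pi * real j / real n" for j
  define x where "x k = (\<mu> k - \<mu> l) / of_nat n" for k
  define I where "I = {..<n} - {l}"
  define \<beta> where "\<beta> m = K / of_nat n * first_coeff n \<mu> l m" for m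
  have n1: "n \<ge> 1" using l by simp
  have n0: "(of_nat n :: complex) \<noteq> 0" using l by simp
  have holf: "f holomorphic_on UNIV" using f by (simp add: normal_solution_def)
  have TS: "tower_system n \<mu> ((-1) ^ n) UNIV (tower \<mu> f)"
    using f by (intro tower_system_tower) (simp_all add: normal_solution_def)
  \<comment> \<open>The difference of the two sides, taken for all stages at once so that it is
    again a solution of the tower system.\<close>
  define F where "F k t = (\<Sum>j<n. c j * tower \<mu> f k (t + \<i> * of_real (\<alpha> j))) - K * first_tower n \<mu> l k t" for k t
  have "exp (of_nat n * (\<i> * of_real (\<alpha> j))) = 1" for j
  proof -
    have "of_nat n * (\<i> * of_real (\<alpha> j)) = 2 * of_real pi * \<i> * of_nat j"
      using n0 by (simp add: \<alpha>_def)
    also have "exp \<dots> = exp (2 * of_real pi * \<i>) ^ j" by (rule exp_of_nat2_mult)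
    finally show ?thesis by simp
  qed
  then have "tower_system n \<mu> ((-1) ^ n) UNIV (\<lambda>k t. \<Sum>j<n. c j * tower \<mu> f k (t + \<i> * of_real (\<alpha> j)))"
    by (intro tower_system_shift_sum [OF TS])
  moreover have "tower_system n \<mu> ((-1) ^ n) UNIV (\<lambda>k t. K * first_tower n \<mu> l k t)"
    using tower_system_shift_sum [OF tower_system_first [OF l, of \<mu>], of "{0::nat}" "\<lambda>_. 0" "\<lambda>_. K"] by simp
  ultimately have TF: "tower_system n \<mu> ((-1) ^ n) UNIV F"
    unfolding F_def [abs_def] by (rule tower_system_diff)
  obtain R where R: "R holomorphic_on UNIV"
    and RP: "\<forall>s P. Re s > G + real n + 2 \<longrightarrow> left_primitive f s P \<longrightarrow>
        P 0 + R s = of_real (mellin_const n) * exp (s * of_real (ln (real n))) * (\<Prod>k<n. Gamma ((s - \<mu> k) / of_nat n))"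
    using mellin_normal_solution [OF n1 \<mu> f b0 asym tow] unfolding G_def by blast
  have sf: "summable (\<lambda>m. norm (first_coeff n \<mu> l m))"
    using powser_insidea [OF first_coeff_summable [OF l, of \<mu> 2], of 1] by simp
  have "summable (\<lambda>m. norm (\<beta> m))"
    unfolding \<beta>_def norm_mult by (rule summable_mult [OF sf])
  moreover have "\<beta> m = (-1) ^ m / fact m * E (- of_nat m)" for m
    unfolding \<beta>_def K_def E_def connection_entire_neg_nat [OF l \<mu>] ..
  moreover have "E holomorphic_on UNIV" unfolding E_def by (rule connection_entire_holomorphic)
  ultimately obtain e where e: "e holomorphic_on UNIV"
    and ew: "\<forall>w. w \<notin> \<int>\<^sub>\<le>\<^sub>0 \<longrightarrow> e w = Gamma w * E w - (\<Sum>m. \<beta> m / (w + of_nat m))"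
    using Gamma_minus_poles_entire [of E \<beta>] by blast
  \<comment> \<open>The expected entire transform: \<open>e\<close> is the Gamma part without its
    poles, the segment integrals carry the primitive of f from 0 to the translated endpoints, and R
    takes away the half over t \<ge> 0.\<close>
  define M where "M s = e ((s - \<mu> l) / of_nat n) +
      (\<Sum>j<n. c j * exp (- s * (\<i> * of_real (\<alpha> j))) * (segment_integral f 0 (\<i> * of_real (\<alpha> j)) s - R s))" for s
  have holM: "M holomorphic_on UNIV"
  proof -
    have "(e \<circ> (\<lambda>s. (s - \<mu> l) / of_nat n)) holomorphic_on UNIV"
      using n0 by (intro holomorphic_on_compose_gen [OF _ e] holomorphic_intros) auto
    then have 1: "(\<lambda>s. e ((s - \<mu> l) / of_nat n)) holomorphic_on UNIV" by (simp only: o_def)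
    show ?thesis unfolding M_def [abs_def]
      by (intro holomorphic_on_add 1 holomorphic_on_sum holomorphic_on_mult holomorphic_on_diff R
          segment_integral_holomorphic holf holomorphic_intros)
  qed
  have main: "P 0 = M s" if s: "Re s > G + real n + 3" and P: "left_primitive (F 0) s P" for s P
  proof -
    define w where "w = (s - \<mu> l) / of_nat n"
    define ex where "ex j = exp (- s * (\<i> * of_real (\<alpha> j)))" for j
    have \<mu>G: "norm (\<mu> k) \<le> G" if "k < n" for k unfolding G_def by (rule growth_exp_ge [OF that])
    have Rs: "Re (s - \<mu> k) > 0" if "k < n" for k
      using \<mu>G [OF that] s abs_Re_le_cmod [of "\<mu> k"] by simp
    have wk: "(s - \<mu> k) / of_nat n = w - x k" for k
      by (simp add: w_def x_def diff_divide_distrib)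
    have wn: "w - x k \<notin> \<int>\<^sub>\<le>\<^sub>0" if "k < n" for k
    proof -
      have "Re ((s - \<mu> k) / of_nat n) > 0" using Rs [OF that] l by (simp add: Re_divide_of_nat)
      then show ?thesis unfolding wk by (rule Re_pos_not_nonpos_Int)
    qed
    have xl: "x l = 0" by (simp add: x_def)
    have w0: "w \<notin> \<int>\<^sub>\<le>\<^sub>0" using wn [OF l] xl by simp
    define PJ where "PJ t = exp ((s - \<mu> l) * t) *
        (\<Sum>m. first_coeff n \<mu> l m / (of_nat n * of_nat m + (s - \<mu> l)) * exp (of_nat n * t) ^ m)" for t
    have LJ: "left_primitive (first_tower n \<mu> l 0) s PJ"
      unfolding PJ_def [abs_def] by (rule left_primitive_first [where \<mu> = \<mu>, OF l Rs [OF l]])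
    have "\<exists>Q. left_primitive (tower \<mu> f 0) s Q"
      using s n1 by (intro tower_left_primitive_exists [OF TS]) (simp_all add: G_def)
    then obtain Q where Q: "left_primitive f s Q" by auto
    define S where "S = (\<lambda>t. (\<Sum>j<n. c j * (ex j * Q (t + \<i> * of_real (\<alpha> j)))) - K * PJ t)"
    have "left_primitive (F 0) s S"
      unfolding F_def [abs_def] tower.simps S_def ex_def
      by (intro left_primitive_diff left_primitive_sum left_primitive_cmult left_primitive_shift Q LJ)
    then have "P = S" by (rule left_primitive_unique [OF P])
    then have P0: "P 0 = (\<Sum>j<n. c j * (ex j * Q (\<i> * of_real (\<alpha> j)))) - K * PJ 0" by (simp add: S_def)
    have seg: "segment_integral f 0 d s = Q d - Q 0" for d
      using segment_integral_eq [of Q f s 0 d] Q by (simp add: left_primitive_def)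
    have D: "Q 0 + R s = of_real (mellin_const n) * exp (s * of_real (ln (real n))) * (\<Prod>k<n. Gamma (w - x k))"
      using RP [rule_format, OF _ Q] s by (simp only: wk)
    \<comment> \<open>The j-th translation multiplies the transform by T^j, so the hypothesis
      \<open>c\<close> turns the linear combination into a product.\<close>
    define T where "T = exp (- 2 * of_real pi * \<i> * s / of_nat n)"
    have exT: "ex j = T ^ j" for j
    proof -
      have "- s * (\<i> * of_real (\<alpha> j)) = of_nat j * (- 2 * of_real pi * \<i> * s / of_nat n)"
        by (simp add: \<alpha>_def)
      then show ?thesis unfolding ex_def T_def by (simp only: exp_of_nat_mult)
    qed
    have fac: "Gamma (w - x k) * (T - exp (- 2 * of_real pi * \<i> * \<mu> k / of_nat n))
        = - 2 * of_real pi * \<i> * exp (- 2 * of_real pi * \<i> * \<mu> k / of_nat n) * exp (- of_real pi * \<i> * (w - x k)) * rGamma (1 - (w - x k))"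
      if "k < n" for k
    proof -
      have "T = exp (- 2 * of_real pi * \<i> * \<mu> k / of_nat n) * exp (- 2 * of_real pi * \<i> * (w - x k))"
        unfolding T_def wk [symmetric] mult_exp_exp using n0 by (simp add: field_simps)
      then have "Gamma (w - x k) * (T - exp (- 2 * of_real pi * \<i> * \<mu> k / of_nat n)) =
          exp (- 2 * of_real pi * \<i> * \<mu> k / of_nat n) * (Gamma (w - x k) * (exp (- 2 * of_real pi * \<i> * (w - x k)) - 1))"
        by (simp add: algebra_simps)
      then show ?thesis unfolding Gamma_mult_exp_minus_1 [OF wn [OF that]] by (simp only: mult_ac)
    qed
    have "(\<Prod>k<n. Gamma (w - x k)) = Gamma (w - x l) * (\<Prod>k\<in>I. Gamma (w - x k))"
      unfolding I_def using l by (intro prod.remove) auto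
    then have pG: "(\<Prod>k<n. Gamma (w - x k)) = Gamma w * (\<Prod>k\<in>I. Gamma (w - x k))" by (simp add: xl)
    have cT: "(\<Sum>j<n. c j * ex j) = (\<Prod>k\<in>I. T - exp (- 2 * of_real pi * \<i> * \<mu> k / of_nat n))"
      unfolding exT I_def by (rule c)
    have sw: "s = of_nat n * w + \<mu> l" using n0 by (simp add: w_def)
    \<comment> \<open>The factors of the product attach one by one to the Gamma factors with k
      \<noteq> l and make them entire; the l-th factor stays as it is.\<close>
    have "(\<Sum>j<n. c j * ex j) * (Q 0 + R s) = Gamma w * (of_real (mellin_const n) * exp (s * of_real (ln (real n))) *
        (\<Prod>k\<in>I. Gamma (w - x k) * (T - exp (- 2 * of_real pi * \<i> * \<mu> k / of_nat n))))"
      unfolding cT D pG prod.distrib by (simp only: mult_ac)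
    also have "(\<Prod>k\<in>I. Gamma (w - x k) * (T - exp (- 2 * of_real pi * \<i> * \<mu> k / of_nat n))) =
        (\<Prod>k\<in>I. - 2 * of_real pi * \<i> * exp (- 2 * of_real pi * \<i> * \<mu> k / of_nat n) * exp (- of_real pi * \<i> * (w - x k)) * rGamma (1 - (w - x k)))"
      by (rule prod.cong [OF refl], rule fac) (simp add: I_def)
    also have "of_real (mellin_const n) * exp (s * of_real (ln (real n))) * \<dots> = E w"
      unfolding E_def connection_entire_def x_def I_def sw [symmetric] ..
    finally have GE: "(\<Sum>j<n. c j * ex j) * (Q 0 + R s) = Gamma w * E w" .
    have smJ: "summable (\<lambda>m. first_coeff n \<mu> l m / (of_nat n * of_nat m + (s - \<mu> l)))"
      using first_primitive_summable [where \<mu> = \<mu> and u = 1, OF l Rs [OF l]] by simp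
    have "K * PJ 0 = (\<Sum>m. K * (first_coeff n \<mu> l m / (of_nat n * of_nat m + (s - \<mu> l))))"
      using suminf_mult [OF smJ, of K] by (simp add: PJ_def)
    also have "\<dots> = (\<Sum>m. \<beta> m / (w + of_nat m))"
    proof (rule suminf_cong)
      fix m
      have "of_nat n * of_nat m + (s - \<mu> l) = of_nat n * (w + of_nat m)" using sw by (simp add: algebra_simps)
      then show "K * (first_coeff n \<mu> l m / (of_nat n * of_nat m + (s - \<mu> l))) = \<beta> m / (w + of_nat m)"
        by (simp add: \<beta>_def)
    qed
    finally have KP: "K * PJ 0 = (\<Sum>m. \<beta> m / (w + of_nat m))" .
    have "M s = e w + (\<Sum>j<n. c j * ex j * (Q (\<i> * of_real (\<alpha> j)) - Q 0 - R s))"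
      unfolding M_def w_def [symmetric] ex_def [symmetric] seg ..
    also have "(\<Sum>j<n. c j * ex j * (Q (\<i> * of_real (\<alpha> j)) - Q 0 - R s))
        = (\<Sum>j<n. c j * (ex j * Q (\<i> * of_real (\<alpha> j))) - c j * ex j * (Q 0 + R s))"
      by (rule sum.cong) (simp_all add: algebra_simps)
    also have "\<dots> = (\<Sum>j<n. c j * (ex j * Q (\<i> * of_real (\<alpha> j)))) - (\<Sum>j<n. c j * ex j) * (Q 0 + R s)"
      by (simp only: sum_subtractf sum_distrib_right)
    also have "e w = Gamma w * E w - K * PJ 0" unfolding KP by (rule ew [rule_format, OF w0])
    finally show ?thesis unfolding P0 GE by simp
  qed
  have "G + real n + 3 > growth_exp n \<mu> ((-1) ^ n)" by (simp add: G_def)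
  then have "F 0 t = 0"
    by (rule tower_zero_of_entire_mellin [where m = M and F = F, OF n1 TF holM]) (rule main)
  then show ?thesis by (simp add: F_def K_def \<alpha>_def)
qed

section \<open>Collecting constants, and the theorem\<close>

section \<open>Normalising constants\<close>

lemma uarg_bessel_xi: "uarg (bessel_xi n a j) = pi * of_int (2 * int j + a - 2) / of_nat n"
  and umod_bessel_xi: "umod (bessel_xi n a j) = 1"
  by (simp_all add: uarg_def umod_def bessel_xi_def polar_inverse)

text \<open>The argument of \<xi>_1 is pi a / n, so the n-th power of e^\<sigma> is n^n (-1)^a
  (-i)^n. This is where the sign (-1)^a of the first-kind function enters.\<close>

lemma prod_first_kind_term:
  fixes lam :: "nat \<Rightarrow> complex" and u :: complex
  assumes n: "n \<ge> 1"
  shows "(((-1) powi a) * \<i> ^ n) ^ m * exp (of_nat n * (- lam (Suc l) + of_nat m) * u) *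
          (\<Prod>k=1..n. rGamma (lam k - lam (Suc l) + of_nat m + 1)) =
     exp (- of_nat n * lam (Suc l) * u) *
       (first_coeff n (\<lambda>k. of_nat n * lam (Suc k)) l m * exp (of_nat n * (u + bessel_shift n (bessel_xi n a 1))) ^ m)"
proof -
  define s where "s = bessel_shift n (bessel_xi n a 1)"
  have "exp s = of_real (exp (ln (real n))) * exp (\<i> * of_real (pi * of_int a / real n)) * exp (- (\<i> * of_real (pi / 2)))"
    unfolding s_def bessel_shift_def uarg_bessel_xi exp_of_real [symmetric] mult_exp_exp by (simp add: algebra_simps)
  also have "exp (- (\<i> * of_real (pi / 2))) = - \<i>"
    using cis_conv_exp [of "- pi / 2"] by (simp add: cis.ctr complex_eq_iff)
  also have "complex_of_real (exp (ln (real n))) = of_nat n" using n by simp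
  finally have "exp s ^ n = of_nat n ^ n * exp (\<i> * of_real (pi * of_int a / real n)) ^ n * (- \<i>) ^ n"
    by (simp only: power_mult_distrib)
  also have "exp (\<i> * of_real (pi * of_int a / real n)) ^ n = exp (of_nat n * (\<i> * of_real (pi * of_int a / real n)))"
    by (rule exp_of_nat_mult [symmetric])
  also have "of_nat n * (\<i> * of_real (pi * of_int a / real n)) = \<i> * of_real (of_int a * pi)"
    using n by simp
  also have "exp \<dots> = cis (of_int a * pi)" by (simp only: cis_conv_exp)
  also have "\<dots> = cis pi powi a" by (rule cis_power_int [symmetric])
  also have "cis pi = - 1" by (rule cis_pi)
  finally have es: "exp s ^ n = of_nat n ^ n * ((-1) powi a) * (- \<i>) ^ n" .
  have ii: "(-1) ^ n * (- \<i>) ^ n = \<i> ^ n" by (simp add: power_mult_distrib [symmetric])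
  have "(-1) ^ n / of_nat n ^ n * exp s ^ n = ((-1) powi a) * ((-1) ^ n * (- \<i>) ^ n)"
    unfolding es using n by simp
  then have q: "(-1) ^ n / of_nat n ^ n * exp s ^ n = ((-1) powi a) * \<i> ^ n" unfolding ii .
  have "(\<Prod>k=1..n. rGamma (lam k - lam (Suc l) + of_nat m + 1)) = (\<Prod>k<n. rGamma (lam (Suc k) - lam (Suc l) + of_nat m + 1))"
    by (simp only: One_nat_def prod.atLeast1_atMost_eq)
  also have "\<dots> = (\<Prod>k<n. rGamma ((of_nat n * lam (Suc k) - of_nat n * lam (Suc l)) / of_nat n + of_nat m + 1))"
    using n by (simp add: diff_divide_distrib)
  finally have fc: "first_coeff n (\<lambda>k. of_nat n * lam (Suc k)) l m =
      ((-1) ^ n / of_nat n ^ n) ^ m * (\<Prod>k=1..n. rGamma (lam k - lam (Suc l) + of_nat m + 1))"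
    by (simp only: first_coeff_def)
  have "exp (of_nat n * (u + s)) = exp (of_nat n * u) * exp s ^ n"
    by (simp only: distrib_left exp_add exp_of_nat_mult)
  then have e1: "exp (of_nat n * (u + s)) ^ m = exp (of_nat n * u) ^ m * (exp s ^ n) ^ m"
    by (simp only: power_mult_distrib)
  have "exp (of_nat n * (- lam (Suc l) + of_nat m) * u) = exp (- of_nat n * lam (Suc l) * u) * exp (of_nat m * (of_nat n * u))"
    unfolding mult_exp_exp by (simp add: algebra_simps)
  then have e2: "exp (of_nat n * (- lam (Suc l) + of_nat m) * u) = exp (- of_nat n * lam (Suc l) * u) * exp (of_nat n * u) ^ m"
    by (simp only: exp_of_nat_mult)
  show ?thesis
    unfolding s_def [symmetric] fc e1 e2 q [symmetric] power_mult_distrib by (simp only: mult_ac)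
qed

text \<open>Every factor is written as an exponential of ln n, ln (2 pi) and multiples of pi i; the
  claim is then that the exponents add up to 0.\<close>

lemma connection_constants:
  assumes n: "n \<ge> 1"
  shows "exp (3 / 4 * of_real pi * \<i> * (of_nat n - 1)) / of_real (sqrt (real n) * (2 * pi) powr ((real n - 1) / 2))
    * exp (of_real pi * \<i> * (of_nat n / 2 + of_int a - 2) * lam (Suc l))
    * (exp (- bexp n * (of_real (ln (real n)) - \<i> * of_real (pi / 2)))
       * (connection_const n (\<lambda>k. of_nat n * lam (Suc k)) l
          * exp (- (of_nat n * lam (Suc l)) * bessel_shift n (bessel_xi n a 1)))) = 1"
proof -
  define L where "L = complex_of_real (ln (real n))"
  define H where "H = complex_of_real (ln (2 * pi))"
  define y where "y = lam (Suc l)"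
  define \<nu> where "\<nu> = (of_nat n :: complex)"
  have n0: "real n > 0" using n by simp
  have \<nu>0: "\<nu> \<noteq> 0" using n by (simp add: \<nu>_def)
  have eL: "of_nat n = exp L" using n by (simp add: L_def exp_of_real)
  have sq: "sqrt (real n) * (2 * pi) powr ((real n - 1) / 2) = exp (ln (real n) / 2 + (real n - 1) / 2 * ln (2 * pi))"
    using n0 exp_ln [of "sqrt (real n)"] by (simp only: exp_add powr_def ln_sqrt) simp
  have c1: "of_real (sqrt (real n) * (2 * pi) powr ((real n - 1) / 2)) = exp (L / 2 + (\<nu> - 1) / 2 * H)"
    unfolding sq by (simp add: exp_of_real [symmetric] L_def H_def \<nu>_def)
  have c2: "of_real (mellin_const n) = exp (- (\<nu> - 1) / 2 * H - \<nu> / 2 * L)"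
    by (simp add: mellin_const_def exp_of_real [symmetric] L_def H_def \<nu>_def)
  have eH: "exp H = of_real (2 * pi)" by (simp only: H_def exp_of_real) simp
  have ei: "exp (- (\<i> * of_real (pi / 2))) = - \<i>"
    using cis_conv_exp [of "- pi / 2"] by (simp add: cis.ctr complex_eq_iff)
  have "exp (H - \<i> * of_real (pi / 2)) = of_real (2 * pi) * - \<i>"
    unfolding eH [symmetric] ei [symmetric] mult_exp_exp by (simp only: diff_conv_add_uminus)
  then have "- 2 * of_real pi * \<i> = exp (H - \<i> * of_real (pi / 2))" by simp
  then have "(- 2 * of_real pi * \<i>) ^ (n - 1) = exp (of_nat (n - 1) * (H - \<i> * of_real (pi / 2)))"
    by (simp only: exp_of_nat_mult)
  moreover have "of_nat (n - 1) = \<nu> - 1" using n by (simp add: \<nu>_def of_nat_diff)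
  ultimately have c3: "(- 2 * of_real pi * \<i>) ^ (n - 1) = exp ((\<nu> - 1) * (H - \<i> * of_real (pi / 2)))" by simp
  have c4: "bessel_shift n (bessel_xi n a 1) = L + \<i> * (of_real pi * of_int a / \<nu> - of_real pi / 2)"
    by (simp add: bessel_shift_def uarg_bessel_xi L_def \<nu>_def)
  have K: "connection_const n (\<lambda>k. of_nat n * lam (Suc k)) l = exp (L + (- (\<nu> - 1) / 2 * H - \<nu> / 2 * L) + \<nu> * y * L
      + (\<nu> - 1) * (H - \<i> * of_real (pi / 2)) + (2 * of_real pi * \<i> * (\<nu> * y) / \<nu> - of_real pi * \<i> * (\<nu> * y)))"
    unfolding connection_const_def c2 c3 L_def [symmetric] y_def [symmetric] \<nu>_def [symmetric] exp_add
    by (simp only: eL \<nu>_def)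
  \<comment> \<open>The variables stand, in this order, for pi, the imaginary unit, n, ln n, ln (2
    pi), pi a / n and the l-th index.\<close>
  have poly: "3 / 4 * P * j * (N - 1) - (X / 2 + (N - 1) / 2 * Y) + j * (P * N / 2 + N * A - 2 * P) * w
    + (- (- (N - 1) / 2) * (X - j * (P / 2))
       + ((X + (- (N - 1) / 2 * Y - N / 2 * X) + N * w * X + (N - 1) * (Y - j * (P / 2)) + (2 * P * j * w - P * j * (N * w)))
          + - (N * w) * (X + j * (A - P / 2)))) = 0" for P j N X Y A w :: complex
    by (simp add: algebra_simps add_divide_distrib diff_divide_distrib)
  define A where "A = of_real pi * of_int a / \<nu>"
  have a1: "of_real pi * \<i> * (\<nu> / 2 + of_int a - 2) = \<i> * (of_real pi * \<nu> / 2 + \<nu> * A - 2 * of_real pi)"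
    using \<nu>0 by (simp add: A_def algebra_simps)
  have a2: "2 * of_real pi * \<i> * (\<nu> * y) / \<nu> = 2 * of_real pi * \<i> * y" using \<nu>0 by simp
  have a3: "complex_of_real (pi / 2) = of_real pi / 2" by simp
  have "3 / 4 * of_real pi * \<i> * (\<nu> - 1) - (L / 2 + (\<nu> - 1) / 2 * H)
    + of_real pi * \<i> * (\<nu> / 2 + of_int a - 2) * y
    + (- (- (\<nu> - 1) / 2) * (L - \<i> * of_real (pi / 2))
       + ((L + (- (\<nu> - 1) / 2 * H - \<nu> / 2 * L) + \<nu> * y * L
          + (\<nu> - 1) * (H - \<i> * of_real (pi / 2)) + (2 * of_real pi * \<i> * (\<nu> * y) / \<nu> - of_real pi * \<i> * (\<nu> * y)))
          + - (\<nu> * y) * (L + \<i> * (of_real pi * of_int a / \<nu> - of_real pi / 2)))) = 0"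
    unfolding a1 a2 a3 A_def [symmetric] by (rule poly)
  then show ?thesis
    unfolding c1 c4 K
    unfolding bexp_def L_def [symmetric] y_def [symmetric] \<nu>_def [symmetric] exp_diff [symmetric] mult_exp_exp
    by (simp only: exp_zero)
qed

theorem corollary12p7:
  fixes n l :: nat and lam :: "nat \<Rightarrow> complex" and a :: int and z :: ucover
  assumes "n \<ge> 2"
    and "(\<Sum>k=1..n. lam k) = 0"
    and "l \<in> {1..n}"
  shows "bessel_first n l z ((-1) powi a) lam =
    exp (3 / 4 * of_real pi * \<i> * (of_nat n - 1))
      / of_real (sqrt (real n) * (2 * pi) powr ((real n - 1) / 2))
    * exp (of_real pi * \<i> * (of_nat n / 2 + of_int a - 2) * lam l)
    * (\<Sum>j=1..n. (-1) ^ (n - j)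
         * upowr (bessel_xi n a j) (- (of_nat n - 1) / 2)
         * esym ({1..n} - {l}) (\<lambda>k. exp (- 2 * of_real pi * \<i> * lam k)) (n - j)
         * bessel_second n z lam (bessel_xi n a j))"
proof -
  have n1: "n \<ge> 1" using assms(1) by simp
  obtain l' where l': "l = Suc l'" "l' < n" using assms(3) by (cases l) auto
  define \<mu> where "\<mu> = (\<lambda>k. of_nat n * lam (Suc k))"
  have \<mu>0: "(\<Sum>k<n. \<mu> k) = 0"
    using assms(2) by (simp add: \<mu>_def sum_distrib_left [symmetric] sum.atLeast1_atMost_eq)
  obtain b where b: "b 0 = 1" "ladder_coeff (\<lambda>k. bexp n + of_nat k + \<mu> k) b n = b"
    using ladder_coeff_fixpoint_exists [OF n1 sum_bexp [OF \<mu>0]] by blast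
  obtain f where f: "normal_solution n \<mu> f"
    and asym: "\<forall>N. \<exists>C. \<forall>t. Re t > 0 \<longrightarrow> \<bar>Im t\<bar> < pi / 2 \<longrightarrow>
        norm (f t / exp (bexp n * t - exp t) - (\<Sum>m<N. b m * exp (- of_nat m * t))) \<le> C * exp (- real N * Re t)"
    and tow: "\<forall>k<n. \<exists>C. \<forall>t. Re t > 0 \<longrightarrow> \<bar>Im t\<bar> < pi / 2 \<longrightarrow>
        norm (tower \<mu> f k t) \<le> C * norm (exp ((of_nat k + bexp n) * t - exp t))"
    using normal_solution_exists [OF n1 b(2)] by auto
  define y where "y k = exp (- 2 * of_real pi * \<i> * lam k)" for k
  \<comment> \<open>The summation index of the theorem is lowered by one, so that T^j belongs to the
    j-th translation; \<open>n - Suc j\<close> is the n - j of the theorem.\<close>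
  define c where "c j = (-1) ^ (n - Suc j) * esym ({1..n} - {l}) y (n - Suc j)" for j
  have c: "(\<Sum>j<n. c j * T ^ j) = (\<Prod>k\<in>{..<n} - {l'}. T - exp (- 2 * of_real pi * \<i> * \<mu> k / of_nat n))" for T
  proof -
    have bij: "bij_betw Suc ({..<n} - {l'}) ({1..n} - {l})"
      by (rule bij_betw_byWitness [where f' = "\<lambda>k. k - 1"]) (use l' in auto)
    have card: "card ({1..n} - {l}) = n - 1" using assms(3) by simp
    have "(\<Prod>k\<in>{..<n} - {l'}. T - exp (- 2 * of_real pi * \<i> * \<mu> k / of_nat n)) = (\<Prod>k\<in>{..<n} - {l'}. T - y (Suc k))"
      using n1 by (simp add: \<mu>_def y_def mult.assoc)
    also have "\<dots> = (\<Prod>k\<in>{1..n} - {l}. T - y k)" by (rule prod.reindex_bij_betw [OF bij])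
    also have "\<dots> = (\<Sum>i\<le>n - 1. T ^ i * (-1) ^ (n - 1 - i) * esym ({1..n} - {l}) y (n - 1 - i))"
      using prod_diff_esym [of "{1..n} - {l}" T y] by (simp only: card finite_Diff finite_atLeastAtMost simp_thms)
    also have "{..n - 1} = {..<n}" using n1 by auto
    finally show ?thesis by (simp add: c_def mult_ac)
  qed
  \<comment> \<open>The first point serves as origin: the shift of the j-th point exceeds it by 2 pi
    (j - 1) / n times the imaginary unit.\<close>
  define \<sigma> where "\<sigma> = bessel_shift n (bessel_xi n a 1)"
  define t where "t = ulog z + \<sigma>"
  \<comment> \<open>The power of \<xi>_j in the theorem cancels the argument of \<xi>_j in the
    normalisation of the second kind, and what remains is the same for all j.\<close>
  define Q where "Q = exp (- bexp n * (of_real (ln (real n)) - \<i> * of_real (pi / 2)))"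
  have second: "upowr (bessel_xi n a (Suc i)) (bexp n) * bessel_second n z lam (bessel_xi n a (Suc i))
      = Q * f (t + \<i> * of_real (2 * pi * real i / real n))" for i
  proof -
    define \<tau> where "\<tau> = bessel_shift n (bessel_xi n a (Suc i))"
    have 1: "bessel_second n z lam (bessel_xi n a (Suc i)) = exp (- bexp n * \<tau>) * f (ulog z + \<tau>)"
      unfolding \<tau>_def
      by (rule bessel_second_eq [OF assms(1) umod_bessel_xi \<mu>0 [unfolded \<mu>_def] b [unfolded \<mu>_def] f [unfolded \<mu>_def] asym [rule_format]])
    have 2: "upowr (bessel_xi n a (Suc i)) (bexp n) = exp (bexp n * (\<i> * of_real (uarg (bessel_xi n a (Suc i)))))"
      by (simp add: upowr_def ulog_def umod_bessel_xi Complex_eq)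
    have "upowr (bessel_xi n a (Suc i)) (bexp n) * exp (- bexp n * \<tau>) = Q"
      unfolding 2 mult_exp_exp Q_def \<tau>_def bessel_shift_def by (simp add: algebra_simps)
    moreover have "\<tau> = \<sigma> + \<i> * of_real (2 * pi * real i / real n)"
      unfolding \<tau>_def \<sigma>_def bessel_shift_def uarg_bessel_xi using n1 by (simp add: field_simps)
    ultimately show ?thesis unfolding 1 t_def by (simp only: mult.assoc [symmetric] add.assoc)
  qed
  have "(\<Sum>j=1..n. (-1) ^ (n - j) * upowr (bessel_xi n a j) (- (of_nat n - 1) / 2)
         * esym ({1..n} - {l}) y (n - j) * bessel_second n z lam (bessel_xi n a j))
     = (\<Sum>i<n. c i * (upowr (bessel_xi n a (Suc i)) (bexp n) * bessel_second n z lam (bessel_xi n a (Suc i))))"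
    unfolding One_nat_def sum.atLeast1_atMost_eq c_def bexp_def by (simp only: mult_ac)
  also have "\<dots> = Q * (\<Sum>i<n. c i * f (t + \<i> * of_real (2 * pi * real i / real n)))"
    unfolding second sum_distrib_left by (simp only: mult_ac)
  also have "(\<Sum>i<n. c i * f (t + \<i> * of_real (2 * pi * real i / real n))) = connection_const n \<mu> l' * first_tower n \<mu> l' 0 t"
    by (rule normal_solution_connection [OF \<mu>0 l'(2) f b(1) asym [rule_format] tow [rule_format] c])
  finally have sum: "(\<Sum>j=1..n. (-1) ^ (n - j) * upowr (bessel_xi n a j) (- (of_nat n - 1) / 2)
         * esym ({1..n} - {l}) y (n - j) * bessel_second n z lam (bessel_xi n a j))
     = Q * (connection_const n \<mu> l' * first_tower n \<mu> l' 0 t)" .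
  have sm: "summable (\<lambda>m. first_coeff n \<mu> l' m * exp (of_nat n * t) ^ m)"
    by (rule first_coeff_summable [OF l'(2)])
  define S where "S = (\<Sum>m. first_coeff n \<mu> l' m * exp (of_nat n * t) ^ m)"
  have "bessel_first n l z ((-1) powi a) lam = (\<Sum>m. exp (- of_nat n * lam l * ulog z) * (first_coeff n \<mu> l' m * exp (of_nat n * t) ^ m))"
    unfolding bessel_first_def upowr_def \<mu>_def t_def \<sigma>_def l'(1) prod_first_kind_term [OF n1] ..
  also have "\<dots> = exp (- of_nat n * lam l * ulog z) * S" unfolding S_def by (rule suminf_mult [OF sm])
  finally have first: "bessel_first n l z ((-1) powi a) lam = exp (- of_nat n * lam l * ulog z) * S" .
  have "first_tower n \<mu> l' 0 t = exp (- \<mu> l' * t) * S" by (simp add: first_tower_def S_def)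
  also have "exp (- \<mu> l' * t) = exp (- (of_nat n * lam l) * \<sigma>) * exp (- of_nat n * lam l * ulog z)"
    unfolding mult_exp_exp by (simp add: \<mu>_def l' t_def algebra_simps)
  finally have tower: "first_tower n \<mu> l' 0 t = exp (- (of_nat n * lam l) * \<sigma>) * exp (- of_nat n * lam l * ulog z) * S" .
  have "exp (3 / 4 * of_real pi * \<i> * (of_nat n - 1)) / of_real (sqrt (real n) * (2 * pi) powr ((real n - 1) / 2))
    * exp (of_real pi * \<i> * (of_nat n / 2 + of_int a - 2) * lam l)
    * (Q * (connection_const n \<mu> l' * exp (- (of_nat n * lam l) * \<sigma>))) = 1"
    unfolding Q_def \<mu>_def \<sigma>_def l'(1) by (rule connection_constants [OF n1])
  then have "exp (3 / 4 * of_real pi * \<i> * (of_nat n - 1)) / of_real (sqrt (real n) * (2 * pi) powr ((real n - 1) / 2))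
    * exp (of_real pi * \<i> * (of_nat n / 2 + of_int a - 2) * lam l)
    * (Q * (connection_const n \<mu> l' * exp (- (of_nat n * lam l) * \<sigma>))) * (exp (- of_nat n * lam l * ulog z) * S)
    = exp (- of_nat n * lam l * ulog z) * S" by simp
  then show ?thesis
    unfolding y_def [symmetric] sum tower first by (simp only: mult.assoc)
qed

end
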